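(* Consider the mean field game with measure-dependent geometric dynamics described in the context. Then the set of mean field game equilibria, ordered by $\le^L$, is a nonempty and complete lattice.
   Context: Let $T>0$, $W$ a Brownian motion on a complete filtered probability space $(\Omega,\mathcal F,(\mathcal F_t)_{t\in[0,T]},\mathbb P)$, $\sigma\ge0$ a constant, $\xi$ a positive square-integrable $\mathcal F_0$-measurable random variable, $U\subset\mathbb R$ compact, and $\mathcal A$ the set of (square integrable) progressively measurable processes $\alpha:\Omega\times[0,T]\to U$. $\mathcal P(\mathbb R)$ is the set of Borel probability measures on $\mathbb R$ with the Borel $\sigma$-algebra of the weak topology. Write $\mu(s):=\mu(-\infty,s]$; first order stochastic dominance: $\mu\le^{\rm st}\nu$ iff $\mu(s)\ge\nu(s)$ for all $s\in\mathbb R$. Let $m:\mathcal P(\mathbb R)\to\mathbb R$ be bounded, measurable and increasing with respect to $\le^{\rm st}$. For $\alpha\in\mathcal A$ and a measurable flow $\mu=(\mu_t)_{t\in[0,T]}$ of probability measures, $X^{\alpha,\mu}$ is the solution of $$dX_t=X_t(\alpha_t+m(\mu_t))dt+\sigma X_tdW_t,\quad X_0=\xi .$$ There is a constant $K>0$ with $\sup_{t\in[0,T]}\mathbb E[|X^{\alpha,\mu}_t|^2]\le K$ for all $\alpha,\mu$; fix such $K$ and let $\mu^{\rm Min},\mu^{\rm Max}\in\mathcal P(\mathbb R)$ have distribution functions $\mu^{\rm Min}(s)=\min\{1,K/s^2\}$ for $s<0$, $\mu^{\rm Min}(s)=1$ for $s\ge0$; $\mu^{\rm Max}(s)=\max\{0,1-K/s^2\}$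 for $s>0$, $\mu^{\rm Max}(s)=0$ for $s\le0$. Let $\pi:=\delta_0+dt+\delta_T$ on $[0,T]$. $L$ is the set of $\pi$-equivalence classes of measurable flows $(\mu_t)_{t\in[0,T]}$ with $\mu^{\rm Min}\le^{\rm st}\mu_t\le^{\rm st}\mu^{\rm Max}$ for $\pi$-a.a. $t\in(0,T]$ and $\mu_0=\mathbb P\circ\xi$ (law of $\xi$), with order $\mu\le^L\nu$ iff $\mu_t\le^{\rm st}\nu_t$ for $\pi$-a.a. $t$. Costs: $l(t,x,a)=a^2/2$ and $f(t,x,\mu)=x\psi(\mu)$, where $\psi:\mathcal P(\mathbb R)\to(-\infty,0]$ is measurable and decreasing with respect to $\le^{\rm st}$; no terminal cost. Thus, for $\mu\in L$, $$J(\alpha,\mu)=\mathbb E\Big[\int_0^T\Big(\frac{\alpha_t^2}{2}+X^{\alpha,\mu}_t\psi(\mu_t)\Big)dt\Big],\quad\alpha\in\mathcal A.$$ With such a choice of the costs, the functional $J$ is strictly convex with respect to $\alpha$; hence, for each $\mu\in L$, there exists a unique minimizer $\alpha^\mu\in\mathcal A$ of $J(\cdot,\mu)$ (as asserted by the authors from the form of the costs). The best-response-map is $R:L\to L$, $R(\mu):=(\mathbb P\circ X^{\alpha^\mu,\mu}_t)_{t\in[0,T]}$, where $\mathbb P\circ Z$ is the law of $Z$. A mean field game equilibrium is $\mu\in L$ with $R(\mu)=\mu$. A partially ordered set is a complete lattice if each of its subsets has a least upper bound and a greatest lower bound in it.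
   Formalization: Existence and (dt⊗P-a.e.) uniqueness of the minimizer of J(·,μ) for each μ in L is an explicit hypothesis: it does not follow from the form of the costs (U={-1,1}, ψ=0 makes J constant), and without it the best-response map R is undefined. *)

theory Defs
  imports "HOL-Probability.Probability" "HOL-Algebra.Complete_Lattice"
begin

section \<open>Probability measures on the real line\<close>

definition prob_measures :: "real measure set" where
  "prob_measures = {\<mu>. real_distribution \<mu>}"

definition weak_topology :: "real measure topology" where
  "weak_topology = topology_generated_by
     {{\<mu> \<in> prob_measures. (\<integral>x. f x \<partial>\<mu>) \<in> V} | (f :: real \<Rightarrow> real) (V :: real set).
        continuous_on UNIV f \<and> bounded (range f) \<and> open V}"

definition weak_borel :: "real measure measure" where
  "weak_borel = sigma prob_measures {S. openin weak_topology S}"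

definition st_le :: "real measure \<Rightarrow> real measure \<Rightarrow> bool" where
  "st_le \<mu> \<nu> \<longleftrightarrow> (\<forall>s. cdf \<nu> s \<le> cdf \<mu> s)"

definition mu_min :: "real \<Rightarrow> real measure" where
  "mu_min K = interval_measure (\<lambda>s. if s < 0 then min 1 (K / s\<^sup>2) else 1)"

definition mu_max :: "real \<Rightarrow> real measure" where
  "mu_max K = interval_measure (\<lambda>s. if s > 0 then max 0 (1 - K / s\<^sup>2) else 0)"

text \<open>The measure \<open>\<delta>\<^sub>0 + dt + \<delta>\<^sub>T\<close> on the interval from \<open>0\<close> to \<open>T\<close>.\<close>

definition time_measure :: "real \<Rightarrow> real measure" where
  "time_measure T = measure_of {0..T} (sets (restrict_space borel {0..T}))
     (\<lambda>A. indicator A 0 + emeasure lborel A + indicator A T)"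

text \<open>Flows and processes are functions of a real time variable; only their values at times
  in \<open>{0..T}\<close> matter.\<close>

definition measurable_flows :: "real \<Rightarrow> (real \<Rightarrow> real measure) set" where
  "measurable_flows T = measurable (restrict_space borel {0..T}) weak_borel"


section \<open>Filtrations, Brownian motion and the Ito integral\<close>

definition complete_filtered_prob_space ::
  "'w measure \<Rightarrow> (real \<Rightarrow> 'w measure) \<Rightarrow> real \<Rightarrow> bool" where
  "complete_filtered_prob_space M F T \<longleftrightarrow>
     prob_space M \<and> complete_measure M \<and>
     (\<forall>t\<in>{0..T}. subalgebra M (F t) \<and> null_sets M \<subseteq> sets (F t)) \<and>
     (\<forall>s t. 0 \<le> s \<and> s \<le> t \<and> t \<le> T \<longrightarrow> sets (F s) \<subseteq> sets (F t))"

definition progressive ::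
  "(real \<Rightarrow> 'w measure) \<Rightarrow> real \<Rightarrow> (real \<Rightarrow> 'w \<Rightarrow> real) \<Rightarrow> bool" where
  "progressive F T H \<longleftrightarrow>
     (\<forall>t\<in>{0..T}. (\<lambda>(s, \<omega>). H s \<omega>)
        \<in> borel_measurable (restrict_space borel {0..t} \<Otimes>\<^sub>M F t))"

definition brownian_motion ::
  "'w measure \<Rightarrow> (real \<Rightarrow> 'w measure) \<Rightarrow> real \<Rightarrow> (real \<Rightarrow> 'w \<Rightarrow> real) \<Rightarrow> bool" where
  "brownian_motion M F T W \<longleftrightarrow>
     (\<forall>t\<in>{0..T}. W t \<in> borel_measurable (F t)) \<and>
     (AE \<omega> in M. W 0 \<omega> = 0) \<and>
     (AE \<omega> in M. continuous_on {0..T} (\<lambda>t. W t \<omega>)) \<and>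
     (\<forall>s t. 0 \<le> s \<and> s < t \<and> t \<le> T \<longrightarrow>
        distributed M lborel (\<lambda>\<omega>. W t \<omega> - W s \<omega>) (normal_density 0 (sqrt (t - s))) \<and>
        prob_space.indep_set M (sets (F s))
          {(\<lambda>\<omega>. W t \<omega> - W s \<omega>) -` B \<inter> space M | B. B \<in> sets borel})"

text \<open>The triple \<open>n, \<tau>, h\<close> encodes the simple process
  \<open>\<Sum>i<n. h i * indicator {\<tau> i<..\<tau> (Suc i)}\<close>.\<close>

definition simple_integrand ::
  "'w measure \<Rightarrow> (real \<Rightarrow> 'w measure) \<Rightarrow> real \<Rightarrow> nat \<Rightarrow> (nat \<Rightarrow> real) \<Rightarrow> (nat \<Rightarrow> 'w \<Rightarrow> real) \<Rightarrow> bool"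
  where
  "simple_integrand M F r n \<tau> h \<longleftrightarrow>
     (\<forall>i<n. 0 \<le> \<tau> i \<and> \<tau> i \<le> \<tau> (Suc i) \<and> \<tau> (Suc i) \<le> r \<and>
        h i \<in> borel_measurable (F (\<tau> i)) \<and> (\<exists>C. \<forall>\<omega>\<in>space M. \<bar>h i \<omega>\<bar> \<le> C))"

definition simple_process ::
  "nat \<Rightarrow> (nat \<Rightarrow> real) \<Rightarrow> (nat \<Rightarrow> 'w \<Rightarrow> real) \<Rightarrow> real \<Rightarrow> 'w \<Rightarrow> real" where
  "simple_process n \<tau> h s \<omega> = (\<Sum>i<n. h i \<omega> * indicator {\<tau> i<..\<tau> (Suc i)} s)"

definition simple_integral ::
  "(real \<Rightarrow> 'w \<Rightarrow> real) \<Rightarrow> nat \<Rightarrow> (nat \<Rightarrow> real) \<Rightarrow> (nat \<Rightarrow> 'w \<Rightarrow> real) \<Rightarrow> 'w \<Rightarrow> real" where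
  "simple_integral W n \<tau> h \<omega> = (\<Sum>i<n. h i \<omega> * (W (\<tau> (Suc i)) \<omega> - W (\<tau> i) \<omega>))"

text \<open>\<open>Y\<close> is a version of the stochastic integral of \<open>H\<close> against \<open>W\<close> over \<open>{0..r}\<close>: the
  \<open>L\<^sup>2\<close> limit of the integrals of simple processes that approximate \<open>H\<close> in
  \<open>L\<^sup>2(dt \<otimes> M)\<close>.\<close>

definition has_ito_integral ::
  "'w measure \<Rightarrow> (real \<Rightarrow> 'w measure) \<Rightarrow> (real \<Rightarrow> 'w \<Rightarrow> real) \<Rightarrow> real \<Rightarrow>
   (real \<Rightarrow> 'w \<Rightarrow> real) \<Rightarrow> ('w \<Rightarrow> real) \<Rightarrow> bool" where
  "has_ito_integral M F W r H Y \<longleftrightarrow>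
     Y \<in> borel_measurable M \<and>
     (\<exists>n \<tau> h.
        (\<forall>k. simple_integrand M F r (n k) (\<tau> k) (h k)) \<and>
        (\<lambda>k. \<integral>\<^sup>+\<omega>. (\<integral>\<^sup>+s\<in>{0..r}.
            ennreal ((simple_process (n k) (\<tau> k) (h k) s \<omega> - H s \<omega>)\<^sup>2) \<partial>lborel) \<partial>M)
          \<longlonglongrightarrow> 0 \<and>
        (\<lambda>k. \<integral>\<^sup>+\<omega>. ennreal ((simple_integral W (n k) (\<tau> k) (h k) \<omega> - Y \<omega>)\<^sup>2) \<partial>M)
          \<longlonglongrightarrow> 0)"


section \<open>The controlled geometric dynamics\<close>

locale geometric_dynamics =
  fixes M :: "'w measure" and F :: "real \<Rightarrow> 'w measure" and T :: real
    and W :: "real \<Rightarrow> 'w \<Rightarrow> real" and \<sigma> :: real and \<xi> :: "'w \<Rightarrow> real"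
    and U :: "real set" and m :: "real measure \<Rightarrow> real"
  assumes T_pos: "0 < T"
    and filtered: "complete_filtered_prob_space M F T"
    and brownian: "brownian_motion M F T W"
    and sigma_nonneg: "0 \<le> \<sigma>"
    and xi_measurable: "\<xi> \<in> borel_measurable (F 0)"
    and xi_pos: "AE \<omega> in M. 0 < \<xi> \<omega>"
    and xi_square_integrable: "integrable M (\<lambda>\<omega>. (\<xi> \<omega>)\<^sup>2)"
    and U_compact: "compact U"
    and m_measurable: "m \<in> borel_measurable weak_borel"
    and m_bounded: "bounded (m ` prob_measures)"
    and m_increasing:
      "\<And>\<mu> \<nu>. \<mu> \<in> prob_measures \<Longrightarrow> \<nu> \<in> prob_measures \<Longrightarrow> st_le \<mu> \<nu> \<Longrightarrow> m \<mu> \<le> m \<nu>"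
begin

text \<open>Square integrability of the controls is automatic, because \<open>U\<close> is compact.\<close>

definition controls :: "(real \<Rightarrow> 'w \<Rightarrow> real) set" where
  "controls = {\<alpha>. progressive F T \<alpha> \<and> (\<forall>t\<in>{0..T}. \<forall>\<omega>\<in>space M. \<alpha> t \<omega> \<in> U)}"

definition sde_solution ::
  "(real \<Rightarrow> 'w \<Rightarrow> real) \<Rightarrow> (real \<Rightarrow> real measure) \<Rightarrow> (real \<Rightarrow> 'w \<Rightarrow> real) \<Rightarrow> bool" where
  "sde_solution \<alpha> \<mu> X \<longleftrightarrow>
     progressive F T X \<and>
     (AE \<omega> in M. continuous_on {0..T} (\<lambda>t. X t \<omega>)) \<and>
     (\<integral>\<^sup>+\<omega>. (\<integral>\<^sup>+t\<in>{0..T}. ennreal ((X t \<omega>)\<^sup>2) \<partial>lborel) \<partial>M) < \<infinity> \<and>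
     (\<forall>t\<in>{0..T}. \<exists>I. has_ito_integral M F W t (\<lambda>s \<omega>. \<sigma> * X s \<omega>) I \<and>
        (AE \<omega> in M. X t \<omega> =
           \<xi> \<omega> + (LINT s:{0..t}|lborel. X s \<omega> * (\<alpha> s \<omega> + m (\<mu> s))) + I \<omega>))"

text \<open>The solution is unique up to indistinguishability; a version is chosen.\<close>

definition state ::
  "(real \<Rightarrow> 'w \<Rightarrow> real) \<Rightarrow> (real \<Rightarrow> real measure) \<Rightarrow> real \<Rightarrow> 'w \<Rightarrow> real" where
  "state \<alpha> \<mu> = (SOME X. sde_solution \<alpha> \<mu> X)"

end


section \<open>The mean field game\<close>

locale geometric_mfg = geometric_dynamics M F T W \<sigma> \<xi> U m
  for M :: "'w measure" and F T W \<sigma> \<xi> U m +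
  fixes \<psi> :: "real measure \<Rightarrow> real" and K :: real
  assumes psi_measurable: "\<psi> \<in> borel_measurable weak_borel"
    and psi_nonpos: "\<And>\<mu>. \<mu> \<in> prob_measures \<Longrightarrow> \<psi> \<mu> \<le> 0"
    and psi_decreasing:
      "\<And>\<mu> \<nu>. \<mu> \<in> prob_measures \<Longrightarrow> \<nu> \<in> prob_measures \<Longrightarrow> st_le \<mu> \<nu> \<Longrightarrow> \<psi> \<nu> \<le> \<psi> \<mu>"
    and K_pos: "0 < K"
    and K_bound: "\<And>\<alpha> \<mu> t. \<alpha> \<in> controls \<Longrightarrow> \<mu> \<in> measurable_flows T \<Longrightarrow> t \<in> {0..T} \<Longrightarrow>
       (\<integral>\<^sup>+\<omega>. ennreal ((state \<alpha> \<mu> t \<omega>)\<^sup>2) \<partial>M) \<le> ennreal K"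
begin

text \<open>Representatives of the elements of the lattice \<open>L\<close>.\<close>

definition flows :: "(real \<Rightarrow> real measure) set" where
  "flows = {\<mu> \<in> measurable_flows T. \<mu> 0 = distr M borel \<xi> \<and>
     (AE t in time_measure T. 0 < t \<longrightarrow> st_le (mu_min K) (\<mu> t) \<and> st_le (\<mu> t) (mu_max K))}"

definition flow_equiv :: "((real \<Rightarrow> real measure) \<times> (real \<Rightarrow> real measure)) set" where
  "flow_equiv = {(\<mu>, \<nu>). \<mu> \<in> flows \<and> \<nu> \<in> flows \<and> (AE t in time_measure T. \<mu> t = \<nu> t)}"

definition L :: "(real \<Rightarrow> real measure) set set" where
  "L = flows // flow_equiv"

definition L_le :: "(real \<Rightarrow> real measure) set \<Rightarrow> (real \<Rightarrow> real measure) set \<Rightarrow> bool" where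
  "L_le C D \<longleftrightarrow> (\<exists>\<mu>\<in>C. \<exists>\<nu>\<in>D. AE t in time_measure T. st_le (\<mu> t) (\<nu> t))"

definition J :: "(real \<Rightarrow> 'w \<Rightarrow> real) \<Rightarrow> (real \<Rightarrow> real measure) \<Rightarrow> real" where
  "J \<alpha> \<mu> = (\<integral>\<omega>. (LINT t:{0..T}|lborel. (\<alpha> t \<omega>)\<^sup>2 / 2 + state \<alpha> \<mu> t \<omega> * \<psi> (\<mu> t)) \<partial>M)"

definition minimizer :: "(real \<Rightarrow> real measure) \<Rightarrow> (real \<Rightarrow> 'w \<Rightarrow> real) \<Rightarrow> bool" where
  "minimizer \<mu> \<alpha> \<longleftrightarrow> \<alpha> \<in> controls \<and> (\<forall>\<beta>\<in>controls. J \<alpha> \<mu> \<le> J \<beta> \<mu>)"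

text \<open>As usual, controls that agree \<open>dt \<otimes> M\<close>-almost everywhere are identified.\<close>

definition unique_minimizer :: "(real \<Rightarrow> real measure) \<Rightarrow> bool" where
  "unique_minimizer \<mu> \<longleftrightarrow> (\<exists>\<alpha>. minimizer \<mu> \<alpha>) \<and>
     (\<forall>\<alpha> \<beta>. minimizer \<mu> \<alpha> \<and> minimizer \<mu> \<beta> \<longrightarrow>
        (AE p in restrict_space lborel {0..T} \<Otimes>\<^sub>M M.
           \<alpha> (fst p) (snd p) = \<beta> (fst p) (snd p)))"

definition optimal_control :: "(real \<Rightarrow> real measure) \<Rightarrow> real \<Rightarrow> 'w \<Rightarrow> real" where
  "optimal_control \<mu> = (SOME \<alpha>. minimizer \<mu> \<alpha>)"

definition response_flow :: "(real \<Rightarrow> real measure) \<Rightarrow> real \<Rightarrow> real measure" where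
  "response_flow \<mu> = (\<lambda>t. distr M borel (state (optimal_control \<mu>) \<mu> t))"

text \<open>The best-response map on equivalence classes, with the usual lifting of a map on
  representatives to a quotient.\<close>

definition R :: "(real \<Rightarrow> real measure) set \<Rightarrow> (real \<Rightarrow> real measure) set" where
  "R C = (\<Union>\<mu>\<in>C. flow_equiv `` {response_flow \<mu>})"

definition equilibria :: "(real \<Rightarrow> real measure) set set" where
  "equilibria = {C \<in> L. R C = C}"

definition equilibrium_order :: "(real \<Rightarrow> real measure) set gorder" where
  "equilibrium_order = \<lparr>carrier = equilibria, eq = (=), le = L_le\<rparr>"

end

end

theory Submission
  imports Defs
begin

text \<open>The state equation has the explicit solution \<open>\<xi> exp (A\<^sub>t + \<integral> m(\<mu>\<^sub>s) ds + \<sigma> W\<^sub>t - \<sigma>\<^sup>2 t / 2)\<close>, where \<open>A\<close> is the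
  primitive of the control; uniqueness follows from the isometry for simple integrals and Gronwall's
  inequality.  Given two controls, using at each time the one whose primitive is larger (smaller)
  yields controls \<open>\<alpha> \<or> \<beta>\<close> and \<open>\<alpha> \<and> \<beta>\<close> whose primitives are the maximum and the minimum.  As \<open>m\<close> increases
  and \<open>\<psi> \<le> 0\<close> decreases, \<open>J(\<alpha> \<and> \<beta>, \<mu>) + J(\<alpha> \<or> \<beta>, \<nu>) \<le> J(\<alpha>, \<mu>) + J(\<beta>, \<nu>)\<close> for \<open>\<mu> \<le> \<nu>\<close>.  If \<open>\<alpha>\<close> and \<open>\<beta>\<close>
  are optimal for \<open>\<mu>\<close> and \<open>\<nu>\<close>, then \<open>\<alpha> \<or> \<beta>\<close> is optimal for \<open>\<nu>\<close>, hence equal to \<open>\<beta>\<close>, and the best response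
  is monotone.  The flows between the two bounds form a complete lattice, because an uncountable
  supremum is attained, up to null sets, along a countable subfamily; Tarski's theorem concludes.\<close>


section \<open>Distribution functions and the stochastic order\<close>

text \<open>Taking pointwise maxima of controls would fail: the state sees a control through its
  primitive, and the primitive of a maximum may exceed the maximum of the primitives. Switching
  instead permutes the values of the two controls at each time, so the quadratic costs cancel and
  only the products of state and \<open>\<psi>\<close> remain to be compared. The explicit solution
  is verified without an Ito formula: over a uniform grid its increments are the terms of a simple
  integral plus a drift integral plus errors, and the errors vanish in L2. A stochastic integral is
  given only as an L2 limit along some simple processes, possibly on unrelated grids; hence the
  isometry is proved for overlapping intervals. Null sets are the other obstacle. The stochastic
  order involves all real arguments, but distribution functions are determined by their values at
  rationals, which leaves countably many exceptional sets; the same reduction makes measurability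
  for the weak topology a condition on countably many functions. Best responses are ordered at every
  time, so the point masses of the time measure cause no loss.\<close>

definition distribution_function :: "(real \<Rightarrow> real) \<Rightarrow> bool" where
  "distribution_function G \<longleftrightarrow> mono G \<and> (\<forall>a. continuous (at_right a) G) \<and>
     (G \<longlongrightarrow> 0) at_bot \<and> (G \<longlongrightarrow> 1) at_top"

lemma distribution_function_interval_measure:
  assumes "distribution_function G"
  shows "real_distribution (interval_measure G)" "cdf (interval_measure G) = G"
  using assms unfolding distribution_function_def mono_def
  by (auto intro!: real_distribution_interval_measure cdf_interval_measure)

lemma distribution_function_cdf:
  assumes "real_distribution \<mu>"
  shows "distribution_function (cdf \<mu>)"
proof -
  interpret real_distribution \<mu> by fact
  show ?thesis
    unfolding distribution_function_def
    using cdf_is_right_cont cdf_lim_at_bot cdf_lim_at_top_prob cdf_nondecreasing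
    by (auto intro!: monoI)
qed

section \<open>The two extremal distribution functions\<close>

lemma tendsto_const_div_square_at_bot: "((\<lambda>s. K / s\<^sup>2) \<longlongrightarrow> (0::real)) at_bot"
  by real_asymp

definition min_df :: "real \<Rightarrow> real \<Rightarrow> real" where
  "min_df K = (\<lambda>s. if s < 0 then min 1 (K / s\<^sup>2) else 1)"

definition max_df :: "real \<Rightarrow> real \<Rightarrow> real" where
  "max_df K = (\<lambda>s. if s > 0 then max 0 (1 - K / s\<^sup>2) else 0)"

text \<open>Reflection exchanges the two tail bounds, so that \<open>max_df\<close> inherits its
  properties from \<open>min_df\<close>.\<close>

lemma max_df_eq: "max_df K s = 1 - min_df K (- s)"
  by (auto simp: max_df_def min_df_def)

lemma mono_min_df:
  assumes "0 < K" shows "mono (min_df K)"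
proof (rule monoI)
  fix x y :: real assume "x \<le> y"
  show "min_df K x \<le> min_df K y"
  proof (cases "y < 0")
    case True
    then have "y\<^sup>2 \<le> x\<^sup>2" "0 < y\<^sup>2"
      using \<open>x \<le> y\<close> by (simp_all add: abs_le_square_iff[symmetric])
    then have "K / x\<^sup>2 \<le> K / y\<^sup>2" using assms by (intro divide_left_mono mult_pos_pos) linarith+
    then show ?thesis using True \<open>x \<le> y\<close> by (auto simp: min_df_def)
  qed (auto simp: min_df_def)
qed

text \<open>Full continuity rather than right continuity, because the reflection in
  \<open>max_df_eq\<close> turns right limits into left limits.\<close>

lemma isCont_min_df:
  assumes "0 < K" shows "isCont (min_df K) s"
proof (cases "s < 0")
  case True
  have "\<forall>\<^sub>F x in nhds s. min_df K x = min 1 (K / x\<^sup>2)"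
    using eventually_nhds_in_open[of "{..<0}" s] True
    by (auto elim!: eventually_mono simp: min_df_def)
  moreover have "isCont (\<lambda>x. min 1 (K / x\<^sup>2)) s"
    using True by (intro continuous_intros) auto
  ultimately show ?thesis by (simp add: isCont_cong)
next
  case False
  \<comment> \<open>The cap at 1 is already active on (- sqrt K, 0), so neither the case distinction
    at 0 nor the division by zero there produces a jump.\<close>
  have "min_df K x = 1" if "x > - sqrt K" for x
  proof (cases "x < 0")
    case True
    then have "\<bar>x\<bar> < sqrt K" using that by auto
    then have "x\<^sup>2 < K" by (metis abs_ge_zero power2_abs real_less_rsqrt real_sqrt_abs real_sqrt_less_iff)
    then show ?thesis using True by (auto simp: min_df_def)
  qed (auto simp: min_df_def)
  then have "\<forall>\<^sub>F x in nhds s. min_df K x = 1"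
    using eventually_nhds_in_open[of "{- sqrt K<..}" s] False assms
    by (auto elim!: eventually_mono simp: order.strict_trans2[of _ 0])
  then show ?thesis by (simp add: isCont_cong)
qed

lemma distribution_function_min_df:
  assumes "0 < K" shows "distribution_function (min_df K)"
proof -
  have "((\<lambda>s. min 1 (K / s\<^sup>2)) \<longlongrightarrow> min 1 0) at_bot"
    by (intro tendsto_intros tendsto_const_div_square_at_bot)
  then have "(min_df K \<longlongrightarrow> 0) at_bot"
    using assms
    by (auto elim!: Lim_transform_eventually simp: eventually_at_bot_linorder min_df_def
        intro!: exI[of _ "-1"])
  moreover have "(min_df K \<longlongrightarrow> 1) at_top"
    by (rule tendsto_eventually)
       (auto simp: eventually_at_top_linorder min_df_def intro!: exI[of _ "0"])
  ultimately show ?thesis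
    unfolding distribution_function_def
    using mono_min_df isCont_min_df assms by (auto intro: continuous_within_subset)
qed

lemma distribution_function_max_df:
  assumes "0 < K" shows "distribution_function (max_df K)"
proof -
  have "mono (max_df K)"
    using mono_min_df[OF assms] by (auto simp: max_df_eq mono_def)
  moreover have "isCont (max_df K) s" for s
  proof -
    have "isCont (\<lambda>s. 1 - min_df K (- s)) s"
      by (intro continuous_intros isCont_o2[OF _ isCont_min_df[OF assms]])
    then show ?thesis by (simp add: max_df_eq[abs_def])
  qed
  moreover have lim: "(min_df K \<longlongrightarrow> 0) at_bot" "(min_df K \<longlongrightarrow> 1) at_top"
    using distribution_function_min_df[OF assms] by (auto simp: distribution_function_def)
  have "((\<lambda>s. 1 - min_df K (- s)) \<longlongrightarrow> 1 - 1) at_bot" "((\<lambda>s. 1 - min_df K (- s)) \<longlongrightarrow> 1 - 0) at_top"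
    by (rule tendsto_diff[OF tendsto_const filterlim_compose[OF lim(2) filterlim_uminus_at_top_at_bot]]
        tendsto_diff[OF tendsto_const filterlim_compose[OF lim(1) filterlim_uminus_at_bot_at_top]])+
  ultimately show ?thesis
    unfolding distribution_function_def max_df_eq[abs_def]
    by (auto intro: continuous_within_subset simp: max_df_eq[abs_def])
qed

lemma mu_min_in_prob_measures: "0 < K \<Longrightarrow> mu_min K \<in> prob_measures"
  and mu_max_in_prob_measures: "0 < K \<Longrightarrow> mu_max K \<in> prob_measures"
  and cdf_mu_min: "0 < K \<Longrightarrow> cdf (mu_min K) = min_df K"
  and cdf_mu_max: "0 < K \<Longrightarrow> cdf (mu_max K) = max_df K"
  using distribution_function_interval_measure[OF distribution_function_min_df]
    distribution_function_interval_measure[OF distribution_function_max_df]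
  by (auto simp: prob_measures_def mu_min_def mu_max_def min_df_def max_df_def)

section \<open>Stochastic order and its test at rational points\<close>

lemma st_le_refl: "st_le \<mu> \<mu>"
  by (simp add: st_le_def)

lemma st_le_trans: "st_le \<mu> \<nu> \<Longrightarrow> st_le \<nu> \<rho> \<Longrightarrow> st_le \<mu> \<rho>"
  by (auto simp: st_le_def intro: order.trans)

lemma st_le_antisym:
  "\<mu> \<in> prob_measures \<Longrightarrow> \<nu> \<in> prob_measures \<Longrightarrow> st_le \<mu> \<nu> \<Longrightarrow> st_le \<nu> \<mu> \<Longrightarrow> \<mu> = \<nu>"
  by (auto simp: prob_measures_def st_le_def intro!: cdf_unique order.antisym[of "cdf \<mu>" "cdf \<nu>"] le_funI)

text \<open>Rationals strictly to the right of \<open>a\<close> converge to it, and right continuity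
  carries the inequality to the limit.\<close>

lemma right_continuous_le_of_rat:
  fixes F G :: "real \<Rightarrow> real"
  assumes F: "continuous (at_right a) F" and G: "continuous (at_right a) G"
    and le: "\<And>q::rat. F (of_rat q) \<le> G (of_rat q)"
  shows "F a \<le> G a"
proof -
  have "\<exists>q::rat. a < of_rat q \<and> of_rat q < a + 1 / Suc n" for n
    using of_rat_dense[of a "a + 1 / Suc n"] by auto
  then obtain q :: "nat \<Rightarrow> rat" where q: "\<And>n. a < of_rat (q n) \<and> of_rat (q n) < a + 1 / Suc n"
    by metis
  have lim: "(\<lambda>n. real_of_rat (q n)) \<longlonglongrightarrow> a"
  proof (rule tendsto_sandwich[where f="\<lambda>_. a" and h="\<lambda>n. a + 1 / Suc n"])
    show "(\<lambda>n. a + 1 / real (Suc n)) \<longlonglongrightarrow> a"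
      using LIMSEQ_inverse_real_of_nat_add[of a] by (simp add: field_simps)
  qed (use q in \<open>auto intro!: always_eventually simp: less_imp_le\<close>)
  then have at: "filterlim (\<lambda>n. real_of_rat (q n)) (at_right a) sequentially"
    using q by (auto simp: filterlim_at intro!: always_eventually less_imp_neq[symmetric])
  show ?thesis
  proof (rule LIMSEQ_le)
    show "(\<lambda>n. F (of_rat (q n))) \<longlonglongrightarrow> F a" "(\<lambda>n. G (of_rat (q n))) \<longlonglongrightarrow> G a"
      using F G at by (auto simp: continuous_within intro: filterlim_compose)
  qed (use le in auto)
qed

text \<open>Replaces the uncountably many inequalities of \<open>st_le\<close> by countably many,
  each of which may later fail on a null set of its own.\<close>

lemma st_le_rat:
  assumes "\<mu> \<in> prob_measures" "\<nu> \<in> prob_measures"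
    and "\<And>q::rat. cdf \<nu> (of_rat q) \<le> cdf \<mu> (of_rat q)"
  shows "st_le \<mu> \<nu>"
  using assms distribution_function_cdf[of \<mu>] distribution_function_cdf[of \<nu>]
    right_continuous_le_of_rat[of _ "cdf \<nu>" "cdf \<mu>"]
  by (auto simp: st_le_def prob_measures_def distribution_function_def)


section \<open>The weak topology and its Borel sets\<close>

lemma openin_weak_topology_subset: "openin weak_topology S \<Longrightarrow> S \<subseteq> prob_measures"
  using openin_subset[of weak_topology S]
  by (fastforce simp: weak_topology_def)

lemma space_weak_borel: "space weak_borel = prob_measures"
  using openin_weak_topology_subset unfolding weak_borel_def by (intro space_measure_of) auto

lemma sets_weak_borel: "sets weak_borel = sigma_sets prob_measures {S. openin weak_topology S}"
  using openin_weak_topology_subset unfolding weak_borel_def by (intro sets_measure_of) auto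

lemma openin_weak_topology_basic:
  fixes f :: "real \<Rightarrow> real"
  assumes "continuous_on UNIV f" "bounded (range f)" "open V"
  shows "openin weak_topology {\<mu> \<in> prob_measures. (\<integral>x. f x \<partial>\<mu>) \<in> V}"
  unfolding weak_topology_def
  by (rule topology_generated_by_Basis) (use assms in blast)

lemma measurable_weak_borel_integral:
  fixes f :: "real \<Rightarrow> real"
  assumes "continuous_on UNIV f" "bounded (range f)"
  shows "(\<lambda>\<mu>. \<integral>x. f x \<partial>\<mu>) \<in> borel_measurable weak_borel"
proof (rule borel_measurableI)
  fix V :: "real set" assume "open V"
  then have "{\<mu> \<in> prob_measures. (\<integral>x. f x \<partial>\<mu>) \<in> V} \<in> sets weak_borel"
    using openin_weak_topology_basic[OF assms] by (auto simp: sets_weak_borel)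
  then show "(\<lambda>\<mu>. \<integral>x. f x \<partial>\<mu>) -` V \<inter> space weak_borel \<in> sets weak_borel"
    by (simp add: space_weak_borel vimage_def Collect_conj_eq Int_commute)
qed

text \<open>The indicator of a half-line is not continuous; the functions \<open>g n\<close> drop
  linearly from 1 to 0 just to the right of \<open>s\<close> and converge to it, so the distribution
  function is a pointwise limit of weakly continuous functionals.\<close>

lemma measurable_weak_borel_cdf: "(\<lambda>\<mu>. cdf \<mu> s) \<in> borel_measurable weak_borel"
proof -
  define g where "g n = cts_step s (s + 1 / Suc n)" for n :: nat
  have cont: "continuous_on UNIV (g n)" for n
    unfolding g_def by (intro uniformly_continuous_imp_continuous cts_step_uniformly_continuous) auto
  have "(s + d - x) / d \<le> 1" if "s < x" "0 < d" for d x :: real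
    using that by (simp add: divide_le_eq_1)
  from this[of _ "1 / real (Suc _)"] have g01: "0 \<le> g n x" "g n x \<le> 1" for n x
    by (auto simp: g_def cts_step_def zero_le_divide_iff simp del: of_nat_Suc)
  have bdd: "bounded (range (g n))" for n
    using g01[of n] by (intro boundedI[of _ 1]) (auto simp: abs_of_nonneg)
  show ?thesis
  proof (rule borel_measurable_LIMSEQ_real[of weak_borel "\<lambda>n \<mu>. \<integral>x. g n x \<partial>\<mu>"])
    fix \<mu> assume "\<mu> \<in> space weak_borel"
    then interpret real_distribution \<mu> by (simp add: space_weak_borel prob_measures_def)
    have "(\<lambda>n. \<integral>x. g n x \<partial>\<mu>) \<longlonglongrightarrow> (\<integral>x. indicator {..s} x \<partial>\<mu>)"
    proof (rule integral_dominated_convergence[where w="\<lambda>_. 1"])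
      show "g n \<in> borel_measurable \<mu>" for n
        using borel_measurable_continuous_onI[OF cont] by simp
      show "AE x in \<mu>. (\<lambda>n. g n x) \<longlonglongrightarrow> indicator {..s} x"
      proof (rule AE_I2)
        fix x
        show "(\<lambda>n. g n x) \<longlonglongrightarrow> indicator {..s} x"
        proof (cases "x \<le> s")
          case False
          then obtain N where "1 / Suc N < x - s"
            using nat_approx_posE[of "x - s"] by auto
          moreover have "1 / Suc n \<le> 1 / Suc N" if "n \<ge> N" for n
            using that by (intro divide_left_mono) auto
          ultimately have "g n x = 0" if "n \<ge> N" for n
            using that False by (force simp: g_def cts_step_def)
          then show ?thesis using False
            by (intro tendsto_eventually) (auto simp: eventually_sequentially)
        qed (simp add: g_def cts_step_def)
      qed
    qed (use g01 in auto)
    then show "(\<lambda>n. \<integral>x. g n x \<partial>\<mu>) \<longlonglongrightarrow> cdf \<mu> s"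
      by (simp add: cdf_def)
  qed (rule measurable_weak_borel_integral[OF cont bdd])
qed

text \<open>Around a continuity point x two rationals p < x < q squeeze all distribution functions
  by monotonicity, while the limit varies little between p and q.\<close>

lemma weak_conv_of_rat_cdf:
  assumes \<mu>: "\<And>k. \<mu> k \<in> prob_measures" and \<nu>: "\<nu> \<in> prob_measures"
    and conv: "\<And>q::rat. (\<lambda>k. cdf (\<mu> k) (of_rat q)) \<longlonglongrightarrow> cdf \<nu> (of_rat q)"
  shows "weak_conv_m \<mu> \<nu>"
  unfolding weak_conv_m_def weak_conv_def
proof (intro allI impI)
  fix x assume cont: "isCont (cdf \<nu>) x"
  interpret \<nu>: real_distribution \<nu> using \<nu> by (simp add: prob_measures_def)
  interpret \<mu>: real_distribution "\<mu> k" for k using \<mu> by (simp add: prob_measures_def)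
  show "(\<lambda>k. cdf (\<mu> k) x) \<longlonglongrightarrow> cdf \<nu> x"
  proof (rule LIMSEQ_I)
    fix e :: real assume "0 < e"
    then obtain d where d: "0 < d" "\<And>y. \<bar>y - x\<bar> < d \<Longrightarrow> \<bar>cdf \<nu> y - cdf \<nu> x\<bar> < e / 2"
      using cont unfolding continuous_at_eps_delta dist_real_def by (metis half_gt_zero)
    obtain p q :: rat where p: "x - d < of_rat p" "of_rat p < x" and q: "x < of_rat q" "of_rat q < x + d"
      using of_rat_dense[of "x - d" x] of_rat_dense[of x "x + d"] d(1) by auto
    have near: "\<bar>cdf \<nu> (of_rat p) - cdf \<nu> x\<bar> < e / 2" "\<bar>cdf \<nu> (of_rat q) - cdf \<nu> x\<bar> < e / 2"
      using p q by (intro d(2); simp add: abs_less_iff)+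
    obtain N1 where N1: "\<And>k. k \<ge> N1 \<Longrightarrow> \<bar>cdf (\<mu> k) (of_rat p) - cdf \<nu> (of_rat p)\<bar> < e / 2"
      using LIMSEQ_D[OF conv[of p], of "e / 2"] \<open>0 < e\<close> by auto
    obtain N2 where N2: "\<And>k. k \<ge> N2 \<Longrightarrow> \<bar>cdf (\<mu> k) (of_rat q) - cdf \<nu> (of_rat q)\<bar> < e / 2"
      using LIMSEQ_D[OF conv[of q], of "e / 2"] \<open>0 < e\<close> by auto
    have mono: "cdf (\<mu> k) (of_rat p) \<le> cdf (\<mu> k) x" "cdf (\<mu> k) x \<le> cdf (\<mu> k) (of_rat q)" for k
      using p q by (auto intro!: \<mu>.cdf_nondecreasing)
    have "\<bar>cdf (\<mu> k) x - cdf \<nu> x\<bar> < e" if "k \<ge> max N1 N2" for k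
    proof -
      have "\<bar>cdf (\<mu> k) (of_rat p) - cdf \<nu> (of_rat p)\<bar> < e / 2" "\<bar>cdf (\<mu> k) (of_rat q) - cdf \<nu> (of_rat q)\<bar> < e / 2"
        using that N1 N2 by auto
      then show ?thesis
        using near mono[of k] unfolding abs_less_iff by linarith
    qed
    then show "\<exists>no. \<forall>n\<ge>no. norm (cdf (\<mu> n) x - cdf \<nu> x) < e"
      by (intro exI[of _ "max N1 N2"]) auto
  qed
qed

text \<open>Induction over the generation of the topology. Finite intersections and unions preserve
  an eventual property; only basic sets use weak convergence, as convergence of integrals of bounded
  continuous functions.\<close>

lemma weak_conv_eventually_in_open:
  assumes S: "openin weak_topology S" and \<nu>: "\<nu> \<in> S" and \<mu>: "\<And>k. \<mu> k \<in> prob_measures"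
    and conv: "weak_conv_m \<mu> \<nu>"
  shows "\<forall>\<^sub>F k in sequentially. \<mu> k \<in> S"
proof -
  have "generate_topology_on {{\<mu> \<in> prob_measures. (\<integral>x. f x \<partial>\<mu>) \<in> V} | (f :: real \<Rightarrow> real) (V :: real set).
        continuous_on UNIV f \<and> bounded (range f) \<and> open V} S"
    using S by (simp add: weak_topology_def openin_topology_generated_by_iff)
  then show ?thesis using \<nu>
  proof (induction S)
    case (Int a b)
    then show ?case by (auto intro: eventually_conj)
  next
    case (UN A)
    then obtain a where "a \<in> A" "\<nu> \<in> a" by auto
    then have "\<forall>\<^sub>F k in sequentially. \<mu> k \<in> a" using UN by blast
    then show ?case using \<open>a \<in> A\<close> by (auto elim!: eventually_mono)
  next
    case (Basis s)
    then obtain f :: "real \<Rightarrow> real" and V where s: "s = {\<mu> \<in> prob_measures. (\<integral>x. f x \<partial>\<mu>) \<in> V}"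
      and f: "continuous_on UNIV f" "bounded (range f)" "open V" by auto
    obtain B where B: "\<And>x. norm (f x) \<le> B" using f(2) by (auto simp: bounded_iff)
    have "(\<lambda>k. \<integral>x. f x \<partial>\<mu> k) \<longlonglongrightarrow> (\<integral>x. f x \<partial>\<nu>)"
      using \<mu> Basis(2) conv f(1) B
      by (intro weak_conv_imp_integral_bdd_continuous_conv)
         (auto simp: prob_measures_def s continuous_on_eq_continuous_at)
    then have "\<forall>\<^sub>F k in sequentially. (\<integral>x. f x \<partial>\<mu> k) \<in> V"
      using Basis(2) f(3) by (intro topological_tendstoD) (auto simp: s)
    then show ?case using \<mu> by (auto elim!: eventually_mono simp: s)
  qed simp
qed

text \<open>A weakly open set is the preimage of an open set under the map to the countably many values
  of the distribution function at rational points.  Weak Borel measurability is therefore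
  measurability of these values, although the weak topology is generated by an uncountable family.\<close>

lemma openin_weak_topology_rat_cdf:
  assumes S: "openin weak_topology S"
  obtains V :: "(rat \<Rightarrow> real) set" where "open V"
    "\<And>\<mu>. \<mu> \<in> prob_measures \<Longrightarrow> \<mu> \<in> S \<longleftrightarrow> (\<lambda>q. cdf \<mu> (of_rat q)) \<in> V"
proof -
  define e :: "real measure \<Rightarrow> rat \<Rightarrow> real" where "e \<mu> = (\<lambda>q. cdf \<mu> (of_rat q))" for \<mu>
  \<comment> \<open>The countable product \<open>rat \<Rightarrow> real\<close> is metric. If no
    ball around \<open>e \<nu>\<close> worked, measures outside \<open>S\<close> at distance below
    1/(k+1) would converge to \<open>\<nu>\<close> at all rationals, hence weakly, and would have to
    enter the open set \<open>S\<close>.\<close>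
  have "\<exists>d>0. \<forall>\<mu>\<in>prob_measures. dist (e \<mu>) (e \<nu>) < d \<longrightarrow> \<mu> \<in> S" if "\<nu> \<in> S" for \<nu>
  proof (rule ccontr)
    assume "\<not> ?thesis"
    then have far: "\<exists>\<mu>\<in>prob_measures. dist (e \<mu>) (e \<nu>) < r \<and> \<mu> \<notin> S" if "0 < r" for r
      using that by blast
    have "\<exists>\<mu>. \<forall>k. \<mu> k \<in> prob_measures \<and> dist (e (\<mu> k)) (e \<nu>) < 1 / Suc k \<and> \<mu> k \<notin> S"
    proof (intro choice allI)
      fix k :: nat
      show "\<exists>\<mu>. \<mu> \<in> prob_measures \<and> dist (e \<mu>) (e \<nu>) < 1 / Suc k \<and> \<mu> \<notin> S"
        using far[of "1 / Suc k"] by auto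
    qed
    then obtain \<mu> where \<mu>: "\<And>k. \<mu> k \<in> prob_measures"
      "\<And>k. dist (e (\<mu> k)) (e \<nu>) < 1 / Suc k" "\<And>k. \<mu> k \<notin> S" by blast
    have "(\<lambda>k. dist (e (\<mu> k)) (e \<nu>)) \<longlonglongrightarrow> 0"
    proof (rule Lim_null_comparison[OF _ LIMSEQ_inverse_real_of_nat], rule always_eventually, rule allI)
      show "norm (dist (e (\<mu> k)) (e \<nu>)) \<le> inverse (real (Suc k))" for k
        using \<mu>(2)[of k] by (simp add: inverse_eq_divide)
    qed
    then have "(\<lambda>k. e (\<mu> k)) \<longlonglongrightarrow> e \<nu>"
      by (rule tendsto_dist_iff[THEN iffD2])
    then have "(\<lambda>k. e (\<mu> k) q) \<longlonglongrightarrow> e \<nu> q" for q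
      using continuous_on_tendsto_compose[OF continuous_on_product_coordinates[where i=q]] by auto
    then have conv: "(\<lambda>k. cdf (\<mu> k) (of_rat q)) \<longlonglongrightarrow> cdf \<nu> (of_rat q)" for q
      by (simp only: e_def)
    have "\<nu> \<in> prob_measures" using that openin_weak_topology_subset[OF S] by blast
    then have "weak_conv_m \<mu> \<nu>"
      using weak_conv_of_rat_cdf[of \<mu> \<nu>, OF \<mu>(1) _ conv] by blast
    then show False
      using eventually_happens'[OF sequentially_bot weak_conv_eventually_in_open[OF S that, of \<mu>, OF \<mu>(1)]] \<mu>(3)
      by blast
  qed
  then have "\<exists>d. \<forall>\<nu>\<in>S. d \<nu> > 0 \<and> (\<forall>\<mu>\<in>prob_measures. dist (e \<mu>) (e \<nu>) < d \<nu> \<longrightarrow> \<mu> \<in> S)"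
    by (intro bchoice ballI)
  then obtain d where d: "\<And>\<nu>. \<nu> \<in> S \<Longrightarrow> d \<nu> > 0"
    "\<And>\<nu> \<mu>. \<nu> \<in> S \<Longrightarrow> \<mu> \<in> prob_measures \<Longrightarrow> dist (e \<mu>) (e \<nu>) < d \<nu> \<Longrightarrow> \<mu> \<in> S"
    by blast
  \<comment> \<open>The image of \<open>S\<close> under \<open>e\<close> need not be open; the union
    of the balls is, and it contains no further images of probability measures.\<close>
  have "\<mu> \<in> S \<longleftrightarrow> e \<mu> \<in> (\<Union>\<nu>\<in>S. ball (e \<nu>) (d \<nu>))" if "\<mu> \<in> prob_measures" for \<mu>
  proof
    assume "\<mu> \<in> S"
    then show "e \<mu> \<in> (\<Union>\<nu>\<in>S. ball (e \<nu>) (d \<nu>))"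
      using d(1)[of \<mu>] by (intro UN_I[of \<mu>]) auto
  next
    assume "e \<mu> \<in> (\<Union>\<nu>\<in>S. ball (e \<nu>) (d \<nu>))"
    then show "\<mu> \<in> S" using d(2) that by (auto simp: dist_commute)
  qed
  then show ?thesis
    unfolding e_def by (rule that[rotated]) auto
qed

text \<open>A map into a countable product is Borel measurable as soon as its coordinates are, and
  weakly open sets are preimages of open sets of that product.\<close>

lemma measurable_weak_borelI:
  assumes "\<And>x. x \<in> space N \<Longrightarrow> \<mu> x \<in> prob_measures"
    and cdf: "\<And>q::rat. (\<lambda>x. cdf (\<mu> x) (of_rat q)) \<in> borel_measurable N"
  shows "\<mu> \<in> measurable N weak_borel"
  unfolding weak_borel_def
proof (rule measurable_measure_of)
  fix S assume "S \<in> {S. openin weak_topology S}"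
  then obtain V :: "(rat \<Rightarrow> real) set" where V: "open V"
    "\<And>\<mu>. \<mu> \<in> prob_measures \<Longrightarrow> \<mu> \<in> S \<longleftrightarrow> (\<lambda>q. cdf \<mu> (of_rat q)) \<in> V"
    by (auto intro: openin_weak_topology_rat_cdf[of S])
  have "(\<lambda>x. (\<lambda>q::rat. cdf (\<mu> x) (of_rat q))) \<in> borel_measurable N"
    using cdf by (intro measurable_coordinatewise_then_product)
  then have "(\<lambda>x. (\<lambda>q::rat. cdf (\<mu> x) (of_rat q))) -` V \<inter> space N \<in> sets N"
    using V(1) by (intro measurable_sets) auto
  also have "(\<lambda>x. (\<lambda>q::rat. cdf (\<mu> x) (of_rat q))) -` V \<inter> space N = \<mu> -` S \<inter> space N"
    using V(2) assms(1) by auto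
  finally show "\<mu> -` S \<inter> space N \<in> sets N" .
qed (use assms(1) in \<open>auto dest!: openin_weak_topology_subset\<close>)

text \<open>Tailored to laws of processes with continuous paths: preimages of weakly open sets are
  relatively open in time. Distribution functions at a fixed argument need not be continuous in
  time.\<close>

lemma continuous_imp_measurable_flow:
  assumes \<mu>: "\<And>t. t \<in> {0..T} \<Longrightarrow> \<mu> t \<in> prob_measures"
    and cont: "\<And>f :: real \<Rightarrow> real. continuous_on UNIV f \<Longrightarrow> bounded (range f) \<Longrightarrow>
      continuous_on {0..T} (\<lambda>t. \<integral>x. f x \<partial>\<mu> t)"
  shows "\<mu> \<in> measurable_flows T"
  unfolding measurable_flows_def weak_borel_def
proof (rule measurable_measure_of)
  fix S assume "S \<in> {S. openin weak_topology S}"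
  then have "generate_topology_on {{\<mu> \<in> prob_measures. (\<integral>x. f x \<partial>\<mu>) \<in> V} | (f :: real \<Rightarrow> real) (V :: real set).
        continuous_on UNIV f \<and> bounded (range f) \<and> open V} S"
    by (simp add: weak_topology_def openin_topology_generated_by_iff)
  then have "openin (top_of_set {0..T}) ({0..T} \<inter> \<mu> -` S)"
  proof (induction S)
    case (Int a b)
    then have "openin (top_of_set {0..T}) (({0..T} \<inter> \<mu> -` a) \<inter> ({0..T} \<inter> \<mu> -` b))"
      using Int by (intro openin_Int[of _ "{0..T} \<inter> \<mu> -` a" "{0..T} \<inter> \<mu> -` b"])
    then show ?case by (simp add: Int_ac)
  next
    case (UN A)
    have "openin (top_of_set {0..T}) (\<Union>a\<in>A. {0..T} \<inter> \<mu> -` a)" using UN by (intro openin_Union) auto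
    moreover have "(\<Union>a\<in>A. {0..T} \<inter> \<mu> -` a) = {0..T} \<inter> \<mu> -` \<Union>A" by auto
    ultimately show ?case by (simp only:)
  next
    case (Basis s)
    then obtain f :: "real \<Rightarrow> real" and V where s: "s = {\<mu> \<in> prob_measures. (\<integral>x. f x \<partial>\<mu>) \<in> V}"
      and f: "continuous_on UNIV f" "bounded (range f)" "open V" by auto
    have "openin (top_of_set {0..T}) ({0..T} \<inter> (\<lambda>t. \<integral>x. f x \<partial>\<mu> t) -` V)"
      using cont[OF f(1,2)] f(3) by (rule continuous_openin_preimage_gen)
    also have "{0..T} \<inter> (\<lambda>t. \<integral>x. f x \<partial>\<mu> t) -` V = {0..T} \<inter> \<mu> -` s"
      using \<mu> by (auto simp: s)
    finally show ?case .
  qed simp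
  then have "{0..T} \<inter> \<mu> -` S \<in> sets (restrict_space borel {0..T})"
    by (auto simp: openin_open sets_restrict_space)
  then show "\<mu> -` S \<inter> space (restrict_space borel {0..T}) \<in> sets (restrict_space borel {0..T})"
    by (simp add: space_restrict_space Int_commute)
qed (use \<mu> in \<open>auto simp: space_restrict_space dest!: openin_weak_topology_subset\<close>)


section \<open>The time measure\<close>

text \<open>\<open>measure_of\<close> would be the zero measure if the set function were not
  countably additive; proving additivity gives the three summands their meaning.\<close>

lemma
  assumes T: "0 < T"
  shows space_time_measure: "space (time_measure T) = {0..T}"
    and sets_time_measure: "sets (time_measure T) = sets (restrict_space borel {0..T})"
    and emeasure_time_measure: "A \<in> sets (restrict_space borel {0..T}) \<Longrightarrow>
      emeasure (time_measure T) A = indicator A 0 + emeasure lborel A + indicator A T"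
proof -
  let ?N = "restrict_space borel {0..T}" and ?\<pi> = "\<lambda>A. indicator A 0 + emeasure lborel A + indicator A T"
  have sp: "space ?N = {0..T}" by (simp add: space_restrict_space)
  have sub: "sets ?N \<subseteq> Pow {0..T}" using sets.space_closed[of ?N] sp by simp
  have sig: "sigma_sets {0..T} (sets ?N) = sets ?N"
    using sets.sigma_sets_eq[of ?N] sp by simp
  show "space (time_measure T) = {0..T}" "sets (time_measure T) = sets ?N"
    using sub sig by (auto simp: time_measure_def space_measure_of_conv)
  have "countably_additive (sets ?N) ?\<pi>"
  proof (rule countably_additiveI)
    fix A :: "nat \<Rightarrow> real set"
    assume A: "range A \<subseteq> sets ?N" "disjoint_family A"
    then have "range A \<subseteq> sets lborel" by (auto simp: sets_restrict_space)
    then have "(\<Sum>i. emeasure lborel (A i)) = emeasure lborel (\<Union>i. A i)"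
      using A(2) by (rule suminf_emeasure)
    moreover have "(\<Sum>i. indicator (A i) x) = (indicator (\<Union>i. A i) x :: ennreal)" for x
      using A(2) by (rule suminf_indicator)
    ultimately show "(\<Sum>i. ?\<pi> (A i)) = ?\<pi> (\<Union>i. A i)"
      by (simp add: suminf_add[symmetric])
  qed
  moreover have "positive (sets ?N) ?\<pi>" by (simp add: positive_def)
  ultimately show "A \<in> sets ?N \<Longrightarrow> emeasure (time_measure T) A = ?\<pi> A"
    unfolding time_measure_def using sub sig
    by (subst emeasure_measure_of[OF refl]) auto
qed

lemma finite_measure_time_measure:
  assumes "0 < T" shows "finite_measure (time_measure T)"
proof
  have "{0..T} \<in> sets (restrict_space borel {0..T})" by (auto simp: sets_restrict_space)
  then show "emeasure (time_measure T) (space (time_measure T)) \<noteq> \<infinity>"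
    using assms by (simp add: space_time_measure emeasure_time_measure)
qed

lemma AE_time_measureI:
  assumes "0 < T" "\<And>t. t \<in> {0..T} \<Longrightarrow> P t"
  shows "AE t in time_measure T. P t"
  using assms by (intro AE_I2) (simp add: space_time_measure)

text \<open>Lebesgue measure is one of the three summands. Drifts and costs see a flow only through
  time integrals, so this is all they require of the order on flows.\<close>

lemma AE_time_measure_lborel:
  assumes T: "0 < T" and "AE t in time_measure T. P t"
  shows "AE t in lborel. t \<in> {0..T} \<longrightarrow> P t"
proof -
  obtain N where N: "{t\<in>{0..T}. \<not> P t} \<subseteq> N" "emeasure (time_measure T) N = 0" "N \<in> sets (restrict_space borel {0..T})"
    using AE_E[OF assms(2)] T by (auto simp: space_time_measure sets_time_measure)
  then have "emeasure lborel N = 0" "N \<in> sets lborel"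
    using T by (auto simp: emeasure_time_measure sets_restrict_space)
  then show ?thesis using N(1) by (intro AE_I[where N=N]) auto
qed


section \<open>Primitives of bounded measurable functions\<close>

definition bounded_density :: "real \<Rightarrow> real \<Rightarrow> (real \<Rightarrow> real) \<Rightarrow> bool" where
  "bounded_density T C b \<longleftrightarrow> set_borel_measurable borel {0..T} b \<and> (\<forall>s\<in>{0..T}. \<bar>b s\<bar> \<le> C)"

definition primitive :: "(real \<Rightarrow> real) \<Rightarrow> real \<Rightarrow> real" where
  "primitive b t = (LINT s:{0..t}|lborel. b s)"

lemma bounded_density_nonneg: "0 \<le> T \<Longrightarrow> bounded_density T C b \<Longrightarrow> 0 \<le> C"
  by (force simp: bounded_density_def intro: order.trans[OF abs_ge_zero])

lemma bounded_density_set_integrable: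
  assumes "bounded_density T C b" "0 \<le> u" "t \<le> T"
  shows "set_integrable lborel {u..t} b"
proof -
  have "set_integrable lborel {0..T} b"
    unfolding set_integrable_def
  proof (rule integrableI_bounded_set[of "{0..T}" _ _ C])
    show "(\<lambda>x. indicat_real {0..T} x *\<^sub>R b x) \<in> borel_measurable lborel"
      using assms(1) by (auto simp: bounded_density_def set_borel_measurable_def)
    show "AE x in lborel. x \<in> {0..T} \<longrightarrow> norm (indicat_real {0..T} x *\<^sub>R b x) \<le> C"
      using assms(1) by (auto simp: bounded_density_def)
  qed (auto simp: emeasure_lborel_Icc_eq)
  then show ?thesis by (rule set_integrable_subset) (use assms in auto)
qed

lemma set_integral_abs_le:
  fixes f :: "real \<Rightarrow> real"
  assumes "set_integrable lborel {u..t} f" "\<And>s. s \<in> {u..t} \<Longrightarrow> \<bar>f s\<bar> \<le> B" "u \<le> t"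
  shows "\<bar>LINT s:{u..t}|lborel. f s\<bar> \<le> B * (t - u)"
proof -
  have "\<bar>LINT s:{u..t}|lborel. f s\<bar> \<le> (LINT s:{u..t}|lborel. \<bar>f s\<bar>)"
    using set_integral_norm_bound[OF assms(1)] by simp
  also have "\<dots> \<le> (LINT s:{u..t}|lborel. B)"
    using assms set_integrable_abs[OF assms(1)]
    by (intro set_integral_mono) (auto simp: set_integrable_def)
  also have "\<dots> = B * (t - u)" using assms(3) by (simp add: set_lebesgue_integral_def)
  finally show ?thesis .
qed

lemma primitive_0 [simp]: "primitive b 0 = 0"
  unfolding primitive_def set_lebesgue_integral_def
proof (rule integral_eq_zero_AE)
  show "AE s in lborel. indicat_real {0..0} s *\<^sub>R b s = 0"
    using AE_lborel_singleton[of "0::real"] by eventually_elim simp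
qed

lemma set_integral_Icc_split:
  fixes f :: "real \<Rightarrow> real"
  assumes "set_integrable lborel {a..t} f" "a \<le> u" "u \<le> t"
  shows "(LINT s:{a..t}|lborel. f s) = (LINT s:{a..u}|lborel. f s) + (LINT s:{u..t}|lborel. f s)"
proof -
  have i1: "set_integrable lborel {a..u} f" and i2: "set_integrable lborel {u<..t} f" "set_integrable lborel {u..t} f"
    using assms by (auto intro: set_integrable_subset[OF assms(1)])
  have "{a..t} = {a..u} \<union> {u<..t}" using assms by auto
  then have "(LINT s:{a..t}|lborel. f s) = (LINT s:{a..u}|lborel. f s) + (LINT s:{u<..t}|lborel. f s)"
    using i1 i2 by (simp only:) (intro set_integral_Un; auto)
  also have "(LINT s:{u<..t}|lborel. f s) = (LINT s:{u..t}|lborel. f s)"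
    unfolding set_lebesgue_integral_def
  proof (rule integral_cong_AE)
    show "AE s in lborel. indicat_real {u<..t} s *\<^sub>R f s = indicat_real {u..t} s *\<^sub>R f s"
      using AE_lborel_singleton[of u] by eventually_elim (auto simp: indicator_def)
  qed (use i2 in \<open>auto simp: set_integrable_def\<close>)
  finally show ?thesis .
qed

lemma primitive_diff:
  assumes "bounded_density T C b" "0 \<le> u" "u \<le> t" "t \<le> T"
  shows "primitive b t - primitive b u = (LINT s:{u..t}|lborel. b s)"
  using set_integral_Icc_split[OF bounded_density_set_integrable[OF assms(1)], of 0 t u] assms
  by (simp add: primitive_def)

lemma primitive_Lipschitz:
  assumes "bounded_density T C b" "s \<in> {0..T}" "t \<in> {0..T}"
  shows "\<bar>primitive b t - primitive b s\<bar> \<le> C * \<bar>t - s\<bar>"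
proof -
  have *: "\<bar>primitive b t - primitive b s\<bar> \<le> C * \<bar>t - s\<bar>" if "0 \<le> s" "s \<le> t" "t \<le> T" for s t
  proof -
    have "\<bar>LINT x:{s..t}|lborel. b x\<bar> \<le> C * (t - s)"
      using assms(1) that
      by (intro set_integral_abs_le bounded_density_set_integrable[OF assms(1)])
         (auto simp: bounded_density_def)
    then show ?thesis using primitive_diff[OF assms(1) that] that by simp
  qed
  show ?thesis
    using *[of s t] *[of t s] assms by (cases "s \<le> t") (auto simp: abs_minus_commute)
qed

lemma primitive_abs_le:
  assumes "bounded_density T C b" "t \<in> {0..T}"
  shows "\<bar>primitive b t\<bar> \<le> C * T"
proof -
  have "\<bar>primitive b t\<bar> \<le> C * t" using primitive_Lipschitz[OF assms(1), of 0 t] assms(2) by auto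
  also have "\<dots> \<le> C * T"
    using bounded_density_nonneg[OF _ assms(1)] assms(2) by (intro mult_left_mono) auto
  finally show ?thesis .
qed

lemma continuous_on_primitive:
  assumes "bounded_density T C b"
  shows "continuous_on {0..T} (primitive b)"
proof (rule continuous_on_subset[OF lipschitz_on_continuous_on[of "\<bar>C\<bar>"] subset_refl], rule lipschitz_onI)
  fix x y assume *: "x \<in> {0..T}" "y \<in> {0..T}"
  have "\<bar>primitive b x - primitive b y\<bar> \<le> C * \<bar>x - y\<bar>"
    using primitive_Lipschitz[OF assms *(2,1)] .
  also have "\<dots> \<le> \<bar>C\<bar> * \<bar>x - y\<bar>" by (intro mult_right_mono) auto
  finally show "dist (primitive b x) (primitive b y) \<le> \<bar>C\<bar> * dist x y"
    by (simp add: dist_real_def)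
qed simp

text \<open>A quadratic modulus forces every difference quotient to tend to 0.\<close>

lemma constant_of_quadratic_bound:
  fixes f :: "real \<Rightarrow> real"
  assumes "\<And>s t. s \<in> {0..T} \<Longrightarrow> t \<in> {0..T} \<Longrightarrow> s \<le> t \<Longrightarrow> \<bar>f t - f s\<bar> \<le> k * (t - s)\<^sup>2" and t: "t \<in> {0..T}"
  shows "f t = f 0"
proof -
  have bound: "\<bar>f y - f x\<bar> \<le> k * (y - x)\<^sup>2" if "x \<in> {0..T}" "y \<in> {0..T}" for x y
    using assms(1)[of x y] assms(1)[of y x] that
    by (cases "x \<le> y") (auto simp: abs_minus_commute power2_commute)
  have "\<exists>c. \<forall>x\<in>{0..T}. f x = c"
  proof (rule has_field_derivative_zero_constant)
    fix x assume x: "x \<in> {0..T}"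
    have "((\<lambda>y. (f y - f x) / (y - x)) \<longlongrightarrow> 0) (at x within {0..T})"
    proof (rule Lim_null_comparison)
      show "\<forall>\<^sub>F y in at x within {0..T}. norm ((f y - f x) / (y - x)) \<le> k * \<bar>y - x\<bar>"
        unfolding eventually_at_filter
      proof (rule always_eventually, intro allI impI)
        fix y assume "y \<noteq> x" "y \<in> {0..T}"
        then show "norm ((f y - f x) / (y - x)) \<le> k * \<bar>y - x\<bar>"
          using bound[OF x, of y] by (simp add: divide_le_eq power2_eq_square abs_mult_self_eq ac_simps)
      qed
      show "((\<lambda>y. k * \<bar>y - x\<bar>) \<longlongrightarrow> 0) (at x within {0..T})"
        by (rule tendsto_eq_intros | simp)+
    qed
    then show "(f has_field_derivative 0) (at x within {0..T})"
      by (simp add: has_field_derivative_iff)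
  qed simp
  then show ?thesis using t by force
qed

text \<open>The primitive need not be differentiable everywhere; both sides of the chain rule change by the
  same amount up to a quadratic error, so their difference has derivative zero.\<close>

lemma primitive_chain_rule:
  assumes d: "bounded_density T C d"
    and S: "\<And>t. t \<in> {0..T} \<Longrightarrow> primitive d t \<in> S"
    and quad: "\<And>x y. x \<in> S \<Longrightarrow> y \<in> S \<Longrightarrow> \<bar>\<phi> y - \<phi> x - \<phi>' x * (y - x)\<bar> \<le> c * (y - x)\<^sup>2"
    and lip: "\<And>x y. x \<in> S \<Longrightarrow> y \<in> S \<Longrightarrow> \<bar>\<phi>' y - \<phi>' x\<bar> \<le> c * \<bar>y - x\<bar>"
    and c: "0 \<le> c" and t: "t \<in> {0..T}"
  obtains C' where "bounded_density T C' (\<lambda>s. \<phi>' (primitive d s) * d s)"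
    "\<phi> (primitive d t) - \<phi> 0 = primitive (\<lambda>s. \<phi>' (primitive d s) * d s) t"
proof -
  define D where "D = primitive d"
  define e where "e s = \<phi>' (D s) * d s" for s
  have T0: "0 \<le> T" using t by auto
  have C0: "0 \<le> C" using bounded_density_nonneg[OF T0 d] .
  have DS: "D s \<in> S" if "s \<in> {0..T}" for s using S that by (simp add: D_def)
  have D0: "D 0 = 0" by (simp add: D_def)
  have Dlip: "\<bar>D t - D s\<bar> \<le> C * \<bar>t - s\<bar>" if "s \<in> {0..T}" "t \<in> {0..T}" for s t
    using primitive_Lipschitz[OF d that] by (simp add: D_def)
  have \<phi>'lip: "\<bar>\<phi>' (D t) - \<phi>' (D s)\<bar> \<le> c * (C * \<bar>t - s\<bar>)" if "s \<in> {0..T}" "t \<in> {0..T}" for s t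
    using lip[OF DS[OF that(1)] DS[OF that(2)]] mult_left_mono[OF Dlip[OF that] c] by linarith
  have cont: "continuous_on {0..T} (\<lambda>s. \<phi>' (D s))"
  proof (rule lipschitz_on_continuous_on[of "c * C"], rule lipschitz_onI)
    show "dist (\<phi>' (D x)) (\<phi>' (D y)) \<le> c * C * dist x y" if "x \<in> {0..T}" "y \<in> {0..T}" for x y
      using \<phi>'lip[OF that(2,1)] by (simp add: dist_real_def ac_simps)
  qed (use c C0 in auto)
  \<comment> \<open>The value of \<open>\<phi>'\<close> at the start plus its largest variation
    along the primitive, times the bound of \<open>d\<close>.\<close>
  define C' where "C' = (\<bar>\<phi>' (D 0)\<bar> + c * (C * T)) * C"
  have e: "bounded_density T C' e"
    unfolding bounded_density_def
  proof
    have "set_borel_measurable borel {0..T} (\<lambda>s. \<phi>' (D s))"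
      unfolding set_borel_measurable_def using cont by (intro borel_measurable_continuous_on_indicator) auto
    moreover have "set_borel_measurable borel {0..T} d" using d by (simp add: bounded_density_def)
    ultimately have "(\<lambda>s. (indicat_real {0..T} s *\<^sub>R \<phi>' (D s)) * (indicat_real {0..T} s *\<^sub>R d s)) \<in> borel_measurable borel"
      unfolding set_borel_measurable_def by (intro borel_measurable_times)
    also have "(\<lambda>s. (indicat_real {0..T} s *\<^sub>R \<phi>' (D s)) * (indicat_real {0..T} s *\<^sub>R d s)) = (\<lambda>s. indicat_real {0..T} s *\<^sub>R e s)"
      by (auto simp: indicator_def e_def)
    finally show "set_borel_measurable borel {0..T} e" by (simp add: set_borel_measurable_def)
    show "\<forall>s\<in>{0..T}. \<bar>e s\<bar> \<le> C'"
    proof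
      fix s assume s: "s \<in> {0..T}"
      have "c * (C * \<bar>s - 0\<bar>) \<le> c * (C * T)" using s c C0 by (intro mult_left_mono) auto
      then have "\<bar>\<phi>' (D s)\<bar> \<le> \<bar>\<phi>' (D 0)\<bar> + c * (C * T)" using \<phi>'lip[of 0 s] s by auto
      moreover have "\<bar>d s\<bar> \<le> C" using d s by (simp add: bounded_density_def)
      ultimately show "\<bar>e s\<bar> \<le> C'"
        unfolding e_def C'_def abs_mult by (intro mult_mono) (use c C0 T0 in auto)
    qed
  qed
  define \<Psi> where "\<Psi> s = \<phi> (D s) - primitive e s" for s
  \<comment> \<open>One summand c C^2 bounds the Taylor remainder of \<open>\<phi>\<close> over a
    step, the other the replacement of \<open>\<phi>' (D s)\<close> by \<open>\<phi>' (D u)\<close>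
    under the integral.\<close>
  have "\<Psi> t = \<Psi> 0"
  proof (rule constant_of_quadratic_bound[where k="c * C\<^sup>2 + c * C\<^sup>2", OF _ t])
    fix u v assume u: "u \<in> {0..T}" and v: "v \<in> {0..T}" and uv: "u \<le> v"
    have id: "set_integrable lborel {u..v} d" and ie: "set_integrable lborel {u..v} e"
      using u v by (auto intro: bounded_density_set_integrable[OF d] bounded_density_set_integrable[OF e])
    have ic: "set_integrable lborel {u..v} (\<lambda>s. \<phi>' (D u) * d s)" using id by simp
    have "\<Psi> v - \<Psi> u = (\<phi> (D v) - \<phi> (D u) - \<phi>' (D u) * (D v - D u))
        + (\<phi>' (D u) * (LINT s:{u..v}|lborel. d s) - (LINT s:{u..v}|lborel. e s))"
      using primitive_diff[OF d, of u v] primitive_diff[OF e, of u v] u v uv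
      unfolding \<Psi>_def D_def[symmetric] by (auto simp: algebra_simps)
    also have "\<phi>' (D u) * (LINT s:{u..v}|lborel. d s) - (LINT s:{u..v}|lborel. e s)
        = (LINT s:{u..v}|lborel. (\<phi>' (D u) * d s - e s))"
      using set_integral_diff(2)[OF ic ie] by simp
    finally have step: "\<bar>\<Psi> v - \<Psi> u\<bar> \<le> \<bar>\<phi> (D v) - \<phi> (D u) - \<phi>' (D u) * (D v - D u)\<bar>
        + \<bar>LINT s:{u..v}|lborel. (\<phi>' (D u) * d s - e s)\<bar>" by linarith
    have "\<bar>\<phi> (D v) - \<phi> (D u) - \<phi>' (D u) * (D v - D u)\<bar> \<le> c * (D v - D u)\<^sup>2"
      using quad DS u v by blast
    moreover have "c * (D v - D u)\<^sup>2 \<le> c * (C * \<bar>v - u\<bar>)\<^sup>2"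
      using Dlip[OF u v] C0 c by (intro mult_left_mono abs_le_square_iff[THEN iffD1]) auto
    moreover have "c * (C * \<bar>v - u\<bar>)\<^sup>2 = c * C\<^sup>2 * (v - u)\<^sup>2" by (simp add: power_mult_distrib)
    moreover have "\<bar>LINT s:{u..v}|lborel. (\<phi>' (D u) * d s - e s)\<bar> \<le> (c * C\<^sup>2 * (v - u)) * (v - u)"
    proof (rule set_integral_abs_le)
      show "set_integrable lborel {u..v} (\<lambda>s. \<phi>' (D u) * d s - e s)"
        using ic ie by (rule set_integral_diff)
      fix s assume s: "s \<in> {u..v}"
      then have s': "s \<in> {0..T}" using u v by auto
      have "c * (C * \<bar>u - s\<bar>) \<le> c * (C * (v - u))" using s c C0 by (intro mult_left_mono) auto
      then have "\<bar>\<phi>' (D u) - \<phi>' (D s)\<bar> \<le> c * (C * (v - u))" using \<phi>'lip[OF s' u] by auto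
      moreover have "\<bar>d s\<bar> \<le> C" using d s' by (simp add: bounded_density_def)
      ultimately have "\<bar>\<phi>' (D u) - \<phi>' (D s)\<bar> * \<bar>d s\<bar> \<le> c * (C * (v - u)) * C"
        using c C0 uv by (intro mult_mono) auto
      then show "\<bar>\<phi>' (D u) * d s - e s\<bar> \<le> c * C\<^sup>2 * (v - u)"
        by (simp add: e_def abs_mult[symmetric] power2_eq_square algebra_simps)
    qed (use uv in auto)
    moreover have "(c * C\<^sup>2 * (v - u)) * (v - u) = c * C\<^sup>2 * (v - u)\<^sup>2"
      by (simp add: power2_eq_square)
    ultimately show "\<bar>\<Psi> v - \<Psi> u\<bar> \<le> (c * C\<^sup>2 + c * C\<^sup>2) * (v - u)\<^sup>2"
      using step by (simp add: distrib_right)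
  qed
  then have "\<phi> (D t) - \<phi> 0 = primitive e t" by (simp add: \<Psi>_def D0)
  then show ?thesis using e that unfolding e_def[abs_def] D_def by blast
qed

section \<open>The chain rule for the exponential and for the positive part\<close>

lemma exp_Lipschitz:
  fixes x y k :: real
  assumes "x \<le> k" "y \<le> k"
  shows "\<bar>exp y - exp x\<bar> \<le> exp k * \<bar>y - x\<bar>"
proof -
  have *: "\<bar>exp y - exp x\<bar> \<le> exp k * \<bar>y - x\<bar>" if "y \<le> k" "x \<le> y" for x y :: real
  proof -
    have "exp y * (1 + (x - y)) \<le> exp y * exp (x - y)"
      by (intro mult_left_mono exp_ge_add_one_self) auto
    then have "exp y - exp x \<le> exp y * (y - x)"
      by (simp add: exp_add[symmetric] algebra_simps)
    also have "\<dots> \<le> exp k * (y - x)" using that by (intro mult_right_mono) auto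
    finally show ?thesis using that by simp
  qed
  show ?thesis
    using *[of x y] *[of y x] assms by (cases "x \<le> y") (auto simp: abs_minus_commute)
qed

text \<open>On the whole line the exponential has neither bounded slope nor bounded curvature, so
  the chain rule is applied on the interval \<open>S\<close> that contains all values of the
  primitive; there exp (C T) bounds both.\<close>

lemma primitive_exp_density:
  assumes d: "bounded_density T C d" and T: "0 \<le> T"
  obtains C' where "bounded_density T C' (\<lambda>s. exp (primitive d s) * d s)"
    "\<And>t. t \<in> {0..T} \<Longrightarrow> exp (primitive d t) - 1 = primitive (\<lambda>s. exp (primitive d s) * d s) t"
proof -
  define S where "S = {- (C * T)..C * T}"
  define c where "c = exp (C * T)"
  have mv: "\<bar>exp y - exp x\<bar> \<le> c * \<bar>y - x\<bar>" if "x \<in> S" "y \<in> S" for x y :: real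
    using that unfolding c_def S_def by (intro exp_Lipschitz) auto
  have quad: "\<bar>exp y - exp x - exp x * (y - x)\<bar> \<le> c * (y - x)\<^sup>2" if "x \<in> S" "y \<in> S" for x y :: real
  proof -
    have "exp x * (1 + (y - x)) \<le> exp x * exp (y - x)"
      by (intro mult_left_mono exp_ge_add_one_self) auto
    then have lo: "0 \<le> exp y - exp x - exp x * (y - x)"
      by (simp add: exp_add[symmetric] algebra_simps)
    have "exp y * (1 + (x - y)) \<le> exp y * exp (x - y)"
      by (intro mult_left_mono exp_ge_add_one_self) auto
    then have "exp y - exp x - exp x * (y - x) \<le> (exp y - exp x) * (y - x)"
      by (simp add: exp_add[symmetric] algebra_simps)
    also have "\<dots> \<le> \<bar>exp y - exp x\<bar> * \<bar>y - x\<bar>" by (simp add: abs_mult[symmetric])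
    also have "\<dots> \<le> c * \<bar>y - x\<bar> * \<bar>y - x\<bar>" by (intro mult_right_mono mv that) auto
    finally show ?thesis using lo by (simp add: power2_eq_square abs_mult_self_eq ac_simps)
  qed
  have inS: "primitive d s \<in> S" if "s \<in> {0..T}" for s
    using primitive_abs_le[OF d that] by (auto simp: S_def abs_le_iff)
  have chain: "\<exists>C'. bounded_density T C' (\<lambda>s. exp (primitive d s) * d s) \<and>
      exp (primitive d t) - 1 = primitive (\<lambda>s. exp (primitive d s) * d s) t" if "t \<in> {0..T}" for t
    by (rule primitive_chain_rule[of T C d S exp exp c t]) (use d inS quad mv that in \<open>auto simp: c_def\<close>)
  \<comment> \<open>The bound in \<open>chain\<close> may depend on t, but the density does not, so
    the bound found at t = 0 serves for all times.\<close>
  from chain[of 0] obtain C' where "bounded_density T C' (\<lambda>s. exp (primitive d s) * d s)" using T by auto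
  with chain show ?thesis by (intro that) auto
qed

text \<open>Unlike the positive part, its square has a Lipschitz derivative, 2 max x 0; the
  left-hand side is its first-order Taylor remainder.\<close>

lemma square_pos_part_bounds:
  fixes x y :: real
  shows "\<bar>(max y 0)\<^sup>2 - (max x 0)\<^sup>2 - 2 * max x 0 * (y - x)\<bar> \<le> (y - x)\<^sup>2"
proof -
  consider "x \<ge> 0" "y \<ge> 0" | "x \<ge> 0" "y < 0" | "x < 0" "y \<ge> 0" | "x < 0" "y < 0" by linarith
  then show ?thesis
  proof cases
    case 1
    then have "(max y 0)\<^sup>2 - (max x 0)\<^sup>2 - 2 * max x 0 * (y - x) = (y - x)\<^sup>2"
      by (simp add: power2_eq_square algebra_simps)
    then show ?thesis by simp
  next
    case 2
    then have "(max y 0)\<^sup>2 - (max x 0)\<^sup>2 - 2 * max x 0 * (y - x) = (y - x)\<^sup>2 - y\<^sup>2"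
      by (simp add: power2_eq_square algebra_simps)
    moreover have "x * y \<le> 0" using 2 by (simp add: mult_nonneg_nonpos)
    moreover have "(y - x)\<^sup>2 - y\<^sup>2 = x\<^sup>2 - 2 * (x * y)"
      by (simp add: power2_eq_square algebra_simps)
    ultimately show ?thesis using zero_le_power2[of x] zero_le_power2[of y] by linarith
  next
    case 3
    then have "\<bar>y\<bar> \<le> \<bar>y - x\<bar>" by auto
    then show ?thesis using 3 by (simp add: abs_le_square_iff)
  qed simp
qed

text \<open>The kink of the positive part is smoothed on [0, \<open>\<epsilon>\<close>] before the
  chain rule is applied. The derivatives of the smoothings vanish at 0, which decides the value 0 of
  the density on the set where the primitive is 0. This lemma is what turns a switch between two
  controls into a maximum of primitives.\<close>

lemma primitive_pos_part:
  assumes d: "bounded_density T C d" and t: "t \<in> {0..T}"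
  shows "primitive (\<lambda>s. if primitive d s > 0 then d s else 0) t = max (primitive d t) 0"
proof -
  define D where "D = primitive d"
  \<comment> \<open>A difference of two shifted squares, to which
    \<open>square_pos_part_bounds\<close> applies: it equals x^2 / (2 \<open>\<epsilon>\<close>) on
    [0, \<open>\<epsilon>\<close>] and x - \<open>\<epsilon>\<close> / 2 beyond, with a slope
    \<open>\<phi>'\<close> that rises linearly from 0 to 1.\<close>
  define \<phi> where "\<phi> \<epsilon> x = ((max x 0)\<^sup>2 - (max (x - \<epsilon>) 0)\<^sup>2) / (2 * \<epsilon>)" for \<epsilon> x :: real
  define \<phi>' where "\<phi>' \<epsilon> x = (max x 0 - max (x - \<epsilon>) 0) / \<epsilon>" for \<epsilon> x :: real
  have \<phi>': "0 \<le> \<phi>' \<epsilon> x" "\<phi>' \<epsilon> x \<le> 1" if "0 < \<epsilon>" for \<epsilon> x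
    using that by (auto simp: \<phi>'_def divide_le_eq_1 zero_le_divide_iff)
  have chain: "\<phi> \<epsilon> (D t) = (LINT s:{0..t}|lborel. \<phi>' \<epsilon> (D s) * d s)"
    and meas: "(\<lambda>s. indicat_real {0..t} s *\<^sub>R (\<phi>' \<epsilon> (D s) * d s)) \<in> borel_measurable lborel"
    if \<epsilon>: "0 < \<epsilon>" for \<epsilon>
  proof -
    have quad: "\<bar>\<phi> \<epsilon> y - \<phi> \<epsilon> x - \<phi>' \<epsilon> x * (y - x)\<bar> \<le> (2 / \<epsilon>) * (y - x)\<^sup>2" for x y
    proof -
      have "\<phi> \<epsilon> y - \<phi> \<epsilon> x - \<phi>' \<epsilon> x * (y - x)
        = (((max y 0)\<^sup>2 - (max x 0)\<^sup>2 - 2 * max x 0 * (y - x))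
          - ((max (y - \<epsilon>) 0)\<^sup>2 - (max (x - \<epsilon>) 0)\<^sup>2 - 2 * max (x - \<epsilon>) 0 * ((y - \<epsilon>) - (x - \<epsilon>)))) / (2 * \<epsilon>)"
        using \<epsilon> by (simp add: \<phi>_def \<phi>'_def divide_simps) (simp add: algebra_simps)
      also have "\<bar>\<dots>\<bar> \<le> ((y - x)\<^sup>2 + ((y - \<epsilon>) - (x - \<epsilon>))\<^sup>2) / (2 * \<epsilon>)"
      proof -
        have "\<bar>A - B\<bar> / \<bar>2 * \<epsilon>\<bar> \<le> (a + b) / (2 * \<epsilon>)" if "\<bar>A\<bar> \<le> a" "\<bar>B\<bar> \<le> b" for A B a b :: real
          using that \<epsilon> by (simp add: divide_right_mono)
        then show ?thesis
          unfolding abs_divide using square_pos_part_bounds by blast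
      qed
      also have "\<dots> \<le> (2 / \<epsilon>) * (y - x)\<^sup>2"
        using \<epsilon> by (simp add: field_simps)
      finally show ?thesis .
    qed
    have lip: "\<bar>\<phi>' \<epsilon> y - \<phi>' \<epsilon> x\<bar> \<le> (2 / \<epsilon>) * \<bar>y - x\<bar>" for x y
    proof -
      have "\<bar>(max y 0 - max (y - \<epsilon>) 0) - (max x 0 - max (x - \<epsilon>) 0)\<bar> \<le> 2 * \<bar>y - x\<bar>"
        by (auto simp: max_def abs_if)
      then have "\<bar>((max y 0 - max (y - \<epsilon>) 0) - (max x 0 - max (x - \<epsilon>) 0)) / \<epsilon>\<bar> \<le> 2 * \<bar>y - x\<bar> / \<epsilon>"
        unfolding abs_divide using \<epsilon> by (simp add: divide_right_mono)
      then show ?thesis by (simp add: \<phi>'_def diff_divide_distrib)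
    qed
    obtain C' where C': "bounded_density T C' (\<lambda>s. \<phi>' \<epsilon> (primitive d s) * d s)"
      "\<phi> \<epsilon> (primitive d t) - \<phi> \<epsilon> 0 = primitive (\<lambda>s. \<phi>' \<epsilon> (primitive d s) * d s) t"
      by (rule primitive_chain_rule[OF d, of UNIV "\<phi> \<epsilon>" "\<phi>' \<epsilon>" "2 / \<epsilon>" t])
         (use quad lip \<epsilon> t in auto)
    then show "\<phi> \<epsilon> (D t) = (LINT s:{0..t}|lborel. \<phi>' \<epsilon> (D s) * d s)"
      using \<epsilon> by (simp add: D_def primitive_def \<phi>_def max_def)
    show "(\<lambda>s. indicat_real {0..t} s *\<^sub>R (\<phi>' \<epsilon> (D s) * d s)) \<in> borel_measurable lborel"
      using bounded_density_set_integrable[OF C'(1), of 0 t] t by (simp add: D_def set_integrable_def)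
  qed
  let ?\<epsilon> = "\<lambda>n. 1 / real (Suc n)"
  have \<epsilon>0: "?\<epsilon> \<longlonglongrightarrow> 0" using LIMSEQ_inverse_real_of_nat by (simp add: inverse_eq_divide)
  have small: "\<forall>\<^sub>F n in sequentially. ?\<epsilon> n < x" if "x > 0" for x
    using order_tendstoD(2)[OF \<epsilon>0 that] .
  have lim\<phi>': "(\<lambda>n. \<phi>' (?\<epsilon> n) x) \<longlonglongrightarrow> (if x > 0 then 1 else 0)" for x
  proof (cases "x > 0")
    case True
    have "\<forall>\<^sub>F n in sequentially. \<phi>' (?\<epsilon> n) x = 1"
      using small[OF True] by eventually_elim (use True in \<open>auto simp: \<phi>'_def max_def simp del: of_nat_Suc\<close>)
    then show ?thesis using True by (simp add: tendsto_eventually)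
  next
    case False
    have "max (x - ?\<epsilon> n) 0 = 0" for n
    proof -
      have "0 < ?\<epsilon> n" by simp
      then show ?thesis using False by (intro max_absorb2) linarith
    qed
    then have "\<phi>' (?\<epsilon> n) x = 0" for n
      using False by (simp add: \<phi>'_def max_def)
    then show ?thesis using False by simp
  qed
  have lim\<phi>: "(\<lambda>n. \<phi> (?\<epsilon> n) x) \<longlonglongrightarrow> max x 0" for x
  proof (cases "x > 0")
    case True
    have "\<forall>\<^sub>F n in sequentially. \<phi> (?\<epsilon> n) x = x - ?\<epsilon> n / 2"
      using small[OF True]
    proof eventually_elim
      case (elim n)
      have p: "0 < ?\<epsilon> n" by simp
      have "\<phi> (?\<epsilon> n) x = (x\<^sup>2 - (x - ?\<epsilon> n)\<^sup>2) / (2 * ?\<epsilon> n)" using True elim by (simp add: \<phi>_def max_def)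
      also have "\<dots> = x - ?\<epsilon> n / 2"
      proof -
        have "(x\<^sup>2 - (x - e)\<^sup>2) / (2 * e) = x - e / 2" if "0 < e" for e
          using that by (simp add: power2_eq_square field_simps)
        from this[OF p] show ?thesis .
      qed
      finally show ?case .
    qed
    moreover have "(\<lambda>n. x - ?\<epsilon> n / 2) \<longlonglongrightarrow> x - 0 / 2" by (intro tendsto_intros \<epsilon>0) auto
    ultimately have "(\<lambda>n. \<phi> (?\<epsilon> n) x) \<longlonglongrightarrow> x" by (subst tendsto_cong) auto
    then show ?thesis using True by (simp add: max_def)
  next
    case False
    have "max (x - ?\<epsilon> n) 0 = 0" for n
    proof -
      have "0 < ?\<epsilon> n" by simp
      then show ?thesis using False by (intro max_absorb2) linarith
    qed
    then have "\<phi> (?\<epsilon> n) x = 0" for n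
      using False by (simp add: \<phi>_def max_def)
    then show ?thesis using False by (simp add: max_def)
  qed
  have "(\<lambda>n. LINT s:{0..t}|lborel. \<phi>' (?\<epsilon> n) (D s) * d s) \<longlonglongrightarrow>
      (LINT s:{0..t}|lborel. (if D s > 0 then d s else 0))"
    unfolding set_lebesgue_integral_def
  proof (rule integral_dominated_convergence[where w="\<lambda>s. indicat_real {0..t} s * C"])
    show lim: "AE s in lborel. (\<lambda>n. indicat_real {0..t} s *\<^sub>R (\<phi>' (?\<epsilon> n) (D s) * d s))
        \<longlonglongrightarrow> indicat_real {0..t} s *\<^sub>R (if D s > 0 then d s else 0)"
    proof (rule AE_I2)
      fix s
      have "(\<lambda>n. indicat_real {0..t} s *\<^sub>R (\<phi>' (?\<epsilon> n) (D s) * d s))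
        \<longlonglongrightarrow> indicat_real {0..t} s *\<^sub>R ((if D s > 0 then 1 else 0) * d s)"
        by (intro tendsto_intros lim\<phi>')
      then show "(\<lambda>n. indicat_real {0..t} s *\<^sub>R (\<phi>' (?\<epsilon> n) (D s) * d s))
        \<longlonglongrightarrow> indicat_real {0..t} s *\<^sub>R (if D s > 0 then d s else 0)"
        by (simp split: if_splits cong: if_cong)
    qed
    show "(\<lambda>s. indicat_real {0..t} s *\<^sub>R (\<phi>' (?\<epsilon> n) (D s) * d s)) \<in> borel_measurable lborel" for n
      by (rule meas) simp
    show "(\<lambda>s. indicat_real {0..t} s *\<^sub>R (if D s > 0 then d s else 0)) \<in> borel_measurable lborel"
    proof (rule borel_measurable_LIMSEQ_real)
      show "(\<lambda>s. indicat_real {0..t} s *\<^sub>R (\<phi>' (?\<epsilon> n) (D s) * d s)) \<in> borel_measurable lborel" for n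
        by (rule meas) simp
      fix s
      have "(\<lambda>n. indicat_real {0..t} s *\<^sub>R (\<phi>' (?\<epsilon> n) (D s) * d s))
        \<longlonglongrightarrow> indicat_real {0..t} s *\<^sub>R ((if D s > 0 then 1 else 0) * d s)"
        by (intro tendsto_intros lim\<phi>')
      then show "(\<lambda>n. indicat_real {0..t} s *\<^sub>R (\<phi>' (?\<epsilon> n) (D s) * d s))
        \<longlonglongrightarrow> indicat_real {0..t} s *\<^sub>R (if D s > 0 then d s else 0)"
        by (simp split: if_splits cong: if_cong)
    qed
    show "integrable lborel (\<lambda>s. indicat_real {0..t} s * C)"
      by (intro integrable_mult_left integrable_real_indicator) (auto simp: emeasure_lborel_Icc_eq)
    show "AE s in lborel. norm (indicat_real {0..t} s *\<^sub>R (\<phi>' (?\<epsilon> n) (D s) * d s)) \<le> indicat_real {0..t} s * C" for n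
    proof (rule AE_I2)
      fix s
      show "norm (indicat_real {0..t} s *\<^sub>R (\<phi>' (?\<epsilon> n) (D s) * d s)) \<le> indicat_real {0..t} s * C"
      proof (cases "s \<in> {0..t}")
        case True
        then have "\<bar>d s\<bar> \<le> C" using d t by (auto simp: bounded_density_def)
        then have "\<bar>\<phi>' (?\<epsilon> n) (D s)\<bar> * \<bar>d s\<bar> \<le> 1 * C"
          using \<phi>'[of "?\<epsilon> n" "D s"] by (intro mult_mono) auto
        then show ?thesis using True by (simp add: abs_mult)
      qed simp
    qed
  qed
  then have "(\<lambda>n. \<phi> (?\<epsilon> n) (D t)) \<longlonglongrightarrow> (LINT s:{0..t}|lborel. (if D s > 0 then d s else 0))"
    by (simp add: chain)
  from LIMSEQ_unique[OF this lim\<phi>] show ?thesis by (simp add: primitive_def D_def)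
qed


section \<open>Square integrable random variables\<close>

definition sq_int :: "'a measure \<Rightarrow> ('a \<Rightarrow> real) \<Rightarrow> bool" where
  "sq_int M f \<longleftrightarrow> f \<in> borel_measurable M \<and> integrable M (\<lambda>x. (f x)\<^sup>2)"

lemma sq_int_measurable: "sq_int M f \<Longrightarrow> f \<in> borel_measurable M"
  by (simp add: sq_int_def)

lemma sq_int_mult:
  assumes "sq_int M f" "sq_int M g"
  shows "integrable M (\<lambda>x. f x * g x)"
proof (rule Bochner_Integration.integrable_bound)
  show "integrable M (\<lambda>x. (f x)\<^sup>2 + (g x)\<^sup>2)" using assms by (simp add: sq_int_def)
  show "(\<lambda>x. f x * g x) \<in> borel_measurable M"
    using assms by (intro borel_measurable_times sq_int_measurable)
  have "\<bar>a * b\<bar> \<le> a\<^sup>2 + b\<^sup>2" for a b :: real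
  proof -
    have "0 \<le> (\<bar>a\<bar> - \<bar>b\<bar>)\<^sup>2" by simp
    then have "2 * \<bar>a * b\<bar> \<le> a\<^sup>2 + b\<^sup>2" by (simp add: power2_diff abs_mult)
    then show ?thesis by simp
  qed
  then show "AE x in M. norm (f x * g x) \<le> norm ((f x)\<^sup>2 + (g x)\<^sup>2)"
    by (intro AE_I2) simp
qed

lemma sq_int_add:
  assumes "sq_int M f" "sq_int M g"
  shows "sq_int M (\<lambda>x. f x + g x)"
  using assms sq_int_mult[OF assms] borel_measurable_add[of f M g]
  by (simp add: sq_int_def power2_sum mult.assoc)

lemma sq_int_cmult: "sq_int M f \<Longrightarrow> sq_int M (\<lambda>x. c * f x)"
  using borel_measurable_times[of "\<lambda>_. c" M f] by (simp add: sq_int_def power_mult_distrib)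

lemma sq_int_diff:
  assumes "sq_int M f" "sq_int M g"
  shows "sq_int M (\<lambda>x. f x - g x)"
  using sq_int_add[OF assms(1) sq_int_cmult[OF assms(2), of "-1"]] by simp

lemma sq_int_sum:
  "(\<And>i. i \<in> I \<Longrightarrow> sq_int M (f i)) \<Longrightarrow> sq_int M (\<lambda>x. \<Sum>i\<in>I. f i x)"
proof (induction I rule: infinite_finite_induct)
  case (insert i I)
  then show ?case using sq_int_add[of M "f i" "\<lambda>x. \<Sum>i\<in>I. f i x"] by simp
qed (auto simp: sq_int_def)

lemma sq_int_bound:
  assumes "sq_int M g" "f \<in> borel_measurable M" "AE x in M. \<bar>f x\<bar> \<le> c * \<bar>g x\<bar>"
  shows "sq_int M f"
  unfolding sq_int_def
proof
  show "integrable M (\<lambda>x. (f x)\<^sup>2)"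
  proof (rule Bochner_Integration.integrable_bound)
    show "integrable M (\<lambda>x. (c * g x)\<^sup>2)" using assms by (simp add: sq_int_def power_mult_distrib)
    show "AE x in M. norm ((f x)\<^sup>2) \<le> norm ((c * g x)\<^sup>2)"
      using assms(3)
    proof eventually_elim
      case (elim x)
      also have "c * \<bar>g x\<bar> \<le> \<bar>c * g x\<bar>" by (simp add: abs_mult mult_right_mono)
      finally show ?case by (simp add: abs_le_square_iff)
    qed
  qed (use assms in simp)
qed fact

lemma (in prob_space) sq_int_bounded:
  assumes "f \<in> borel_measurable M" "\<And>x. x \<in> space M \<Longrightarrow> \<bar>f x\<bar> \<le> c"
  shows "sq_int M f"
  by (rule sq_int_bound[of M "\<lambda>_. 1" _ c]) (use assms in \<open>auto simp: sq_int_def\<close>)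

lemma (in prob_space) sq_int_integrable: "sq_int M f \<Longrightarrow> integrable M f"
  using sq_int_mult[of M f "\<lambda>_. 1"] by (simp add: sq_int_def)

lemma nn_integral_sq: "sq_int M f \<Longrightarrow> (\<integral>\<^sup>+x. ennreal ((f x)\<^sup>2) \<partial>M) = ennreal (\<integral>x. (f x)\<^sup>2 \<partial>M)"
  by (intro nn_integral_eq_integral) (auto simp: sq_int_def)

text \<open>Pythagoras, with orthogonality asked only for i < j, the form in which martingale
  differences provide it.\<close>

lemma integral_sum_sq_orthogonal:
  fixes n :: nat
  assumes "\<And>i. i < n \<Longrightarrow> sq_int M (f i)"
    and "\<And>i j. i < j \<Longrightarrow> j < n \<Longrightarrow> (\<integral>x. f i x * f j x \<partial>M) = 0"
  shows "(\<integral>x. (\<Sum>i<n. f i x)\<^sup>2 \<partial>M) = (\<Sum>i<n. \<integral>x. (f i x)\<^sup>2 \<partial>M)"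
  using assms
proof (induct n)
  case (Suc n)
  have s: "sq_int M (\<lambda>x. \<Sum>i<n. f i x)" "sq_int M (f n)"
    using Suc.prems(1) by (auto intro: sq_int_sum)
  have "(\<integral>x. (\<Sum>i<n. f i x) * f n x \<partial>M) = (\<Sum>i<n. \<integral>x. f i x * f n x \<partial>M)"
    using Suc.prems(1) by (simp add: sum_distrib_right sq_int_mult)
  also have "\<dots> = 0" using Suc.prems(2) by simp
  finally have cross: "(\<integral>x. (\<Sum>i<n. f i x) * f n x \<partial>M) = 0" .
  have "(\<integral>x. (\<Sum>i<Suc n. f i x)\<^sup>2 \<partial>M)
      = (\<integral>x. (\<Sum>i<n. f i x)\<^sup>2 + (f n x)\<^sup>2 + 2 * ((\<Sum>i<n. f i x) * f n x) \<partial>M)"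
    by (simp add: power2_sum mult.assoc)
  also have "\<dots> = (\<integral>x. (\<Sum>i<n. f i x)\<^sup>2 \<partial>M) + (\<integral>x. (f n x)\<^sup>2 \<partial>M) + 2 * (\<integral>x. (\<Sum>i<n. f i x) * f n x \<partial>M)"
    using s sq_int_mult[OF s] by (simp add: sq_int_def)
  finally show ?case using cross Suc by simp
qed simp


section \<open>Brownian increments\<close>

text \<open>Completing the square: an exponential weight only shifts the mean, so exponential
  moments of increments become ordinary moments of a shifted normal density.\<close>

lemma normal_density_exp_tilt:
  assumes "0 < s"
  shows "normal_density 0 s x * exp (c * x) = exp (c\<^sup>2 * s\<^sup>2 / 2) * normal_density (c * s\<^sup>2) s x"
proof -
  have "- x\<^sup>2 / (2 * s\<^sup>2) + c * x = c\<^sup>2 * s\<^sup>2 / 2 - (x - c * s\<^sup>2)\<^sup>2 / (2 * s\<^sup>2)"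
    using assms by (simp add: power2_eq_square field_simps)
  then show ?thesis
    by (simp add: normal_density_def exp_add[symmetric])
qed

context geometric_dynamics
begin

lemma prob_M: "prob_space M"
  using filtered by (simp add: complete_filtered_prob_space_def)

lemma subalgebra_F: "t \<in> {0..T} \<Longrightarrow> subalgebra M (F t)"
  using filtered by (simp add: complete_filtered_prob_space_def)

lemma space_F: "t \<in> {0..T} \<Longrightarrow> space (F t) = space M"
  using subalgebra_F by (auto simp: subalgebra_def)

lemma measurable_F_M: "t \<in> {0..T} \<Longrightarrow> X \<in> measurable (F t) N \<Longrightarrow> X \<in> measurable M N"
  by (rule measurable_from_subalg[OF subalgebra_F])

lemma measurable_F_mono:
  assumes "0 \<le> s" "s \<le> t" "t \<le> T" "X \<in> measurable (F s) N"
  shows "X \<in> measurable (F t) N"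
proof (rule measurable_from_subalg[OF _ assms(4)])
  show "subalgebra (F t) (F s)"
    using filtered assms(1-3) space_F[of s] space_F[of t]
    by (auto simp: complete_filtered_prob_space_def subalgebra_def)
qed

lemma measurable_W: "t \<in> {0..T} \<Longrightarrow> W t \<in> borel_measurable (F t)"
  using brownian by (simp add: brownian_motion_def)

text \<open>Brownian motion is defined through independence from the whole sigma-algebra at time s,
  and the one generated by \<open>g\<close> is contained in it.\<close>

lemma indep_var_increment:
  assumes st: "0 \<le> s" "s < t" "t \<le> T" and g: "g \<in> borel_measurable (F s)"
  shows "prob_space.indep_var M borel g borel (\<lambda>\<omega>. W t \<omega> - W s \<omega>)"
proof -
  interpret prob_space M by (rule prob_M)
  let ?Z = "\<lambda>\<omega>. W t \<omega> - W s \<omega>"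
  let ?B = "{?Z -` B \<inter> space M | B. B \<in> sets borel}"
  have sM: "s \<in> {0..T}" "t \<in> {0..T}" using st by auto
  have indep: "indep_set (sets (F s)) ?B"
    using brownian st by (simp add: brownian_motion_def)
  have [measurable]: "g \<in> borel_measurable M" "W s \<in> borel_measurable M" "W t \<in> borel_measurable M"
    using measurable_F_M measurable_W g sM by blast+
  have "sigma_sets (space M) {g -` A \<inter> space M | A. A \<in> sets borel} \<subseteq> sets (F s)"
    using sets.sigma_sets_subset[of "{g -` A \<inter> space M | A. A \<in> sets borel}" "F s"]
      measurable_sets[OF g] space_F[OF sM(1)] by auto
  moreover have "sigma_sets (space M) ?B = ?B"
    using sets_vimage_algebra[of "space M" ?Z borel] sets_vimage_algebra2[of ?Z "space M" borel] by auto
  ultimately have "indep_set (sigma_sets (space M) {g -` A \<inter> space M | A. A \<in> sets borel}) (sigma_sets (space M) ?B)"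
    using indep unfolding indep_sets2_eq by (metis (no_types, lifting) subset_iff)
  then show ?thesis unfolding indep_var_eq by auto
qed

text \<open>Independence factors the expectation. The degenerate case s = t is included so that
  interval ends may coincide; there the increment vanishes and \<open>v\<close> is
  \<open>\<phi> 0\<close>.\<close>

lemma increment_expectation:
  assumes st: "0 \<le> s" "s \<le> t" "t \<le> T" and g: "g \<in> borel_measurable (F s)" "integrable M g"
    and \<phi>: "\<phi> \<in> borel_measurable borel" "has_bochner_integral M (\<lambda>\<omega>. \<phi> (W t \<omega> - W s \<omega>)) (v::real)"
  shows "has_bochner_integral M (\<lambda>\<omega>. g \<omega> * \<phi> (W t \<omega> - W s \<omega>)) ((\<integral>\<omega>. g \<omega> \<partial>M) * v)"
proof -
  interpret prob_space M by (rule prob_M)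
  show ?thesis
  proof (cases "s = t")
    case True
    then have "v = \<phi> 0" using \<phi>(2) by (simp add: has_bochner_integral_iff prob_space)
    then show ?thesis using g True by (simp add: has_bochner_integral_iff)
  next
    case False
    let ?Z = "\<lambda>\<omega>. W t \<omega> - W s \<omega>"
    have "indep_var borel g borel ?Z" using indep_var_increment st False g by simp
    then have "indep_var borel (id \<circ> g) borel (\<phi> \<circ> ?Z)"
      by (rule indep_var_compose) (use \<phi> in auto)
    then have ind: "indep_var borel g borel (\<lambda>\<omega>. \<phi> (?Z \<omega>))" by (simp add: comp_def)
    have "integrable M (\<lambda>\<omega>. \<phi> (?Z \<omega>))" "(\<integral>\<omega>. \<phi> (?Z \<omega>) \<partial>M) = v"
      using \<phi>(2) by (simp_all add: has_bochner_integral_iff)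
    then show ?thesis
      using indep_var_integrable[OF ind g(2)] indep_var_lebesgue_integral[OF ind g(2)]
      by (simp add: has_bochner_integral_iff)
  qed
qed

lemma
  assumes st: "0 \<le> s" "s \<le> t" "t \<le> T"
  shows increment_exp_moment:
      "has_bochner_integral M (\<lambda>\<omega>. exp (c * (W t \<omega> - W s \<omega>))) (exp (c\<^sup>2 * (t - s) / 2))"
    and increment_mult_exp_moment:
      "has_bochner_integral M (\<lambda>\<omega>. (W t \<omega> - W s \<omega>) * exp (c * (W t \<omega> - W s \<omega>))) (c * (t - s) * exp (c\<^sup>2 * (t - s) / 2))"
    and increment_second_moment:
      "has_bochner_integral M (\<lambda>\<omega>. (W t \<omega> - W s \<omega>)\<^sup>2) (t - s)"
proof -
  interpret prob_space M by (rule prob_M)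
  let ?Z = "\<lambda>\<omega>. W t \<omega> - W s \<omega>" and ?e = "exp (c\<^sup>2 * (t - s) / 2)"
  have "has_bochner_integral M (\<lambda>\<omega>. exp (c * ?Z \<omega>)) ?e \<and>
    has_bochner_integral M (\<lambda>\<omega>. ?Z \<omega> * exp (c * ?Z \<omega>)) (c * (t - s) * ?e) \<and>
    has_bochner_integral M (\<lambda>\<omega>. (?Z \<omega>)\<^sup>2) (t - s)"
  proof (cases "s = t")
    case True
    then show ?thesis by (simp add: has_bochner_integral_iff prob_space)
  next
    case False
    define d where "d = sqrt (t - s)"
    have d: "0 < d" "d\<^sup>2 = t - s" using False st by (auto simp: d_def)
    have dist: "distributed M lborel ?Z (normal_density 0 d)"
      using brownian st False by (simp add: brownian_motion_def d_def)
    have transfer: "has_bochner_integral M (\<lambda>\<omega>. \<phi> (?Z \<omega>)) v"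
      if "\<phi> \<in> borel_measurable borel" "has_bochner_integral lborel (\<lambda>x. normal_density 0 d x * \<phi> x) v" for \<phi> :: "real \<Rightarrow> real" and v
      using that distributed_integral[OF dist, of \<phi>] distributed_integrable[OF dist, of \<phi>]
      by (auto simp: has_bochner_integral_iff)
    have tilt: "normal_density 0 d x * exp (c * x) = ?e * normal_density (c * (t - s)) d x" for x
      using normal_density_exp_tilt[OF d(1), of x c] d(2) by simp
    have "has_bochner_integral lborel (\<lambda>x. ?e * normal_density (c * (t - s)) d x) (?e * 1)"
      using d by (intro has_bochner_integral_mult_right) (simp add: has_bochner_integral_iff)
    then have 1: "has_bochner_integral M (\<lambda>\<omega>. exp (c * ?Z \<omega>)) ?e"
      by (intro transfer) (simp_all add: tilt)
    have "has_bochner_integral lborel (\<lambda>x. ?e * (normal_density (c * (t - s)) d x * x)) (?e * (c * (t - s)))"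
      using d by (intro has_bochner_integral_mult_right normal_moment_nz_1)
    also have "(\<lambda>x. ?e * (normal_density (c * (t - s)) d x * x)) = (\<lambda>x. normal_density 0 d x * (x * exp (c * x)))"
    proof
      fix x
      have "?e * (normal_density (c * (t - s)) d x * x) = (?e * normal_density (c * (t - s)) d x) * x" by simp
      then show "?e * (normal_density (c * (t - s)) d x * x) = normal_density 0 d x * (x * exp (c * x))"
        by (simp only: tilt[symmetric]) simp
    qed
    finally have 2: "has_bochner_integral M (\<lambda>\<omega>. ?Z \<omega> * exp (c * ?Z \<omega>)) (c * (t - s) * ?e)"
      by (intro transfer) (simp_all add: mult.commute)
    have "has_bochner_integral lborel (\<lambda>x. normal_density 0 d x * x\<^sup>2) (t - s)"
      using normal_moment_even[OF d(1), of 0 1] d by (simp add: fact_numeral diff_divide_distrib)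
    then have "has_bochner_integral M (\<lambda>\<omega>. (?Z \<omega>)\<^sup>2) (t - s)"
      by (intro transfer) simp_all
    then show ?thesis using 1 2 by simp
  qed
  then show "has_bochner_integral M (\<lambda>\<omega>. exp (c * ?Z \<omega>)) ?e"
    "has_bochner_integral M (\<lambda>\<omega>. ?Z \<omega> * exp (c * ?Z \<omega>)) (c * (t - s) * ?e)"
    "has_bochner_integral M (\<lambda>\<omega>. (?Z \<omega>)\<^sup>2) (t - s)" by auto
qed

lemma increment_first_moment:
  assumes "0 \<le> s" "s \<le> t" "t \<le> T"
  shows "has_bochner_integral M (\<lambda>\<omega>. W t \<omega> - W s \<omega>) 0"
  using increment_mult_exp_moment[OF assms, of 0] by simp

text \<open>\<open>G\<close> is the factor by which the exponential martingale grows between s and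
  t. Its variance yields regularity in time, the linearized error \<open>G\<close> - 1 -
  \<open>\<sigma>\<close> z is the local error of the Ito sums, and the fourth moment controls the
  truncation.\<close>

lemma
  assumes st: "0 \<le> s" "s \<le> t" "t \<le> T"
  defines "G \<equiv> \<lambda>z. exp (\<sigma> * z - \<sigma>\<^sup>2 * (t - s) / 2)"
  shows G_variance: "has_bochner_integral M (\<lambda>\<omega>. (G (W t \<omega> - W s \<omega>) - 1)\<^sup>2) (exp (\<sigma>\<^sup>2 * (t - s)) - 1)"
    and G_linear_variance: "has_bochner_integral M (\<lambda>\<omega>. (G (W t \<omega> - W s \<omega>) - 1 - \<sigma> * (W t \<omega> - W s \<omega>))\<^sup>2)
      (exp (\<sigma>\<^sup>2 * (t - s)) - 1 - \<sigma>\<^sup>2 * (t - s))"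
    and G_linear_mean: "has_bochner_integral M (\<lambda>\<omega>. G (W t \<omega> - W s \<omega>) - 1 - \<sigma> * (W t \<omega> - W s \<omega>)) 0"
    and G_fourth_moment: "has_bochner_integral M (\<lambda>\<omega>. (G (W t \<omega> - W s \<omega>))^4) (exp (6 * \<sigma>\<^sup>2 * (t - s)))"
    and G_second_moment: "has_bochner_integral M (\<lambda>\<omega>. (G (W t \<omega> - W s \<omega>))\<^sup>2) (exp (\<sigma>\<^sup>2 * (t - s)))"
proof -
  interpret prob_space M by (rule prob_M)
  define Z where "Z = (\<lambda>\<omega>. W t \<omega> - W s \<omega>)"
  define v where "v = \<sigma>\<^sup>2 * (t - s)"
  have G: "G z = exp (- v / 2) * exp (\<sigma> * z)" for z
    by (simp add: G_def v_def exp_add[symmetric])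
  have G2: "(G z)\<^sup>2 = exp (- v) * exp (2 * \<sigma> * z)" for z
    by (simp add: G_def v_def exp_add[symmetric] power2_eq_square)
  have G4: "(G z)^4 = exp (- 2 * v) * exp (4 * \<sigma> * z)" for z
  proof -
    have "(G z)^4 = ((G z)\<^sup>2)\<^sup>2" by (simp add: power_mult[symmetric])
    also have "\<dots> = exp (- 2 * v) * exp (4 * \<sigma> * z)"
      unfolding G2 by (simp add: power2_eq_square exp_add[symmetric])
    finally show ?thesis .
  qed
  have one: "has_bochner_integral M (\<lambda>\<omega>. 1) (1::real)" by (simp add: has_bochner_integral_iff prob_space)
  have h0: "has_bochner_integral M Z 0" using increment_first_moment[OF st] by (simp add: Z_def)
  have hz2: "has_bochner_integral M (\<lambda>\<omega>. (Z \<omega>)\<^sup>2) (t - s)"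
    using increment_second_moment[OF st] by (simp add: Z_def)
  have h1: "has_bochner_integral M (\<lambda>\<omega>. G (Z \<omega>)) 1"
    using has_bochner_integral_mult_right[OF increment_exp_moment[OF st, of \<sigma>], of "exp (- v / 2)"]
    by (simp add: G Z_def v_def exp_add[symmetric])
  have hz: "has_bochner_integral M (\<lambda>\<omega>. Z \<omega> * G (Z \<omega>)) (\<sigma> * (t - s))"
    using has_bochner_integral_mult_right[OF increment_mult_exp_moment[OF st, of \<sigma>], of "exp (- v / 2)"]
    by (simp add: G Z_def v_def mult.assoc mult.left_commute exp_add[symmetric])
  have h2: "has_bochner_integral M (\<lambda>\<omega>. (G (Z \<omega>))\<^sup>2) (exp v)"
    using has_bochner_integral_mult_right[OF increment_exp_moment[OF st, of "2 * \<sigma>"], of "exp (- v)"]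
    by (simp add: G2 Z_def v_def exp_add[symmetric] power_mult_distrib mult.commute[of "t - s"])
  have h4: "has_bochner_integral M (\<lambda>\<omega>. (G (Z \<omega>))^4) (exp (6 * v))"
    using has_bochner_integral_mult_right[OF increment_exp_moment[OF st, of "4 * \<sigma>"], of "exp (- 2 * v)"]
    by (simp add: G4 Z_def v_def exp_add[symmetric] power_mult_distrib mult.commute[of "t - s"])
  have "has_bochner_integral M (\<lambda>\<omega>. (G (Z \<omega>))\<^sup>2 - 2 * G (Z \<omega>) + 1) (exp v - 2 * 1 + 1)"
    by (intro has_bochner_integral_add has_bochner_integral_diff has_bochner_integral_mult_right one h1 h2)
  then have hv: "has_bochner_integral M (\<lambda>\<omega>. (G (Z \<omega>) - 1)\<^sup>2) (exp v - 1)"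
    by (simp add: power2_diff add.commute diff_add_eq add_diff_eq)
  have hl: "has_bochner_integral M (\<lambda>\<omega>. G (Z \<omega>) - 1 - \<sigma> * Z \<omega>) (1 - 1 - \<sigma> * 0)"
    by (intro has_bochner_integral_diff has_bochner_integral_mult_right one h1 h0)
  have "has_bochner_integral M (\<lambda>\<omega>. (G (Z \<omega>) - 1)\<^sup>2 - 2 * \<sigma> * (Z \<omega> * G (Z \<omega>)) + 2 * \<sigma> * Z \<omega> + \<sigma>\<^sup>2 * (Z \<omega>)\<^sup>2)
      ((exp v - 1) - 2 * \<sigma> * (\<sigma> * (t - s)) + 2 * \<sigma> * 0 + \<sigma>\<^sup>2 * (t - s))"
    by (intro has_bochner_integral_add has_bochner_integral_diff has_bochner_integral_mult_right hv hz h0 hz2)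
  also have "(\<lambda>\<omega>. (G (Z \<omega>) - 1)\<^sup>2 - 2 * \<sigma> * (Z \<omega> * G (Z \<omega>)) + 2 * \<sigma> * Z \<omega> + \<sigma>\<^sup>2 * (Z \<omega>)\<^sup>2)
      = (\<lambda>\<omega>. (G (Z \<omega>) - 1 - \<sigma> * Z \<omega>)\<^sup>2)"
    by (simp add: fun_eq_iff power2_eq_square algebra_simps)
  also have "(exp v - 1) - 2 * \<sigma> * (\<sigma> * (t - s)) + 2 * \<sigma> * 0 + \<sigma>\<^sup>2 * (t - s) = exp v - 1 - v"
    by (simp add: v_def power2_eq_square algebra_simps)
  finally have hlv: "has_bochner_integral M (\<lambda>\<omega>. (G (Z \<omega>) - 1 - \<sigma> * Z \<omega>)\<^sup>2) (exp v - 1 - v)" .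
  show "has_bochner_integral M (\<lambda>\<omega>. (G (W t \<omega> - W s \<omega>) - 1)\<^sup>2) (exp (\<sigma>\<^sup>2 * (t - s)) - 1)"
    "has_bochner_integral M (\<lambda>\<omega>. (G (W t \<omega> - W s \<omega>) - 1 - \<sigma> * (W t \<omega> - W s \<omega>))\<^sup>2)
      (exp (\<sigma>\<^sup>2 * (t - s)) - 1 - \<sigma>\<^sup>2 * (t - s))"
    "has_bochner_integral M (\<lambda>\<omega>. G (W t \<omega> - W s \<omega>) - 1 - \<sigma> * (W t \<omega> - W s \<omega>)) 0"
    "has_bochner_integral M (\<lambda>\<omega>. (G (W t \<omega> - W s \<omega>))^4) (exp (6 * \<sigma>\<^sup>2 * (t - s)))"
    "has_bochner_integral M (\<lambda>\<omega>. (G (W t \<omega> - W s \<omega>))\<^sup>2) (exp (\<sigma>\<^sup>2 * (t - s)))"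
    using hv hlv hl h4 h2 by (simp_all add: Z_def v_def mult.assoc)
qed

text \<open>With the identity for \<open>\<phi>\<close> this is the Ito isometry on a single
  interval.\<close>

lemma sq_int_increment_mult:
  assumes st: "0 \<le> s" "s \<le> t" "t \<le> T" and g: "g \<in> borel_measurable (F s)" "sq_int M g"
    and \<phi>: "\<phi> \<in> borel_measurable borel" "has_bochner_integral M (\<lambda>\<omega>. (\<phi> (W t \<omega> - W s \<omega>))\<^sup>2) (v::real)"
  shows "sq_int M (\<lambda>\<omega>. g \<omega> * \<phi> (W t \<omega> - W s \<omega>))"
    and "(\<integral>\<omega>. (g \<omega> * \<phi> (W t \<omega> - W s \<omega>))\<^sup>2 \<partial>M) = (\<integral>\<omega>. (g \<omega>)\<^sup>2 \<partial>M) * v"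
proof -
  have "has_bochner_integral M (\<lambda>\<omega>. (g \<omega>)\<^sup>2 * (\<phi> (W t \<omega> - W s \<omega>))\<^sup>2) ((\<integral>\<omega>. (g \<omega>)\<^sup>2 \<partial>M) * v)"
    using g \<phi> by (intro increment_expectation[OF st, of "\<lambda>\<omega>. (g \<omega>)\<^sup>2" "\<lambda>z. (\<phi> z)\<^sup>2"]) (auto simp: sq_int_def)
  moreover have [measurable]: "W t \<in> borel_measurable M" "W s \<in> borel_measurable M"
    using st measurable_F_M[OF _ measurable_W, of t] measurable_F_M[OF _ measurable_W, of s] by auto
  have "(\<lambda>\<omega>. g \<omega> * \<phi> (W t \<omega> - W s \<omega>)) \<in> borel_measurable M"
    using g(2) \<phi>(1) by (auto simp: sq_int_def)
  ultimately show "sq_int M (\<lambda>\<omega>. g \<omega> * \<phi> (W t \<omega> - W s \<omega>))"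
    "(\<integral>\<omega>. (g \<omega> * \<phi> (W t \<omega> - W s \<omega>))\<^sup>2 \<partial>M) = (\<integral>\<omega>. (g \<omega>)\<^sup>2 \<partial>M) * v"
    by (auto simp: sq_int_def power_mult_distrib has_bochner_integral_iff)
qed


section \<open>Stochastic integrals of simple processes\<close>

text \<open>Instead of refining two grids to a common one, the covariance is computed for
  overlapping intervals. Both increments are cut at the ends of the overlap; only the squared
  increment over the overlap survives, since every other product contains an increment of mean zero
  that is independent of its remaining factors.\<close>

lemma increment_cross:
  assumes ab: "0 \<le> a" "a \<le> b" "b \<le> T" and cd: "0 \<le> c" "c \<le> d" "d \<le> T" and ac: "a \<le> c"
    and h: "h \<in> borel_measurable (F a)" "\<And>\<omega>. \<omega> \<in> space M \<Longrightarrow> \<bar>h \<omega>\<bar> \<le> B"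
    and k: "k \<in> borel_measurable (F c)" "\<And>\<omega>. \<omega> \<in> space M \<Longrightarrow> \<bar>k \<omega>\<bar> \<le> B'"
  shows "(\<integral>\<omega>. (h \<omega> * (W b \<omega> - W a \<omega>)) * (k \<omega> * (W d \<omega> - W c \<omega>)) \<partial>M)
    = (\<integral>\<omega>. h \<omega> * k \<omega> \<partial>M) * measure lborel ({a<..b} \<inter> {c<..d})"
proof -
  interpret prob_space M by (rule prob_M)
  note F_mono = measurable_F_mono
  have hM: "h \<in> borel_measurable M" and kM: "k \<in> borel_measurable M"
    using measurable_F_M[OF _ h(1)] measurable_F_M[OF _ k(1)] ab cd by simp_all
  have WF: "W u \<in> borel_measurable (F v)" if "0 \<le> u" "u \<le> v" "v \<le> T" for u v
    using measurable_F_mono[OF that measurable_W] that by auto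
  have sqhW: "sq_int M (\<lambda>\<omega>. h' \<omega> * (W v \<omega> - W u \<omega>))"
    if "h' \<in> borel_measurable (F u)" "\<And>\<omega>. \<omega> \<in> space M \<Longrightarrow> \<bar>h' \<omega>\<bar> \<le> B''" "0 \<le> u" "u \<le> v" "v \<le> T" for h' u v B''
    using sq_int_increment_mult(1)[OF that(3-5,1), of "\<lambda>z. z"] increment_second_moment[OF that(3-5)]
      sq_int_bounded[OF measurable_F_M[OF _ that(1)] that(2)] that by simp
  have zero: "(\<integral>\<omega>. g \<omega> * (W v \<omega> - W u \<omega>) \<partial>M) = 0"
    if "g \<in> borel_measurable (F u)" "integrable M g" "0 \<le> u" "u \<le> v" "v \<le> T" for g u v
    using increment_expectation[OF that(3-5,1,2), of "\<lambda>z. z"] increment_first_moment[OF that(3-5)]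
    by (auto simp: has_bochner_integral_iff)
  have bnd: "\<bar>h \<omega> * k \<omega>\<bar> \<le> B * B'" if "\<omega> \<in> space M" for \<omega>
    unfolding abs_mult using h(2)[OF that] k(2)[OF that] by (intro mult_mono) auto
  have hF: "h \<in> borel_measurable (F c)" using F_mono[OF ab(1) ac _ h(1)] cd by auto
  have hkF: "(\<lambda>\<omega>. h \<omega> * k \<omega>) \<in> borel_measurable (F c)" using hF k(1) by simp
  show ?thesis
  proof (cases "b \<le> c")
    case True
    have hWF: "(\<lambda>\<omega>. (h \<omega> * (W b \<omega> - W a \<omega>)) * k \<omega>) \<in> borel_measurable (F c)"
      using WF[of b c] WF[of a c] hF k(1) ab cd ac True by simp
    have "integrable M (\<lambda>\<omega>. (h \<omega> * (W b \<omega> - W a \<omega>)) * k \<omega>)"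
      by (rule sq_int_mult[OF sqhW[OF h ab] sq_int_bounded[OF kM k(2)]])
    from zero[OF hWF this cd] True show ?thesis by (simp add: mult.assoc)
  next
    case False
    \<comment> \<open>The right end of the overlap. It equals b or d, so one of \<open>p3\<close>
      and \<open>p4\<close> vanishes identically.\<close>
    define e where "e = min b d"
    have e: "c \<le> e" "e \<le> b" "e \<le> d" "e \<le> T" using False cd ab by (auto simp: e_def)
    have [simp]: "sq_int M (\<lambda>\<omega>. k \<omega> * (W d \<omega> - W c \<omega>))"
      by (rule sqhW[OF k cd])
    define p1 where "p1 \<omega> = (h \<omega> * (W c \<omega> - W a \<omega>)) * (k \<omega> * (W d \<omega> - W c \<omega>))" for \<omega>
    define p2 where "p2 \<omega> = (h \<omega> * k \<omega>) * (W e \<omega> - W c \<omega>)\<^sup>2" for \<omega>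
    define p3 where "p3 \<omega> = ((h \<omega> * k \<omega>) * (W e \<omega> - W c \<omega>)) * (W d \<omega> - W e \<omega>)" for \<omega>
    define p4 where "p4 \<omega> = ((h \<omega> * k \<omega>) * (W d \<omega> - W c \<omega>)) * (W b \<omega> - W e \<omega>)" for \<omega>
    have i1: "integrable M p1"
      unfolding p1_def using ab ac e cd by (intro sq_int_mult sqhW[OF h] sqhW[OF k]) auto
    have int_hk: "integrable M (\<lambda>\<omega>. h \<omega> * k \<omega>)"
      by (rule integrable_const_bound[of _ "B * B'"]) (use bnd hM kM in auto)
    have i2: "has_bochner_integral M p2 ((\<integral>\<omega>. h \<omega> * k \<omega> \<partial>M) * (e - c))"
      unfolding p2_def using e cd hkF int_hk
      by (intro increment_expectation[of c e "\<lambda>\<omega>. h \<omega> * k \<omega>" "\<lambda>z. z\<^sup>2"] increment_second_moment) auto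
    have sq1: "sq_int M (\<lambda>\<omega>. 1 * (W v \<omega> - W u \<omega>))" if "0 \<le> u" "u \<le> v" "v \<le> T" for u v
      by (rule sqhW[of "\<lambda>_. 1" u 1, OF _ _ that]) auto
    have i3: "integrable M p3"
      unfolding p3_def using sq_int_mult[OF sqhW[OF hkF bnd, of e] sq1[of e d]] e cd by simp
    have z3: "(\<integral>\<omega>. p3 \<omega> \<partial>M) = 0"
      unfolding p3_def
    proof (rule zero)
      show "(\<lambda>\<omega>. (h \<omega> * k \<omega>) * (W e \<omega> - W c \<omega>)) \<in> borel_measurable (F e)"
        using F_mono[OF cd(1) e(1,4) hkF] WF[of e e] WF[of c e] e cd by simp
      show "integrable M (\<lambda>\<omega>. (h \<omega> * k \<omega>) * (W e \<omega> - W c \<omega>))"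
        using sqhW[OF hkF bnd, of e] e cd by (intro sq_int_integrable) auto
    qed (use e cd in auto)
    have z1: "(\<integral>\<omega>. p1 \<omega> \<partial>M) = 0"
    proof -
      have hWk: "(\<lambda>\<omega>. (h \<omega> * (W c \<omega> - W a \<omega>)) * k \<omega>) \<in> borel_measurable (F c)"
        using hF k(1) WF[of c c] WF[of a c] ab ac cd by simp
      have "integrable M (\<lambda>\<omega>. (h \<omega> * (W c \<omega> - W a \<omega>)) * k \<omega>)"
        using ab ac cd by (intro sq_int_mult sqhW[OF h] sq_int_bounded[OF kM k(2)]) auto
      from zero[OF hWk this cd] show ?thesis by (simp add: p1_def mult.assoc)
    qed
    have i4: "integrable M p4 \<and> (\<integral>\<omega>. p4 \<omega> \<partial>M) = 0"
    proof (cases "b \<le> d")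
      case True
      then show ?thesis by (simp add: p4_def[abs_def] e_def min_absorb1)
    next
      case bd: False
      then have [simp]: "e = d" by (simp add: e_def)
      have "integrable M p4"
        unfolding p4_def using sq_int_mult[OF sqhW[OF hkF bnd cd] sq1[of d b]] ab cd bd by simp
      moreover have "(\<integral>\<omega>. p4 \<omega> \<partial>M) = 0"
        unfolding p4_def \<open>e = d\<close>
      proof (rule zero)
        show "(\<lambda>\<omega>. (h \<omega> * k \<omega>) * (W d \<omega> - W c \<omega>)) \<in> borel_measurable (F d)"
          using F_mono[OF cd hkF] WF[of d d] WF[of c d] cd by simp
        show "integrable M (\<lambda>\<omega>. (h \<omega> * k \<omega>) * (W d \<omega> - W c \<omega>))"
          by (intro sq_int_integrable sqhW[OF hkF bnd cd])
      qed (use ab cd bd in auto)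
      ultimately show ?thesis by simp
    qed
    have split: "(h \<omega> * (W b \<omega> - W a \<omega>)) * (k \<omega> * (W d \<omega> - W c \<omega>)) = p1 \<omega> + p2 \<omega> + p3 \<omega> + p4 \<omega>" for \<omega>
      by (simp add: p1_def p2_def p3_def p4_def power2_eq_square algebra_simps)
    have "{a<..b} \<inter> {c<..d} = {c<..e}" using ac by (auto simp: e_def)
    then have "measure lborel ({a<..b} \<inter> {c<..d}) = e - c" using e by simp
    then show ?thesis unfolding split using i1 i2 i3 i4 z1 z3
      by (simp add: has_bochner_integral_iff)
  qed
qed

lemma increment_inner:
  assumes ab: "0 \<le> a" "a \<le> b" "b \<le> T" and cd: "0 \<le> c" "c \<le> d" "d \<le> T"
    and h: "h \<in> borel_measurable (F a)" "\<And>\<omega>. \<omega> \<in> space M \<Longrightarrow> \<bar>h \<omega>\<bar> \<le> B"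
    and k: "k \<in> borel_measurable (F c)" "\<And>\<omega>. \<omega> \<in> space M \<Longrightarrow> \<bar>k \<omega>\<bar> \<le> B'"
  shows "(\<integral>\<omega>. (h \<omega> * (W b \<omega> - W a \<omega>)) * (k \<omega> * (W d \<omega> - W c \<omega>)) \<partial>M)
    = (\<integral>\<omega>. h \<omega> * k \<omega> \<partial>M) * measure lborel ({a<..b} \<inter> {c<..d})"
  using increment_cross[OF ab cd _ h k] increment_cross[OF cd ab _ k h]
  by (cases "a \<le> c") (simp_all add: mult.commute Int_commute)

end

section \<open>L2 inequalities, Gronwall and Cauchy-Schwarz\<close>

lemma square_sum3_le: "(a + b + c)\<^sup>2 \<le> 3 * (a\<^sup>2 + b\<^sup>2 + (c::real)\<^sup>2)"
proof -
  have "3 * (a\<^sup>2 + b\<^sup>2 + c\<^sup>2) - (a + b + c)\<^sup>2 = (a - b)\<^sup>2 + (b - c)\<^sup>2 + (a - c)\<^sup>2"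
    by (simp add: power2_eq_square algebra_simps)
  moreover have "0 \<le> (a - b)\<^sup>2 + (b - c)\<^sup>2 + (a - c)\<^sup>2" by simp
  ultimately show ?thesis by linarith
qed

lemma square_sum2_le: "(a + b)\<^sup>2 \<le> 2 * a\<^sup>2 + 2 * (b::real)\<^sup>2"
proof -
  have "2 * a\<^sup>2 + 2 * b\<^sup>2 - (a + b)\<^sup>2 = (a - b)\<^sup>2"
    by (simp add: power2_eq_square algebra_simps)
  then show ?thesis using zero_le_power2[of "a - b"] by linarith
qed

lemma nn_integral_square_sum3:
  assumes [measurable]: "f \<in> borel_measurable N" "g \<in> borel_measurable N" "h \<in> borel_measurable N"
  shows "(\<integral>\<^sup>+x. ennreal ((f x + g x + h x)\<^sup>2) \<partial>N) \<le>
    3 * ((\<integral>\<^sup>+x. ennreal ((f x)\<^sup>2) \<partial>N) + (\<integral>\<^sup>+x. ennreal ((g x)\<^sup>2) \<partial>N) + (\<integral>\<^sup>+x. ennreal ((h x)\<^sup>2) \<partial>N))"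
proof -
  have "(\<integral>\<^sup>+x. ennreal ((f x + g x + h x)\<^sup>2) \<partial>N) \<le>
    (\<integral>\<^sup>+x. 3 * (ennreal ((f x)\<^sup>2) + ennreal ((g x)\<^sup>2) + ennreal ((h x)\<^sup>2)) \<partial>N)"
  proof (rule nn_integral_mono)
    fix x
    have "ennreal ((f x + g x + h x)\<^sup>2) \<le> ennreal (3 * ((f x)\<^sup>2 + (g x)\<^sup>2 + (h x)\<^sup>2))"
      by (intro ennreal_leI square_sum3_le)
    then show "ennreal ((f x + g x + h x)\<^sup>2) \<le> 3 * (ennreal ((f x)\<^sup>2) + ennreal ((g x)\<^sup>2) + ennreal ((h x)\<^sup>2))"
      by (simp add: ennreal_mult ennreal_plus)
  qed
  also have "\<dots> = 3 * ((\<integral>\<^sup>+x. ennreal ((f x)\<^sup>2) \<partial>N) + (\<integral>\<^sup>+x. ennreal ((g x)\<^sup>2) \<partial>N) + (\<integral>\<^sup>+x. ennreal ((h x)\<^sup>2) \<partial>N))"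
    by (simp add: nn_integral_cmult nn_integral_add)
  finally show ?thesis .
qed

text \<open>The weighted supremum of \<open>exp (-2At) u(t)\<close> is at most half of itself.\<close>

lemma gronwall_nn_integral:
  fixes u :: "real \<Rightarrow> ennreal"
  assumes A: "0 < A" and u: "\<And>t. t \<in> {0..T} \<Longrightarrow> u t \<le> ennreal A * (\<integral>\<^sup>+s\<in>{0..t}. u s \<partial>lborel)"
    and fin: "(\<integral>\<^sup>+s\<in>{0..T}. u s \<partial>lborel) < \<infinity>" and t: "t \<in> {0..T}"
  shows "u t = 0"
proof -
  define S where "S = (SUP t\<in>{0..T}. ennreal (exp (- 2 * A * t)) * u t)"
  define U where "U = (\<integral>\<^sup>+s\<in>{0..T}. u s \<partial>lborel)"
  have uU: "u t \<le> ennreal A * U" if "t \<in> {0..T}" for t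
  proof -
    have "(\<integral>\<^sup>+s\<in>{0..t}. u s \<partial>lborel) \<le> U"
      unfolding U_def using that by (intro nn_integral_mono) (auto simp: indicator_def)
    then show ?thesis using u[OF that] by (meson mult_left_mono order.trans zero_le)
  qed
  \<comment> \<open>Without finiteness the final inequality S <= S / 2 would also allow S to be
    infinite; one use of the hypothesis with the full integral bounds S.\<close>
  have "S \<le> ennreal A * U"
    unfolding S_def
  proof (rule SUP_least)
    fix s assume s: "s \<in> {0..T}"
    have "ennreal (exp (- 2 * A * s)) \<le> 1" using A s by (simp add: ennreal_le_1)
    then have "ennreal (exp (- 2 * A * s)) * u s \<le> 1 * (ennreal A * U)"
      using uU[OF s] by (intro mult_mono) auto
    then show "ennreal (exp (- 2 * A * s)) * u s \<le> ennreal A * U" by simp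
  qed
  moreover have "ennreal A * U < \<infinity>" using fin by (simp add: U_def ennreal_mult_less_top)
  ultimately have S_fin: "S < \<infinity>" by (rule order.strict_trans1)
  have us: "u s \<le> ennreal (exp (2 * A * s)) * S" if "s \<in> {0..T}" for s
  proof -
    have "ennreal (exp (- 2 * A * s)) * u s \<le> S"
      unfolding S_def using that by (intro SUP_upper)
    then have "ennreal (exp (2 * A * s)) * (ennreal (exp (- 2 * A * s)) * u s) \<le> ennreal (exp (2 * A * s)) * S"
      by (intro mult_left_mono) auto
    moreover have "ennreal (exp (2 * A * s)) * ennreal (exp (- 2 * A * s)) = 1"
      by (simp add: ennreal_mult[symmetric] exp_add[symmetric])
    ultimately show ?thesis by (simp add: mult.assoc[symmetric])
  qed
  have "(SUP t\<in>{0..T}. ennreal (exp (- 2 * A * t)) * u t) \<le> ennreal (1 / 2) * S"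
  proof (rule SUP_least)
    fix t assume t: "t \<in> {0..T}"
    have "(\<integral>\<^sup>+s\<in>{0..t}. u s \<partial>lborel) \<le> (\<integral>\<^sup>+s. (ennreal (exp (2 * A * s)) * indicator {0..t} s) * S \<partial>lborel)"
      using us t by (intro nn_integral_mono) (auto simp: indicator_def)
    also have "\<dots> = (\<integral>\<^sup>+s. ennreal (exp (2 * A * s)) * indicator {0..t} s \<partial>lborel) * S"
      by (intro nn_integral_multc) auto
    also have "(\<integral>\<^sup>+s. ennreal (exp (2 * A * s)) * indicator {0..t} s \<partial>lborel) = ennreal (exp (2 * A * t) / (2 * A) - exp (2 * A * 0) / (2 * A))"
      using A t by (intro nn_integral_FTC_Icc) (auto intro!: derivative_eq_intros)
    also have "\<dots> \<le> ennreal (exp (2 * A * t) / (2 * A))" using A by (intro ennreal_leI) simp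
    finally have le: "(\<integral>\<^sup>+s\<in>{0..t}. u s \<partial>lborel) \<le> ennreal (exp (2 * A * t) / (2 * A)) * S"
      by (simp add: mult_right_mono)
    have scale: "ennreal x * (ennreal A * (ennreal y * S)) = ennreal (x * (A * y)) * S" if "0 \<le> x" "0 \<le> y" for x y
      using that A by (simp add: ennreal_mult mult.assoc)
    have "ennreal (exp (- 2 * A * t)) * u t \<le> ennreal (exp (- 2 * A * t)) * (ennreal A * (ennreal (exp (2 * A * t) / (2 * A)) * S))"
      using u[OF t] le by (meson mult_left_mono order.trans zero_le)
    also have "\<dots> = ennreal (exp (- 2 * A * t) * (A * (exp (2 * A * t) / (2 * A)))) * S"
      using A by (intro scale) auto
    also have "exp (- 2 * A * t) * (A * (exp (2 * A * t) / (2 * A))) = 1 / 2"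
      using A by (simp add: exp_add[symmetric] mult.left_commute[of "exp (- (2 * A * t))"])
    finally show "ennreal (exp (- 2 * A * t)) * u t \<le> ennreal (1 / 2) * S" .
  qed
  then have "S \<le> ennreal (1 / 2) * S" by (simp only: S_def[symmetric])
  moreover obtain x where x: "S = ennreal x" "0 \<le> x" using S_fin by (cases S) auto
  ultimately have "ennreal x \<le> ennreal (1 / 2 * x)" by (simp only: ennreal_mult)
  then have "S = 0" using x by simp
  then show ?thesis using us[OF t] by simp
qed

text \<open>Cauchy-Schwarz against the constant 1, read off from the nonnegative integral of the
  squared deviation of \<open>f\<close> from its mean. The mean requires a < b, and outside L2 the
  right-hand side is infinite.\<close>

lemma set_integral_square_le:
  fixes f :: "real \<Rightarrow> real"
  assumes "a \<le> b" and [measurable]: "f \<in> borel_measurable borel"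
  shows "ennreal ((LINT s:{a..b}|lborel. f s)\<^sup>2) \<le> ennreal (b - a) * (\<integral>\<^sup>+s\<in>{a..b}. ennreal ((f s)\<^sup>2) \<partial>lborel)"
proof -
  have zero: "(LINT s:{a..b}|lborel. f s) = 0" if "a = b"
    unfolding set_lebesgue_integral_def
  proof (rule integral_eq_zero_AE)
    show "AE s in lborel. indicat_real {a..b} s *\<^sub>R f s = 0"
      using AE_lborel_singleton[of a] by eventually_elim (use that in simp)
  qed
  show ?thesis
  proof (cases "a = b \<or> (\<integral>\<^sup>+s\<in>{a..b}. ennreal ((f s)\<^sup>2) \<partial>lborel) = \<infinity>")
    case True
    then show ?thesis using zero assms(1) by (cases "a = b") (auto simp: ennreal_mult_top)
  next
    case False
    define N where "N = restrict_space lborel {a..b}"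
    interpret finite_measure N
      by standard (simp add: N_def space_restrict_space emeasure_restrict_space emeasure_lborel_Icc_eq)
    have [measurable]: "f \<in> borel_measurable N" by (simp add: N_def measurable_restrict_space1)
    have nn: "(\<integral>\<^sup>+s\<in>{a..b}. ennreal ((f s)\<^sup>2) \<partial>lborel) = (\<integral>\<^sup>+s. ennreal ((f s)\<^sup>2) \<partial>N)"
      unfolding N_def by (subst nn_integral_restrict_space) auto
    have sq: "sq_int N f"
      unfolding sq_int_def using False nn
      by (auto intro!: integrableI_bounded simp: less_top[symmetric])
    have sq1: "sq_int N (\<lambda>_. 1)" by (simp add: sq_int_def)
    have i: "integrable N f" using sq_int_mult[OF sq sq1] by simp
    define I where "I = (\<integral>s. f s \<partial>N)"
    define Q where "Q = (\<integral>s. (f s)\<^sup>2 \<partial>N)"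
    define t where "t = b - a"
    have I: "(LINT s:{a..b}|lborel. f s) = I"
      unfolding I_def N_def set_lebesgue_integral_def by (subst integral_restrict_space) auto
    have mN: "measure N (space N) = t"
      using assms(1) by (simp add: N_def space_restrict_space measure_restrict_space t_def)
    have t: "0 < t" using assms(1) False by (simp add: t_def)
    have "0 \<le> (\<integral>s. (f s - I / t)\<^sup>2 \<partial>N)" by simp
    also have "\<dots> = (\<integral>s. (f s)\<^sup>2 - 2 * (I / t) * f s + (I / t)\<^sup>2 \<partial>N)"
      by (intro Bochner_Integration.integral_cong) (auto simp: power2_eq_square algebra_simps)
    also have "\<dots> = Q - 2 * (I / t) * I + (I / t)\<^sup>2 * t"
      using sq i mN by (simp add: sq_int_def Q_def I_def)
    also have "\<dots> = Q - I\<^sup>2 / t" using t by (simp add: power2_eq_square field_simps)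
    finally have "I\<^sup>2 \<le> t * Q" using t by (simp add: field_simps)
    then have "ennreal (I\<^sup>2) \<le> ennreal (t * Q)" by (rule ennreal_leI)
    also have "\<dots> = ennreal t * ennreal Q" using t by (simp add: ennreal_mult Q_def)
    finally show ?thesis using nn_integral_sq[OF sq] by (simp add: I nn Q_def t_def)
  qed
qed

section \<open>The norm of L2(dt x M), the Ito isometry and stability of the integral\<close>

context geometric_dynamics
begin

definition joint_measurable :: "real \<Rightarrow> (real \<Rightarrow> 'w \<Rightarrow> real) \<Rightarrow> bool" where
  "joint_measurable r H \<longleftrightarrow>
     (\<lambda>(s, \<omega>). H s \<omega>) \<in> borel_measurable (restrict_space borel {0..r} \<Otimes>\<^sub>M M)"

text \<open>Composing with the projection onto \<open>{0..r}\<close> extends a process to all times without losing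
  measurability.\<close>

lemma measurable_clip: "0 \<le> r \<Longrightarrow> (\<lambda>s. max 0 (min r s)) \<in> measurable borel (restrict_space borel {0..r::real})"
  by (rule measurable_restrict_space2) auto

lemma measurable_clip_process:
  fixes H :: "real \<Rightarrow> 'a \<Rightarrow> real"
  assumes r: "0 \<le> r" and H: "(\<lambda>(s, \<omega>). H s \<omega>) \<in> borel_measurable (restrict_space borel {0..r} \<Otimes>\<^sub>M N)"
  shows "(\<lambda>p. H (max 0 (min r (fst p))) (snd p)) \<in> borel_measurable (lborel \<Otimes>\<^sub>M N)"
    "(\<lambda>p. H (max 0 (min r (snd p))) (fst p)) \<in> borel_measurable (N \<Otimes>\<^sub>M lborel)"
proof -
  have *: "(\<lambda>s. max 0 (min r s)) \<in> measurable lborel (restrict_space borel {0..r})"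
    using measurable_clip[OF r] by simp
  have "(\<lambda>p. (max 0 (min r (fst p)), snd p)) \<in> measurable (lborel \<Otimes>\<^sub>M N) (restrict_space borel {0..r} \<Otimes>\<^sub>M N)"
    by (intro measurable_Pair measurable_compose[OF measurable_fst *]) auto
  from measurable_compose[OF this H]
  show "(\<lambda>p. H (max 0 (min r (fst p))) (snd p)) \<in> borel_measurable (lborel \<Otimes>\<^sub>M N)" by simp
  have "(\<lambda>p. (max 0 (min r (snd p)), fst p)) \<in> measurable (N \<Otimes>\<^sub>M lborel) (restrict_space borel {0..r} \<Otimes>\<^sub>M N)"
    by (intro measurable_Pair measurable_compose[OF measurable_snd *]) auto
  from measurable_compose[OF this H]
  show "(\<lambda>p. H (max 0 (min r (snd p))) (fst p)) \<in> borel_measurable (N \<Otimes>\<^sub>M lborel)" by simp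
qed

text \<open>The squared norm of L2(dt x M), iterated in the same order as in
  \<open>has_ito_integral\<close> so that the two match by unfolding.\<close>

definition sq_norm :: "real \<Rightarrow> (real \<Rightarrow> 'w \<Rightarrow> real) \<Rightarrow> ennreal" where
  "sq_norm r H = (\<integral>\<^sup>+\<omega>. (\<integral>\<^sup>+s\<in>{0..r}. ennreal ((H s \<omega>)\<^sup>2) \<partial>lborel) \<partial>M)"

lemma pair_sigma_finite_M_lborel: "pair_sigma_finite M lborel"
proof -
  interpret prob_space M by (rule prob_M)
  show ?thesis ..
qed

text \<open>Tonelli wants a function that is measurable on the whole product. The clipped process is
  one, and it agrees with \<open>H\<close> wherever the indicator is not 0.\<close>

lemma
  assumes r: "0 \<le> r" and H: "joint_measurable r H"
  shows sq_norm_pair: "sq_norm r H =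
      (\<integral>\<^sup>+p. ennreal ((indicat_real {0..r} (snd p) * H (max 0 (min r (snd p))) (fst p))\<^sup>2) \<partial>(M \<Otimes>\<^sub>M lborel))"
    and sq_norm_swap: "sq_norm r H = (\<integral>\<^sup>+s\<in>{0..r}. (\<integral>\<^sup>+\<omega>. ennreal ((H s \<omega>)\<^sup>2) \<partial>M) \<partial>lborel)"
    and measurable_inner_sq_norm: "(\<lambda>\<omega>. \<integral>\<^sup>+s\<in>{0..r}. ennreal ((H s \<omega>)\<^sup>2) \<partial>lborel) \<in> borel_measurable M"
proof -
  interpret P: pair_sigma_finite M lborel by (rule pair_sigma_finite_M_lborel)
  let ?H = "\<lambda>s \<omega>. indicat_real {0..r} s * H (max 0 (min r s)) \<omega>"
  have eq: "ennreal ((H s \<omega>)\<^sup>2) * indicator {0..r} s = ennreal ((?H s \<omega>)\<^sup>2)" for s \<omega>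
    by (auto simp: indicator_def max_def min_def)
  note [measurable] = measurable_clip_process(2)[OF r H[unfolded joint_measurable_def]]
  have m: "(\<lambda>p. ennreal ((?H (snd p) (fst p))\<^sup>2)) \<in> borel_measurable (M \<Otimes>\<^sub>M lborel)" by measurable
  have "sq_norm r H = (\<integral>\<^sup>+\<omega>. (\<integral>\<^sup>+s. ennreal ((?H s \<omega>)\<^sup>2) \<partial>lborel) \<partial>M)"
    unfolding sq_norm_def eq ..
  also have "\<dots> = (\<integral>\<^sup>+p. ennreal ((?H (snd p) (fst p))\<^sup>2) \<partial>(M \<Otimes>\<^sub>M lborel))"
    using lborel.nn_integral_fst[OF m] by simp
  finally show 1: "sq_norm r H = (\<integral>\<^sup>+p. ennreal ((?H (snd p) (fst p))\<^sup>2) \<partial>(M \<Otimes>\<^sub>M lborel))" .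
  also have "\<dots> = (\<integral>\<^sup>+s. (\<integral>\<^sup>+\<omega>. ennreal ((?H s \<omega>)\<^sup>2) \<partial>M) \<partial>lborel)"
    using P.nn_integral_snd[OF m] by simp
  also have "\<dots> = (\<integral>\<^sup>+s\<in>{0..r}. (\<integral>\<^sup>+\<omega>. ennreal ((H s \<omega>)\<^sup>2) \<partial>M) \<partial>lborel)"
    by (intro nn_integral_cong) (auto simp: indicator_def max_def min_def)
  finally show "sq_norm r H = (\<integral>\<^sup>+s\<in>{0..r}. (\<integral>\<^sup>+\<omega>. ennreal ((H s \<omega>)\<^sup>2) \<partial>M) \<partial>lborel)" .
  show "(\<lambda>\<omega>. \<integral>\<^sup>+s\<in>{0..r}. ennreal ((H s \<omega>)\<^sup>2) \<partial>lborel) \<in> borel_measurable M"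
    unfolding eq using lborel.borel_measurable_nn_integral_fst[OF m] by simp
qed

lemma sq_norm_sum3:
  assumes r: "0 \<le> r" and "joint_measurable r f" "joint_measurable r g" "joint_measurable r h"
  shows "sq_norm r (\<lambda>s \<omega>. f s \<omega> + g s \<omega> + h s \<omega>) \<le> 3 * (sq_norm r f + sq_norm r g + sq_norm r h)"
proof -
  note [measurable] = measurable_clip_process(2)[OF r assms(2)[unfolded joint_measurable_def]]
    measurable_clip_process(2)[OF r assms(3)[unfolded joint_measurable_def]]
    measurable_clip_process(2)[OF r assms(4)[unfolded joint_measurable_def]]
  have "joint_measurable r (\<lambda>s \<omega>. f s \<omega> + g s \<omega> + h s \<omega>)"
    using assms(2-4) unfolding joint_measurable_def by (simp add: split_beta')
  from sq_norm_pair[OF r this]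
  show ?thesis
    unfolding sq_norm_pair[OF r assms(2)] sq_norm_pair[OF r assms(3)] sq_norm_pair[OF r assms(4)] distrib_left
    using nn_integral_square_sum3[of
      "\<lambda>p. indicat_real {0..r} (snd p) * f (max 0 (min r (snd p))) (fst p)" "M \<Otimes>\<^sub>M lborel"
      "\<lambda>p. indicat_real {0..r} (snd p) * g (max 0 (min r (snd p))) (fst p)"
      "\<lambda>p. indicat_real {0..r} (snd p) * h (max 0 (min r (snd p))) (fst p)"]
    by (simp add: distrib_left)
qed

text \<open>Both sides expand into the same double sum of E[g_i g_j] times the lengths
  \<open>q i j\<close> of the overlaps. The index set is arbitrary so that two simple processes on
  different grids can be merged into one family.\<close>

lemma increment_family_isometry:
  fixes A :: "'i set"
  assumes A: "finite A" and r: "r \<le> T"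
    and ab: "\<And>i. i \<in> A \<Longrightarrow> 0 \<le> a i \<and> a i \<le> b i \<and> b i \<le> r"
    and g: "\<And>i. i \<in> A \<Longrightarrow> g i \<in> borel_measurable (F (a i))"
    and B: "\<And>i \<omega>. i \<in> A \<Longrightarrow> \<omega> \<in> space M \<Longrightarrow> \<bar>g i \<omega>\<bar> \<le> B i"
  shows "sq_int M (\<lambda>\<omega>. \<Sum>i\<in>A. g i \<omega> * (W (b i) \<omega> - W (a i) \<omega>))"
    and "(\<integral>\<^sup>+\<omega>. ennreal ((\<Sum>i\<in>A. g i \<omega> * (W (b i) \<omega> - W (a i) \<omega>))\<^sup>2) \<partial>M)
      = sq_norm r (\<lambda>s \<omega>. \<Sum>i\<in>A. g i \<omega> * indicator {a i<..b i} s)"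
proof -
  interpret prob_space M by (rule prob_M)
  define Y where "Y i \<omega> = g i \<omega> * (W (b i) \<omega> - W (a i) \<omega>)" for i \<omega>
  define q where "q i j = measure lborel ({a i<..b i} \<inter> {a j<..b j})" for i j
  have gM: "g i \<in> borel_measurable M" if "i \<in> A" for i
    using measurable_F_M[OF _ g[OF that]] ab[OF that] r by simp
  have gsq: "sq_int M (g i)" if "i \<in> A" for i
    using sq_int_bounded[OF gM[OF that] B[OF that]] by simp
  have Ysq: "sq_int M (Y i)" if "i \<in> A" for i
    unfolding Y_def using sq_int_increment_mult(1)[of "a i" "b i" "g i" "\<lambda>z. z"]
      increment_second_moment[of "a i" "b i"] ab[OF that] r g[OF that] gsq[OF that] by simp
  show S: "sq_int M (\<lambda>\<omega>. \<Sum>i\<in>A. g i \<omega> * (W (b i) \<omega> - W (a i) \<omega>))"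
    using sq_int_sum[of A M Y] Ysq by (simp add: Y_def[abs_def])
  have "(\<integral>\<omega>. (\<Sum>i\<in>A. Y i \<omega>)\<^sup>2 \<partial>M) = (\<integral>\<omega>. (\<Sum>i\<in>A. \<Sum>j\<in>A. Y i \<omega> * Y j \<omega>) \<partial>M)"
    by (simp add: power2_eq_square sum_product)
  also have "\<dots> = (\<Sum>i\<in>A. \<Sum>j\<in>A. \<integral>\<omega>. Y i \<omega> * Y j \<omega> \<partial>M)"
    using Ysq by (simp add: sq_int_mult)
  also have "\<dots> = (\<Sum>i\<in>A. \<Sum>j\<in>A. (\<integral>\<omega>. g i \<omega> * g j \<omega> \<partial>M) * q i j)"
    unfolding Y_def q_def using ab r g B
    by (intro sum.cong refl increment_inner[where B="B _" and B'="B _"]) (auto intro: order.trans)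
  also have "\<dots> = (\<integral>\<omega>. (\<Sum>i\<in>A. \<Sum>j\<in>A. g i \<omega> * g j \<omega> * q i j) \<partial>M)"
    using gsq by (simp add: sq_int_mult)
  finally have E: "(\<integral>\<omega>. (\<Sum>i\<in>A. Y i \<omega>)\<^sup>2 \<partial>M) = (\<integral>\<omega>. (\<Sum>i\<in>A. \<Sum>j\<in>A. g i \<omega> * g j \<omega> * q i j) \<partial>M)" .
  have inner: "has_bochner_integral lborel (\<lambda>s. (\<Sum>i\<in>A. g i \<omega> * indicator {a i<..b i} s)\<^sup>2)
      (\<Sum>i\<in>A. \<Sum>j\<in>A. g i \<omega> * g j \<omega> * q i j)" for \<omega>
  proof -
    have "has_bochner_integral lborel (\<lambda>s. \<Sum>i\<in>A. \<Sum>j\<in>A. g i \<omega> * g j \<omega> * indicator ({a i<..b i} \<inter> {a j<..b j}) s)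
      (\<Sum>i\<in>A. \<Sum>j\<in>A. g i \<omega> * g j \<omega> * q i j)"
    proof (intro has_bochner_integral_sum has_bochner_integral_mult_right)
      fix i j
      have "emeasure lborel ({a i<..b i} \<inter> {a j<..b j}) \<le> emeasure lborel {a i..b i}"
        by (intro emeasure_mono) auto
      also have "\<dots> < \<infinity>" by (simp add: emeasure_lborel_Icc_eq)
      finally show "has_bochner_integral lborel (indicat_real ({a i<..b i} \<inter> {a j<..b j})) (q i j)"
        unfolding q_def by (intro has_bochner_integral_real_indicator) auto
    qed
    also have "(\<lambda>s. \<Sum>i\<in>A. \<Sum>j\<in>A. g i \<omega> * g j \<omega> * indicator ({a i<..b i} \<inter> {a j<..b j}) s)
      = (\<lambda>s. (\<Sum>i\<in>A. g i \<omega> * indicator {a i<..b i} s)\<^sup>2)"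
      unfolding indicator_inter_arith by (simp add: power2_eq_square sum_product ac_simps)
    finally show ?thesis .
  qed
  have nonneg: "0 \<le> (\<Sum>i\<in>A. \<Sum>j\<in>A. g i \<omega> * g j \<omega> * q i j)" for \<omega>
    by (subst has_bochner_integral_integral_eq[OF inner, symmetric])
       (intro integral_nonneg_AE AE_I2 zero_le_power2)
  have inner_nn: "(\<integral>\<^sup>+s\<in>{0..r}. ennreal ((\<Sum>i\<in>A. g i \<omega> * indicator {a i<..b i} s)\<^sup>2) \<partial>lborel)
    = ennreal (\<Sum>i\<in>A. \<Sum>j\<in>A. g i \<omega> * g j \<omega> * q i j)" for \<omega>
  proof -
    have "(\<Sum>i\<in>A. g i \<omega> * indicator {a i<..b i} s) = 0" if "s \<notin> {0..r}" for s
    proof (rule sum.neutral, rule ballI)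
      fix i assume "i \<in> A"
      then have "s \<notin> {a i<..b i}" using that ab[of i] by auto
      then show "g i \<omega> * indicator {a i<..b i} s = 0" by simp
    qed
    then have "(\<integral>\<^sup>+s\<in>{0..r}. ennreal ((\<Sum>i\<in>A. g i \<omega> * indicator {a i<..b i} s)\<^sup>2) \<partial>lborel)
      = (\<integral>\<^sup>+s. ennreal ((\<Sum>i\<in>A. g i \<omega> * indicator {a i<..b i} s)\<^sup>2) \<partial>lborel)"
      by (intro nn_integral_cong) (simp add: indicator_def)
    also have "\<dots> = ennreal (\<Sum>i\<in>A. \<Sum>j\<in>A. g i \<omega> * g j \<omega> * q i j)"
      using inner[of \<omega>] by (simp add: has_bochner_integral_iff nn_integral_eq_integral)
    finally show ?thesis .
  qed
  have "integrable M (\<lambda>\<omega>. \<Sum>i\<in>A. \<Sum>j\<in>A. g i \<omega> * g j \<omega> * q i j)"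
    using gsq by (simp add: sq_int_mult)
  then have "sq_norm r (\<lambda>s \<omega>. \<Sum>i\<in>A. g i \<omega> * indicator {a i<..b i} s)
    = ennreal (\<integral>\<omega>. (\<Sum>i\<in>A. \<Sum>j\<in>A. g i \<omega> * g j \<omega> * q i j) \<partial>M)"
    unfolding sq_norm_def inner_nn using nonneg by (intro nn_integral_eq_integral) auto
  then show "(\<integral>\<^sup>+\<omega>. ennreal ((\<Sum>i\<in>A. g i \<omega> * (W (b i) \<omega> - W (a i) \<omega>))\<^sup>2) \<partial>M)
      = sq_norm r (\<lambda>s \<omega>. \<Sum>i\<in>A. g i \<omega> * indicator {a i<..b i} s)"
    using nn_integral_sq[OF S] E by (simp add: Y_def)
qed

text \<open>The two families are joined over a disjoint sum of indices, the second with negated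
  coefficients; this replaces a common refinement of the grids.\<close>

lemma simple_integral_difference_isometry:
  assumes r: "r \<le> T" and S: "simple_integrand M F r n \<tau> h" and S': "simple_integrand M F r n' \<tau>' h'"
  shows "(\<integral>\<^sup>+\<omega>. ennreal ((simple_integral W n \<tau> h \<omega> - simple_integral W n' \<tau>' h' \<omega>)\<^sup>2) \<partial>M)
    = sq_norm r (\<lambda>s \<omega>. simple_process n \<tau> h s \<omega> - simple_process n' \<tau>' h' s \<omega>)"
proof -
  define a where "a = case_sum \<tau> \<tau>'"
  define b where "b = case_sum (\<lambda>i. \<tau> (Suc i)) (\<lambda>i. \<tau>' (Suc i))"
  define g where "g = case_sum h (\<lambda>i \<omega>. - h' i \<omega>)"
  let ?A = "{..<n} <+> {..<n'}"
  have sum_A: "(\<Sum>i\<in>?A. f i) = (\<Sum>i<n. f (Inl i)) + (\<Sum>i<n'. f (Inr i))" for f :: "nat + nat \<Rightarrow> real"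
    by (simp add: sum.Plus)
  have "\<exists>C. \<forall>\<omega>\<in>space M. \<bar>g i \<omega>\<bar> \<le> C" if "i \<in> ?A" for i
    using that S S' by (auto simp: simple_integrand_def g_def)
  then obtain B where B: "\<And>i \<omega>. i \<in> ?A \<Longrightarrow> \<omega> \<in> space M \<Longrightarrow> \<bar>g i \<omega>\<bar> \<le> B i"
    by metis
  have eq: "(\<integral>\<^sup>+\<omega>. ennreal ((\<Sum>i\<in>?A. g i \<omega> * (W (b i) \<omega> - W (a i) \<omega>))\<^sup>2) \<partial>M)
      = sq_norm r (\<lambda>s \<omega>. \<Sum>i\<in>?A. g i \<omega> * indicator {a i<..b i} s)"
    by (rule increment_family_isometry(2)[OF _ r _ _ B])
       (use S S' in \<open>auto simp: simple_integrand_def a_def b_def g_def\<close>)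
  have "(\<Sum>i\<in>?A. g i \<omega> * (W (b i) \<omega> - W (a i) \<omega>)) = simple_integral W n \<tau> h \<omega> - simple_integral W n' \<tau>' h' \<omega>" for \<omega>
    unfolding sum_A simple_integral_def by (simp add: a_def b_def g_def sum_negf)
  moreover have "(\<Sum>i\<in>?A. g i \<omega> * indicator {a i<..b i} s) = simple_process n \<tau> h s \<omega> - simple_process n' \<tau>' h' s \<omega>" for s \<omega>
    unfolding sum_A simple_process_def by (simp add: a_def b_def g_def sum_negf)
  ultimately show ?thesis using eq by simp
qed

lemma
  assumes r: "r \<le> T" and S: "simple_integrand M F r n \<tau> h"
  shows measurable_simple_integral: "simple_integral W n \<tau> h \<in> borel_measurable M"
    and joint_measurable_simple_process: "joint_measurable r (simple_process n \<tau> h)"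
proof -
  have si: "h i \<in> borel_measurable (F (\<tau> i))" "\<tau> i \<in> {0..T}" "\<tau> (Suc i) \<in> {0..T}" if "i < n" for i
    using S r that unfolding simple_integrand_def by force+
  have h[measurable]: "h i \<in> borel_measurable M" if "i < n" for i
    using measurable_F_M[OF si(2,1)] that by blast
  have [measurable]: "W (\<tau> i) \<in> borel_measurable M" "W (\<tau> (Suc i)) \<in> borel_measurable M" if "i < n" for i
    using measurable_F_M[OF si(2) measurable_W[OF si(2)]] measurable_F_M[OF si(3) measurable_W[OF si(3)]] that
    by blast+
  show "simple_integral W n \<tau> h \<in> borel_measurable M"
    unfolding simple_integral_def[abs_def] by measurable
  have "(\<lambda>p. indicat_real {\<tau> i<..\<tau> (Suc i)} (fst p)) \<in> borel_measurable (restrict_space borel {0..r} \<Otimes>\<^sub>M M)" for i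
    by (intro measurable_compose[OF measurable_fst] measurable_restrict_space1) auto
  then show "joint_measurable r (simple_process n \<tau> h)"
    unfolding joint_measurable_def simple_process_def[abs_def] split_beta'
    by (intro borel_measurable_sum borel_measurable_times measurable_compose[OF measurable_snd h]) auto
qed

text \<open>The difference of the integrals is split at two simple integrals, and the difference of
  the simple processes again at \<open>H\<close> and \<open>H'\<close>. Each split into three terms
  costs a factor 3, and the approximation errors vanish in the limit. A constant larger than that of
  the isometry is harmless in a Gronwall argument.\<close>

lemma ito_integral_difference_bound:
  assumes r: "0 \<le> r" "r \<le> T"
    and I: "has_ito_integral M F W r H Y" "has_ito_integral M F W r H' Y'"
    and meas: "joint_measurable r H" "joint_measurable r H'"
  shows "(\<integral>\<^sup>+\<omega>. ennreal ((Y \<omega> - Y' \<omega>)\<^sup>2) \<partial>M) \<le> 9 * sq_norm r (\<lambda>s \<omega>. H s \<omega> - H' s \<omega>)"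
proof -
  obtain n \<tau> h where S: "\<And>k. simple_integrand M F r (n k) (\<tau> k) (h k)"
    and SH: "(\<lambda>k. sq_norm r (\<lambda>s \<omega>. simple_process (n k) (\<tau> k) (h k) s \<omega> - H s \<omega>)) \<longlonglongrightarrow> 0"
    and SY: "(\<lambda>k. \<integral>\<^sup>+\<omega>. ennreal ((simple_integral W (n k) (\<tau> k) (h k) \<omega> - Y \<omega>)\<^sup>2) \<partial>M) \<longlonglongrightarrow> 0"
    using I(1) unfolding has_ito_integral_def sq_norm_def by blast
  obtain n' \<tau>' h' where S': "\<And>k. simple_integrand M F r (n' k) (\<tau>' k) (h' k)"
    and SH': "(\<lambda>k. sq_norm r (\<lambda>s \<omega>. simple_process (n' k) (\<tau>' k) (h' k) s \<omega> - H' s \<omega>)) \<longlonglongrightarrow> 0"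
    and SY': "(\<lambda>k. \<integral>\<^sup>+\<omega>. ennreal ((simple_integral W (n' k) (\<tau>' k) (h' k) \<omega> - Y' \<omega>)\<^sup>2) \<partial>M) \<longlonglongrightarrow> 0"
    using I(2) unfolding has_ito_integral_def sq_norm_def by blast
  have [measurable]: "Y \<in> borel_measurable M" "Y' \<in> borel_measurable M"
    using I by (auto simp: has_ito_integral_def)
  define s1 where "s1 k = simple_integral W (n k) (\<tau> k) (h k)" for k
  define s2 where "s2 k = simple_integral W (n' k) (\<tau>' k) (h' k)" for k
  define p1 where "p1 k = simple_process (n k) (\<tau> k) (h k)" for k
  define p2 where "p2 k = simple_process (n' k) (\<tau>' k) (h' k)" for k
  have [measurable]: "s1 k \<in> borel_measurable M" "s2 k \<in> borel_measurable M" for k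
    unfolding s1_def s2_def using measurable_simple_integral[OF r(2)] S S' by auto
  have jp: "joint_measurable r (p1 k)" "joint_measurable r (p2 k)" for k
    unfolding p1_def p2_def using joint_measurable_simple_process[OF r(2)] S S' by auto
  have jd: "joint_measurable r (\<lambda>s \<omega>. f s \<omega> - g s \<omega>)" if "joint_measurable r f" "joint_measurable r g" for f g
    using that unfolding joint_measurable_def by (simp add: split_beta')
  have sq_comm: "(x - y)\<^sup>2 = (y - x)\<^sup>2" for x y :: real by (rule power2_commute)
  let ?D = "sq_norm r (\<lambda>s \<omega>. H s \<omega> - H' s \<omega>)"
  have bound: "(\<integral>\<^sup>+\<omega>. ennreal ((Y \<omega> - Y' \<omega>)\<^sup>2) \<partial>M) \<le>
    3 * ((\<integral>\<^sup>+\<omega>. ennreal ((s1 k \<omega> - Y \<omega>)\<^sup>2) \<partial>M)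
      + 3 * (sq_norm r (\<lambda>s \<omega>. p1 k s \<omega> - H s \<omega>) + ?D + sq_norm r (\<lambda>s \<omega>. p2 k s \<omega> - H' s \<omega>))
      + (\<integral>\<^sup>+\<omega>. ennreal ((s2 k \<omega> - Y' \<omega>)\<^sup>2) \<partial>M))" for k
  proof -
    have "(\<integral>\<^sup>+\<omega>. ennreal ((Y \<omega> - Y' \<omega>)\<^sup>2) \<partial>M) = (\<integral>\<^sup>+\<omega>. ennreal (((Y \<omega> - s1 k \<omega>) + (s1 k \<omega> - s2 k \<omega>) + (s2 k \<omega> - Y' \<omega>))\<^sup>2) \<partial>M)"
      by simp
    also have "\<dots> \<le> 3 * ((\<integral>\<^sup>+\<omega>. ennreal ((Y \<omega> - s1 k \<omega>)\<^sup>2) \<partial>M)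
      + (\<integral>\<^sup>+\<omega>. ennreal ((s1 k \<omega> - s2 k \<omega>)\<^sup>2) \<partial>M) + (\<integral>\<^sup>+\<omega>. ennreal ((s2 k \<omega> - Y' \<omega>)\<^sup>2) \<partial>M))"
      by (rule nn_integral_square_sum3) measurable
    also have "(\<integral>\<^sup>+\<omega>. ennreal ((s1 k \<omega> - s2 k \<omega>)\<^sup>2) \<partial>M) = sq_norm r (\<lambda>s \<omega>. p1 k s \<omega> - p2 k s \<omega>)"
      unfolding s1_def s2_def p1_def p2_def by (rule simple_integral_difference_isometry[OF r(2) S S'])
    also have "\<dots> = sq_norm r (\<lambda>s \<omega>. (p1 k s \<omega> - H s \<omega>) + (H s \<omega> - H' s \<omega>) + (H' s \<omega> - p2 k s \<omega>))"
      by simp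
    finally have 1: "(\<integral>\<^sup>+\<omega>. ennreal ((Y \<omega> - Y' \<omega>)\<^sup>2) \<partial>M) \<le>
      3 * ((\<integral>\<^sup>+\<omega>. ennreal ((Y \<omega> - s1 k \<omega>)\<^sup>2) \<partial>M)
      + sq_norm r (\<lambda>s \<omega>. (p1 k s \<omega> - H s \<omega>) + (H s \<omega> - H' s \<omega>) + (H' s \<omega> - p2 k s \<omega>))
      + (\<integral>\<^sup>+\<omega>. ennreal ((s2 k \<omega> - Y' \<omega>)\<^sup>2) \<partial>M))" .
    have 2: "sq_norm r (\<lambda>s \<omega>. (p1 k s \<omega> - H s \<omega>) + (H s \<omega> - H' s \<omega>) + (H' s \<omega> - p2 k s \<omega>))
      \<le> 3 * (sq_norm r (\<lambda>s \<omega>. p1 k s \<omega> - H s \<omega>) + ?D + sq_norm r (\<lambda>s \<omega>. H' s \<omega> - p2 k s \<omega>))"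
      by (intro sq_norm_sum3 r jd jp meas)
    have 3: "sq_norm r (\<lambda>s \<omega>. H' s \<omega> - p2 k s \<omega>) = sq_norm r (\<lambda>s \<omega>. p2 k s \<omega> - H' s \<omega>)"
      unfolding sq_norm_def by (simp only: sq_comm[of "H' _ _"])
    have 4: "(\<integral>\<^sup>+\<omega>. ennreal ((Y \<omega> - s1 k \<omega>)\<^sup>2) \<partial>M) = (\<integral>\<^sup>+\<omega>. ennreal ((s1 k \<omega> - Y \<omega>)\<^sup>2) \<partial>M)"
      by (simp only: sq_comm[of "Y _"])
    show ?thesis
      by (rule order.trans[OF 1]) (intro mult_left_mono add_mono 2[unfolded 3] eq_refl[OF 4] order_refl zero_le)
  qed
  have "(\<lambda>k. 3 * ((\<integral>\<^sup>+\<omega>. ennreal ((s1 k \<omega> - Y \<omega>)\<^sup>2) \<partial>M)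
      + 3 * (sq_norm r (\<lambda>s \<omega>. p1 k s \<omega> - H s \<omega>) + ?D + sq_norm r (\<lambda>s \<omega>. p2 k s \<omega> - H' s \<omega>))
      + (\<integral>\<^sup>+\<omega>. ennreal ((s2 k \<omega> - Y' \<omega>)\<^sup>2) \<partial>M))) \<longlonglongrightarrow> 3 * (0 + 3 * (0 + ?D + 0) + 0)"
    using SH SY SH' SY' unfolding s1_def s2_def p1_def p2_def
    by (intro tendsto_add ennreal_tendsto_cmult tendsto_const) auto
  then have "(\<integral>\<^sup>+\<omega>. ennreal ((Y \<omega> - Y' \<omega>)\<^sup>2) \<partial>M) \<le> 3 * (0 + 3 * (0 + ?D + 0) + 0)"
    by (rule LIMSEQ_le_const) (use bound in auto)
  also have "3 * (0 + 3 * (0 + ?D + 0) + 0) = 9 * ?D"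
    by (simp add: mult.assoc[symmetric])
  finally show ?thesis .
qed

end


section \<open>Progressive processes\<close>

context geometric_dynamics
begin

lemma progressiveD:
  "progressive F T H \<Longrightarrow> t \<in> {0..T} \<Longrightarrow>
    (\<lambda>p. H (fst p) (snd p)) \<in> borel_measurable (restrict_space borel {0..t} \<Otimes>\<^sub>M F t)"
  by (auto simp: progressive_def split_beta')

lemma progressiveI:
  "(\<And>t. t \<in> {0..T} \<Longrightarrow>
    (\<lambda>p. H (fst p) (snd p)) \<in> borel_measurable (restrict_space borel {0..t} \<Otimes>\<^sub>M F t)) \<Longrightarrow> progressive F T H"
  by (auto simp: progressive_def split_beta')

lemma progressive_adapted:
  assumes H: "progressive F T H" and t: "t \<in> {0..T}"
  shows "H t \<in> borel_measurable (F t)"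
proof -
  have "(\<lambda>\<omega>. (t, \<omega>)) \<in> measurable (F t) (restrict_space borel {0..t} \<Otimes>\<^sub>M F t)"
    using t by (intro measurable_Pair) (auto simp: space_restrict_space)
  from measurable_compose[OF this progressiveD[OF H t]] show ?thesis by simp
qed

lemma progressive_joint_measurable:
  assumes H: "progressive F T H" and t: "t \<in> {0..T}"
  shows "joint_measurable t H"
proof -
  have "(\<lambda>\<omega>. \<omega>) \<in> measurable M (F t)" using t by (intro measurable_F_M) auto
  then have "(\<lambda>p. (fst p, snd p)) \<in> measurable (restrict_space borel {0..t} \<Otimes>\<^sub>M M) (restrict_space borel {0..t} \<Otimes>\<^sub>M F t)"
    by (intro measurable_Pair measurable_fst measurable_compose[OF measurable_snd])
  from measurable_compose[OF this progressiveD[OF H t]] show ?thesis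
    by (simp add: joint_measurable_def split_beta')
qed

lemma joint_measurable_section:
  assumes H: "joint_measurable r H" and "\<omega> \<in> space M"
  shows "set_borel_measurable borel {0..r} (\<lambda>s. H s \<omega>)"
proof -
  have "(\<lambda>s. (s, \<omega>)) \<in> measurable (restrict_space borel {0..r}) (restrict_space borel {0..r} \<Otimes>\<^sub>M M)"
    using assms(2) by (intro measurable_Pair) auto
  from measurable_compose[OF this H[unfolded joint_measurable_def]]
  have "(\<lambda>s. H s \<omega>) \<in> borel_measurable (restrict_space borel {0..r})" by simp
  then show ?thesis by (simp add: set_borel_measurable_def borel_measurable_restrict_space_iff)
qed

lemma measurable_snd_F_mono:
  assumes "Y \<in> measurable (F s) N" "0 \<le> s" "s \<le> t" "t \<le> T"
  shows "(\<lambda>p. Y (snd p)) \<in> measurable (L \<Otimes>\<^sub>M F t) N"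
  by (rule measurable_compose[OF measurable_snd measurable_F_mono[OF assms(2-4,1)]])

text \<open>Time is rounded up to a multiple of 1/(n+1) and capped at t. Each approximation thus
  takes countably many time values, none after t, and path continuity gives the limit.\<close>

lemma progressive_continuous:
  assumes Y: "\<And>t. t \<in> {0..T} \<Longrightarrow> Y t \<in> borel_measurable (F t)"
    and cont: "\<And>\<omega>. \<omega> \<in> space M \<Longrightarrow> continuous_on {0..T} (\<lambda>t. Y t \<omega>)"
  shows "progressive F T Y"
proof (rule progressiveI)
  fix t assume t: "t \<in> {0..T}"
  let ?N = "restrict_space borel {0..t} \<Otimes>\<^sub>M F t"
  define s where "s n x = min t (real (nat \<lceil>x * real (Suc n)\<rceil>) / real (Suc n))" for n x
  show "(\<lambda>p. Y (fst p) (snd p)) \<in> borel_measurable ?N"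
  proof (rule borel_measurable_LIMSEQ_real[of ?N "\<lambda>n p. Y (s n (fst p)) (snd p)"])
    fix p assume "p \<in> space ?N"
    then have "fst p \<in> space (restrict_space borel {0..t})" "snd p \<in> space (F t)"
      by (auto simp: space_pair_measure)
    then have p: "fst p \<in> {0..t}" "snd p \<in> space M"
      by (simp_all add: space_F[OF t] space_restrict_space)
    have lim: "(\<lambda>n. s n (fst p)) \<longlonglongrightarrow> fst p"
    proof (rule tendsto_sandwich[where f="\<lambda>_. fst p" and h="\<lambda>n. fst p + 1 / real (Suc n)"])
      have pos: "0 < real (Suc n)" for n by simp
      have lo: "x \<le> real (nat \<lceil>x * real (Suc n)\<rceil>) / real (Suc n)"
        and hi: "real (nat \<lceil>x * real (Suc n)\<rceil>) / real (Suc n) \<le> x + 1 / real (Suc n)" if "0 \<le> x" for x n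
      proof -
        have nn: "0 \<le> x * real (Suc n)" using that by simp
        have c: "real (nat \<lceil>x * real (Suc n)\<rceil>) = of_int \<lceil>x * real (Suc n)\<rceil>"
          using nn by (simp add: of_nat_nat)
        show "x \<le> real (nat \<lceil>x * real (Suc n)\<rceil>) / real (Suc n)"
          using le_of_int_ceiling[of "x * real (Suc n)"] unfolding c by (subst le_divide_eq) auto
        have "of_int \<lceil>x * real (Suc n)\<rceil> \<le> x * real (Suc n) + 1"
          using of_int_ceiling_le_add_one by blast
        also have "\<dots> = (x + 1 / real (Suc n)) * real (Suc n)" by (simp add: distrib_right)
        finally show "real (nat \<lceil>x * real (Suc n)\<rceil>) / real (Suc n) \<le> x + 1 / real (Suc n)"
          unfolding c using pos[of n] by (subst divide_le_eq) simp
      qed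
      show "\<forall>\<^sub>F n in sequentially. fst p \<le> s n (fst p)"
        using p lo[of "fst p"] unfolding s_def by (intro always_eventually allI min.boundedI) auto
      show "\<forall>\<^sub>F n in sequentially. s n (fst p) \<le> fst p + 1 / real (Suc n)"
        using p hi[of "fst p"] unfolding s_def by (intro always_eventually allI min.coboundedI2) auto
      show "(\<lambda>n. fst p + 1 / real (Suc n)) \<longlonglongrightarrow> fst p"
        using LIMSEQ_inverse_real_of_nat_add[of "fst p"] by (simp add: inverse_eq_divide)
    qed simp
    have "\<forall>\<^sub>F n in sequentially. s n (fst p) \<in> {0..T}"
      using t by (intro always_eventually allI) (auto simp: s_def min_def)
    with lim show "(\<lambda>n. Y (s n (fst p)) (snd p)) \<longlonglongrightarrow> Y (fst p) (snd p)"
      using continuous_on_tendsto_compose[OF cont[OF p(2)] lim] p t by auto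
  next
    fix n
    have 1: "(\<lambda>p. Y (min t (real k / real (Suc n))) (snd p)) \<in> borel_measurable ?N" for k
      using t by (intro measurable_snd_F_mono[OF Y]) (auto simp: min_def)
    have "(\<lambda>p. fst p) \<in> borel_measurable ?N"
      by (intro measurable_compose[OF measurable_fst] measurable_restrict_space1) auto
    then have "(\<lambda>p. \<lceil>fst p * real (Suc n)\<rceil>) \<in> measurable ?N (count_space UNIV)"
      by measurable
    then have 2: "(\<lambda>p. nat \<lceil>fst p * real (Suc n)\<rceil>) \<in> measurable ?N (count_space UNIV)"
      by (rule measurable_compose) auto
    show "(\<lambda>p. Y (s n (fst p)) (snd p)) \<in> borel_measurable ?N"
      unfolding s_def using measurable_compose_countable[OF 1 2] by simp
  qed
qed

text \<open>A parameter integral over (time, outcome), measurable by Fubini. Clipping the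
  integration variable at t keeps the integrand measurable with respect to
  \<open>F t\<close>.\<close>

lemma progressive_primitive:
  assumes b: "progressive F T b"
  shows "progressive F T (\<lambda>t \<omega>. primitive (\<lambda>s. b s \<omega>) t)"
proof (rule progressiveI)
  fix t assume t: "t \<in> {0..T}"
  let ?N = "restrict_space borel {0..t} \<Otimes>\<^sub>M F t"
  have bm: "(\<lambda>p. b (max 0 (min t (snd p))) (fst p)) \<in> borel_measurable (F t \<Otimes>\<^sub>M lborel)"
    using measurable_clip_process(2)[of t b "F t"] progressiveD[OF b t] t by (simp add: split_beta')
  have "(\<lambda>q. (snd (fst q), snd q)) \<in> measurable (?N \<Otimes>\<^sub>M lborel) (F t \<Otimes>\<^sub>M lborel)"
    by (intro measurable_Pair measurable_compose[OF measurable_fst measurable_snd] measurable_snd)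
  from measurable_compose[OF this bm]
  have [measurable]: "(\<lambda>q. b (max 0 (min t (snd q))) (snd (fst q))) \<in> borel_measurable (?N \<Otimes>\<^sub>M lborel)"
    by simp
  have id: "(\<lambda>s. s) \<in> borel_measurable (restrict_space borel {0..t})"
    by (rule measurable_restrict_space1) simp
  have [measurable]: "(\<lambda>q. fst (fst q)) \<in> borel_measurable (?N \<Otimes>\<^sub>M lborel)"
    by (rule measurable_compose[OF measurable_fst measurable_compose[OF measurable_fst id]])
  have "(\<lambda>q. if 0 \<le> snd q \<and> snd q \<le> fst (fst q) then b (max 0 (min t (snd q))) (snd (fst q)) else 0)
      \<in> borel_measurable (?N \<Otimes>\<^sub>M lborel)"
    by measurable
  then have "(\<lambda>p. \<integral>u. (if 0 \<le> u \<and> u \<le> fst p then b (max 0 (min t u)) (snd p) else 0) \<partial>lborel) \<in> borel_measurable ?N"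
    by (intro lborel.borel_measurable_lebesgue_integral) (simp add: split_beta')
  also have "?this \<longleftrightarrow> (\<lambda>p. primitive (\<lambda>s. b s (snd p)) (fst p)) \<in> borel_measurable ?N"
  proof (intro measurable_cong)
    fix p assume "p \<in> space ?N"
    then have "fst p \<in> space (restrict_space borel {0..t})" by (auto simp: space_pair_measure)
    then have "max 0 (min t u) = u" if "0 \<le> u" "u \<le> fst p" for u
      using that by (simp add: space_restrict_space)
    then show "(\<integral>u. (if 0 \<le> u \<and> u \<le> fst p then b (max 0 (min t u)) (snd p) else 0) \<partial>lborel) = primitive (\<lambda>s. b s (snd p)) (fst p)"
      unfolding primitive_def set_lebesgue_integral_def
      by (intro Bochner_Integration.integral_cong) (simp_all add: indicator_def)
  qed
  finally show "(\<lambda>p. primitive (\<lambda>s. b s (snd p)) (fst p)) \<in> borel_measurable ?N" .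
qed

text \<open>The modification stays adapted because the filtration contains the null sets.\<close>

lemma continuous_modification:
  obtains V where "\<And>t. t \<in> {0..T} \<Longrightarrow> V t \<in> borel_measurable (F t)"
    "\<And>\<omega>. \<omega> \<in> space M \<Longrightarrow> continuous_on {0..T} (\<lambda>t. V t \<omega>)"
    "AE \<omega> in M. \<forall>t. V t \<omega> = W t \<omega>"
proof -
  have "AE \<omega> in M. continuous_on {0..T} (\<lambda>t. W t \<omega>)"
    using brownian by (simp add: brownian_motion_def)
  then obtain N where N: "{\<omega>\<in>space M. \<not> continuous_on {0..T} (\<lambda>t. W t \<omega>)} \<subseteq> N" "N \<in> null_sets M"
    by (auto elim!: AE_E simp: null_sets_def)
  define V where "V t \<omega> = (if \<omega> \<in> N then 0 else W t \<omega>)" for t \<omega>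
  show ?thesis
  proof (rule that[of V])
    fix t assume t: "t \<in> {0..T}"
    have "N \<in> sets (F t)" using N(2) filtered t by (auto simp: complete_filtered_prob_space_def)
    moreover from this have "{\<omega> \<in> space (F t). \<omega> \<in> N} = N" using sets.sets_into_space by blast
    ultimately have "{\<omega> \<in> space (F t). \<omega> \<in> N} \<in> sets (F t)" by simp
    then show "V t \<in> borel_measurable (F t)"
      unfolding V_def[abs_def] using measurable_W[OF t] by (intro measurable_If) auto
  next
    fix \<omega> assume "\<omega> \<in> space M"
    then show "continuous_on {0..T} (\<lambda>t. V t \<omega>)"
      using N(1) by (cases "\<omega> \<in> N") (auto simp: V_def)
  next
    show "AE \<omega> in M. \<forall>t. V t \<omega> = W t \<omega>"
      using AE_not_in[OF N(2)] by eventually_elim (simp add: V_def)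
  qed
qed

lemma measurable_flows_prob_measures:
  "\<mu> \<in> measurable_flows T \<Longrightarrow> t \<in> {0..T} \<Longrightarrow> \<mu> t \<in> prob_measures"
  unfolding measurable_flows_def
  by (drule measurable_space[where x=t]) (auto simp: space_restrict_space space_weak_borel)

lemma drift_bound:
  obtains C where "\<And>\<alpha> \<mu> s \<omega>. \<alpha> \<in> controls \<Longrightarrow> \<mu> \<in> measurable_flows T \<Longrightarrow> s \<in> {0..T} \<Longrightarrow> \<omega> \<in> space M \<Longrightarrow>
    \<bar>\<alpha> s \<omega> + m (\<mu> s)\<bar> \<le> C \<and> \<bar>\<alpha> s \<omega>\<bar> \<le> C"
proof -
  obtain C1 where C1: "\<And>a. a \<in> U \<Longrightarrow> \<bar>a\<bar> \<le> C1"
    using compact_imp_bounded[OF U_compact] by (auto simp: bounded_iff)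
  obtain C2 where C2: "\<And>\<mu>. \<mu> \<in> prob_measures \<Longrightarrow> \<bar>m \<mu>\<bar> \<le> C2"
    using m_bounded by (auto simp: bounded_iff)
  show ?thesis
  proof (rule that[of "C1 + \<bar>C2\<bar>"])
    fix \<alpha> \<mu> s \<omega>
    assume a: "\<alpha> \<in> controls" "\<mu> \<in> measurable_flows T" "s \<in> {0..T}" "\<omega> \<in> space M"
    then have "\<bar>\<alpha> s \<omega>\<bar> \<le> C1" by (intro C1) (auto simp: controls_def)
    moreover have "\<bar>m (\<mu> s)\<bar> \<le> C2" using a by (intro C2 measurable_flows_prob_measures)
    ultimately show "\<bar>\<alpha> s \<omega> + m (\<mu> s)\<bar> \<le> C1 + \<bar>C2\<bar> \<and> \<bar>\<alpha> s \<omega>\<bar> \<le> C1 + \<bar>C2\<bar>" by linarith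
  qed
qed

lemma measurable_flow_compose:
  assumes "f \<in> borel_measurable weak_borel" "\<mu> \<in> measurable_flows T"
  shows "(\<lambda>s. f (\<mu> s)) \<in> borel_measurable (restrict_space borel {0..T})"
  using assms by (auto simp: measurable_flows_def intro: measurable_compose)

lemma progressive_drift:
  assumes "\<alpha> \<in> controls" "\<mu> \<in> measurable_flows T"
  shows "progressive F T (\<lambda>s \<omega>. \<alpha> s \<omega> + m (\<mu> s))"
proof (rule progressiveI)
  fix t assume t: "t \<in> {0..T}"
  have "(\<lambda>s. m (\<mu> s)) \<in> borel_measurable (restrict_space borel {0..t})"
    by (rule measurable_restrict_mono[OF measurable_flow_compose[OF m_measurable assms(2)]]) (use t in auto)
  then show "(\<lambda>p. \<alpha> (fst p) (snd p) + m (\<mu> (fst p))) \<in> borel_measurable (restrict_space borel {0..t} \<Otimes>\<^sub>M F t)"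
    using assms(1) t by (intro borel_measurable_add progressiveD measurable_compose[OF measurable_fst])
      (auto simp: controls_def)
qed

end


section \<open>Linear equations with bounded drift: uniqueness\<close>

text \<open>Control and interaction enter the dynamics only through their sum, here a single bounded
  progressive process; \<open>solution\<close> is \<open>sde_solution\<close> for that sum.\<close>

locale bounded_drift = geometric_dynamics M F T W \<sigma> \<xi> U m
  for M :: "'w measure" and F T W \<sigma> \<xi> U m +
  fixes b :: "real \<Rightarrow> 'w \<Rightarrow> real" and C :: real
  assumes drift_progressive: "progressive F T b"
    and drift_bounded: "\<And>s \<omega>. s \<in> {0..T} \<Longrightarrow> \<omega> \<in> space M \<Longrightarrow> \<bar>b s \<omega>\<bar> \<le> C"
begin

definition solution :: "(real \<Rightarrow> 'w \<Rightarrow> real) \<Rightarrow> bool" where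
  "solution X \<longleftrightarrow>
     progressive F T X \<and>
     (AE \<omega> in M. continuous_on {0..T} (\<lambda>t. X t \<omega>)) \<and>
     (\<integral>\<^sup>+\<omega>. (\<integral>\<^sup>+t\<in>{0..T}. ennreal ((X t \<omega>)\<^sup>2) \<partial>lborel) \<partial>M) < \<infinity> \<and>
     (\<forall>t\<in>{0..T}. \<exists>I. has_ito_integral M F W t (\<lambda>s \<omega>. \<sigma> * X s \<omega>) I \<and>
        (AE \<omega> in M. X t \<omega> = \<xi> \<omega> + (LINT s:{0..t}|lborel. X s \<omega> * b s \<omega>) + I \<omega>))"

lemma drift_density: "\<omega> \<in> space M \<Longrightarrow> bounded_density T C (\<lambda>s. b s \<omega>)"
  using joint_measurable_section[OF progressive_joint_measurable[OF drift_progressive], of T] T_pos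
    drift_bounded by (simp add: bounded_density_def)

lemma C_nonneg: "0 \<le> C"
proof -
  interpret prob_space M by (rule prob_M)
  obtain \<omega> where "\<omega> \<in> space M" using not_empty by blast
  then show ?thesis using drift_bounded[of 0 \<omega>] T_pos by force
qed

text \<open>Allows the drift integrals of two solutions to be subtracted under one integral sign.
  Square integrability of a path, which holds almost surely, suffices because the drift is bounded
  on a bounded interval.\<close>

lemma path_drift_integrable:
  assumes X: "joint_measurable T X" and \<omega>: "\<omega> \<in> space M" and t: "t \<in> {0..T}"
    and fin: "(\<integral>\<^sup>+s\<in>{0..T}. ennreal ((X s \<omega>)\<^sup>2) \<partial>lborel) < \<infinity>"
  shows "set_integrable lborel {0..t} (\<lambda>s. X s \<omega> * b s \<omega>)"
proof -
  let ?x = "\<lambda>s. indicat_real {0..T} s * X s \<omega>" and ?b = "\<lambda>s. indicat_real {0..T} s * b s \<omega>"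
  have mx[measurable]: "?x \<in> borel_measurable borel" and mb[measurable]: "?b \<in> borel_measurable borel"
    using joint_measurable_section[OF X \<omega>] drift_density[OF \<omega>]
    by (auto simp: set_borel_measurable_def bounded_density_def)
  have "(\<integral>\<^sup>+s. ennreal ((?x s)\<^sup>2) \<partial>lborel) = (\<integral>\<^sup>+s\<in>{0..T}. ennreal ((X s \<omega>)\<^sup>2) \<partial>lborel)"
    by (intro nn_integral_cong) (auto simp: indicator_def)
  then have "sq_int lborel ?x"
    unfolding sq_int_def using fin mx by (auto intro!: integrableI_bounded borel_measurable_power)
  moreover have "sq_int lborel ?b"
  proof (rule sq_int_bound[of _ "indicat_real {0..T}" _ C])
    have "(\<lambda>x. (indicat_real {0..T} x)\<^sup>2) = indicat_real {0..T}" by (auto simp: indicator_def)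
    then show "sq_int lborel (indicat_real {0..T})"
      using T_pos by (simp add: sq_int_def)
    show "AE s in lborel. \<bar>?b s\<bar> \<le> C * \<bar>indicat_real {0..T} s\<bar>"
      using drift_bounded[OF _ \<omega>] by (auto simp: indicator_def)
  qed simp
  ultimately have "integrable lborel (\<lambda>s. ?x s * ?b s)" by (rule sq_int_mult)
  moreover have "(\<lambda>s. ?x s * ?b s) = (\<lambda>s. indicat_real {0..T} s *\<^sub>R (X s \<omega> * b s \<omega>))"
    by (auto simp: indicator_def)
  ultimately have "set_integrable lborel {0..T} (\<lambda>s. X s \<omega> * b s \<omega>)" by (simp add: set_integrable_def)
  then show ?thesis by (rule set_integrable_subset) (use t in auto)
qed

lemma solution_unique:
  assumes X: "solution X" and Y: "solution Y" and t: "t \<in> {0..T}"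
  shows "AE \<omega> in M. X t \<omega> = Y t \<omega>"
proof -
  interpret prob_space M by (rule prob_M)
  define D where "D s \<omega> = X s \<omega> - Y s \<omega>" for s \<omega>
  define u where "u s = (\<integral>\<^sup>+\<omega>. ennreal ((D s \<omega>)\<^sup>2) \<partial>M)" for s
  have pX: "progressive F T X" and pY: "progressive F T Y"
    using X Y by (auto simp: solution_def)
  note j = progressive_joint_measurable[OF pX] progressive_joint_measurable[OF pY]
  have jD: "joint_measurable r D" if "r \<in> {0..T}" for r
    using j[OF that] unfolding joint_measurable_def D_def[abs_def] by (simp add: split_beta')
  have T: "T \<in> {0..T}" using T_pos by simp
  have finX: "sq_norm T X < \<infinity>" "sq_norm T Y < \<infinity>"
    using X Y by (auto simp: solution_def sq_norm_def)
  have "sq_norm T D < \<infinity>"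
  proof -
    have "sq_norm T (\<lambda>s \<omega>. X s \<omega> + (- Y s \<omega>) + 0) \<le> 3 * (sq_norm T X + sq_norm T (\<lambda>s \<omega>. - Y s \<omega>) + sq_norm T (\<lambda>s \<omega>. 0))"
      using j[OF T] T_pos by (intro sq_norm_sum3) (auto simp: joint_measurable_def split_beta')
    also have "\<dots> < \<infinity>" using finX by (simp add: sq_norm_def ennreal_mult_less_top)
    finally show ?thesis by (simp add: D_def[abs_def])
  qed
  then have ufin: "(\<integral>\<^sup>+s\<in>{0..T}. u s \<partial>lborel) < \<infinity>"
    using sq_norm_swap[OF _ jD[OF T]] T_pos by (simp add: u_def)
  have AEfin: "AE \<omega> in M. (\<integral>\<^sup>+s\<in>{0..T}. ennreal ((X s \<omega>)\<^sup>2) \<partial>lborel) < \<infinity>"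
    "AE \<omega> in M. (\<integral>\<^sup>+s\<in>{0..T}. ennreal ((Y s \<omega>)\<^sup>2) \<partial>lborel) < \<infinity>"
    using nn_integral_noteq_infinite[OF measurable_inner_sq_norm[OF _ j(1)[OF T]]]
      nn_integral_noteq_infinite[OF measurable_inner_sq_norm[OF _ j(2)[OF T]]] finX T_pos
    by (auto simp: sq_norm_def less_top)
  \<comment> \<open>2 T C^2 comes from Cauchy-Schwarz for the drift term, 18
    \<open>\<sigma>\<close>^2 from twice the constant 9 of
    \<open>ito_integral_difference_bound\<close>; the summand 1 keeps \<open>A\<close> positive when
    both vanish.\<close>
  define A where "A = 2 * T * C\<^sup>2 + 18 * \<sigma>\<^sup>2 + 1"
  have A: "0 < A" using T_pos by (simp add: A_def add_nonneg_pos)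
  have step: "u r \<le> ennreal A * (\<integral>\<^sup>+s\<in>{0..r}. u s \<partial>lborel)" if r: "r \<in> {0..T}" for r
  proof -
    obtain I where I: "has_ito_integral M F W r (\<lambda>s \<omega>. \<sigma> * X s \<omega>) I"
      "AE \<omega> in M. X r \<omega> = \<xi> \<omega> + (LINT s:{0..r}|lborel. X s \<omega> * b s \<omega>) + I \<omega>"
      using X r unfolding solution_def by blast
    obtain I' where I': "has_ito_integral M F W r (\<lambda>s \<omega>. \<sigma> * Y s \<omega>) I'"
      "AE \<omega> in M. Y r \<omega> = \<xi> \<omega> + (LINT s:{0..r}|lborel. Y s \<omega> * b s \<omega>) + I' \<omega>"
      using Y r unfolding solution_def by blast
    have [measurable]: "I \<in> borel_measurable M" "I' \<in> borel_measurable M"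
      using I I' by (auto simp: has_ito_integral_def)
    let ?Q = "\<lambda>\<omega>. \<integral>\<^sup>+s\<in>{0..r}. ennreal ((D s \<omega>)\<^sup>2) \<partial>lborel"
    have [measurable]: "?Q \<in> borel_measurable M"
      using r by (intro measurable_inner_sq_norm jD) auto
    have "AE \<omega> in M. ennreal ((D r \<omega>)\<^sup>2) \<le> ennreal (2 * T * C\<^sup>2) * ?Q \<omega> + 2 * ennreal ((I \<omega> - I' \<omega>)\<^sup>2)"
      using I(2) I'(2) AEfin AE_space
    proof eventually_elim
      case (elim \<omega>)
      note \<omega> = \<open>\<omega> \<in> space M\<close>
      define L where "L = (LINT s:{0..r}|lborel. D s \<omega> * b s \<omega>)"
      have iX: "set_integrable lborel {0..r} (\<lambda>s. X s \<omega> * b s \<omega>)"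
        and iY: "set_integrable lborel {0..r} (\<lambda>s. Y s \<omega> * b s \<omega>)"
        using path_drift_integrable[OF j(1)[OF T] \<omega> r] path_drift_integrable[OF j(2)[OF T] \<omega> r] elim by auto
      have "D r \<omega> = L + (I \<omega> - I' \<omega>)"
        using elim set_integral_diff(2)[OF iX iY] by (simp add: D_def L_def left_diff_distrib)
      then have "(D r \<omega>)\<^sup>2 \<le> 2 * L\<^sup>2 + 2 * (I \<omega> - I' \<omega>)\<^sup>2" by (simp add: square_sum2_le)
      then have 1: "ennreal ((D r \<omega>)\<^sup>2) \<le> 2 * ennreal (L\<^sup>2) + 2 * ennreal ((I \<omega> - I' \<omega>)\<^sup>2)"
        by (metis (mono_tags, lifting) ennreal_leI ennreal_mult ennreal_numeral ennreal_plus mult_nonneg_nonneg zero_le_numeral zero_le_power2)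
      let ?f = "\<lambda>s. indicat_real {0..r} s *\<^sub>R D s \<omega> * (indicat_real {0..T} s *\<^sub>R b s \<omega>)"
      have mf: "?f \<in> borel_measurable borel"
        using joint_measurable_section[OF jD[OF r] \<omega>] drift_density[OF \<omega>]
        by (auto simp: set_borel_measurable_def bounded_density_def)
      have [measurable]: "(\<lambda>s. indicat_real {0..r} s * D s \<omega>) \<in> borel_measurable borel"
        using joint_measurable_section[OF jD[OF r] \<omega>] by (simp add: set_borel_measurable_def)
      have "(\<lambda>s. ennreal ((indicat_real {0..r} s * D s \<omega>)\<^sup>2)) \<in> borel_measurable lborel" by measurable
      also have "(\<lambda>s. ennreal ((indicat_real {0..r} s * D s \<omega>)\<^sup>2)) = (\<lambda>s. ennreal ((D s \<omega>)\<^sup>2) * indicator {0..r} s)"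
        by (auto simp: indicator_def)
      finally have mQ: "(\<lambda>s. ennreal ((D s \<omega>)\<^sup>2) * indicator {0..r} s) \<in> borel_measurable lborel" .
      have "L = (LINT s:{0..r}|lborel. ?f s)"
        unfolding L_def set_lebesgue_integral_def using r
        by (intro Bochner_Integration.integral_cong) (auto simp: indicator_def)
      then have "ennreal (L\<^sup>2) \<le> ennreal r * (\<integral>\<^sup>+s\<in>{0..r}. ennreal ((?f s)\<^sup>2) \<partial>lborel)"
        using set_integral_square_le[OF _ mf, of 0 r] r by simp
      also have "\<dots> \<le> ennreal T * (\<integral>\<^sup>+s. ennreal (C\<^sup>2) * (ennreal ((D s \<omega>)\<^sup>2) * indicator {0..r} s) \<partial>lborel)"
      proof (rule mult_mono)
        show "ennreal r \<le> ennreal T" using r by (intro ennreal_leI) simp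
        show "(\<integral>\<^sup>+s\<in>{0..r}. ennreal ((?f s)\<^sup>2) \<partial>lborel) \<le>
          (\<integral>\<^sup>+s. ennreal (C\<^sup>2) * (ennreal ((D s \<omega>)\<^sup>2) * indicator {0..r} s) \<partial>lborel)"
        proof (rule nn_integral_mono)
        fix s
        show "ennreal ((?f s)\<^sup>2) * indicator {0..r} s \<le> ennreal (C\<^sup>2) * (ennreal ((D s \<omega>)\<^sup>2) * indicator {0..r} s)"
        proof (cases "s \<in> {0..r}")
          case True
          then have "(b s \<omega>)\<^sup>2 \<le> C\<^sup>2"
            using drift_bounded[OF _ \<omega>, of s] r C_nonneg by (intro abs_le_square_iff[THEN iffD1]) auto
          then have "(D s \<omega> * b s \<omega>)\<^sup>2 \<le> C\<^sup>2 * (D s \<omega>)\<^sup>2"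
            using mult_left_mono[of "(b s \<omega>)\<^sup>2" "C\<^sup>2" "(D s \<omega>)\<^sup>2"]
            by (simp add: power_mult_distrib mult.commute[of "C\<^sup>2"])
          then show ?thesis using True r by (simp add: ennreal_mult[symmetric] ennreal_leI)
        qed simp
        qed
      qed auto
      also have "\<dots> = ennreal T * (ennreal (C\<^sup>2) * ?Q \<omega>)"
        by (subst nn_integral_cmult[OF mQ]) simp
      finally have "2 * ennreal (L\<^sup>2) \<le> 2 * (ennreal T * (ennreal (C\<^sup>2) * ?Q \<omega>))"
        by (rule mult_left_mono) simp
      also have "\<dots> = ennreal (2 * T * C\<^sup>2) * ?Q \<omega>"
        using T_pos by (simp add: ennreal_mult mult.assoc)
      finally show ?case using 1 by (meson add_right_mono order.trans)
    qed
    then have "u r \<le> (\<integral>\<^sup>+\<omega>. ennreal (2 * T * C\<^sup>2) * ?Q \<omega> + 2 * ennreal ((I \<omega> - I' \<omega>)\<^sup>2) \<partial>M)"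
      unfolding u_def by (rule nn_integral_mono_AE)
    also have "\<dots> = ennreal (2 * T * C\<^sup>2) * sq_norm r D + 2 * (\<integral>\<^sup>+\<omega>. ennreal ((I \<omega> - I' \<omega>)\<^sup>2) \<partial>M)"
      by (simp add: nn_integral_add nn_integral_cmult sq_norm_def)
    also have "\<dots> \<le> ennreal (2 * T * C\<^sup>2) * sq_norm r D + 2 * (9 * sq_norm r (\<lambda>s \<omega>. \<sigma> * X s \<omega> - \<sigma> * Y s \<omega>))"
      using r j[OF r] by (intro add_left_mono mult_left_mono ito_integral_difference_bound I(1) I'(1))
        (auto simp: joint_measurable_def split_beta')
    also have "sq_norm r (\<lambda>s \<omega>. \<sigma> * X s \<omega> - \<sigma> * Y s \<omega>) = ennreal (\<sigma>\<^sup>2) * sq_norm r D"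
    proof -
      have jsD: "joint_measurable r (\<lambda>s \<omega>. \<sigma> * D s \<omega>)"
        using jD[OF r] by (simp add: joint_measurable_def split_beta')
      have [measurable]: "(\<lambda>p. D (max 0 (min r (snd p))) (fst p)) \<in> borel_measurable (M \<Otimes>\<^sub>M lborel)"
        using measurable_clip_process(2)[OF _ jD[OF r, unfolded joint_measurable_def]] r by simp
      have "sq_norm r (\<lambda>s \<omega>. \<sigma> * X s \<omega> - \<sigma> * Y s \<omega>) = sq_norm r (\<lambda>s \<omega>. \<sigma> * D s \<omega>)"
        by (simp add: D_def right_diff_distrib)
      also have "\<dots> = (\<integral>\<^sup>+p. ennreal (\<sigma>\<^sup>2) * ennreal ((indicat_real {0..r} (snd p) * D (max 0 (min r (snd p))) (fst p))\<^sup>2) \<partial>(M \<Otimes>\<^sub>M lborel))"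
        using sq_norm_pair[OF _ jsD] r by (simp add: power_mult_distrib ennreal_mult[symmetric] mult.left_commute)
      also have "\<dots> = ennreal (\<sigma>\<^sup>2) * sq_norm r D"
        using sq_norm_pair[OF _ jD[OF r]] r by (simp add: nn_integral_cmult)
      finally show ?thesis .
    qed
    also have "ennreal (2 * T * C\<^sup>2) * sq_norm r D + 2 * (9 * (ennreal (\<sigma>\<^sup>2) * sq_norm r D))
      = (ennreal (2 * T * C\<^sup>2) + ennreal (18 * \<sigma>\<^sup>2)) * sq_norm r D"
      by (simp add: distrib_right ennreal_mult mult.assoc[symmetric])
    also have "\<dots> \<le> ennreal A * sq_norm r D"
      using T_pos by (intro mult_right_mono) (simp_all add: ennreal_plus[symmetric] A_def ennreal_leI del: ennreal_plus)
    also have "sq_norm r D = (\<integral>\<^sup>+s\<in>{0..r}. u s \<partial>lborel)"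
      using sq_norm_swap[OF _ jD[OF r]] r by (simp add: u_def)
    finally show ?thesis .
  qed
  have "u t = 0" by (rule gronwall_nn_integral[OF A step ufin t])
  moreover have "D t \<in> borel_measurable M"
    using measurable_F_M[OF t progressive_adapted[OF pX t]] measurable_F_M[OF t progressive_adapted[OF pY t]]
    by (simp add: D_def[abs_def])
  ultimately have "AE \<omega> in M. ennreal ((D t \<omega>)\<^sup>2) = 0"
    unfolding u_def by (subst (asm) nn_integral_0_iff_AE) auto
  then show ?thesis by eventually_elim (simp add: D_def)
qed

end


section \<open>Linear equations with bounded drift: the explicit solution\<close>

lemma exp_minus_one_le: "0 \<le> x \<Longrightarrow> exp x - 1 \<le> x * exp (x::real)"
  using exp_Lipschitz[of 0 x x] by (simp add: mult.commute)

lemma exp_linear_remainder_le: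
  assumes "0 \<le> (x::real)" shows "exp x - 1 - x \<le> x\<^sup>2 * exp x"
proof -
  have "exp x * (1 + (- x)) \<le> exp x * exp (- x)"
    by (intro mult_left_mono exp_ge_add_one_self) auto
  then have "exp x - 1 - x \<le> x * (exp x - 1)"
    by (simp add: exp_minus field_simps)
  also have "\<dots> \<le> x * (x * exp x)" using exp_minus_one_le[OF assms] assms by (intro mult_left_mono) auto
  finally show ?thesis by (simp add: power2_eq_square)
qed

lemma integral_sq_le:
  assumes "sq_int M g" "f \<in> borel_measurable M" "AE x in M. \<bar>f x\<bar> \<le> c * \<bar>g x\<bar>"
  shows "(\<integral>x. (f x)\<^sup>2 \<partial>M) \<le> c\<^sup>2 * (\<integral>x. (g x)\<^sup>2 \<partial>M)"
proof -
  have "(\<integral>x. (f x)\<^sup>2 \<partial>M) \<le> (\<integral>x. c\<^sup>2 * (g x)\<^sup>2 \<partial>M)"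
  proof (rule integral_mono_AE)
    show "integrable M (\<lambda>x. (f x)\<^sup>2)" using sq_int_bound[OF assms] by (simp add: sq_int_def)
    show "integrable M (\<lambda>x. c\<^sup>2 * (g x)\<^sup>2)" using assms(1) by (simp add: sq_int_def)
    show "AE x in M. (f x)\<^sup>2 \<le> c\<^sup>2 * (g x)\<^sup>2"
      using assms(3)
    proof eventually_elim
      case (elim x)
      then have "\<bar>f x\<bar>\<^sup>2 \<le> (c * \<bar>g x\<bar>)\<^sup>2" by (intro power_mono) auto
      then show ?case by (simp add: power_mult_distrib)
    qed
  qed
  then show ?thesis by simp
qed

lemma integral_sq_add_le:
  assumes "sq_int M f" "sq_int M g"
  shows "(\<integral>x. (f x + g x)\<^sup>2 \<partial>M) \<le> 2 * (\<integral>x. (f x)\<^sup>2 \<partial>M) + 2 * (\<integral>x. (g x)\<^sup>2 \<partial>M)"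
proof -
  have "(\<integral>x. (f x + g x)\<^sup>2 \<partial>M) \<le> (\<integral>x. 2 * (f x)\<^sup>2 + 2 * (g x)\<^sup>2 \<partial>M)"
    using sq_int_add[OF assms] assms by (intro integral_mono square_sum2_le) (auto simp: sq_int_def)
  then show ?thesis using assms by (simp add: sq_int_def)
qed

lemma sq_int_cong_AE:
  assumes "sq_int M g" "f \<in> borel_measurable M" "AE x in M. f x = g x"
  shows "sq_int M f" "(\<integral>x. (f x)\<^sup>2 \<partial>M) = (\<integral>x. (g x)\<^sup>2 \<partial>M)"
proof -
  have ae: "AE x in M. (f x)\<^sup>2 = (g x)\<^sup>2" using assms(3) by eventually_elim simp
  have m: "(\<lambda>x. (f x)\<^sup>2) \<in> borel_measurable M" "(\<lambda>x. (g x)\<^sup>2) \<in> borel_measurable M"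
    using assms by (auto simp: sq_int_def)
  show "sq_int M f" using assms integrable_cong_AE[OF m ae] by (simp add: sq_int_def)
  show "(\<integral>x. (f x)\<^sup>2 \<partial>M) = (\<integral>x. (g x)\<^sup>2 \<partial>M)" by (rule integral_cong_AE[OF m ae])
qed

definition truncate :: "real \<Rightarrow> real \<Rightarrow> real" where
  "truncate N x = max (- N) (min N x)"

lemma truncate_measurable [measurable]: "truncate N \<in> borel_measurable borel"
  unfolding truncate_def[abs_def] by measurable

lemma truncate_abs_le: "0 \<le> N \<Longrightarrow> \<bar>truncate N x\<bar> \<le> N"
  by (auto simp: truncate_def)

lemma truncate_error_le: "0 \<le> N \<Longrightarrow> \<bar>x - truncate N x\<bar> \<le> \<bar>x\<bar>"
  by (auto simp: truncate_def max_def min_def abs_if)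

section \<open>The continuous version of \<open>W\<close> and the exponential martingale\<close>

context geometric_dynamics
begin

text \<open>The explicit solution is built from this version, so that all of its paths are
  continuous and it is progressive. Moments are computed with \<open>W\<close>, which agrees with it
  almost surely at all times.\<close>

definition W_mod :: "real \<Rightarrow> 'w \<Rightarrow> real" where
  "W_mod = (SOME W_mod. (\<forall>t\<in>{0..T}. W_mod t \<in> borel_measurable (F t)) \<and>
     (\<forall>\<omega>\<in>space M. continuous_on {0..T} (\<lambda>t. W_mod t \<omega>)) \<and> (AE \<omega> in M. \<forall>t. W_mod t \<omega> = W t \<omega>))"

lemma W_mod_measurable: "t \<in> {0..T} \<Longrightarrow> W_mod t \<in> borel_measurable (F t)"
  and W_mod_continuous: "\<omega> \<in> space M \<Longrightarrow> continuous_on {0..T} (\<lambda>t. W_mod t \<omega>)"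
  and W_mod_eq_W: "AE \<omega> in M. \<forall>t. W_mod t \<omega> = W t \<omega>"
proof -
  have "\<exists>W_mod. (\<forall>t\<in>{0..T}. W_mod t \<in> borel_measurable (F t)) \<and>
     (\<forall>\<omega>\<in>space M. continuous_on {0..T} (\<lambda>t. W_mod t \<omega>)) \<and> (AE \<omega> in M. \<forall>t. W_mod t \<omega> = W t \<omega>)"
    by (rule continuous_modification) blast
  from someI_ex[OF this, folded W_mod_def]
  show "t \<in> {0..T} \<Longrightarrow> W_mod t \<in> borel_measurable (F t)"
    "\<omega> \<in> space M \<Longrightarrow> continuous_on {0..T} (\<lambda>t. W_mod t \<omega>)" "AE \<omega> in M. \<forall>t. W_mod t \<omega> = W t \<omega>" by auto
qed

text \<open>The stochastic exponential of \<open>\<sigma>\<close> times \<open>W\<close>.\<close>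

definition G :: "real \<Rightarrow> 'w \<Rightarrow> real" where
  "G t \<omega> = exp (\<sigma> * W t \<omega> - \<sigma>\<^sup>2 * t / 2)"

definition xi_sq_mean :: real where "xi_sq_mean = (\<integral>\<omega>. (\<xi> \<omega>)\<^sup>2 \<partial>M)"

lemma xi_sq_mean_nonneg: "0 \<le> xi_sq_mean"
  by (simp add: xi_sq_mean_def)

lemma G_measurable: "t \<in> {0..T} \<Longrightarrow> G t \<in> borel_measurable (F t)"
  unfolding G_def[abs_def] using measurable_W by simp

lemma xi_F: "t \<in> {0..T} \<Longrightarrow> \<xi> \<in> borel_measurable (F t)"
  by (rule measurable_F_mono[of 0, OF _ _ _ xi_measurable]) auto

lemma sq_int_xi: "sq_int M \<xi>"
  using measurable_F_M[OF _ xi_measurable] xi_square_integrable T_pos by (simp add: sq_int_def)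

lemma G_split: "G t \<omega> = G s \<omega> * exp (\<sigma> * (W t \<omega> - W s \<omega>) - \<sigma>\<^sup>2 * (t - s) / 2)"
  by (simp add: G_def exp_add[symmetric] algebra_simps diff_divide_distrib)

lemma AE_W0: "AE \<omega> in M. W 0 \<omega> = 0"
  using brownian by (simp add: brownian_motion_def)

text \<open>\<open>W\<close> starts at 0 only almost surely, so \<open>G u\<close> is first replaced
  by the growth factor from time 0, which is independent of \<open>\<xi>\<close>.\<close>

lemma
  assumes u: "u \<in> {0..T}"
  shows sq_int_xi_G: "sq_int M (\<lambda>\<omega>. \<xi> \<omega> * G u \<omega>)"
    and integral_xi_G: "(\<integral>\<omega>. (\<xi> \<omega> * G u \<omega>)\<^sup>2 \<partial>M) = xi_sq_mean * exp (\<sigma>\<^sup>2 * u)"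
proof -
  have u': "0 \<le> (0::real)" "0 \<le> u" "u \<le> T" using u by auto
  let ?f = "\<lambda>\<omega>. \<xi> \<omega> * exp (\<sigma> * (W u \<omega> - W 0 \<omega>) - \<sigma>\<^sup>2 * (u - 0) / 2)"
  have f: "sq_int M ?f" "(\<integral>\<omega>. (?f \<omega>)\<^sup>2 \<partial>M) = xi_sq_mean * exp (\<sigma>\<^sup>2 * (u - 0))"
    using sq_int_increment_mult[OF u' xi_measurable sq_int_xi _ G_second_moment[OF u']]
    by (simp_all add: xi_sq_mean_def)
  have m: "(\<lambda>\<omega>. \<xi> \<omega> * G u \<omega>) \<in> borel_measurable M"
    by (rule measurable_F_M[OF u]) (use xi_F[OF u] G_measurable[OF u] in simp)
  have ae: "AE \<omega> in M. \<xi> \<omega> * G u \<omega> = ?f \<omega>"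
    using AE_W0 by eventually_elim (simp add: G_def)
  show "sq_int M (\<lambda>\<omega>. \<xi> \<omega> * G u \<omega>)" "(\<integral>\<omega>. (\<xi> \<omega> * G u \<omega>)\<^sup>2 \<partial>M) = xi_sq_mean * exp (\<sigma>\<^sup>2 * u)"
    using sq_int_cong_AE[OF f(1) m ae] f(2) by simp_all
qed

lemma integral_xi_G_le: "u \<in> {0..T} \<Longrightarrow> (\<integral>\<omega>. (\<xi> \<omega> * G u \<omega>)\<^sup>2 \<partial>M) \<le> xi_sq_mean * exp (\<sigma>\<^sup>2 * T)"
  using integral_xi_G xi_sq_mean_nonneg by (auto intro!: mult_left_mono)

text \<open>The first factor bounds the second moment of \<open>\<xi>\<close> times
  \<open>G\<close>; the second is the slope in exp x - 1 <= x exp x for x =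
  \<open>\<sigma>\<close>^2 (t - s).\<close>

definition G_diff_const :: real where "G_diff_const = xi_sq_mean * exp (\<sigma>\<^sup>2 * T) * (\<sigma>\<^sup>2 * exp (\<sigma>\<^sup>2 * T))"

lemma G_diff_const_nonneg: "0 \<le> G_diff_const"
  using xi_sq_mean_nonneg by (simp add: G_diff_const_def)

text \<open>Factoring out \<open>G\<close> at the earlier time leaves an independent growth factor
  minus 1, whose variance is linear in the elapsed time.\<close>

lemma xi_G_diff:
  assumes p: "p \<in> {0..T}" and q: "q \<in> {0..T}"
  shows "sq_int M (\<lambda>\<omega>. \<xi> \<omega> * (G p \<omega> - G q \<omega>))"
    and "(\<integral>\<omega>. (\<xi> \<omega> * (G p \<omega> - G q \<omega>))\<^sup>2 \<partial>M) \<le> G_diff_const * \<bar>p - q\<bar>"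
proof -
  have le: "sq_int M (\<lambda>\<omega>. \<xi> \<omega> * (G t \<omega> - G s \<omega>)) \<and>
      (\<integral>\<omega>. (\<xi> \<omega> * (G t \<omega> - G s \<omega>))\<^sup>2 \<partial>M) \<le> G_diff_const * (t - s)" if st: "0 \<le> s" "s \<le> t" "t \<le> T" for s t
  proof -
    have s: "s \<in> {0..T}" using st by auto
    have eq: "\<xi> \<omega> * (G t \<omega> - G s \<omega>) = (\<xi> \<omega> * G s \<omega>) * (exp (\<sigma> * (W t \<omega> - W s \<omega>) - \<sigma>\<^sup>2 * (t - s) / 2) - 1)" for \<omega>
      by (simp add: G_split[of t \<omega> s] algebra_simps)
    have m: "(\<lambda>\<omega>. \<xi> \<omega> * G s \<omega>) \<in> borel_measurable (F s)" using xi_F[OF s] G_measurable[OF s] by simp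
    note I = sq_int_increment_mult[OF st m sq_int_xi_G[OF s] _ G_variance[OF st]]
    have "(\<integral>\<omega>. (\<xi> \<omega> * (G t \<omega> - G s \<omega>))\<^sup>2 \<partial>M) = (xi_sq_mean * exp (\<sigma>\<^sup>2 * s)) * (exp (\<sigma>\<^sup>2 * (t - s)) - 1)"
      using I(2) integral_xi_G[OF s] by (simp add: eq)
    also have "\<dots> \<le> (xi_sq_mean * exp (\<sigma>\<^sup>2 * T)) * ((\<sigma>\<^sup>2 * (t - s)) * exp (\<sigma>\<^sup>2 * T))"
    proof (rule mult_mono)
      show "xi_sq_mean * exp (\<sigma>\<^sup>2 * s) \<le> xi_sq_mean * exp (\<sigma>\<^sup>2 * T)" using xi_sq_mean_nonneg s by (auto intro!: mult_left_mono)
      have "exp (\<sigma>\<^sup>2 * (t - s)) - 1 \<le> (\<sigma>\<^sup>2 * (t - s)) * exp (\<sigma>\<^sup>2 * (t - s))"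
        using st by (intro exp_minus_one_le) simp
      also have "\<dots> \<le> (\<sigma>\<^sup>2 * (t - s)) * exp (\<sigma>\<^sup>2 * T)" using st by (auto intro!: mult_left_mono)
      finally show "exp (\<sigma>\<^sup>2 * (t - s)) - 1 \<le> (\<sigma>\<^sup>2 * (t - s)) * exp (\<sigma>\<^sup>2 * T)" .
    qed (use xi_sq_mean_nonneg st in auto)
    finally show ?thesis using I(1) by (simp add: eq G_diff_const_def ac_simps)
  qed
  have sw: "(\<lambda>\<omega>. \<xi> \<omega> * (G p \<omega> - G q \<omega>)) = (\<lambda>\<omega>. - 1 * (\<xi> \<omega> * (G q \<omega> - G p \<omega>)))"
    by (simp add: algebra_simps)
  show "sq_int M (\<lambda>\<omega>. \<xi> \<omega> * (G p \<omega> - G q \<omega>))"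
    using le[of q p] le[of p q] p q sq_int_cmult[of M "\<lambda>\<omega>. \<xi> \<omega> * (G q \<omega> - G p \<omega>)" "- 1"]
    by (cases "q \<le> p") (auto simp: sw simp del: mult_minus1)
  have "(\<xi> \<omega> * (G p \<omega> - G q \<omega>))\<^sup>2 = (\<xi> \<omega> * (G q \<omega> - G p \<omega>))\<^sup>2" for \<omega>
    by (simp add: power_mult_distrib power2_commute)
  then show "(\<integral>\<omega>. (\<xi> \<omega> * (G p \<omega> - G q \<omega>))\<^sup>2 \<partial>M) \<le> G_diff_const * \<bar>p - q\<bar>"
    using le[of q p] le[of p q] p q by (cases "q \<le> p") auto
qed

end

section \<open>The drift factor, its product with the martingale factor, and truncation\<close>

context bounded_drift
begin

definition B :: "real \<Rightarrow> 'w \<Rightarrow> real" where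
  "B t \<omega> = exp (primitive (\<lambda>s. b s \<omega>) t)"

text \<open>Both a bound of the drift factor \<open>B\<close> and the Lipschitz constant of the
  exponential on the range of the primitives.\<close>

definition \<beta> :: real where "\<beta> = exp (C * T)"

lemma \<beta>_nonneg: "0 \<le> \<beta>" by (simp add: \<beta>_def)

lemma progressive_B: "progressive F T B"
  by (rule progressiveI)
     (use progressiveD[OF progressive_primitive[OF drift_progressive]] in \<open>simp add: B_def\<close>)

lemma B_measurable: "t \<in> {0..T} \<Longrightarrow> B t \<in> borel_measurable (F t)"
  using progressive_adapted[OF progressive_B] .

lemma B_bounds:
  assumes "\<omega> \<in> space M" "t \<in> {0..T}"
  shows "0 < B t \<omega>" "B t \<omega> \<le> \<beta>" "\<bar>B t \<omega>\<bar> \<le> \<beta>"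
  using primitive_abs_le[OF drift_density[OF assms(1)] assms(2)] by (auto simp: B_def \<beta>_def)

lemma B_Lipschitz:
  assumes "\<omega> \<in> space M" "s \<in> {0..T}" "t \<in> {0..T}"
  shows "\<bar>B t \<omega> - B s \<omega>\<bar> \<le> \<beta> * C * \<bar>t - s\<bar>"
proof -
  let ?p = "primitive (\<lambda>s. b s \<omega>)"
  note d = drift_density[OF assms(1)]
  have "\<bar>B t \<omega> - B s \<omega>\<bar> \<le> \<beta> * \<bar>?p t - ?p s\<bar>"
    unfolding B_def \<beta>_def using primitive_abs_le[OF d assms(2)] primitive_abs_le[OF d assms(3)]
    by (intro exp_Lipschitz) auto
  also have "\<dots> \<le> \<beta> * (C * \<bar>t - s\<bar>)"
    using primitive_Lipschitz[OF d assms(2,3)] by (intro mult_left_mono \<beta>_nonneg)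
  finally show ?thesis by (simp add: mult.assoc)
qed

text \<open>The drift factor frozen at time \<open>p\<close>, the martingale factor at time \<open>q\<close>.\<close>

definition Q :: "real \<Rightarrow> real \<Rightarrow> 'w \<Rightarrow> real" where
  "Q p q \<omega> = \<xi> \<omega> * B p \<omega> * G q \<omega>"

definition explicit :: "real \<Rightarrow> 'w \<Rightarrow> real" where
  "explicit t \<omega> = \<xi> \<omega> * B t \<omega> * exp (\<sigma> * W_mod t \<omega> - \<sigma>\<^sup>2 * t / 2)"

lemma explicit_eq_Q: "AE \<omega> in M. \<forall>t. explicit t \<omega> = Q t t \<omega>"
  using W_mod_eq_W by eventually_elim (simp add: explicit_def Q_def G_def)

lemma explicit_continuous:
  assumes "\<omega> \<in> space M"
  shows "continuous_on {0..T} (\<lambda>t. explicit t \<omega>)"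
  unfolding explicit_def B_def
  by (intro continuous_intros continuous_on_primitive[OF drift_density[OF assms], THEN continuous_on_subset]
      W_mod_continuous[OF assms] continuous_on_exp) auto

lemma progressive_explicit: "progressive F T explicit"
proof (rule progressive_continuous)
  show "explicit t \<in> borel_measurable (F t)" if "t \<in> {0..T}" for t
    using xi_F[OF that] B_measurable[OF that] W_mod_measurable[OF that] unfolding explicit_def[abs_def] by simp
qed (rule explicit_continuous)

lemma Q_measurable_M: "p \<in> {0..T} \<Longrightarrow> q \<in> {0..T} \<Longrightarrow> Q p q \<in> borel_measurable M"
  using measurable_F_M[OF _ xi_F, of 0] measurable_F_M[OF _ B_measurable, of p] measurable_F_M[OF _ G_measurable, of q] T_pos
  unfolding Q_def[abs_def] by simp

definition Q_const :: real where "Q_const = \<beta>\<^sup>2 * (xi_sq_mean * exp (\<sigma>\<^sup>2 * T))"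

lemma
  assumes pq: "p \<in> {0..T}" "q \<in> {0..T}"
  shows sq_int_Q: "sq_int M (Q p q)" and integral_Q_le: "(\<integral>\<omega>. (Q p q \<omega>)\<^sup>2 \<partial>M) \<le> Q_const"
proof -
  have "\<bar>Q p q \<omega>\<bar> \<le> \<beta> * \<bar>\<xi> \<omega> * G q \<omega>\<bar>" if "\<omega> \<in> space M" for \<omega>
    using mult_right_mono[OF B_bounds(3)[OF that pq(1)], of "\<bar>\<xi> \<omega> * G q \<omega>\<bar>"]
    by (simp add: Q_def abs_mult ac_simps)
  then have ae: "AE \<omega> in M. \<bar>Q p q \<omega>\<bar> \<le> \<beta> * \<bar>\<xi> \<omega> * G q \<omega>\<bar>" by (intro AE_I2)
  show "sq_int M (Q p q)"
    by (rule sq_int_bound[OF sq_int_xi_G[OF pq(2)] Q_measurable_M[OF pq] ae])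
  have "(\<integral>\<omega>. (Q p q \<omega>)\<^sup>2 \<partial>M) \<le> \<beta>\<^sup>2 * (\<integral>\<omega>. (\<xi> \<omega> * G q \<omega>)\<^sup>2 \<partial>M)"
    by (rule integral_sq_le[OF sq_int_xi_G[OF pq(2)] Q_measurable_M[OF pq] ae])
  also have "\<dots> \<le> Q_const" unfolding Q_const_def using integral_xi_G_le[OF pq(2)] by (intro mult_left_mono) auto
  finally show "(\<integral>\<omega>. (Q p q \<omega>)\<^sup>2 \<partial>M) \<le> Q_const" .
qed

lemma Q_const_nonneg: "0 \<le> Q_const"
  using xi_sq_mean_nonneg by (simp add: Q_const_def)

text \<open>The first term pays for moving the martingale factor, the second for moving the drift
  factor, where the better estimate |p - s|^2 is weakened to T |p - s|.\<close>

definition Q_diff_const :: real where "Q_diff_const = 2 * (\<beta>\<^sup>2 * G_diff_const) + 2 * ((\<beta> * C)\<^sup>2 * T * (xi_sq_mean * exp (\<sigma>\<^sup>2 * T)))"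

lemma Q_diff_const_nonneg: "0 \<le> Q_diff_const"
  using xi_sq_mean_nonneg G_diff_const_nonneg T_pos by (simp add: Q_diff_const_def)

text \<open>The times of the two factors vary independently because the drift error of a grid cell
  compares \<open>Q s v\<close> with \<open>Q s s\<close>.\<close>

lemma integral_Q_diff_le:
  assumes p: "p \<in> {0..T}" and q: "q \<in> {0..T}" and s: "s \<in> {0..T}"
  shows "(\<integral>\<omega>. (Q p q \<omega> - Q s s \<omega>)\<^sup>2 \<partial>M) \<le> Q_diff_const * (\<bar>p - s\<bar> + \<bar>q - s\<bar>)"
proof -
  define f where "f \<omega> = \<xi> \<omega> * B p \<omega> * (G q \<omega> - G s \<omega>)" for \<omega>
  define g where "g \<omega> = \<xi> \<omega> * G s \<omega> * (B p \<omega> - B s \<omega>)" for \<omega>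
  have [measurable]: "\<xi> \<in> borel_measurable M" "B p \<in> borel_measurable M" "B s \<in> borel_measurable M"
    "G q \<in> borel_measurable M" "G s \<in> borel_measurable M"
    using measurable_F_M[OF _ xi_F, of 0] measurable_F_M[OF _ B_measurable] measurable_F_M[OF _ G_measurable] T_pos p q s
    by auto
  have mf: "f \<in> borel_measurable M" and mg: "g \<in> borel_measurable M"
    unfolding f_def[abs_def] g_def[abs_def] by measurable
  have "\<bar>f \<omega>\<bar> \<le> \<beta> * \<bar>\<xi> \<omega> * (G q \<omega> - G s \<omega>)\<bar>" if "\<omega> \<in> space M" for \<omega>
    using mult_right_mono[OF B_bounds(3)[OF that p], of "\<bar>\<xi> \<omega> * (G q \<omega> - G s \<omega>)\<bar>"]
    by (simp add: f_def abs_mult ac_simps)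
  then have aef: "AE \<omega> in M. \<bar>f \<omega>\<bar> \<le> \<beta> * \<bar>\<xi> \<omega> * (G q \<omega> - G s \<omega>)\<bar>" by (intro AE_I2)
  have "\<bar>g \<omega>\<bar> \<le> (\<beta> * C * \<bar>p - s\<bar>) * \<bar>\<xi> \<omega> * G s \<omega>\<bar>" if "\<omega> \<in> space M" for \<omega>
    using mult_right_mono[OF B_Lipschitz[OF that s p], of "\<bar>\<xi> \<omega> * G s \<omega>\<bar>"]
    by (simp add: g_def abs_mult ac_simps)
  then have aeg: "AE \<omega> in M. \<bar>g \<omega>\<bar> \<le> (\<beta> * C * \<bar>p - s\<bar>) * \<bar>\<xi> \<omega> * G s \<omega>\<bar>" by (intro AE_I2)
  have sf: "sq_int M f" by (rule sq_int_bound[OF xi_G_diff(1)[OF q s] mf aef])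
  have sg: "sq_int M g" by (rule sq_int_bound[OF sq_int_xi_G[OF s] mg aeg])
  have "(\<integral>\<omega>. (f \<omega>)\<^sup>2 \<partial>M) \<le> \<beta>\<^sup>2 * (\<integral>\<omega>. (\<xi> \<omega> * (G q \<omega> - G s \<omega>))\<^sup>2 \<partial>M)"
    by (rule integral_sq_le[OF xi_G_diff(1)[OF q s] mf aef])
  also have "\<dots> \<le> \<beta>\<^sup>2 * (G_diff_const * \<bar>q - s\<bar>)" using xi_G_diff(2)[OF q s] by (intro mult_left_mono) auto
  finally have If: "(\<integral>\<omega>. (f \<omega>)\<^sup>2 \<partial>M) \<le> \<beta>\<^sup>2 * G_diff_const * \<bar>q - s\<bar>" by simp
  have "(\<integral>\<omega>. (g \<omega>)\<^sup>2 \<partial>M) \<le> (\<beta> * C * \<bar>p - s\<bar>)\<^sup>2 * (\<integral>\<omega>. (\<xi> \<omega> * G s \<omega>)\<^sup>2 \<partial>M)"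
    by (rule integral_sq_le[OF sq_int_xi_G[OF s] mg aeg])
  also have "\<dots> \<le> (\<beta> * C * \<bar>p - s\<bar>)\<^sup>2 * (xi_sq_mean * exp (\<sigma>\<^sup>2 * T))"
    using integral_xi_G_le[OF s] by (intro mult_left_mono) auto
  also have "\<dots> = ((\<beta> * C)\<^sup>2 * (xi_sq_mean * exp (\<sigma>\<^sup>2 * T))) * (\<bar>p - s\<bar> * \<bar>p - s\<bar>)"
    by (simp add: power_mult_distrib power2_eq_square ac_simps)
  also have "\<dots> \<le> ((\<beta> * C)\<^sup>2 * (xi_sq_mean * exp (\<sigma>\<^sup>2 * T))) * (T * \<bar>p - s\<bar>)"
    using p s xi_sq_mean_nonneg by (intro mult_left_mono mult_right_mono) auto
  finally have Ig: "(\<integral>\<omega>. (g \<omega>)\<^sup>2 \<partial>M) \<le> (\<beta> * C)\<^sup>2 * T * (xi_sq_mean * exp (\<sigma>\<^sup>2 * T)) * \<bar>p - s\<bar>"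
    by (simp add: ac_simps)
  have "(\<integral>\<omega>. (Q p q \<omega> - Q s s \<omega>)\<^sup>2 \<partial>M) = (\<integral>\<omega>. (f \<omega> + g \<omega>)\<^sup>2 \<partial>M)"
    by (simp add: Q_def f_def g_def algebra_simps)
  also have "\<dots> \<le> 2 * (\<integral>\<omega>. (f \<omega>)\<^sup>2 \<partial>M) + 2 * (\<integral>\<omega>. (g \<omega>)\<^sup>2 \<partial>M)" by (rule integral_sq_add_le[OF sf sg])
  also have "\<dots> \<le> 2 * (\<beta>\<^sup>2 * G_diff_const * \<bar>q - s\<bar>) + 2 * ((\<beta> * C)\<^sup>2 * T * (xi_sq_mean * exp (\<sigma>\<^sup>2 * T)) * \<bar>p - s\<bar>)"
    using If Ig by linarith
  also have "\<dots> \<le> Q_diff_const * \<bar>q - s\<bar> + Q_diff_const * \<bar>p - s\<bar>"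
  proof -
    have "2 * (\<beta>\<^sup>2 * G_diff_const) \<le> Q_diff_const" "2 * ((\<beta> * C)\<^sup>2 * T * (xi_sq_mean * exp (\<sigma>\<^sup>2 * T))) \<le> Q_diff_const"
      unfolding Q_diff_const_def using xi_sq_mean_nonneg G_diff_const_nonneg T_pos by auto
    then have "2 * (\<beta>\<^sup>2 * G_diff_const) * \<bar>q - s\<bar> \<le> Q_diff_const * \<bar>q - s\<bar>"
      "2 * ((\<beta> * C)\<^sup>2 * T * (xi_sq_mean * exp (\<sigma>\<^sup>2 * T))) * \<bar>p - s\<bar> \<le> Q_diff_const * \<bar>p - s\<bar>"
      by (auto intro!: mult_right_mono)
    then show ?thesis by (simp add: mult.assoc)
  qed
  finally show ?thesis by (simp add: distrib_left)
qed

text \<open>The values of a simple integrand have to be bounded.\<close>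

definition trunc :: "real \<Rightarrow> real \<Rightarrow> 'w \<Rightarrow> real" where
  "trunc N u \<omega> = B u \<omega> * truncate N (\<xi> \<omega>) * min N (G u \<omega>)"

text \<open>Inside the bracket, the first term is the cost of capping \<open>G\<close> at level N,
  the second that of truncating \<open>\<xi>\<close>. Neither depends on the time.\<close>

definition \<epsilon> :: "real \<Rightarrow> real" where
  "\<epsilon> N = \<beta>\<^sup>2 * (2 * (xi_sq_mean * exp (6 * \<sigma>\<^sup>2 * T) / N\<^sup>2) + 2 * ((\<integral>\<omega>. (\<xi> \<omega> - truncate N (\<xi> \<omega>))\<^sup>2 \<partial>M) * exp (\<sigma>\<^sup>2 * T)))"

lemma trunc_measurable: "u \<in> {0..T} \<Longrightarrow> trunc N u \<in> borel_measurable (F u)"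
  unfolding trunc_def[abs_def] using B_measurable G_measurable xi_F by simp

lemma trunc_bounded:
  assumes N: "0 < N" and \<omega>: "\<omega> \<in> space M" and u: "u \<in> {0..T}"
  shows "\<bar>trunc N u \<omega>\<bar> \<le> \<beta> * N * N"
proof -
  have "0 < G u \<omega>" by (simp add: G_def)
  then have "\<bar>min N (G u \<omega>)\<bar> \<le> N" using N by auto
  then show ?thesis
    unfolding trunc_def abs_mult using B_bounds(3)[OF \<omega> u] truncate_abs_le[of N "\<xi> \<omega>"] N \<beta>_nonneg
    by (intro mult_mono) auto
qed

lemma xi_truncate_sq_int: "0 \<le> N \<Longrightarrow> sq_int M (\<lambda>\<omega>. \<xi> \<omega> - truncate N (\<xi> \<omega>))"
  using sq_int_measurable[OF sq_int_xi] truncate_error_le[of N]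
  by (intro sq_int_bound[OF sq_int_xi, where c=1]) auto

text \<open>The error is \<open>B\<close> (f + g), with \<open>f\<close> from capping
  \<open>G\<close> and \<open>g\<close> from truncating \<open>\<xi>\<close>. Only two moments of
  \<open>\<xi>\<close> are given, so the cap uses G - min N G <= G^2 / N together with independence
  and the fourth moment of \<open>G\<close>.\<close>

lemma trunc_error:
  assumes N: "0 < N" and u: "u \<in> {0..T}"
  shows "sq_int M (\<lambda>\<omega>. Q u u \<omega> - trunc N u \<omega>)"
    and "(\<integral>\<omega>. (Q u u \<omega> - trunc N u \<omega>)\<^sup>2 \<partial>M) \<le> \<epsilon> N"
proof -
  have u': "0 \<le> (0::real)" "0 \<le> u" "u \<le> T" using u by auto
  have [measurable]: "\<xi> \<in> borel_measurable M" "B u \<in> borel_measurable M" "G u \<in> borel_measurable M"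
    using measurable_F_M[OF _ xi_F, of 0] measurable_F_M[OF _ B_measurable] measurable_F_M[OF _ G_measurable] T_pos u by auto
  define H where "H z = exp (\<sigma> * z - \<sigma>\<^sup>2 * (u - 0) / 2)" for z
  have [measurable]: "H \<in> borel_measurable borel" by (simp add: H_def[abs_def])
  have GH: "AE \<omega> in M. G u \<omega> = H (W u \<omega> - W 0 \<omega>)"
    using AE_W0 by eventually_elim (simp add: G_def H_def)
  have [measurable]: "W u \<in> borel_measurable M" "W 0 \<in> borel_measurable M"
    using measurable_F_M[OF _ measurable_W] u T_pos by auto
  define f where "f \<omega> = \<xi> \<omega> * (G u \<omega> - min N (G u \<omega>))" for \<omega>
  define g where "g \<omega> = (\<xi> \<omega> - truncate N (\<xi> \<omega>)) * min N (G u \<omega>)" for \<omega>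
  have Gpos: "0 < G u \<omega>" for \<omega> by (simp add: G_def)
  have sqf: "sq_int M (\<lambda>\<omega>. \<xi> \<omega> * (H (W u \<omega> - W 0 \<omega>))\<^sup>2)"
    and intf: "(\<integral>\<omega>. (\<xi> \<omega> * (H (W u \<omega> - W 0 \<omega>))\<^sup>2)\<^sup>2 \<partial>M) = xi_sq_mean * exp (6 * \<sigma>\<^sup>2 * (u - 0))"
    using sq_int_increment_mult[OF u' xi_measurable sq_int_xi, of "\<lambda>z. (H z)\<^sup>2"] G_fourth_moment[OF u']
    by (simp_all add: H_def xi_sq_mean_def power_mult[symmetric])
  have mf: "f \<in> borel_measurable M" and mg: "g \<in> borel_measurable M"
    unfolding f_def[abs_def] g_def[abs_def] by measurable
  have aef: "AE \<omega> in M. \<bar>f \<omega>\<bar> \<le> (1 / N) * \<bar>\<xi> \<omega> * (H (W u \<omega> - W 0 \<omega>))\<^sup>2\<bar>"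
    using GH
  proof eventually_elim
    case (elim \<omega>)
    have "\<bar>G u \<omega> - min N (G u \<omega>)\<bar> \<le> (G u \<omega>)\<^sup>2 / N"
    proof (cases "G u \<omega> \<le> N")
      case False
      then have "G u \<omega> * N \<le> G u \<omega> * G u \<omega>" using Gpos[of \<omega>] by (intro mult_left_mono) auto
      then have "G u \<omega> \<le> (G u \<omega>)\<^sup>2 / N" using N by (simp add: le_divide_eq power2_eq_square)
      then show ?thesis using False N by auto
    qed (use N in auto)
    then have "\<bar>\<xi> \<omega>\<bar> * \<bar>G u \<omega> - min N (G u \<omega>)\<bar> \<le> \<bar>\<xi> \<omega>\<bar> * ((G u \<omega>)\<^sup>2 / N)"
      by (rule mult_left_mono) simp
    then show ?case by (simp add: f_def abs_mult elim)
  qed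
  have sf: "sq_int M f" by (rule sq_int_bound[OF sqf mf aef])
  have "(\<integral>\<omega>. (f \<omega>)\<^sup>2 \<partial>M) \<le> (1 / N)\<^sup>2 * (xi_sq_mean * exp (6 * \<sigma>\<^sup>2 * (u - 0)))"
    using integral_sq_le[OF sqf mf aef] intf by simp
  also have "\<dots> \<le> (1 / N)\<^sup>2 * (xi_sq_mean * exp (6 * \<sigma>\<^sup>2 * T))"
    using u xi_sq_mean_nonneg by (auto intro!: mult_left_mono)
  finally have If: "(\<integral>\<omega>. (f \<omega>)\<^sup>2 \<partial>M) \<le> xi_sq_mean * exp (6 * \<sigma>\<^sup>2 * T) / N\<^sup>2" by (simp add: power_divide)
  let ?d = "\<lambda>\<omega>. \<xi> \<omega> - truncate N (\<xi> \<omega>)"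
  have sd: "sq_int M ?d" using N by (intro xi_truncate_sq_int) simp
  have md: "?d \<in> borel_measurable (F 0)" using xi_measurable by simp
  have sqg: "sq_int M (\<lambda>\<omega>. ?d \<omega> * H (W u \<omega> - W 0 \<omega>))"
    and intg: "(\<integral>\<omega>. (?d \<omega> * H (W u \<omega> - W 0 \<omega>))\<^sup>2 \<partial>M) = (\<integral>\<omega>. (?d \<omega>)\<^sup>2 \<partial>M) * exp (\<sigma>\<^sup>2 * (u - 0))"
    using sq_int_increment_mult[OF u' md sd, of H] G_second_moment[OF u'] by (simp_all add: H_def)
  have aeg: "AE \<omega> in M. \<bar>g \<omega>\<bar> \<le> 1 * \<bar>?d \<omega> * H (W u \<omega> - W 0 \<omega>)\<bar>"
    using GH
  proof eventually_elim
    case (elim \<omega>)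
    have "\<bar>min N (G u \<omega>)\<bar> \<le> \<bar>G u \<omega>\<bar>" using N Gpos[of \<omega>] by auto
    then have "\<bar>?d \<omega>\<bar> * \<bar>min N (G u \<omega>)\<bar> \<le> \<bar>?d \<omega>\<bar> * \<bar>G u \<omega>\<bar>" by (rule mult_left_mono) simp
    then show ?case by (simp add: g_def abs_mult elim)
  qed
  have sg: "sq_int M g" by (rule sq_int_bound[OF sqg mg aeg])
  have "(\<integral>\<omega>. (g \<omega>)\<^sup>2 \<partial>M) \<le> (\<integral>\<omega>. (?d \<omega>)\<^sup>2 \<partial>M) * exp (\<sigma>\<^sup>2 * (u - 0))"
    using integral_sq_le[OF sqg mg aeg] intg by simp
  also have "\<dots> \<le> (\<integral>\<omega>. (?d \<omega>)\<^sup>2 \<partial>M) * exp (\<sigma>\<^sup>2 * T)"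
    using u by (auto intro!: mult_left_mono)
  finally have Ig: "(\<integral>\<omega>. (g \<omega>)\<^sup>2 \<partial>M) \<le> (\<integral>\<omega>. (?d \<omega>)\<^sup>2 \<partial>M) * exp (\<sigma>\<^sup>2 * T)" .
  have eq: "Q u u \<omega> - trunc N u \<omega> = B u \<omega> * (f \<omega> + g \<omega>)" for \<omega>
    by (simp add: Q_def trunc_def f_def g_def algebra_simps)
  have sfg: "sq_int M (\<lambda>\<omega>. f \<omega> + g \<omega>)" by (rule sq_int_add[OF sf sg])
  have mfg: "(\<lambda>\<omega>. B u \<omega> * (f \<omega> + g \<omega>)) \<in> borel_measurable M" using mf mg by simp
  have aefg: "AE \<omega> in M. \<bar>B u \<omega> * (f \<omega> + g \<omega>)\<bar> \<le> \<beta> * \<bar>f \<omega> + g \<omega>\<bar>"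
    using B_bounds(3)[OF _ u] by (intro AE_I2) (simp add: abs_mult mult_right_mono)
  show "sq_int M (\<lambda>\<omega>. Q u u \<omega> - trunc N u \<omega>)"
    unfolding eq by (rule sq_int_bound[OF sfg mfg aefg])
  have "(\<integral>\<omega>. (Q u u \<omega> - trunc N u \<omega>)\<^sup>2 \<partial>M) \<le> \<beta>\<^sup>2 * (\<integral>\<omega>. (f \<omega> + g \<omega>)\<^sup>2 \<partial>M)"
    unfolding eq by (rule integral_sq_le[OF sfg mfg aefg])
  also have "\<dots> \<le> \<beta>\<^sup>2 * (2 * (\<integral>\<omega>. (f \<omega>)\<^sup>2 \<partial>M) + 2 * (\<integral>\<omega>. (g \<omega>)\<^sup>2 \<partial>M))"
    by (intro mult_left_mono integral_sq_add_le sf sg) simp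
  also have "\<dots> \<le> \<epsilon> N"
    unfolding \<epsilon>_def using If Ig by (intro mult_left_mono add_mono) auto
  finally show "(\<integral>\<omega>. (Q u u \<omega> - trunc N u \<omega>)\<^sup>2 \<partial>M) \<le> \<epsilon> N" .
qed

text \<open>The cap on \<open>G\<close> has a rate in N. Square integrability gives none for the
  truncation of \<open>\<xi>\<close>, which converges by domination with its square.\<close>

lemma \<epsilon>_tendsto_0: "(\<lambda>k. \<epsilon> (real (Suc k))) \<longlonglongrightarrow> 0"
proof -
  have inv: "(\<lambda>k. 1 / real (Suc k)) \<longlonglongrightarrow> 0"
    using LIMSEQ_inverse_real_of_nat by (simp add: inverse_eq_divide)
  have 1: "(\<lambda>k. xi_sq_mean * exp (6 * \<sigma>\<^sup>2 * T) * (1 / real (Suc k))\<^sup>2) \<longlonglongrightarrow> xi_sq_mean * exp (6 * \<sigma>\<^sup>2 * T) * 0\<^sup>2"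
    by (intro tendsto_intros inv)
  have [measurable]: "\<xi> \<in> borel_measurable M" by (rule sq_int_measurable[OF sq_int_xi])
  have 2: "(\<lambda>k. \<integral>\<omega>. (\<xi> \<omega> - truncate (real (Suc k)) (\<xi> \<omega>))\<^sup>2 \<partial>M) \<longlonglongrightarrow> (\<integral>\<omega>. 0 \<partial>M)"
  proof (rule integral_dominated_convergence[where w="\<lambda>\<omega>. (\<xi> \<omega>)\<^sup>2"])
    show "AE \<omega> in M. (\<lambda>k. (\<xi> \<omega> - truncate (real (Suc k)) (\<xi> \<omega>))\<^sup>2) \<longlonglongrightarrow> 0"
    proof (rule AE_I2)
      fix \<omega>
      obtain n where n: "\<bar>\<xi> \<omega>\<bar> \<le> real n" using real_arch_simple by blast
      have "(\<xi> \<omega> - truncate (real (Suc k)) (\<xi> \<omega>))\<^sup>2 = 0" if "k \<ge> n" for k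
      proof -
        have "\<bar>\<xi> \<omega>\<bar> \<le> real (Suc k)" using n that by linarith
        then show ?thesis by (auto simp: truncate_def)
      qed
      then show "(\<lambda>k. (\<xi> \<omega> - truncate (real (Suc k)) (\<xi> \<omega>))\<^sup>2) \<longlonglongrightarrow> 0"
        by (intro tendsto_eventually) (auto simp: eventually_sequentially)
    qed
    show "AE \<omega> in M. norm ((\<xi> \<omega> - truncate (real (Suc k)) (\<xi> \<omega>))\<^sup>2) \<le> (\<xi> \<omega>)\<^sup>2" for k
      using truncate_error_le[of "real (Suc k)"] by (intro AE_I2) (simp add: abs_le_square_iff del: of_nat_Suc)
  qed (use xi_square_integrable in auto)
  have "(\<lambda>k. \<beta>\<^sup>2 * (2 * (xi_sq_mean * exp (6 * \<sigma>\<^sup>2 * T) * (1 / real (Suc k))\<^sup>2)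
      + 2 * ((\<integral>\<omega>. (\<xi> \<omega> - truncate (real (Suc k)) (\<xi> \<omega>))\<^sup>2 \<partial>M) * exp (\<sigma>\<^sup>2 * T))))
    \<longlonglongrightarrow> \<beta>\<^sup>2 * (2 * (xi_sq_mean * exp (6 * \<sigma>\<^sup>2 * T) * 0\<^sup>2) + 2 * ((\<integral>\<omega>. 0 \<partial>M) * exp (\<sigma>\<^sup>2 * T)))"
    by (intro tendsto_mult tendsto_add tendsto_const 1 2)
  then show ?thesis by (simp add: \<epsilon>_def power_divide)
qed

end

lemma telescoping_set_integral:
  fixes t :: "nat \<Rightarrow> real"
  assumes "bounded_density T C f" "0 \<le> t 0" "\<And>i. i < n \<Longrightarrow> t i \<le> t (Suc i)" "\<And>i. i \<le> n \<Longrightarrow> t i \<in> {0..T}"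
  shows "(\<Sum>i<n. LINT s:{t i..t (Suc i)}|lborel. f s) = primitive f (t n) - primitive f (t 0)"
proof -
  have "(LINT s:{t i..t (Suc i)}|lborel. f s) = primitive f (t (Suc i)) - primitive f (t i)" if "i < n" for i
    using primitive_diff[OF assms(1), of "t i" "t (Suc i)"] assms(3)[OF that] assms(4)[of i] assms(4)[of "Suc i"] that
    by simp
  then show ?thesis using sum_lessThan_telescope[of "\<lambda>i. primitive f (t i)" n] by simp
qed

section \<open>One-step errors and convergence of the Ito sums\<close>

context bounded_drift
begin

lemma AE_initial: "AE \<omega> in M. \<omega> \<in> space M \<and> W 0 \<omega> = 0 \<and> (\<forall>t. W_mod t \<omega> = W t \<omega>)"
  using AE_W0 W_mod_eq_W AE_space by eventually_elim simp

text \<open>The bound depends on the outcome; it only serves to integrate along one path.\<close>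

lemma explicit_drift_density:
  assumes "\<omega> \<in> space M"
  obtains C' where "bounded_density T C' (\<lambda>s. explicit s \<omega> * b s \<omega>)"
proof -
  have "compact ((\<lambda>s. explicit s \<omega>) ` {0..T})"
    by (intro compact_continuous_image explicit_continuous[OF assms]) simp
  then obtain k where k: "\<And>s. s \<in> {0..T} \<Longrightarrow> \<bar>explicit s \<omega>\<bar> \<le> k"
    using compact_imp_bounded by (force simp: bounded_iff)
  have "set_borel_measurable borel {0..T} (\<lambda>s. explicit s \<omega>)"
    unfolding set_borel_measurable_def
    by (intro borel_measurable_continuous_on_indicator explicit_continuous[OF assms]) simp
  then have "(\<lambda>s. (indicat_real {0..T} s *\<^sub>R explicit s \<omega>) * (indicat_real {0..T} s *\<^sub>R b s \<omega>)) \<in> borel_measurable borel"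
    using drift_density[OF assms] unfolding set_borel_measurable_def bounded_density_def by (intro borel_measurable_times) auto
  also have "(\<lambda>s. (indicat_real {0..T} s *\<^sub>R explicit s \<omega>) * (indicat_real {0..T} s *\<^sub>R b s \<omega>))
      = (\<lambda>s. indicat_real {0..T} s *\<^sub>R (explicit s \<omega> * b s \<omega>))"
    by (auto simp: indicator_def)
  finally have "set_borel_measurable borel {0..T} (\<lambda>s. explicit s \<omega> * b s \<omega>)" by (simp add: set_borel_measurable_def)
  moreover have "\<bar>explicit s \<omega> * b s \<omega>\<bar> \<le> k * C" if "s \<in> {0..T}" for s
    unfolding abs_mult using k[OF that] drift_bounded[OF that assms] by (intro mult_mono) (auto intro: order.trans[OF abs_ge_zero])
  ultimately show ?thesis using that[of "k * C"] by (simp add: bounded_density_def)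
qed

lemma measurable_explicit_drift: "r \<in> {0..T} \<Longrightarrow> (\<lambda>\<omega>. LINT s:{0..r}|lborel. explicit s \<omega> * b s \<omega>) \<in> borel_measurable M"
proof -
  assume r: "r \<in> {0..T}"
  have "progressive F T (\<lambda>s \<omega>. explicit s \<omega> * b s \<omega>)"
    by (rule progressiveI) (intro borel_measurable_times progressiveD progressive_explicit drift_progressive)
  from measurable_F_M[OF r progressive_adapted[OF progressive_primitive[OF this] r]]
  show ?thesis by (simp add: primitive_def)
qed

text \<open>On a grid cell the increment of the solution splits into a martingale part \<open>D\<close>, compared with
  the simple integral of the truncated integrand, and a drift part \<open>R\<close>.\<close>

definition D_err :: "real \<Rightarrow> real \<Rightarrow> real \<Rightarrow> 'w \<Rightarrow> real" where
  "D_err N u v \<omega> = Q u u \<omega> * (exp (\<sigma> * (W v \<omega> - W u \<omega>) - \<sigma>\<^sup>2 * (v - u) / 2) - 1 - \<sigma> * (W v \<omega> - W u \<omega>))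
     + (\<sigma> * (Q u u \<omega> - trunc N u \<omega>)) * (W v \<omega> - W u \<omega>)"

definition R_err :: "real \<Rightarrow> real \<Rightarrow> 'w \<Rightarrow> real" where
  "R_err u v \<omega> = \<xi> \<omega> * G v \<omega> * (B v \<omega> - B u \<omega>) - (LINT s:{u..v}|lborel. explicit s \<omega> * b s \<omega>)"

text \<open>A discrete product rule: the martingale factor moves first, with the drift factor frozen
  at u; then the drift factor moves, with the martingale factor already at v.\<close>

lemma error_decomposition:
  assumes uv: "0 \<le> u" "u \<le> v" "v \<le> T"
  shows "Q v v \<omega> - Q u u \<omega> - (LINT s:{u..v}|lborel. explicit s \<omega> * b s \<omega>)
    - (\<sigma> * trunc N u \<omega>) * (W v \<omega> - W u \<omega>) = D_err N u v \<omega> + R_err u v \<omega>"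
  by (simp add: Q_def D_err_def R_err_def G_split[of v \<omega> u] algebra_simps)

lemma Q_measurable_F: "u \<in> {0..T} \<Longrightarrow> Q u u \<in> borel_measurable (F u)"
  using xi_F B_measurable G_measurable unfolding Q_def[abs_def] by simp

text \<open>Both summands of \<open>D_err\<close> are a coefficient known at time u times a
  mean-zero function of the increment, whence the orthogonality to everything known at u. Their
  second moments are of order (v - u)^2 and \<open>\<epsilon> N\<close> (v - u), small enough to be
  added over the cells.\<close>

lemma
  assumes uv: "0 \<le> u" "u \<le> v" "v \<le> T" and N: "0 < N"
  shows sq_int_D_err: "sq_int M (D_err N u v)"
    and integral_D_err_le: "(\<integral>\<omega>. (D_err N u v \<omega>)\<^sup>2 \<partial>M) \<le>
      2 * (Q_const * ((\<sigma>\<^sup>2 * (v - u))\<^sup>2 * exp (\<sigma>\<^sup>2 * T))) + 2 * (\<sigma>\<^sup>2 * \<epsilon> N * (v - u))"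
    and D_err_measurable: "D_err N u v \<in> borel_measurable (F v)"
    and D_err_orthogonal: "g \<in> borel_measurable (F u) \<Longrightarrow> sq_int M g \<Longrightarrow> (\<integral>\<omega>. g \<omega> * D_err N u v \<omega> \<partial>M) = 0"
proof -
  have u: "u \<in> {0..T}" and v: "v \<in> {0..T}" using uv by auto
  let ?\<phi> = "\<lambda>z. exp (\<sigma> * z - \<sigma>\<^sup>2 * (v - u) / 2) - 1 - \<sigma> * z"
  let ?f = "\<lambda>\<omega>. Q u u \<omega> * ?\<phi> (W v \<omega> - W u \<omega>)"
  let ?k = "\<lambda>\<omega>. \<sigma> * (Q u u \<omega> - trunc N u \<omega>)"
  let ?g = "\<lambda>\<omega>. ?k \<omega> * (W v \<omega> - W u \<omega>)"
  have m\<phi>: "?\<phi> \<in> borel_measurable borel" by measurable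
  have kF: "?k \<in> borel_measurable (F u)" using Q_measurable_F[OF u] trunc_measurable[OF u] by simp
  have sk: "sq_int M ?k" by (rule sq_int_cmult[OF trunc_error(1)[OF N u]])
  note f = sq_int_increment_mult[OF uv Q_measurable_F[OF u] sq_int_Q[OF u u] m\<phi> G_linear_variance[OF uv]]
  note g = sq_int_increment_mult[OF uv kF sk, of "\<lambda>z. z", OF _ increment_second_moment[OF uv], simplified]
  have eq: "D_err N u v = (\<lambda>\<omega>. ?f \<omega> + ?g \<omega>)" by (simp add: D_err_def fun_eq_iff)
  show "sq_int M (D_err N u v)" unfolding eq by (rule sq_int_add[OF f(1) g(1)])
  have "(\<integral>\<omega>. (D_err N u v \<omega>)\<^sup>2 \<partial>M) \<le> 2 * (\<integral>\<omega>. (?f \<omega>)\<^sup>2 \<partial>M) + 2 * (\<integral>\<omega>. (?g \<omega>)\<^sup>2 \<partial>M)"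
    unfolding eq by (rule integral_sq_add_le[OF f(1) g(1)])
  also have "(\<integral>\<omega>. (?f \<omega>)\<^sup>2 \<partial>M) \<le> Q_const * ((\<sigma>\<^sup>2 * (v - u))\<^sup>2 * exp (\<sigma>\<^sup>2 * T))"
  proof -
    let ?x = "\<sigma>\<^sup>2 * (v - u)"
    have "exp ?x - 1 - ?x \<le> ?x\<^sup>2 * exp ?x" using uv by (intro exp_linear_remainder_le) simp
    also have "\<dots> \<le> ?x\<^sup>2 * exp (\<sigma>\<^sup>2 * T)" using uv by (auto intro!: mult_left_mono)
    finally have "exp ?x - 1 - ?x \<le> ?x\<^sup>2 * exp (\<sigma>\<^sup>2 * T)" .
    moreover have "0 \<le> exp ?x - 1 - ?x" using exp_ge_add_one_self[of ?x] by linarith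
    ultimately show ?thesis
      unfolding f(2) using integral_Q_le[OF u u] Q_const_nonneg by (intro mult_mono) auto
  qed
  also have "(\<integral>\<omega>. (?g \<omega>)\<^sup>2 \<partial>M) \<le> \<sigma>\<^sup>2 * \<epsilon> N * (v - u)"
  proof -
    have "(\<integral>\<omega>. (?k \<omega>)\<^sup>2 \<partial>M) = \<sigma>\<^sup>2 * (\<integral>\<omega>. (Q u u \<omega> - trunc N u \<omega>)\<^sup>2 \<partial>M)"
      by (simp add: power_mult_distrib)
    also have "\<dots> \<le> \<sigma>\<^sup>2 * \<epsilon> N" using trunc_error(2)[OF N u] by (intro mult_left_mono) auto
    finally show ?thesis unfolding g(2) using uv by (intro mult_right_mono) auto
  qed
  finally show "(\<integral>\<omega>. (D_err N u v \<omega>)\<^sup>2 \<partial>M) \<le>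
      2 * (Q_const * ((\<sigma>\<^sup>2 * (v - u))\<^sup>2 * exp (\<sigma>\<^sup>2 * T))) + 2 * (\<sigma>\<^sup>2 * \<epsilon> N * (v - u))" by simp
  have WF: "W v \<in> borel_measurable (F v)" "W u \<in> borel_measurable (F v)"
    using measurable_W[OF v] measurable_F_mono[OF uv measurable_W[OF u]] by auto
  have "Q u u \<in> borel_measurable (F v)" "?k \<in> borel_measurable (F v)"
    using measurable_F_mono[OF uv Q_measurable_F[OF u]] measurable_F_mono[OF uv kF] by auto
  then show "D_err N u v \<in> borel_measurable (F v)"
    unfolding eq using WF by measurable
  assume gF: "g \<in> borel_measurable (F u)" and gsq: "sq_int M g"
  have "has_bochner_integral M (\<lambda>\<omega>. (g \<omega> * Q u u \<omega>) * ?\<phi> (W v \<omega> - W u \<omega>)) ((\<integral>\<omega>. g \<omega> * Q u u \<omega> \<partial>M) * 0)"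
    using gF Q_measurable_F[OF u]
    by (intro increment_expectation[OF uv _ _ m\<phi> G_linear_mean[OF uv]] sq_int_mult[OF gsq sq_int_Q[OF u u]]) auto
  moreover have "has_bochner_integral M (\<lambda>\<omega>. (g \<omega> * ?k \<omega>) * (W v \<omega> - W u \<omega>)) ((\<integral>\<omega>. g \<omega> * ?k \<omega> \<partial>M) * 0)"
    using gF kF
    by (intro increment_expectation[OF uv, of _ "\<lambda>z. z"] increment_first_moment[OF uv] sq_int_mult[OF gsq sk]) auto
  ultimately have "has_bochner_integral M (\<lambda>\<omega>. (g \<omega> * Q u u \<omega>) * ?\<phi> (W v \<omega> - W u \<omega>) + (g \<omega> * ?k \<omega>) * (W v \<omega> - W u \<omega>))
      ((\<integral>\<omega>. g \<omega> * Q u u \<omega> \<partial>M) * 0 + (\<integral>\<omega>. g \<omega> * ?k \<omega> \<partial>M) * 0)"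
    by (rule has_bochner_integral_add)
  moreover have "(g \<omega> * Q u u \<omega>) * ?\<phi> (W v \<omega> - W u \<omega>) + (g \<omega> * ?k \<omega>) * (W v \<omega> - W u \<omega>) = g \<omega> * D_err N u v \<omega>" for \<omega>
    by (simp add: D_err_def algebra_simps)
  ultimately show "(\<integral>\<omega>. g \<omega> * D_err N u v \<omega> \<partial>M) = 0"
    by (simp add: has_bochner_integral_iff)
qed

text \<open>The chain rule for the drift factor rewrites \<open>R_err\<close> as the integral of
  (\<open>Q s v\<close> - \<open>explicit s\<close>) \<open>b s\<close> over the cell.
  Cauchy-Schwarz contributes one power of v - u, regularity in time a second and the length of the
  cell a third. That cube outweighs a crude summation over the cells, for which no orthogonality is
  at hand.\<close>

lemma
  assumes uv: "0 \<le> u" "u \<le> v" "v \<le> T"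
  shows sq_int_R_err: "sq_int M (R_err u v)"
    and integral_R_err_le: "(\<integral>\<omega>. (R_err u v \<omega>)\<^sup>2 \<partial>M) \<le> C\<^sup>2 * Q_diff_const * (v - u)^3"
proof -
  interpret prob_space M by (rule prob_M)
  have u: "u \<in> {0..T}" and v: "v \<in> {0..T}" using uv by auto
  \<comment> \<open>Extended by 0 outside the cell, so that the exchange of integrals in
    \<open>sq_norm_swap\<close> applies on all of {0..T}.\<close>
  define H where "H s \<omega> = indicat_real {u..v} s * (Q s v \<omega> - explicit s \<omega>)" for s \<omega>
  have GM: "G v \<in> borel_measurable M" and xM: "\<xi> \<in> borel_measurable M" and BM: "B u \<in> borel_measurable M" "B v \<in> borel_measurable M"
    using measurable_F_M[OF v G_measurable[OF v]] measurable_F_M[OF v xi_F[OF v]]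
      measurable_F_M[OF v B_measurable[OF v]] measurable_F_M[OF u B_measurable[OF u]] by auto
  have jB: "joint_measurable T B" and jX: "joint_measurable T explicit"
    using progressive_joint_measurable[OF progressive_B] progressive_joint_measurable[OF progressive_explicit] T_pos by auto
  have jH: "joint_measurable T H"
  proof -
    have "(\<lambda>p. indicat_real {u..v} (fst p)) \<in> borel_measurable (restrict_space borel {0..T} \<Otimes>\<^sub>M M)"
      by (intro measurable_compose[OF measurable_fst] measurable_restrict_space1) auto
    then show ?thesis
      using jB jX measurable_compose[OF measurable_snd GM] measurable_compose[OF measurable_snd xM]
      unfolding joint_measurable_def H_def Q_def split_beta' by (intro borel_measurable_times borel_measurable_diff) auto
  qed
  have drift_eq: "R_err u v \<omega> = (LINT s:{u..v}|lborel. (Q s v \<omega> - explicit s \<omega>) * b s \<omega>)" if \<omega>: "\<omega> \<in> space M" for \<omega>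
  proof -
    note d = drift_density[OF \<omega>]
    obtain C1 where C1: "bounded_density T C1 (\<lambda>s. B s \<omega> * b s \<omega>)"
      and B1: "\<And>s. s \<in> {0..T} \<Longrightarrow> B s \<omega> - 1 = primitive (\<lambda>s. B s \<omega> * b s \<omega>) s"
      using primitive_exp_density[OF d] T_pos unfolding B_def by auto
    obtain C2 where C2: "bounded_density T C2 (\<lambda>s. explicit s \<omega> * b s \<omega>)"
      using explicit_drift_density[OF \<omega>] .
    have i1: "set_integrable lborel {u..v} (\<lambda>s. B s \<omega> * b s \<omega>)"
      and i2: "set_integrable lborel {u..v} (\<lambda>s. explicit s \<omega> * b s \<omega>)"
      using bounded_density_set_integrable[OF C1] bounded_density_set_integrable[OF C2] uv by auto
    have "B v \<omega> - B u \<omega> = (LINT s:{u..v}|lborel. B s \<omega> * b s \<omega>)"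
      using B1[OF u] B1[OF v] primitive_diff[OF C1 uv] by simp
    then have "R_err u v \<omega> = (LINT s:{u..v}|lborel. \<xi> \<omega> * G v \<omega> * (B s \<omega> * b s \<omega>)) - (LINT s:{u..v}|lborel. explicit s \<omega> * b s \<omega>)"
      by (simp add: R_err_def)
    also have "\<dots> = (LINT s:{u..v}|lborel. \<xi> \<omega> * G v \<omega> * (B s \<omega> * b s \<omega>) - explicit s \<omega> * b s \<omega>)"
      using i1 i2 by (intro set_integral_diff(2)[symmetric]) auto
    finally show ?thesis by (simp add: Q_def algebra_simps)
  qed
  have mR: "R_err u v \<in> borel_measurable M"
  proof -
    have "(LINT s:{u..v}|lborel. explicit s \<omega> * b s \<omega>) = (LINT s:{0..v}|lborel. explicit s \<omega> * b s \<omega>) - (LINT s:{0..u}|lborel. explicit s \<omega> * b s \<omega>)"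
      if \<omega>: "\<omega> \<in> space M" for \<omega>
    proof -
      obtain C2 where C2: "bounded_density T C2 (\<lambda>s. explicit s \<omega> * b s \<omega>)"
        using explicit_drift_density[OF \<omega>] .
      from primitive_diff[OF C2 uv] show ?thesis by (simp add: primitive_def)
    qed
    then have "R_err u v \<in> borel_measurable M \<longleftrightarrow>
      (\<lambda>\<omega>. \<xi> \<omega> * G v \<omega> * (B v \<omega> - B u \<omega>) - ((LINT s:{0..v}|lborel. explicit s \<omega> * b s \<omega>) - (LINT s:{0..u}|lborel. explicit s \<omega> * b s \<omega>))) \<in> borel_measurable M"
      by (intro measurable_cong) (simp add: R_err_def)
    also have "\<dots>" using GM xM BM measurable_explicit_drift[OF u] measurable_explicit_drift[OF v] by measurable
    finally show ?thesis by simp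
  qed
  have "(\<integral>\<^sup>+\<omega>. ennreal ((R_err u v \<omega>)\<^sup>2) \<partial>M) \<le> (\<integral>\<^sup>+\<omega>. ennreal ((v - u) * C\<^sup>2) * (\<integral>\<^sup>+s\<in>{0..T}. ennreal ((H s \<omega>)\<^sup>2) \<partial>lborel) \<partial>M)"
  proof (rule nn_integral_mono)
    fix \<omega> assume \<omega>: "\<omega> \<in> space M"
    have mH: "(\<lambda>s. indicat_real {0..T} s * H s \<omega>) \<in> borel_measurable borel"
      using joint_measurable_section[OF jH \<omega>] by (simp add: set_borel_measurable_def)
    have mb: "(\<lambda>s. indicat_real {0..T} s * b s \<omega>) \<in> borel_measurable borel"
      using drift_density[OF \<omega>] by (simp add: bounded_density_def set_borel_measurable_def)
    let ?f = "\<lambda>s. (indicat_real {0..T} s * H s \<omega>) * (indicat_real {0..T} s * b s \<omega>)"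
    have mf: "?f \<in> borel_measurable borel" using mH mb by (rule borel_measurable_times)
    have "R_err u v \<omega> = (LINT s:{u..v}|lborel. ?f s)"
      unfolding drift_eq[OF \<omega>] set_lebesgue_integral_def using uv
      by (intro Bochner_Integration.integral_cong) (auto simp: indicator_def H_def)
    then have "ennreal ((R_err u v \<omega>)\<^sup>2) \<le> ennreal (v - u) * (\<integral>\<^sup>+s\<in>{u..v}. ennreal ((?f s)\<^sup>2) \<partial>lborel)"
      using set_integral_square_le[OF uv(2) mf] by simp
    also have "\<dots> \<le> ennreal (v - u) * (\<integral>\<^sup>+s. ennreal (C\<^sup>2) * (ennreal ((H s \<omega>)\<^sup>2) * indicator {0..T} s) \<partial>lborel)"
    proof (rule mult_left_mono[OF nn_integral_mono])
      fix s
      show "ennreal ((?f s)\<^sup>2) * indicator {u..v} s \<le> ennreal (C\<^sup>2) * (ennreal ((H s \<omega>)\<^sup>2) * indicator {0..T} s)"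
      proof (cases "s \<in> {u..v}")
        case True
        then have s: "s \<in> {0..T}" using uv by auto
        have "(b s \<omega>)\<^sup>2 \<le> C\<^sup>2"
          using drift_bounded[OF s \<omega>] C_nonneg by (intro abs_le_square_iff[THEN iffD1]) auto
        then have "(H s \<omega> * b s \<omega>)\<^sup>2 \<le> C\<^sup>2 * (H s \<omega>)\<^sup>2"
          using mult_left_mono[of "(b s \<omega>)\<^sup>2" "C\<^sup>2" "(H s \<omega>)\<^sup>2"] by (simp add: power_mult_distrib mult.commute[of "C\<^sup>2"])
        then show ?thesis using True s by (simp add: ennreal_mult[symmetric] ennreal_leI)
      qed simp
    qed simp
    also have "(\<integral>\<^sup>+s. ennreal (C\<^sup>2) * (ennreal ((H s \<omega>)\<^sup>2) * indicator {0..T} s) \<partial>lborel)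
      = ennreal (C\<^sup>2) * (\<integral>\<^sup>+s\<in>{0..T}. ennreal ((H s \<omega>)\<^sup>2) \<partial>lborel)"
    proof (rule nn_integral_cmult)
      have "(\<lambda>s. ennreal ((indicat_real {0..T} s * H s \<omega>)\<^sup>2)) \<in> borel_measurable lborel" using mH by measurable
      also have "(\<lambda>s. ennreal ((indicat_real {0..T} s * H s \<omega>)\<^sup>2)) = (\<lambda>s. ennreal ((H s \<omega>)\<^sup>2) * indicator {0..T} s)"
        by (auto simp: indicator_def)
      finally show "(\<lambda>s. ennreal ((H s \<omega>)\<^sup>2) * indicator {0..T} s) \<in> borel_measurable lborel" .
    qed
    finally show "ennreal ((R_err u v \<omega>)\<^sup>2) \<le> ennreal ((v - u) * C\<^sup>2) * (\<integral>\<^sup>+s\<in>{0..T}. ennreal ((H s \<omega>)\<^sup>2) \<partial>lborel)"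
      using uv by (simp add: ennreal_mult mult.assoc)
  qed
  also have "\<dots> = ennreal ((v - u) * C\<^sup>2) * sq_norm T H"
    unfolding sq_norm_def using T_pos by (intro nn_integral_cmult measurable_inner_sq_norm jH) simp
  also have "sq_norm T H = (\<integral>\<^sup>+s\<in>{0..T}. (\<integral>\<^sup>+\<omega>. ennreal ((H s \<omega>)\<^sup>2) \<partial>M) \<partial>lborel)"
    using sq_norm_swap[OF _ jH] T_pos by simp
  also have "\<dots> \<le> (\<integral>\<^sup>+s. ennreal (Q_diff_const * (v - u)) * indicator {u..v} s \<partial>lborel)"
  proof (rule nn_integral_mono)
    fix s
    show "(\<integral>\<^sup>+\<omega>. ennreal ((H s \<omega>)\<^sup>2) \<partial>M) * indicator {0..T} s \<le> ennreal (Q_diff_const * (v - u)) * indicator {u..v} s"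
    proof (cases "s \<in> {u..v}")
      case True
      then have s: "s \<in> {0..T}" using uv by auto
      have "(\<integral>\<^sup>+\<omega>. ennreal ((H s \<omega>)\<^sup>2) \<partial>M) = (\<integral>\<^sup>+\<omega>. ennreal ((Q s v \<omega> - Q s s \<omega>)\<^sup>2) \<partial>M)"
      proof (rule nn_integral_cong_AE)
        show "AE \<omega> in M. ennreal ((H s \<omega>)\<^sup>2) = ennreal ((Q s v \<omega> - Q s s \<omega>)\<^sup>2)"
          using explicit_eq_Q by eventually_elim (use True in \<open>simp add: H_def\<close>)
      qed
      also have "\<dots> = ennreal (\<integral>\<omega>. (Q s v \<omega> - Q s s \<omega>)\<^sup>2 \<partial>M)"
        by (rule nn_integral_sq[OF sq_int_diff[OF sq_int_Q[OF s v] sq_int_Q[OF s s]]])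
      also have "\<dots> \<le> ennreal (Q_diff_const * (\<bar>s - s\<bar> + \<bar>v - s\<bar>))"
        by (rule ennreal_leI[OF integral_Q_diff_le[OF s v s]])
      also have "\<dots> \<le> ennreal (Q_diff_const * (v - u))"
        using True Q_diff_const_nonneg by (intro ennreal_leI mult_left_mono) auto
      finally show ?thesis using True s by simp
    next
      case False
      then show ?thesis by (simp add: H_def)
    qed
  qed
  also have "\<dots> = ennreal (Q_diff_const * (v - u)) * ennreal (v - u)"
    using uv by (simp add: nn_integral_cmult_indicator)
  finally have "(\<integral>\<^sup>+\<omega>. ennreal ((R_err u v \<omega>)\<^sup>2) \<partial>M) \<le> ennreal ((v - u) * C\<^sup>2) * (ennreal (Q_diff_const * (v - u)) * ennreal (v - u))"
    by (simp add: mult_left_mono)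
  also have "\<dots> = ennreal (C\<^sup>2 * Q_diff_const * (v - u)^3)"
    using uv Q_diff_const_nonneg by (simp add: ennreal_mult[symmetric] power3_eq_cube ac_simps)
  finally have le: "(\<integral>\<^sup>+\<omega>. ennreal ((R_err u v \<omega>)\<^sup>2) \<partial>M) \<le> ennreal (C\<^sup>2 * Q_diff_const * (v - u)^3)" .
  have nn: "0 \<le> C\<^sup>2 * Q_diff_const * (v - u)^3" using uv Q_diff_const_nonneg by simp
  show sq: "sq_int M (R_err u v)"
    unfolding sq_int_def using mR le by (auto intro!: integrableI_bounded order.strict_trans1[OF le])
  show "(\<integral>\<omega>. (R_err u v \<omega>)\<^sup>2 \<partial>M) \<le> C\<^sup>2 * Q_diff_const * (v - u)^3"
    using le nn unfolding nn_integral_sq[OF sq] by (simp add: ennreal_le_iff)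
qed

text \<open>The integrands are \<open>\<sigma>\<close> times the truncated values at left end
  points. Mesh r/(k+1) and truncation level k+1 are coupled, so that both errors vanish along one
  sequence; \<open>e1\<close> bounds the error of the integrands and \<open>e2\<close> that of the
  integrals.\<close>

lemma explicit_ito:
  assumes r: "r \<in> {0..T}"
  shows "has_ito_integral M F W r (\<lambda>s \<omega>. \<sigma> * explicit s \<omega>)
    (\<lambda>\<omega>. explicit r \<omega> - \<xi> \<omega> - (LINT s:{0..r}|lborel. explicit s \<omega> * b s \<omega>))"
proof -
  interpret prob_space M by (rule prob_M)
  define Y where "Y \<omega> = explicit r \<omega> - \<xi> \<omega> - (LINT s:{0..r}|lborel. explicit s \<omega> * b s \<omega>)" for \<omega>
  define \<Delta> where "\<Delta> k = r / real (Suc k)" for k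
  define t where "t k i = real i * \<Delta> k" for k i
  define N where "N k = real (Suc k)" for k
  define h where "h k i \<omega> = \<sigma> * trunc (N k) (t k i) \<omega>" for k i \<omega>
  have N: "0 < N k" for k by (simp add: N_def)
  have \<Delta>0: "0 \<le> \<Delta> k" for k using r by (simp add: \<Delta>_def)
  have n\<Delta>: "real (Suc k) * \<Delta> k = r" for k by (simp add: \<Delta>_def)
  have step: "t k (Suc i) - t k i = \<Delta> k" for k i by (simp add: t_def algebra_simps)
  have t_mono: "t k i \<le> t k j" if "i \<le> j" for k i j
    unfolding t_def using that \<Delta>0 by (intro mult_right_mono) auto
  have t_last: "t k (Suc k) = r" and t_first: "t k 0 = 0" for k using n\<Delta> by (auto simp: t_def)
  have t_range: "t k i \<in> {0..r}" if "i \<le> Suc k" for k i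
    using t_mono[OF that, of k] t_mono[of 0 i k] by (simp add: t_last t_first)
  have t_T: "t k i \<in> {0..T}" if "i \<le> Suc k" for k i
    using t_range[OF that] r by auto
  have r0: "0 \<le> r" "r \<le> T" using r by auto
  have simple: "simple_integrand M F r (Suc k) (t k) (h k)" for k
    unfolding simple_integrand_def
  proof (intro allI impI conjI)
    fix i assume i: "i < Suc k"
    show "0 \<le> t k i" "t k (Suc i) \<le> r" using t_range[of i k] t_range[of "Suc i" k] i by auto
    show "t k i \<le> t k (Suc i)" by (rule t_mono) simp
    show "h k i \<in> borel_measurable (F (t k i))"
      unfolding h_def[abs_def] using trunc_measurable[OF t_T, of i k] i by simp
    have "\<bar>h k i \<omega>\<bar> \<le> \<bar>\<sigma>\<bar> * (\<beta> * N k * N k)" if "\<omega> \<in> space M" for \<omega>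
      unfolding h_def abs_mult using trunc_bounded[OF N that t_T] i by (intro mult_left_mono) auto
    then show "\<exists>c. \<forall>\<omega>\<in>space M. \<bar>h k i \<omega>\<bar> \<le> c" by blast
  qed
  let ?X = "\<lambda>s \<omega>. \<sigma> * explicit s \<omega>"
  have jX: "joint_measurable r ?X"
    using progressive_joint_measurable[OF progressive_explicit r] by (simp add: joint_measurable_def split_beta')
  \<comment> \<open>The length r of the interval times the error of truncation plus that of freezing
    at the left end point, where both time arguments of \<open>Q\<close> move by at most the
    mesh.\<close>
  define e1 where "e1 k = r * (2 * (\<sigma>\<^sup>2 * \<epsilon> (N k)) + 2 * (\<sigma>\<^sup>2 * (Q_diff_const * (2 * \<Delta> k))))" for k
  have \<epsilon>_nonneg: "0 \<le> \<epsilon> (N k)" for k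
    using trunc_error(2)[OF N, of 0 k] T_pos by (intro order.trans[OF _ trunc_error(2)[OF N, of 0 k]]) auto
  have norm_le: "sq_norm r (\<lambda>s \<omega>. simple_process (Suc k) (t k) (h k) s \<omega> - ?X s \<omega>) \<le> ennreal (e1 k)" for k
  proof -
    have jd: "joint_measurable r (\<lambda>s \<omega>. simple_process (Suc k) (t k) (h k) s \<omega> - ?X s \<omega>)"
      using joint_measurable_simple_process[OF r0(2) simple] jX unfolding joint_measurable_def split_beta'
      by (rule borel_measurable_diff)
    let ?c = "2 * (\<sigma>\<^sup>2 * \<epsilon> (N k)) + 2 * (\<sigma>\<^sup>2 * (Q_diff_const * (2 * \<Delta> k)))"
    have c0: "0 \<le> ?c" using \<epsilon>_nonneg Q_diff_const_nonneg \<Delta>0 by simp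
    have cell: "(\<integral>\<^sup>+\<omega>. ennreal ((simple_process (Suc k) (t k) (h k) s \<omega> - ?X s \<omega>)\<^sup>2) \<partial>M) \<le> ennreal ?c"
      if s: "s \<in> {0<..r}" for s
    proof -
      \<comment> \<open>The least grid point not before s ends the cell of s, in agreement with the
        intervals of \<open>simple_process\<close>, which are open on the left and closed on the
        right.\<close>
      define P where "P i \<longleftrightarrow> s \<le> t k i" for i
      have "P (Suc k)" using s by (simp add: P_def t_last)
      moreover have "\<not> P 0" using s by (simp add: P_def t_first)
      ultimately obtain i where i: "i < Suc k" "\<not> P i" "P (Suc i)"
        using ex_least_nat_less[of P "Suc k"] by (metis less_Suc_eq_le lessI order_refl)
      then have si: "t k i < s" "s \<le> t k (Suc i)" by (auto simp: P_def)
      have sT: "s \<in> {0..T}" using s r by auto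
      have ti: "t k i \<in> {0..T}" using i by (intro t_T) simp
      have "simple_process (Suc k) (t k) (h k) s \<omega> = h k i \<omega>" for \<omega>
      proof -
        have ind: "indicat_real {t k j<..t k (Suc j)} s = (if j = i then 1 else 0)" for j
        proof (cases j i rule: linorder_cases)
          case less
          then show ?thesis using t_mono[of "Suc j" i k] si by (auto simp: indicator_def)
        next
          case greater
          then show ?thesis using t_mono[of "Suc i" j k] si by (auto simp: indicator_def)
        qed (use si in \<open>simp add: indicator_def\<close>)
        have "simple_process (Suc k) (t k) (h k) s \<omega> = (\<Sum>j<Suc k. if j = i then h k j \<omega> else 0)"
          unfolding simple_process_def ind by (intro sum.cong) auto
        then show ?thesis using i(1) by (simp del: sum.lessThan_Suc)
      qed
      then have "(\<integral>\<^sup>+\<omega>. ennreal ((simple_process (Suc k) (t k) (h k) s \<omega> - ?X s \<omega>)\<^sup>2) \<partial>M)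
        = (\<integral>\<^sup>+\<omega>. ennreal ((\<sigma> * (trunc (N k) (t k i) \<omega> - Q s s \<omega>))\<^sup>2) \<partial>M)"
        using explicit_eq_Q
        by (intro nn_integral_cong_AE) (auto elim!: AE_mp simp: h_def algebra_simps)
      also have "\<dots> = (\<integral>\<^sup>+\<omega>. ennreal ((\<sigma> * (- 1 * (Q (t k i) (t k i) \<omega> - trunc (N k) (t k i) \<omega>)) + \<sigma> * (Q (t k i) (t k i) \<omega> - Q s s \<omega>))\<^sup>2) \<partial>M)"
        by (simp add: algebra_simps)
      also have "\<dots> = ennreal (\<integral>\<omega>. (\<sigma> * (- 1 * (Q (t k i) (t k i) \<omega> - trunc (N k) (t k i) \<omega>)) + \<sigma> * (Q (t k i) (t k i) \<omega> - Q s s \<omega>))\<^sup>2 \<partial>M)"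
        by (intro nn_integral_sq sq_int_add sq_int_cmult trunc_error(1)[OF N ti] sq_int_diff sq_int_Q ti sT)
      also have "\<dots> \<le> ennreal (2 * (\<integral>\<omega>. (\<sigma> * (- 1 * (Q (t k i) (t k i) \<omega> - trunc (N k) (t k i) \<omega>)))\<^sup>2 \<partial>M) + 2 * (\<integral>\<omega>. (\<sigma> * (Q (t k i) (t k i) \<omega> - Q s s \<omega>))\<^sup>2 \<partial>M))"
        by (intro ennreal_leI integral_sq_add_le sq_int_cmult trunc_error(1)[OF N ti] sq_int_diff sq_int_Q ti sT)
      also have "\<dots> \<le> ennreal ?c"
      proof (intro ennreal_leI add_mono mult_left_mono)
        have "(\<integral>\<omega>. (\<sigma> * (- 1 * (Q (t k i) (t k i) \<omega> - trunc (N k) (t k i) \<omega>)))\<^sup>2 \<partial>M) = \<sigma>\<^sup>2 * (\<integral>\<omega>. (Q (t k i) (t k i) \<omega> - trunc (N k) (t k i) \<omega>)\<^sup>2 \<partial>M)"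
          by (simp add: power_mult_distrib power2_commute)
        also have "\<dots> \<le> \<sigma>\<^sup>2 * \<epsilon> (N k)" using trunc_error(2)[OF N ti] by (intro mult_left_mono) auto
        finally show "(\<integral>\<omega>. (\<sigma> * (- 1 * (Q (t k i) (t k i) \<omega> - trunc (N k) (t k i) \<omega>)))\<^sup>2 \<partial>M) \<le> \<sigma>\<^sup>2 * \<epsilon> (N k)" .
        have "(\<integral>\<omega>. (\<sigma> * (Q (t k i) (t k i) \<omega> - Q s s \<omega>))\<^sup>2 \<partial>M) = \<sigma>\<^sup>2 * (\<integral>\<omega>. (Q (t k i) (t k i) \<omega> - Q s s \<omega>)\<^sup>2 \<partial>M)"
          by (simp add: power_mult_distrib)
        also have "\<dots> \<le> \<sigma>\<^sup>2 * (Q_diff_const * (\<bar>t k i - s\<bar> + \<bar>t k i - s\<bar>))"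
          using integral_Q_diff_le[OF ti ti sT] by (intro mult_left_mono) auto
        also have "\<dots> \<le> \<sigma>\<^sup>2 * (Q_diff_const * (2 * \<Delta> k))"
          using si step[of k i] Q_diff_const_nonneg by (intro mult_left_mono) auto
        finally show "(\<integral>\<omega>. (\<sigma> * (Q (t k i) (t k i) \<omega> - Q s s \<omega>))\<^sup>2 \<partial>M) \<le> \<sigma>\<^sup>2 * (Q_diff_const * (2 * \<Delta> k))" .
      qed auto
      finally show ?thesis .
    qed
    have "sq_norm r (\<lambda>s \<omega>. simple_process (Suc k) (t k) (h k) s \<omega> - ?X s \<omega>)
      = (\<integral>\<^sup>+s\<in>{0..r}. (\<integral>\<^sup>+\<omega>. ennreal ((simple_process (Suc k) (t k) (h k) s \<omega> - ?X s \<omega>)\<^sup>2) \<partial>M) \<partial>lborel)"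
      by (rule sq_norm_swap[OF r0(1) jd])
    also have "\<dots> \<le> (\<integral>\<^sup>+s. ennreal ?c * indicator {0..r} s \<partial>lborel)"
    proof (rule nn_integral_mono_AE)
      show "AE s in lborel. (\<integral>\<^sup>+\<omega>. ennreal ((simple_process (Suc k) (t k) (h k) s \<omega> - ?X s \<omega>)\<^sup>2) \<partial>M) * indicator {0..r} s
        \<le> ennreal ?c * indicator {0..r} s"
        using AE_lborel_singleton[of "0::real"]
      proof eventually_elim
        case (elim s)
        then show ?case using cell[of s] by (cases "s \<in> {0..r}") auto
      qed
    qed
    also have "\<dots> = ennreal ?c * ennreal r" using r0 by (simp add: nn_integral_cmult_indicator)
    also have "\<dots> = ennreal (e1 k)"
      unfolding e1_def using c0 r0 by (subst ennreal_mult[symmetric]) (auto simp: mult.commute)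
    finally show ?thesis .
  qed
  \<comment> \<open>With n = k + 1 cells of length \<open>\<Delta> k\<close>: orthogonality adds n
    martingale errors of order \<open>\<Delta>\<close>^2, giving r \<open>\<Delta>\<close>, while
    Cauchy-Schwarz for sums turns the drift errors into n^2 \<open>\<Delta>\<close>^3, that is r^2
    \<open>\<Delta>\<close>.\<close>
  define e2 where "e2 k = 2 * (2 * (Q_const * (\<sigma>\<^sup>2 * \<sigma>\<^sup>2 * exp (\<sigma>\<^sup>2 * T) * (r * \<Delta> k))) + 2 * (\<sigma>\<^sup>2 * \<epsilon> (N k) * r)) + 2 * (C\<^sup>2 * Q_diff_const * (r\<^sup>2 * \<Delta> k))" for k
  have int_le: "(\<integral>\<^sup>+\<omega>. ennreal ((simple_integral W (Suc k) (t k) (h k) \<omega> - Y \<omega>)\<^sup>2) \<partial>M) \<le> ennreal (e2 k)" for k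
  proof -
    define n where "n = Suc k"
    define D where "D i = D_err (N k) (t k i) (t k (Suc i))" for i
    define R where "R i = R_err (t k i) (t k (Suc i))" for i
    have rng: "0 \<le> t k i" "t k i \<le> t k (Suc i)" "t k (Suc i) \<le> T" if "i < n" for i
      using t_T[of i k] t_T[of "Suc i" k] t_mono[of i "Suc i" k] that by (auto simp: n_def)
    have sD: "sq_int M (D i)" if "i < n" for i unfolding D_def by (rule sq_int_D_err[OF rng[OF that] N])
    have sR: "sq_int M (R i)" if "i < n" for i unfolding R_def by (rule sq_int_R_err[OF rng[OF that]])
    have decomp: "AE \<omega> in M. simple_integral W (Suc k) (t k) (h k) \<omega> - Y \<omega> = - ((\<Sum>i<n. D i \<omega>) + (\<Sum>i<n. R i \<omega>))"
      using AE_initial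
    proof eventually_elim
      case (elim \<omega>)
      then have \<omega>: "\<omega> \<in> space M" by simp
      have XQ: "explicit s \<omega> = Q s s \<omega>" for s using elim by (simp add: explicit_def Q_def G_def)
      have Q0: "Q 0 0 \<omega> = \<xi> \<omega>" using elim by (simp add: Q_def B_def G_def)
      obtain C2 where C2: "bounded_density T C2 (\<lambda>s. explicit s \<omega> * b s \<omega>)"
        using explicit_drift_density[OF \<omega>] .
      have "(\<Sum>i<n. LINT s:{t k i..t k (Suc i)}|lborel. explicit s \<omega> * b s \<omega>)
          = primitive (\<lambda>s. explicit s \<omega> * b s \<omega>) (t k n) - primitive (\<lambda>s. explicit s \<omega> * b s \<omega>) (t k 0)"
        using t_T t_mono t_first by (intro telescoping_set_integral[OF C2]) (auto simp: n_def)
      then have I: "(\<Sum>i<n. LINT s:{t k i..t k (Suc i)}|lborel. explicit s \<omega> * b s \<omega>) = (LINT s:{0..r}|lborel. explicit s \<omega> * b s \<omega>)"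
        by (simp add: n_def t_last t_first primitive_def[of _ r])
      have "(\<Sum>i<n. D i \<omega>) + (\<Sum>i<n. R i \<omega>) = (\<Sum>i<n. D i \<omega> + R i \<omega>)" by (simp add: sum.distrib)
      also have "\<dots> = (\<Sum>i<n. (Q (t k (Suc i)) (t k (Suc i)) \<omega> - Q (t k i) (t k i) \<omega>)
          - (LINT s:{t k i..t k (Suc i)}|lborel. explicit s \<omega> * b s \<omega>)
          - h k i \<omega> * (W (t k (Suc i)) \<omega> - W (t k i) \<omega>))"
        using rng by (intro sum.cong refl) (simp add: D_def R_def error_decomposition[symmetric] h_def)
      also have "\<dots> = (\<Sum>i<n. Q (t k (Suc i)) (t k (Suc i)) \<omega> - Q (t k i) (t k i) \<omega>)
          - (\<Sum>i<n. LINT s:{t k i..t k (Suc i)}|lborel. explicit s \<omega> * b s \<omega>)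
          - (\<Sum>i<n. h k i \<omega> * (W (t k (Suc i)) \<omega> - W (t k i) \<omega>))"
        by (simp only: sum_subtractf)
      also have "\<dots> = (Q (t k n) (t k n) \<omega> - Q (t k 0) (t k 0) \<omega>) - (LINT s:{0..r}|lborel. explicit s \<omega> * b s \<omega>)
          - simple_integral W (Suc k) (t k) (h k) \<omega>"
      proof -
        have "simple_integral W (Suc k) (t k) (h k) \<omega> = (\<Sum>i<n. h k i \<omega> * (W (t k (Suc i)) \<omega> - W (t k i) \<omega>))"
          by (simp only: simple_integral_def n_def)
        then show ?thesis
          using I sum_lessThan_telescope[of "\<lambda>i. Q (t k i) (t k i) \<omega>" n] by simp
      qed
      finally show ?case by (simp add: Y_def XQ Q0 t_last t_first n_def)
    qed
    have ID: "(\<integral>\<omega>. (\<Sum>i<n. D i \<omega>)\<^sup>2 \<partial>M) \<le> 2 * (Q_const * (\<sigma>\<^sup>2 * \<sigma>\<^sup>2 * exp (\<sigma>\<^sup>2 * T) * (r * \<Delta> k))) + 2 * (\<sigma>\<^sup>2 * \<epsilon> (N k) * r)"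
    proof -
      have "(\<integral>\<omega>. (\<Sum>i<n. D i \<omega>)\<^sup>2 \<partial>M) = (\<Sum>i<n. \<integral>\<omega>. (D i \<omega>)\<^sup>2 \<partial>M)"
      proof (rule integral_sum_sq_orthogonal[OF sD])
        fix i j assume ij: "i < j" "j < n"
        then have "i < n" by simp
        have "D i \<in> borel_measurable (F (t k j))"
          unfolding D_def using D_err_measurable[OF rng[OF \<open>i < n\<close>] N] rng[OF ij(2)] rng[OF \<open>i < n\<close>] t_mono[of "Suc i" j k] ij
          by (intro measurable_F_mono[of "t k (Suc i)" "t k j"]) (auto intro: order.trans)
        from D_err_orthogonal[OF rng[OF ij(2)] N this sD[OF \<open>i < n\<close>]]
        show "(\<integral>\<omega>. D i \<omega> * D j \<omega> \<partial>M) = 0" by (simp add: D_def)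
      qed
      also have "\<dots> \<le> (\<Sum>i<n. 2 * (Q_const * ((\<sigma>\<^sup>2 * \<Delta> k)\<^sup>2 * exp (\<sigma>\<^sup>2 * T))) + 2 * (\<sigma>\<^sup>2 * \<epsilon> (N k) * \<Delta> k))"
        unfolding D_def using integral_D_err_le[OF rng N] by (intro sum_mono) (simp add: step)
      also have "\<dots> = 2 * (Q_const * (\<sigma>\<^sup>2 * \<sigma>\<^sup>2 * exp (\<sigma>\<^sup>2 * T) * ((real (Suc k) * \<Delta> k) * \<Delta> k))) + 2 * (\<sigma>\<^sup>2 * \<epsilon> (N k) * (real (Suc k) * \<Delta> k))"
        by (simp add: n_def power2_eq_square algebra_simps)
      finally show ?thesis unfolding n\<Delta> .
    qed
    have IR: "(\<integral>\<omega>. (\<Sum>i<n. R i \<omega>)\<^sup>2 \<partial>M) \<le> C\<^sup>2 * Q_diff_const * (r\<^sup>2 * \<Delta> k)"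
    proof -
      have "(\<integral>\<omega>. (\<Sum>i<n. R i \<omega>)\<^sup>2 \<partial>M) \<le> (\<integral>\<omega>. (\<Sum>i<n. (R i \<omega>)\<^sup>2) * real n \<partial>M)"
        using sq_int_sum[of "{..<n}" M R] sR sum_squared_le_sum_of_squares[of "\<lambda>i. R i _" "{..<n}"]
        by (intro integral_mono) (auto simp: sq_int_def)
      also have "\<dots> = (\<Sum>i<n. \<integral>\<omega>. (R i \<omega>)\<^sup>2 \<partial>M) * real n"
        using sR by (simp add: sq_int_def)
      also have "\<dots> \<le> (\<Sum>i<n. C\<^sup>2 * Q_diff_const * (\<Delta> k)^3) * real n"
        unfolding R_def using integral_R_err_le[OF rng] by (intro mult_right_mono sum_mono) (simp_all add: step)
      also have "\<dots> = C\<^sup>2 * Q_diff_const * ((real (Suc k) * \<Delta> k)\<^sup>2 * \<Delta> k)"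
        by (simp add: n_def power2_eq_square power3_eq_cube algebra_simps)
      finally show ?thesis unfolding n\<Delta> .
    qed
    have sS: "sq_int M (\<lambda>\<omega>. \<Sum>i<n. D i \<omega>)" "sq_int M (\<lambda>\<omega>. \<Sum>i<n. R i \<omega>)"
      using sD sR by (auto intro: sq_int_sum)
    have "(\<integral>\<^sup>+\<omega>. ennreal ((simple_integral W (Suc k) (t k) (h k) \<omega> - Y \<omega>)\<^sup>2) \<partial>M)
      = (\<integral>\<^sup>+\<omega>. ennreal (((\<Sum>i<n. D i \<omega>) + (\<Sum>i<n. R i \<omega>))\<^sup>2) \<partial>M)"
    proof (rule nn_integral_cong_AE)
      show "AE \<omega> in M. ennreal ((simple_integral W (Suc k) (t k) (h k) \<omega> - Y \<omega>)\<^sup>2) = ennreal (((\<Sum>i<n. D i \<omega>) + (\<Sum>i<n. R i \<omega>))\<^sup>2)"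
        using decomp by eventually_elim (simp only: power2_minus)
    qed
    also have "\<dots> = ennreal (\<integral>\<omega>. ((\<Sum>i<n. D i \<omega>) + (\<Sum>i<n. R i \<omega>))\<^sup>2 \<partial>M)"
      by (rule nn_integral_sq[OF sq_int_add[OF sS]])
    also have "\<dots> \<le> ennreal (e2 k)"
      unfolding e2_def
      by (intro ennreal_leI order.trans[OF integral_sq_add_le[OF sS]] add_mono mult_left_mono ID IR) auto
    finally show ?thesis .
  qed
  have \<Delta>_lim: "\<Delta> \<longlonglongrightarrow> 0"
    using tendsto_mult[OF tendsto_const[of r] LIMSEQ_inverse_real_of_nat] by (simp add: \<Delta>_def[abs_def] divide_inverse)
  have \<epsilon>_lim: "(\<lambda>k. \<epsilon> (N k)) \<longlonglongrightarrow> 0" using \<epsilon>_tendsto_0 by (simp add: N_def)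
  have "e1 \<longlonglongrightarrow> r * (2 * (\<sigma>\<^sup>2 * 0) + 2 * (\<sigma>\<^sup>2 * (Q_diff_const * (2 * 0))))"
    unfolding e1_def[abs_def] by (intro tendsto_intros \<Delta>_lim \<epsilon>_lim)
  then have "e1 \<longlonglongrightarrow> 0" by simp
  from tendsto_ennrealI[OF this] have e1_lim: "(\<lambda>k. ennreal (e1 k)) \<longlonglongrightarrow> 0" by simp
  have "e2 \<longlonglongrightarrow> 2 * (2 * (Q_const * (\<sigma>\<^sup>2 * \<sigma>\<^sup>2 * exp (\<sigma>\<^sup>2 * T) * (r * 0))) + 2 * (\<sigma>\<^sup>2 * 0 * r)) + 2 * (C\<^sup>2 * Q_diff_const * (r\<^sup>2 * 0))"
    unfolding e2_def[abs_def] by (intro tendsto_intros \<Delta>_lim \<epsilon>_lim)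
  then have "e2 \<longlonglongrightarrow> 0" by simp
  from tendsto_ennrealI[OF this] have e2_lim: "(\<lambda>k. ennreal (e2 k)) \<longlonglongrightarrow> 0" by simp
  have YM: "Y \<in> borel_measurable M"
    using measurable_F_M[OF r progressive_adapted[OF progressive_explicit r]] measurable_explicit_drift[OF r]
      sq_int_measurable[OF sq_int_xi] unfolding Y_def[abs_def] by measurable
  have "has_ito_integral M F W r ?X Y"
    unfolding has_ito_integral_def
  proof (intro conjI exI allI)
    show "simple_integrand M F r (Suc k) (t k) (h k)" for k by (rule simple)
    show "(\<lambda>k. \<integral>\<^sup>+\<omega>. (\<integral>\<^sup>+s\<in>{0..r}. ennreal ((simple_process (Suc k) (t k) (h k) s \<omega> - ?X s \<omega>)\<^sup>2) \<partial>lborel) \<partial>M) \<longlonglongrightarrow> 0"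
      using norm_le by (intro tendsto_sandwich[OF _ _ tendsto_const e1_lim]) (auto simp: sq_norm_def)
    show "(\<lambda>k. \<integral>\<^sup>+\<omega>. ennreal ((simple_integral W (Suc k) (t k) (h k) \<omega> - Y \<omega>)\<^sup>2) \<partial>M) \<longlonglongrightarrow> 0"
      using int_le by (intro tendsto_sandwich[OF _ _ tendsto_const e2_lim]) auto
  qed (rule YM)
  then show ?thesis by (simp add: Y_def[abs_def])
qed

lemma solution_explicit: "solution explicit"
  unfolding solution_def
proof (intro conjI ballI)
  show "progressive F T explicit" by (rule progressive_explicit)
  show "AE \<omega> in M. continuous_on {0..T} (\<lambda>t. explicit t \<omega>)"
    using explicit_continuous by (intro AE_I2)
  have jX: "joint_measurable T explicit"
    using progressive_joint_measurable[OF progressive_explicit] T_pos by simp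
  have "sq_norm T explicit = (\<integral>\<^sup>+s\<in>{0..T}. (\<integral>\<^sup>+\<omega>. ennreal ((explicit s \<omega>)\<^sup>2) \<partial>M) \<partial>lborel)"
    using sq_norm_swap[OF _ jX] T_pos by simp
  also have "\<dots> \<le> (\<integral>\<^sup>+s. ennreal Q_const * indicator {0..T} s \<partial>lborel)"
  proof (rule nn_integral_mono)
    fix s
    show "(\<integral>\<^sup>+\<omega>. ennreal ((explicit s \<omega>)\<^sup>2) \<partial>M) * indicator {0..T} s \<le> ennreal Q_const * indicator {0..T} s"
    proof (cases "s \<in> {0..T}")
      case True
      have "(\<integral>\<^sup>+\<omega>. ennreal ((explicit s \<omega>)\<^sup>2) \<partial>M) = (\<integral>\<^sup>+\<omega>. ennreal ((Q s s \<omega>)\<^sup>2) \<partial>M)"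
        using explicit_eq_Q by (intro nn_integral_cong_AE) (auto elim!: AE_mp)
      also have "\<dots> \<le> ennreal Q_const"
        unfolding nn_integral_sq[OF sq_int_Q[OF True True]] by (rule ennreal_leI[OF integral_Q_le[OF True True]])
      finally show ?thesis using True by simp
    qed simp
  qed
  also have "\<dots> < \<infinity>" by (simp add: nn_integral_cmult_indicator emeasure_lborel_Icc_eq ennreal_mult_less_top)
  finally show "(\<integral>\<^sup>+\<omega>. (\<integral>\<^sup>+t\<in>{0..T}. ennreal ((explicit t \<omega>)\<^sup>2) \<partial>lborel) \<partial>M) < \<infinity>" by (simp add: sq_norm_def)
  fix t assume t: "t \<in> {0..T}"
  show "\<exists>I. has_ito_integral M F W t (\<lambda>s \<omega>. \<sigma> * explicit s \<omega>) I \<and>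
        (AE \<omega> in M. explicit t \<omega> = \<xi> \<omega> + (LINT s:{0..t}|lborel. explicit s \<omega> * b s \<omega>) + I \<omega>)"
    by (intro exI[of _ "\<lambda>\<omega>. explicit t \<omega> - \<xi> \<omega> - (LINT s:{0..t}|lborel. explicit s \<omega> * b s \<omega>)"] conjI explicit_ito[OF t]) simp
qed

end


section \<open>The controlled state\<close>

lemma primitive_add:
  assumes "bounded_density T C f" "bounded_density T C' g" "t \<in> {0..T}"
  shows "primitive (\<lambda>s. f s + g s) t = primitive f t + primitive g t"
  unfolding primitive_def
  using bounded_density_set_integrable[OF assms(1), of 0 t] bounded_density_set_integrable[OF assms(2), of 0 t] assms(3)
  by (intro set_integral_add) auto

lemma primitive_minus:
  assumes "bounded_density T C f" "bounded_density T C' g" "t \<in> {0..T}"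
  shows "primitive (\<lambda>s. f s - g s) t = primitive f t - primitive g t"
  unfolding primitive_def
  using bounded_density_set_integrable[OF assms(1), of 0 t] bounded_density_set_integrable[OF assms(2), of 0 t] assms(3)
  by (intro set_integral_diff) auto

lemma primitive_mono_AE:
  assumes "bounded_density T C f" "bounded_density T C' g" "t \<in> {0..T}"
    and "AE s in lborel. s \<in> {0..T} \<longrightarrow> f s \<le> g s"
  shows "primitive f t \<le> primitive g t"
  unfolding primitive_def set_lebesgue_integral_def
proof (rule integral_mono_AE)
  show "integrable lborel (\<lambda>s. indicat_real {0..t} s *\<^sub>R f s)" "integrable lborel (\<lambda>s. indicat_real {0..t} s *\<^sub>R g s)"
    using bounded_density_set_integrable[OF assms(1), of 0 t] bounded_density_set_integrable[OF assms(2), of 0 t] assms(3)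
    by (auto simp: set_integrable_def)
  show "AE s in lborel. indicat_real {0..t} s *\<^sub>R f s \<le> indicat_real {0..t} s *\<^sub>R g s"
    using assms(4) by eventually_elim (use assms(3) in \<open>auto simp: indicator_def\<close>)
qed

lemma primitive_cong_AE:
  assumes "bounded_density T C f" "bounded_density T C' g" "t \<in> {0..T}"
    and "AE s in lborel. s \<in> {0..T} \<longrightarrow> f s = g s"
  shows "primitive f t = primitive g t"
proof (rule order.antisym)
  show "primitive f t \<le> primitive g t"
    by (rule primitive_mono_AE[OF assms(1-3)]) (use assms(4) in eventually_elim, auto)
  show "primitive g t \<le> primitive f t"
    by (rule primitive_mono_AE[OF assms(2,1,3)]) (use assms(4) in eventually_elim, auto)
qed

context geometric_dynamics
begin

text \<open>The explicit solution for the drift of the game. It stands in for \<open>state\<close>,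
  which is an arbitrary choice of a solution and agrees with it almost surely at each time.\<close>

definition model :: "(real \<Rightarrow> 'w \<Rightarrow> real) \<Rightarrow> (real \<Rightarrow> real measure) \<Rightarrow> real \<Rightarrow> 'w \<Rightarrow> real" where
  "model \<alpha> \<mu> t \<omega> = \<xi> \<omega> * exp (primitive (\<lambda>s. \<alpha> s \<omega> + m (\<mu> s)) t) * exp (\<sigma> * W_mod t \<omega> - \<sigma>\<^sup>2 * t / 2)"

lemma progressive_deterministic:
  assumes "f \<in> borel_measurable (restrict_space borel {0..T})"
  shows "progressive F T (\<lambda>s \<omega>. f s)"
proof (rule progressiveI)
  fix t assume "t \<in> {0..T}"
  then have "f \<in> borel_measurable (restrict_space borel {0..t})"
    by (intro measurable_restrict_mono[OF assms]) auto
  then show "(\<lambda>p. f (fst p)) \<in> borel_measurable (restrict_space borel {0..t} \<Otimes>\<^sub>M F t)"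
    by (rule measurable_compose[OF measurable_fst])
qed

lemma drift_is_bounded:
  obtains C where "\<And>\<alpha> \<mu>. \<alpha> \<in> controls \<Longrightarrow> \<mu> \<in> measurable_flows T \<Longrightarrow>
    bounded_drift M F T W \<sigma> \<xi> U m (\<lambda>s \<omega>. \<alpha> s \<omega> + m (\<mu> s)) C"
proof -
  obtain C where C: "\<And>\<alpha> \<mu> s \<omega>. \<alpha> \<in> controls \<Longrightarrow> \<mu> \<in> measurable_flows T \<Longrightarrow> s \<in> {0..T} \<Longrightarrow> \<omega> \<in> space M \<Longrightarrow>
    \<bar>\<alpha> s \<omega> + m (\<mu> s)\<bar> \<le> C \<and> \<bar>\<alpha> s \<omega>\<bar> \<le> C"
    by (rule drift_bound) blast
  show ?thesis
  proof (rule that[of C])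
    fix \<alpha> \<mu> assume *: "\<alpha> \<in> controls" "\<mu> \<in> measurable_flows T"
    show "bounded_drift M F T W \<sigma> \<xi> U m (\<lambda>s \<omega>. \<alpha> s \<omega> + m (\<mu> s)) C"
      by unfold_locales (use progressive_drift[OF *] C[OF *] in auto)
  qed
qed

text \<open>Existence gives the choice in \<open>state\<close> its meaning, and uniqueness
  identifies the chosen process with \<open>model\<close>.\<close>

lemma
  assumes \<alpha>: "\<alpha> \<in> controls" and \<mu>: "\<mu> \<in> measurable_flows T"
  shows sde_solution_state: "sde_solution \<alpha> \<mu> (state \<alpha> \<mu>)"
    and state_eq_model: "t \<in> {0..T} \<Longrightarrow> AE \<omega> in M. state \<alpha> \<mu> t \<omega> = model \<alpha> \<mu> t \<omega>"
    and progressive_model: "progressive F T (model \<alpha> \<mu>)"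
    and model_continuous: "\<omega> \<in> space M \<Longrightarrow> continuous_on {0..T} (\<lambda>t. model \<alpha> \<mu> t \<omega>)"
    and sq_norm_model: "sq_norm T (model \<alpha> \<mu>) < \<infinity>"
    and model_initial: "AE \<omega> in M. model \<alpha> \<mu> 0 \<omega> = \<xi> \<omega>"
proof -
  obtain C where C: "\<And>\<alpha> \<mu>. \<alpha> \<in> controls \<Longrightarrow> \<mu> \<in> measurable_flows T \<Longrightarrow>
    bounded_drift M F T W \<sigma> \<xi> U m (\<lambda>s \<omega>. \<alpha> s \<omega> + m (\<mu> s)) C"
    by (rule drift_is_bounded) blast
  interpret b: bounded_drift M F T W \<sigma> \<xi> U m "\<lambda>s \<omega>. \<alpha> s \<omega> + m (\<mu> s)" C
    by (rule C[OF \<alpha> \<mu>])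
  have explicit: "b.explicit = model \<alpha> \<mu>"
    by (simp add: fun_eq_iff b.explicit_def b.B_def model_def)
  have sol: "sde_solution \<alpha> \<mu> X \<longleftrightarrow> b.solution X" for X
    by (simp add: sde_solution_def b.solution_def)
  have "sde_solution \<alpha> \<mu> (model \<alpha> \<mu>)" using b.solution_explicit by (simp add: sol explicit)
  then show st: "sde_solution \<alpha> \<mu> (state \<alpha> \<mu>)" unfolding state_def by (rule someI[of "sde_solution \<alpha> \<mu>"])
  show "t \<in> {0..T} \<Longrightarrow> AE \<omega> in M. state \<alpha> \<mu> t \<omega> = model \<alpha> \<mu> t \<omega>"
    using b.solution_unique[OF _ b.solution_explicit] st by (simp add: sol explicit)
  show "progressive F T (model \<alpha> \<mu>)" using b.progressive_explicit by (simp add: explicit)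
  show "\<omega> \<in> space M \<Longrightarrow> continuous_on {0..T} (\<lambda>t. model \<alpha> \<mu> t \<omega>)"
    using b.explicit_continuous by (simp add: explicit)
  show "sq_norm T (model \<alpha> \<mu>) < \<infinity>"
    using b.solution_explicit by (simp add: explicit b.solution_def sq_norm_def)
  show "AE \<omega> in M. model \<alpha> \<mu> 0 \<omega> = \<xi> \<omega>"
    using b.AE_initial by eventually_elim (simp add: model_def)
qed

lemma progressive_state: "\<alpha> \<in> controls \<Longrightarrow> \<mu> \<in> measurable_flows T \<Longrightarrow> progressive F T (state \<alpha> \<mu>)"
  using sde_solution_state by (simp add: sde_solution_def)

text \<open>Tonelli for the squared difference interchanges the two almost-everywhere quantifiers.
  Costs and primitives integrate over time for a fixed outcome, whereas equality is first known the
  other way round.\<close>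

lemma path_eq_AE:
  assumes X: "progressive F T X" and Y: "progressive F T Y"
    and eq: "AE s in lborel. s \<in> {0..T} \<longrightarrow> (AE \<omega> in M. X s \<omega> = Y s \<omega>)"
  shows "AE \<omega> in M. AE s in lborel. s \<in> {0..T} \<longrightarrow> X s \<omega> = Y s \<omega>"
proof -
  have j: "joint_measurable T (\<lambda>s \<omega>. X s \<omega> - Y s \<omega>)"
    using progressive_joint_measurable[OF X, of T] progressive_joint_measurable[OF Y, of T] T_pos
    by (simp add: joint_measurable_def split_beta')
  have "sq_norm T (\<lambda>s \<omega>. X s \<omega> - Y s \<omega>) = (\<integral>\<^sup>+(s::real). 0 \<partial>lborel)"
    unfolding sq_norm_swap[OF less_imp_le[OF T_pos] j]
  proof (rule nn_integral_cong_AE)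
    show "AE s in lborel. (\<integral>\<^sup>+\<omega>. ennreal ((X s \<omega> - Y s \<omega>)\<^sup>2) \<partial>M) * indicator {0..T} s = 0"
      using eq
    proof eventually_elim
      case (elim s)
      show ?case
      proof (cases "s \<in> {0..T}")
        case True
        with elim have "AE \<omega> in M. ennreal ((X s \<omega> - Y s \<omega>)\<^sup>2) = 0" by (auto elim!: AE_mp)
        then have "(\<integral>\<^sup>+\<omega>. ennreal ((X s \<omega> - Y s \<omega>)\<^sup>2) \<partial>M) = (\<integral>\<^sup>+\<omega>. 0 \<partial>M)" by (rule nn_integral_cong_AE)
        then show ?thesis by simp
      qed simp
    qed
  qed
  then have "AE \<omega> in M. (\<integral>\<^sup>+s\<in>{0..T}. ennreal ((X s \<omega> - Y s \<omega>)\<^sup>2) \<partial>lborel) = 0"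
    using measurable_inner_sq_norm[OF less_imp_le[OF T_pos] j]
    by (simp add: sq_norm_def nn_integral_0_iff_AE)
  then show ?thesis
    using AE_space
  proof eventually_elim
    case (elim \<omega>)
    have "(\<lambda>s. ennreal ((indicat_real {0..T} s *\<^sub>R (X s \<omega> - Y s \<omega>))\<^sup>2)) \<in> borel_measurable lborel"
      using joint_measurable_section[OF j elim(2)] unfolding set_borel_measurable_def by measurable
    also have "(\<lambda>s. ennreal ((indicat_real {0..T} s *\<^sub>R (X s \<omega> - Y s \<omega>))\<^sup>2)) = (\<lambda>s. ennreal ((X s \<omega> - Y s \<omega>)\<^sup>2) * indicator {0..T} s)"
      by (auto simp: indicator_def)
    finally have "AE s in lborel. ennreal ((X s \<omega> - Y s \<omega>)\<^sup>2) * indicator {0..T} s = 0"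
      using elim(1) by (simp add: nn_integral_0_iff_AE)
    then show ?case by eventually_elim (auto simp: indicator_def)
  qed
qed

lemma control_density:
  assumes "\<alpha> \<in> controls" "\<omega> \<in> space M"
  obtains C where "bounded_density T C (\<lambda>s. \<alpha> s \<omega>)"
proof -
  obtain c where "\<And>a. a \<in> U \<Longrightarrow> \<bar>a\<bar> \<le> c"
    using compact_imp_bounded[OF U_compact] by (auto simp: bounded_iff)
  then have "bounded_density T c (\<lambda>s. \<alpha> s \<omega>)"
    using joint_measurable_section[OF progressive_joint_measurable, of \<alpha> T \<omega>] assms T_pos
    by (auto simp: bounded_density_def controls_def)
  then show ?thesis by (rule that)
qed

lemma m_flow_density:
  assumes "\<mu> \<in> measurable_flows T"
  obtains C where "bounded_density T C (\<lambda>s. m (\<mu> s))"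
proof -
  obtain c where "\<And>\<mu>. \<mu> \<in> prob_measures \<Longrightarrow> \<bar>m \<mu>\<bar> \<le> c"
    using m_bounded by (auto simp: bounded_iff)
  then have "bounded_density T c (\<lambda>s. m (\<mu> s))"
    using measurable_flow_compose[OF m_measurable assms] measurable_flows_prob_measures[OF assms]
    by (auto simp: bounded_density_def set_borel_measurable_def borel_measurable_restrict_space_iff)
  then show ?thesis by (rule that)
qed

text \<open>Separates a factor that no control or flow influences from one factor for the control
  and one for the flow; submodularity and monotonicity are read off from this form.\<close>

lemma model_eq:
  assumes "\<alpha> \<in> controls" "\<mu> \<in> measurable_flows T" "\<omega> \<in> space M" "t \<in> {0..T}"
  shows "model \<alpha> \<mu> t \<omega> = \<xi> \<omega> * exp (\<sigma> * W_mod t \<omega> - \<sigma>\<^sup>2 * t / 2) * (exp (primitive (\<lambda>s. \<alpha> s \<omega>) t) * exp (primitive (\<lambda>s. m (\<mu> s)) t))"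
proof -
  obtain c where c: "bounded_density T c (\<lambda>s. \<alpha> s \<omega>)" using control_density[OF assms(1,3)] .
  obtain c' where c': "bounded_density T c' (\<lambda>s. m (\<mu> s))" using m_flow_density[OF assms(2)] .
  show ?thesis using primitive_add[OF c c' assms(4)] by (simp add: model_def exp_add)
qed

section \<open>Switching between two controls\<close>

definition join :: "(real \<Rightarrow> 'w \<Rightarrow> real) \<Rightarrow> (real \<Rightarrow> 'w \<Rightarrow> real) \<Rightarrow> real \<Rightarrow> 'w \<Rightarrow> real" where
  "join \<alpha> \<beta> s \<omega> = (if primitive (\<lambda>u. \<alpha> u \<omega>) s > primitive (\<lambda>u. \<beta> u \<omega>) s then \<alpha> s \<omega> else \<beta> s \<omega>)"

text \<open>At each time it takes the control that \<open>join\<close> leaves aside, also when the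
  primitives tie, so sums of a function of the two controls are preserved.\<close>

definition meet :: "(real \<Rightarrow> 'w \<Rightarrow> real) \<Rightarrow> (real \<Rightarrow> 'w \<Rightarrow> real) \<Rightarrow> real \<Rightarrow> 'w \<Rightarrow> real" where
  "meet \<alpha> \<beta> s \<omega> = (if primitive (\<lambda>u. \<alpha> u \<omega>) s > primitive (\<lambda>u. \<beta> u \<omega>) s then \<beta> s \<omega> else \<alpha> s \<omega>)"

lemma
  assumes \<alpha>: "\<alpha> \<in> controls" and \<beta>: "\<beta> \<in> controls"
  shows join_in_controls: "join \<alpha> \<beta> \<in> controls" and meet_in_controls: "meet \<alpha> \<beta> \<in> controls"
proof -
  have p: "progressive F T \<alpha>" "progressive F T \<beta>" using \<alpha> \<beta> by (auto simp: controls_def)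
  have "progressive F T (join \<alpha> \<beta>) \<and> progressive F T (meet \<alpha> \<beta>)"
  proof (intro conjI progressiveI)
    fix t assume t: "t \<in> {0..T}"
    note [measurable] = progressiveD[OF p(1) t] progressiveD[OF p(2) t]
      progressiveD[OF progressive_primitive[OF p(1)] t] progressiveD[OF progressive_primitive[OF p(2)] t]
    show "(\<lambda>p. join \<alpha> \<beta> (fst p) (snd p)) \<in> borel_measurable (restrict_space borel {0..t} \<Otimes>\<^sub>M F t)"
      unfolding join_def by measurable
    show "(\<lambda>p. meet \<alpha> \<beta> (fst p) (snd p)) \<in> borel_measurable (restrict_space borel {0..t} \<Otimes>\<^sub>M F t)"
      unfolding meet_def by measurable
  qed
  then show "join \<alpha> \<beta> \<in> controls" "meet \<alpha> \<beta> \<in> controls"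
    using \<alpha> \<beta> by (auto simp: controls_def join_def meet_def)
qed

text \<open>\<open>join\<close> minus \<open>\<beta>\<close> is the density of the positive part of
  the difference of the primitives, so \<open>primitive_pos_part\<close> gives the maximum. The
  minimum follows since \<open>\<alpha>\<close> - \<open>meet\<close> equals \<open>join\<close> -
  \<open>\<beta>\<close>.\<close>

lemma
  assumes \<alpha>: "\<alpha> \<in> controls" and \<beta>: "\<beta> \<in> controls" and \<omega>: "\<omega> \<in> space M" and t: "t \<in> {0..T}"
  shows primitive_join: "primitive (\<lambda>s. join \<alpha> \<beta> s \<omega>) t = max (primitive (\<lambda>s. \<alpha> s \<omega>) t) (primitive (\<lambda>s. \<beta> s \<omega>) t)"
    and primitive_meet: "primitive (\<lambda>s. meet \<alpha> \<beta> s \<omega>) t = min (primitive (\<lambda>s. \<alpha> s \<omega>) t) (primitive (\<lambda>s. \<beta> s \<omega>) t)"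
proof -
  let ?A = "primitive (\<lambda>s. \<alpha> s \<omega>)" and ?B = "primitive (\<lambda>s. \<beta> s \<omega>)"
  obtain a where a: "bounded_density T a (\<lambda>s. \<alpha> s \<omega>)" using control_density[OF \<alpha> \<omega>] .
  obtain b where b: "bounded_density T b (\<lambda>s. \<beta> s \<omega>)" using control_density[OF \<beta> \<omega>] .
  obtain j where j: "bounded_density T j (\<lambda>s. join \<alpha> \<beta> s \<omega>)" using control_density[OF join_in_controls[OF \<alpha> \<beta>] \<omega>] .
  obtain k where k: "bounded_density T k (\<lambda>s. meet \<alpha> \<beta> s \<omega>)" using control_density[OF meet_in_controls[OF \<alpha> \<beta>] \<omega>] .
  let ?d = "\<lambda>s. \<alpha> s \<omega> - \<beta> s \<omega>"
  have d: "bounded_density T (a + b) ?d"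
    unfolding bounded_density_def
  proof
    show "set_borel_measurable borel {0..T} ?d"
      using a b unfolding bounded_density_def set_borel_measurable_def scaleR_diff_right by (intro borel_measurable_diff) auto
    show "\<forall>s\<in>{0..T}. \<bar>?d s\<bar> \<le> a + b" using a b by (force simp: bounded_density_def)
  qed
  have D: "primitive ?d s = ?A s - ?B s" if "s \<in> {0..T}" for s by (rule primitive_minus[OF a b that])
  have pos: "primitive (\<lambda>s. join \<alpha> \<beta> s \<omega> - \<beta> s \<omega>) t = max (?A t - ?B t) 0"
  proof -
    have "primitive (\<lambda>s. join \<alpha> \<beta> s \<omega> - \<beta> s \<omega>) t = primitive (\<lambda>s. if primitive ?d s > 0 then ?d s else 0) t"
      unfolding primitive_def[of _ t] set_lebesgue_integral_def
      using t D by (intro Bochner_Integration.integral_cong) (auto simp: indicator_def join_def)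
    then show ?thesis using primitive_pos_part[OF d t] D[OF t] by simp
  qed
  then show J: "primitive (\<lambda>s. join \<alpha> \<beta> s \<omega>) t = max (?A t) (?B t)"
    using primitive_minus[OF j b t] by (simp add: max_def split: if_splits)
  have "primitive (\<lambda>s. \<alpha> s \<omega> - meet \<alpha> \<beta> s \<omega>) t = primitive (\<lambda>s. join \<alpha> \<beta> s \<omega> - \<beta> s \<omega>) t"
    by (rule arg_cong[where f="\<lambda>f. primitive f t"]) (auto simp: join_def meet_def)
  then show "primitive (\<lambda>s. meet \<alpha> \<beta> s \<omega>) t = min (?A t) (?B t)"
    using pos primitive_minus[OF a k t] by (simp add: max_def min_def split: if_splits)
qed

end


section \<open>Essential infima\<close>

text \<open>Over countable subfamilies, the integral of the infimum attains its minimum, and adding one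
  more member to an optimal subfamily can change its infimum only on a null set.\<close>

lemma (in finite_measure) countable_essential_INF:
  fixes f :: "'i \<Rightarrow> 'a \<Rightarrow> real"
  assumes I: "I \<noteq> {}" and meas: "\<And>i. i \<in> I \<Longrightarrow> f i \<in> borel_measurable M"
    and bounds: "\<And>i x. i \<in> I \<Longrightarrow> x \<in> space M \<Longrightarrow> 0 \<le> f i x \<and> f i x \<le> 1"
  obtains C where "countable C" "C \<noteq> {}" "C \<subseteq> I"
    "\<And>i. i \<in> I \<Longrightarrow> AE x in M. (INF j\<in>C. f j x) \<le> f i x"
proof -
  define \<C> where "\<C> = {C. countable C \<and> C \<noteq> {} \<and> C \<subseteq> I}"
  define h where "h C x = (INF j\<in>C. f j x)" for C x
  define \<Phi> where "\<Phi> C = (\<integral>\<^sup>+x. ennreal (h C x) \<partial>M)" for C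
  have meas_h[measurable]: "h C \<in> borel_measurable M" if "C \<in> \<C>" for C
    using that meas unfolding h_def \<C>_def by (intro borel_measurable_cINF_real) auto
  have bdd: "bdd_below ((\<lambda>j. f j x) ` C)" if "C \<in> \<C>" "x \<in> space M" for C x
    using that bounds by (intro bdd_belowI[of _ 0]) (auto simp: \<C>_def)
  have h_mono: "h C x \<le> h D x" if "C \<in> \<C>" "D \<in> \<C>" "D \<subseteq> C" "x \<in> space M" for C D x
    using that bdd[of C x] unfolding h_def by (intro cINF_superset_mono) (auto simp: \<C>_def)
  have h_le: "h C x \<le> f i x" if "C \<in> \<C>" "i \<in> C" "x \<in> space M" for C i x
    using that bdd[of C x] unfolding h_def by (intro cINF_lower) auto
  have h_le1: "h C x \<le> 1" if "C \<in> \<C>" "x \<in> space M" for C x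
  proof -
    obtain i where "i \<in> C" "i \<in> I" using \<open>C \<in> \<C>\<close> by (auto simp: \<C>_def)
    then show ?thesis using h_le[OF that(1) _ that(2)] bounds[of i x] that by fastforce
  qed
  have \<Phi>_mono: "\<Phi> C \<le> \<Phi> D" if "C \<in> \<C>" "D \<in> \<C>" "D \<subseteq> C" for C D
    unfolding \<Phi>_def using h_mono[OF that] by (intro nn_integral_mono ennreal_leI) auto
  have \<Phi>_fin: "\<Phi> C < \<infinity>" if "C \<in> \<C>" for C
  proof -
    have "\<Phi> C \<le> (\<integral>\<^sup>+x. 1 \<partial>M)"
      unfolding \<Phi>_def using h_le1[OF that] by (intro nn_integral_mono) (simp add: ennreal_le_1)
    then show ?thesis using emeasure_finite[of "space M"]
      by (auto simp: less_top[symmetric] top_unique)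
  qed
  obtain i0 where "i0 \<in> I" using I by auto
  then have "{i0} \<in> \<C>" by (simp add: \<C>_def)
  then have "\<Phi> ` \<C> \<noteq> {}" by auto
  then obtain g :: "nat \<Rightarrow> ennreal" where g: "range g \<subseteq> \<Phi> ` \<C>" "Inf (\<Phi> ` \<C>) = (INF n. g n)"
    using ennreal_Inf_countable_INF[of "\<Phi> ` \<C>"] by auto
  then have "\<forall>n. \<exists>C. C \<in> \<C> \<and> g n = \<Phi> C" by auto
  then obtain Cs where Cs: "\<And>n. Cs n \<in> \<C>" "\<And>n. g n = \<Phi> (Cs n)" by metis
  \<comment> \<open>The union of a minimizing sequence of countable families is again countable, and
    its infimum lies below that of each of them.\<close>
  define C where "C = (\<Union>n. Cs n)"
  have C: "C \<in> \<C>" using Cs(1) by (auto simp: \<C>_def C_def)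
  have "\<Phi> C \<le> g n" for n
    using \<Phi>_mono[OF C Cs(1)[of n]] Cs(2) by (auto simp: C_def)
  then have "\<Phi> C \<le> Inf (\<Phi> ` \<C>)" unfolding g(2) by (intro INF_greatest)
  then have C_min: "\<Phi> C \<le> \<Phi> D" if "D \<in> \<C>" for D
    using that by (meson INF_lower order.trans)
  show ?thesis
  proof (rule that[of C])
    show "countable C" "C \<noteq> {}" "C \<subseteq> I" using C by (auto simp: \<C>_def)
    fix i assume i: "i \<in> I"
    define D where "D = insert i C"
    have D: "D \<in> \<C>" using C i by (auto simp: \<C>_def D_def)
    have "(\<integral>\<^sup>+x. ennreal (h C x) - ennreal (h D x) \<partial>M) = \<Phi> C - \<Phi> D"
      unfolding \<Phi>_def
    proof (rule nn_integral_diff)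
      show "AE x in M. ennreal (h D x) \<le> ennreal (h C x)"
        using h_mono[OF D C] by (intro AE_I2 ennreal_leI) (auto simp: D_def)
    qed (use C D \<Phi>_fin[OF D] in \<open>auto simp: \<Phi>_def\<close>)
    also have "\<dots> = 0"
      using C_min[OF D] \<Phi>_fin[OF D] by (intro diff_eq_0_ennreal) auto
    finally have eq0: "AE x in M. ennreal (h C x) - ennreal (h D x) = 0"
      using C D by (subst (asm) nn_integral_0_iff_AE) auto
    have le: "h C x \<le> f i x"
      if "x \<in> space M" "ennreal (h C x) - ennreal (h D x) = 0" for x
    proof -
      have "0 \<le> h D x" using that bounds D unfolding h_def
        by (intro cINF_greatest) (auto simp: \<C>_def)
      moreover have "ennreal (h C x) \<le> ennreal (h D x)"
        using that(2) by (simp add: diff_eq_0_iff_ennreal)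
      ultimately have "h C x \<le> h D x" by (simp add: ennreal_le_iff)
      also have "\<dots> \<le> f i x" using D that by (intro h_le) (auto simp: D_def)
      finally show ?thesis .
    qed
    from AE_space[of M] eq0 have "AE x in M. h C x \<le> f i x"
      by eventually_elim (rule le)
    then show "AE x in M. (INF j\<in>C. f j x) \<le> f i x"
      unfolding h_def .
  qed
qed


section \<open>The lattice of flows\<close>

text \<open>A function nearly minimal at \<open>a\<close> controls the infimum just to the right of
  it. Suprema of distribution functions lack this property, which is why the lattice is built from
  suprema in the stochastic order and infima are derived.\<close>

lemma right_continuous_INF_mono:
  fixes F :: "'i \<Rightarrow> real \<Rightarrow> real"
  assumes D: "D \<noteq> {}" and mono: "\<And>i. i \<in> D \<Longrightarrow> mono (F i)"
    and cont: "\<And>i. i \<in> D \<Longrightarrow> continuous (at_right a) (F i)"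
    and nonneg: "\<And>i s. i \<in> D \<Longrightarrow> 0 \<le> F i s"
  shows "mono (\<lambda>s. INF i\<in>D. F i s)" "continuous (at_right a) (\<lambda>s. INF i\<in>D. F i s)"
proof -
  have bdd: "bdd_below ((\<lambda>i. F i s) ` D)" for s
    using nonneg by (intro bdd_belowI[of _ 0]) auto
  show mono_INF: "mono (\<lambda>s. INF i\<in>D. F i s)"
  proof (intro monoI cINF_mono D bdd)
    fix x y :: real and m assume "x \<le> y" "m \<in> D"
    then show "\<exists>n\<in>D. F n x \<le> F m y" using mono[of m] by (intro bexI[of _ m]) (auto simp: mono_def)
  qed
  show "continuous (at_right a) (\<lambda>s. INF i\<in>D. F i s)"
  proof (subst continuous_at_right_real_increasing)
    show "\<forall>e>0. \<exists>d>0. (INF i\<in>D. F i (a + d)) - (INF i\<in>D. F i a) < e"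
    proof (intro allI impI)
      fix e :: real assume "0 < e"
      then have "(INF i\<in>D. F i a) < (INF i\<in>D. F i a) + e / 2" by simp
      then obtain i where i: "i \<in> D" "F i a < (INF i\<in>D. F i a) + e / 2"
        unfolding cINF_less_iff[OF D bdd] by blast
      have "\<forall>e>0. \<exists>d>0. F i (a + d) - F i a < e"
        using cont[OF i(1)] continuous_at_right_real_increasing[of "F i" a] mono[OF i(1)]
        by (auto simp: mono_def)
      then obtain d where d: "d > 0" "F i (a + d) - F i a < e / 2"
        using \<open>0 < e\<close> half_gt_zero by blast
      have "(INF i\<in>D. F i (a + d)) \<le> F i (a + d)" using bdd i(1) by (intro cINF_lower)
      then have "(INF i\<in>D. F i (a + d)) - (INF i\<in>D. F i a) < e" using d i by linarith
      then show "\<exists>d>0. (INF i\<in>D. F i (a + d)) - (INF i\<in>D. F i a) < e" using d(1) by blast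
    qed
  qed (use mono_INF in \<open>auto simp: mono_def\<close>)
qed

text \<open>An infimum of distribution functions can lose mass at infinity; squeezing it between two
  distribution functions restores the limits.\<close>

lemma distribution_function_clip:
  assumes lo: "distribution_function lo" and hi: "distribution_function hi" and "\<And>s. lo s \<le> hi s"
    and G: "mono G" "\<And>a. continuous (at_right a) G"
  shows "distribution_function (\<lambda>s. max (lo s) (min (hi s) (G s)))"
  unfolding distribution_function_def
proof (intro conjI allI)
  show "mono (\<lambda>s. max (lo s) (min (hi s) (G s)))"
    using lo hi G unfolding distribution_function_def mono_def by (meson max.mono min.mono)
  show "continuous (at_right a) (\<lambda>s. max (lo s) (min (hi s) (G s)))" for a
    using lo hi G unfolding distribution_function_def by (intro continuous_intros) auto
  show "((\<lambda>s. max (lo s) (min (hi s) (G s))) \<longlongrightarrow> 0) at_bot"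
    by (rule tendsto_sandwich[of lo _ _ hi])
       (use assms in \<open>auto simp: distribution_function_def\<close>)
  show "((\<lambda>s. max (lo s) (min (hi s) (G s))) \<longlongrightarrow> 1) at_top"
    by (rule tendsto_sandwich[of lo _ _ hi])
       (use assms in \<open>auto simp: distribution_function_def\<close>)
qed

lemma max_df_le_min_df: "0 < K \<Longrightarrow> max_df K s \<le> min_df K s"
  by (auto simp: max_df_def min_df_def)

section \<open>Suprema of countable and of arbitrary families of flows\<close>

context geometric_mfg
begin

lemma law_xi: "distr M borel \<xi> \<in> prob_measures"
proof -
  interpret prob_space M by (rule prob_M)
  show ?thesis
    using measurable_F_M[OF _ xi_measurable] T_pos by (simp add: prob_measures_def)
qed

lemma flows_prob: "\<mu> \<in> flows \<Longrightarrow> t \<in> {0..T} \<Longrightarrow> \<mu> t \<in> prob_measures"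
  using measurable_flows_prob_measures by (simp add: flows_def)

lemma measurable_flow_cdf:
  assumes "\<mu> \<in> flows"
  shows "(\<lambda>t. cdf (\<mu> t) s) \<in> borel_measurable (restrict_space borel {0..T})"
  using measurable_compose[of \<mu> _ weak_borel, OF _ measurable_weak_borel_cdf] assms
  by (auto simp: flows_def measurable_flows_def)

lemma cdf_flow_bounds:
  assumes "\<mu> \<in> flows" "t \<in> {0..T}"
  shows "0 \<le> cdf (\<mu> t) s" "cdf (\<mu> t) s \<le> 1"
proof -
  interpret real_distribution "\<mu> t" using flows_prob[OF assms] by (simp add: prob_measures_def)
  show "0 \<le> cdf (\<mu> t) s" "cdf (\<mu> t) s \<le> 1" by (auto simp: cdf_nonneg cdf_bounded_prob)
qed

text \<open>A supremum in the stochastic order is an infimum of distribution functions.  Clipping keeps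
  the value a probability measure on the null set where the flows leave the bounds.\<close>

definition sup_flow :: "(real \<Rightarrow> real measure) set \<Rightarrow> real \<Rightarrow> real measure" where
  "sup_flow D t = (if t = 0 then distr M borel \<xi> else
     interval_measure (\<lambda>s. max (max_df K s) (min (min_df K s) (INF \<nu>\<in>D. cdf (\<nu> t) s))))"

lemma
  assumes D: "D \<subseteq> flows" "D \<noteq> {}" and t: "t \<in> {0..T}" "t \<noteq> 0"
  shows sup_flow_prob: "sup_flow D t \<in> prob_measures"
    and cdf_sup_flow: "cdf (sup_flow D t) s = max (max_df K s) (min (min_df K s) (INF \<nu>\<in>D. cdf (\<nu> t) s))"
proof -
  have df: "distribution_function (cdf (\<nu> t))" if "\<nu> \<in> D" for \<nu>
    using that D t flows_prob by (auto simp: prob_measures_def intro!: distribution_function_cdf)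
  have "mono (\<lambda>s. INF \<nu>\<in>D. cdf (\<nu> t) s)"
    and "continuous (at_right a) (\<lambda>s. INF \<nu>\<in>D. cdf (\<nu> t) s)" for a
    using D df t cdf_flow_bounds
    by (auto simp: distribution_function_def intro!: right_continuous_INF_mono)
  then have "distribution_function (\<lambda>s. max (max_df K s) (min (min_df K s) (INF \<nu>\<in>D. cdf (\<nu> t) s)))"
    by (intro distribution_function_clip distribution_function_min_df distribution_function_max_df
        max_df_le_min_df K_pos)
  from distribution_function_interval_measure[OF this]
  show "sup_flow D t \<in> prob_measures"
    "cdf (sup_flow D t) s = max (max_df K s) (min (min_df K s) (INF \<nu>\<in>D. cdf (\<nu> t) s))"
    using t by (auto simp: sup_flow_def prob_measures_def)
qed

lemma sup_flow_in_flows: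
  assumes D: "D \<subseteq> flows" "D \<noteq> {}" "countable D"
  shows "sup_flow D \<in> flows"
proof -
  let ?N = "restrict_space borel {0..T}"
  have prob: "sup_flow D t \<in> prob_measures" if "t \<in> {0..T}" for t
    using sup_flow_prob[OF D(1,2) that] law_xi by (cases "t = 0") (auto simp: sup_flow_def)
  have "sup_flow D \<in> measurable_flows T"
    unfolding measurable_flows_def
  proof (rule measurable_weak_borelI)
    show "sup_flow D t \<in> prob_measures" if "t \<in> space ?N" for t
      using prob that by (simp add: space_restrict_space)
    fix q :: rat
    let ?s = "of_rat q :: real"
    have [measurable]: "(\<lambda>t. cdf (\<nu> t) ?s) \<in> borel_measurable ?N" if "\<nu> \<in> D" for \<nu>
      using that D measurable_flow_cdf by auto
    have [measurable]: "(\<lambda>t. INF \<nu>\<in>D. cdf (\<nu> t) ?s) \<in> borel_measurable ?N"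
      using D(3) by (intro borel_measurable_cINF_real) auto
    have "{t \<in> space ?N. t = 0} \<in> sets ?N"
      by (auto simp: sets_restrict_space space_restrict_space)
    then have "(\<lambda>t. if t = 0 then cdf (distr M borel \<xi>) ?s else
        max (max_df K ?s) (min (min_df K ?s) (INF \<nu>\<in>D. cdf (\<nu> t) ?s))) \<in> borel_measurable ?N"
      by (intro measurable_If) auto
    also have "?this \<longleftrightarrow> (\<lambda>t. cdf (sup_flow D t) ?s) \<in> borel_measurable ?N"
      using cdf_sup_flow[OF D(1,2)]
      by (intro measurable_cong) (auto simp: space_restrict_space sup_flow_def)
    finally show "(\<lambda>t. cdf (sup_flow D t) ?s) \<in> borel_measurable ?N" .
  qed
  moreover have "AE t in time_measure T. 0 < t \<longrightarrow> st_le (mu_min K) (sup_flow D t) \<and> st_le (sup_flow D t) (mu_max K)"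
  proof (rule AE_time_measureI[OF T_pos])
    fix t assume "t \<in> {0..T}"
    then show "0 < t \<longrightarrow> st_le (mu_min K) (sup_flow D t) \<and> st_le (sup_flow D t) (mu_max K)"
      using max_df_le_min_df[OF K_pos] K_pos cdf_sup_flow[OF D(1,2), of t]
      by (auto simp: st_le_def cdf_mu_min cdf_mu_max)
  qed
  ultimately show ?thesis by (simp add: flows_def sup_flow_def)
qed

text \<open>The least flow up to null sets. Adding it to a family makes the family nonempty without
  changing its upper bounds.\<close>

definition bottom_flow :: "real \<Rightarrow> real measure" where
  "bottom_flow t = (if t = 0 then distr M borel \<xi> else mu_min K)"

lemma bottom_flow_in_flows: "bottom_flow \<in> flows"
proof -
  let ?N = "restrict_space borel {0..T}"
  have "{t \<in> space ?N. t = 0} \<in> sets ?N"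
    by (auto simp: sets_restrict_space space_restrict_space)
  then have "bottom_flow \<in> measurable_flows T"
    unfolding measurable_flows_def bottom_flow_def[abs_def]
    using law_xi mu_min_in_prob_measures[OF K_pos]
    by (intro measurable_If measurable_const) (auto simp: space_weak_borel)
  moreover have "AE t in time_measure T. 0 < t \<longrightarrow> st_le (mu_min K) (bottom_flow t) \<and> st_le (bottom_flow t) (mu_max K)"
    using max_df_le_min_df[OF K_pos] K_pos
    by (intro AE_time_measureI[OF T_pos]) (auto simp: bottom_flow_def st_le_def cdf_mu_min cdf_mu_max)
  ultimately show ?thesis by (simp add: flows_def bottom_flow_def)
qed

lemma bottom_flow_le:
  assumes "\<mu> \<in> flows"
  shows "AE t in time_measure T. st_le (bottom_flow t) (\<mu> t)"
proof -
  have "AE t in time_measure T. t \<in> {0..T}" by (rule AE_time_measureI[OF T_pos])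
  moreover have "AE t in time_measure T. 0 < t \<longrightarrow> st_le (mu_min K) (\<mu> t)"
    using assms by (auto simp: flows_def)
  ultimately show ?thesis
  proof eventually_elim
    case (elim t)
    then show ?case using assms by (auto simp: bottom_flow_def st_le_refl flows_def)
  qed
qed

text \<open>Each rational has its own optimal countable subfamily; their union \<open>D\<close> is
  still countable and works at all rationals at once, which decides the stochastic order.
  Countability makes the supremum measurable and lets an upper bound dominate all of
  \<open>D\<close> off a single null set.\<close>

lemma flows_sup_exists:
  assumes S: "S \<subseteq> flows" "S \<noteq> {}"
  obtains \<kappa> where "\<kappa> \<in> flows"
    "\<And>\<mu>. \<mu> \<in> S \<Longrightarrow> AE t in time_measure T. st_le (\<mu> t) (\<kappa> t)"
    "\<And>\<rho>. \<rho> \<in> flows \<Longrightarrow> (\<And>\<mu>. \<mu> \<in> S \<Longrightarrow> AE t in time_measure T. st_le (\<mu> t) (\<rho> t)) \<Longrightarrow>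
       AE t in time_measure T. st_le (\<kappa> t) (\<rho> t)"
proof -
  let ?\<pi> = "time_measure T"
  interpret \<pi>: finite_measure ?\<pi> by (rule finite_measure_time_measure[OF T_pos])
  have "\<exists>C. countable C \<and> C \<noteq> {} \<and> C \<subseteq> S \<and>
      (\<forall>\<mu>\<in>S. AE t in ?\<pi>. (INF \<nu>\<in>C. cdf (\<nu> t) (of_rat q)) \<le> cdf (\<mu> t) (of_rat q))" for q :: rat
  proof -
    have "(\<lambda>t. cdf (\<mu> t) (of_rat q)) \<in> borel_measurable ?\<pi>" if "\<mu> \<in> S" for \<mu>
      using measurable_flow_cdf[of \<mu>] S that
      by (auto simp: measurable_cong_sets[OF sets_time_measure[OF T_pos] refl])
    moreover have "0 \<le> cdf (\<mu> t) (of_rat q) \<and> cdf (\<mu> t) (of_rat q) \<le> 1" if "\<mu> \<in> S" "t \<in> space ?\<pi>" for \<mu> t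
      using that S cdf_flow_bounds T_pos by (auto simp: space_time_measure)
    ultimately show ?thesis
      by (rule \<pi>.countable_essential_INF[OF S(2), of "\<lambda>\<mu> t. cdf (\<mu> t) (of_rat q)"]) blast+
  qed
  then have "\<exists>C. \<forall>q. countable (C q) \<and> C q \<noteq> {} \<and> C q \<subseteq> S \<and>
      (\<forall>\<mu>\<in>S. AE t in ?\<pi>. (INF \<nu>\<in>C q. cdf (\<nu> t) (of_rat q)) \<le> cdf (\<mu> t) (of_rat q))"
    by (intro choice allI)
  then obtain C where C': "\<forall>q. countable (C q) \<and> C q \<noteq> {} \<and> C q \<subseteq> S \<and>
      (\<forall>\<mu>\<in>S. AE t in ?\<pi>. (INF \<nu>\<in>C q. cdf (\<nu> t) (of_rat q)) \<le> cdf (\<mu> t) (of_rat q))" ..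
  then have C: "countable (C q)" "C q \<noteq> {}" "C q \<subseteq> S"
    "\<mu> \<in> S \<Longrightarrow> AE t in ?\<pi>. (INF \<nu>\<in>C q. cdf (\<nu> t) (of_rat q)) \<le> cdf (\<mu> t) (of_rat q)" for q \<mu>
    by simp_all
  define D where "D = (\<Union>q. C q)"
  have "D \<subseteq> S" using C(3) by (auto simp: D_def)
  then have D: "D \<subseteq> flows" "D \<noteq> {}" "countable D" "D \<subseteq> S"
    using C(1,2) S by (auto simp: D_def)
  have dom: "AE t in ?\<pi>. t \<in> {0..T}" by (rule AE_time_measureI[OF T_pos])
  have "AE t in ?\<pi>. \<forall>\<nu>\<in>D. 0 < t \<longrightarrow> st_le (mu_min K) (\<nu> t) \<and> st_le (\<nu> t) (mu_max K)"
    using D by (subst AE_ball_countable) (auto simp: flows_def)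
  \<comment> \<open>Off one null set all members of \<open>D\<close> respect the bounds, and there
    clipping has no effect.\<close>
  then have cdf_sup: "AE t in ?\<pi>. t \<noteq> 0 \<longrightarrow> (\<forall>s. cdf (sup_flow D t) s = (INF \<nu>\<in>D. cdf (\<nu> t) s))"
    using dom
  proof eventually_elim
    case (elim t)
    show ?case
    proof (intro impI allI)
      fix s assume "t \<noteq> 0"
      then have t: "0 < t" using elim by auto
      obtain \<nu>0 where "\<nu>0 \<in> D" using D by auto
      have bdd: "bdd_below ((\<lambda>\<nu>. cdf (\<nu> t) s) ` D)"
        using cdf_flow_bounds D elim by (intro bdd_belowI[of _ 0]) blast
      have "max_df K s \<le> cdf (\<nu> t) s \<and> cdf (\<nu> t) s \<le> min_df K s" if "\<nu> \<in> D" for \<nu>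
        using elim that t K_pos by (auto simp: st_le_def cdf_mu_min cdf_mu_max)
      then have "max_df K s \<le> (INF \<nu>\<in>D. cdf (\<nu> t) s)" "(INF \<nu>\<in>D. cdf (\<nu> t) s) \<le> min_df K s"
        using D(2) cINF_lower2[OF bdd \<open>\<nu>0 \<in> D\<close>] \<open>\<nu>0 \<in> D\<close> by (auto intro!: cINF_greatest)
      then show "cdf (sup_flow D t) s = (INF \<nu>\<in>D. cdf (\<nu> t) s)"
        using cdf_sup_flow[OF D(1,2) elim(2) \<open>t \<noteq> 0\<close>] by simp
    qed
  qed
  note in_flows = sup_flow_in_flows[OF D(1-3)]
  show ?thesis
  proof (rule that[OF in_flows])
    fix \<mu> assume \<mu>: "\<mu> \<in> S"
    have "AE t in ?\<pi>. \<forall>q. (INF \<nu>\<in>C q. cdf (\<nu> t) (of_rat q)) \<le> cdf (\<mu> t) (of_rat q)"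
      using C(4)[OF \<mu>] by (simp add: AE_all_countable)
    then show "AE t in ?\<pi>. st_le (\<mu> t) (sup_flow D t)"
      using cdf_sup dom
    proof eventually_elim
      case (elim t)
      show ?case
      proof (cases "t = 0")
        case True
        then show ?thesis using \<mu> S by (auto simp: flows_def sup_flow_def st_le_refl)
      next
        case False
        have bdd: "bdd_below ((\<lambda>\<nu>. cdf (\<nu> t) s) ` D)" for s
          using cdf_flow_bounds D elim by (intro bdd_belowI[of _ 0]) blast
        have "cdf (sup_flow D t) (of_rat q) \<le> cdf (\<mu> t) (of_rat q)" for q
        proof -
          have "(INF \<nu>\<in>D. cdf (\<nu> t) (of_rat q)) \<le> (INF \<nu>\<in>C q. cdf (\<nu> t) (of_rat q))"
            using C(2) bdd by (intro cINF_superset_mono) (auto simp: D_def)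
          then show ?thesis using elim(1)[rule_format, of q] elim(2) False by simp
        qed
        then show ?thesis
          using flows_prob[OF in_flows elim(3)] flows_prob[of \<mu>] \<mu> S elim(3) by (intro st_le_rat) auto
      qed
    qed
  next
    fix \<rho> assume \<rho>: "\<rho> \<in> flows" and ub: "\<And>\<mu>. \<mu> \<in> S \<Longrightarrow> AE t in ?\<pi>. st_le (\<mu> t) (\<rho> t)"
    have "AE t in ?\<pi>. \<forall>\<nu>\<in>D. st_le (\<nu> t) (\<rho> t)"
      using D ub by (subst AE_ball_countable) auto
    then show "AE t in ?\<pi>. st_le (sup_flow D t) (\<rho> t)"
      using cdf_sup
    proof eventually_elim
      case (elim t)
      show ?case
      proof (cases "t = 0")
        case True
        then show ?thesis using \<rho> by (auto simp: flows_def sup_flow_def st_le_refl)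
      next
        case False
        then show ?thesis
          using elim D(2) by (auto simp: st_le_def intro!: cINF_greatest)
      qed
    qed
  qed
qed

section \<open>Classes of flows, completeness and fixed points\<close>

lemma equiv_flow_equiv: "equiv flows flow_equiv"
proof (rule equivI)
  show "flow_equiv \<subseteq> flows \<times> flows" by (auto simp: flow_equiv_def)
  show "refl_on flows flow_equiv" by (auto simp: refl_on_def flow_equiv_def)
  show "sym flow_equiv" by (auto simp: sym_def flow_equiv_def elim: AE_mp)
  show "trans flow_equiv" by (auto simp: trans_def flow_equiv_def elim!: AE_mp)
qed

abbreviation flow_class :: "(real \<Rightarrow> real measure) \<Rightarrow> (real \<Rightarrow> real measure) set" where
  "flow_class \<mu> \<equiv> flow_equiv `` {\<mu>}"

lemma flow_class_in_L: "\<mu> \<in> flows \<Longrightarrow> flow_class \<mu> \<in> L"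
  by (simp add: L_def quotientI)

lemma L_E:
  assumes "C \<in> L"
  obtains \<mu> where "\<mu> \<in> flows" "C = flow_class \<mu>"
  using assms by (auto simp: L_def elim: quotientE)

lemma flow_equiv_iff_st_le:
  assumes "\<mu> \<in> flows" "\<nu> \<in> flows"
    and "AE t in time_measure T. st_le (\<mu> t) (\<nu> t)" "AE t in time_measure T. st_le (\<nu> t) (\<mu> t)"
  shows "flow_class \<mu> = flow_class \<nu>"
proof -
  have "AE t in time_measure T. t \<in> {0..T}" by (rule AE_time_measureI[OF T_pos])
  with assms(3,4) have "AE t in time_measure T. \<mu> t = \<nu> t"
    by eventually_elim (use assms(1,2) flows_prob in \<open>auto intro: st_le_antisym\<close>)
  then have "(\<mu>, \<nu>) \<in> flow_equiv" using assms(1,2) by (simp add: flow_equiv_def)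
  then show ?thesis by (rule equiv_class_eq[OF equiv_flow_equiv])
qed

text \<open>\<open>L_le\<close> asks for some pair of representatives; these differ from the given
  ones only on null sets, so any pair decides.\<close>

lemma L_le_class_iff:
  assumes "\<mu> \<in> flows" "\<nu> \<in> flows"
  shows "L_le (flow_class \<mu>) (flow_class \<nu>) \<longleftrightarrow> (AE t in time_measure T. st_le (\<mu> t) (\<nu> t))"
proof
  assume "L_le (flow_class \<mu>) (flow_class \<nu>)"
  then obtain \<mu>' \<nu>' where "AE t in time_measure T. \<mu> t = \<mu>' t" "AE t in time_measure T. \<nu> t = \<nu>' t"
    "AE t in time_measure T. st_le (\<mu>' t) (\<nu>' t)"
    by (auto simp: L_le_def flow_equiv_def)
  then show "AE t in time_measure T. st_le (\<mu> t) (\<nu> t)" by eventually_elim auto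
next
  have "\<mu> \<in> flow_class \<mu>" "\<nu> \<in> flow_class \<nu>"
    using assms by (auto simp: flow_equiv_def)
  then show "AE t in time_measure T. st_le (\<mu> t) (\<nu> t) \<Longrightarrow> L_le (flow_class \<mu>) (flow_class \<nu>)"
    unfolding L_le_def by blast
qed

definition L_order :: "(real \<Rightarrow> real measure) set gorder" where
  "L_order = \<lparr>carrier = L, eq = (=), le = L_le\<rparr>"

lemma L_order_simps [simp]: "carrier L_order = L" "eq L_order = (=)" "le L_order = L_le"
  by (simp_all add: L_order_def)

lemma partial_order_L: "partial_order L_order"
proof
  fix x y z
  show "x \<in> carrier L_order \<Longrightarrow> x \<sqsubseteq>\<^bsub>L_order\<^esub> x"
    by (auto elim!: L_E simp: L_le_class_iff st_le_refl)
  show "x \<sqsubseteq>\<^bsub>L_order\<^esub> y \<Longrightarrow> y \<sqsubseteq>\<^bsub>L_order\<^esub> x \<Longrightarrow> x \<in> carrier L_order \<Longrightarrow> y \<in> carrier L_order \<Longrightarrow> x .=\<^bsub>L_order\<^esub> y"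
    by (clarsimp elim!: L_E simp: L_le_class_iff) (rule flow_equiv_iff_st_le)
  show "x \<sqsubseteq>\<^bsub>L_order\<^esub> y \<Longrightarrow> y \<sqsubseteq>\<^bsub>L_order\<^esub> z \<Longrightarrow> x \<in> carrier L_order \<Longrightarrow> y \<in> carrier L_order \<Longrightarrow>
    z \<in> carrier L_order \<Longrightarrow> x \<sqsubseteq>\<^bsub>L_order\<^esub> z"
    by (clarsimp elim!: L_E simp: L_le_class_iff, eventually_elim) (blast intro: st_le_trans)
qed auto

text \<open>Suprema come from \<open>flows_sup_exists\<close>, applied to all representatives at
  once; \<open>bottom_flow\<close> takes care of the empty set. An infimum is the supremum of the
  lower bounds.\<close>

lemma complete_lattice_L: "complete_lattice L_order"
proof -
  interpret partial_order L_order by (rule partial_order_L)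
  have sup: "\<exists>s. least L_order s (Upper L_order A)" if A: "A \<subseteq> carrier L_order" for A
  proof -
    define S where "S = insert bottom_flow {\<mu> \<in> flows. flow_class \<mu> \<in> A}"
    have "S \<subseteq> flows" "S \<noteq> {}" using bottom_flow_in_flows by (auto simp: S_def)
    then obtain \<kappa> where \<kappa>: "\<kappa> \<in> flows"
      "\<And>\<mu>. \<mu> \<in> S \<Longrightarrow> AE t in time_measure T. st_le (\<mu> t) (\<kappa> t)"
      "\<And>\<rho>. \<rho> \<in> flows \<Longrightarrow> (\<And>\<mu>. \<mu> \<in> S \<Longrightarrow> AE t in time_measure T. st_le (\<mu> t) (\<rho> t)) \<Longrightarrow>
         AE t in time_measure T. st_le (\<kappa> t) (\<rho> t)"
      using flows_sup_exists by blast
    have "least L_order (flow_class \<kappa>) (Upper L_order A)"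
    proof (rule least_UpperI)
      fix C assume C: "C \<in> A"
      then obtain \<mu> where \<mu>: "\<mu> \<in> flows" "C = flow_class \<mu>" using A by (auto elim: L_E)
      then have "\<mu> \<in> S" using C by (auto simp: S_def)
      then show "C \<sqsubseteq>\<^bsub>L_order\<^esub> flow_class \<kappa>" using \<kappa> \<mu> by (simp add: L_le_class_iff)
    next
      fix C assume C: "C \<in> Upper L_order A"
      then have "C \<in> L" by (auto simp: Upper_def)
      then obtain \<rho> where \<rho>: "\<rho> \<in> flows" "C = flow_class \<rho>" by (auto elim: L_E)
      have "AE t in time_measure T. st_le (\<kappa> t) (\<rho> t)"
      proof (rule \<kappa>(3)[OF \<rho>(1)])
        fix \<mu> assume "\<mu> \<in> S"
        then consider "\<mu> = bottom_flow" | "\<mu> \<in> flows" "flow_class \<mu> \<in> A" by (auto simp: S_def)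
        then show "AE t in time_measure T. st_le (\<mu> t) (\<rho> t)"
        proof cases
          case 1
          then show ?thesis using bottom_flow_le[OF \<rho>(1)] by simp
        next
          case 2
          then have "flow_class \<mu> \<sqsubseteq>\<^bsub>L_order\<^esub> C" using C A by (auto simp: Upper_def)
          then show ?thesis using 2 \<rho> by (simp add: L_le_class_iff)
        qed
      qed
      then show "flow_class \<kappa> \<sqsubseteq>\<^bsub>L_order\<^esub> C" using \<kappa>(1) \<rho> by (simp add: L_le_class_iff)
    qed (use A \<kappa>(1) flow_class_in_L in auto)
    then show ?thesis by blast
  qed
  show ?thesis
  proof (rule complete_latticeI)
    fix A assume A: "A \<subseteq> carrier L_order"
    have B: "Lower L_order A \<subseteq> carrier L_order" by (rule Lower_closed)
    obtain s where s: "least L_order s (Upper L_order (Lower L_order A))" using sup[OF B] by blast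
    have "greatest L_order s (Lower L_order A)"
    proof (rule greatest_LowerI)
      fix x assume "x \<in> A"
      then have "x \<in> Upper L_order (Lower L_order A)" using A by (auto simp: Upper_def Lower_def)
      then show "s \<sqsubseteq>\<^bsub>L_order\<^esub> x" using s by (auto simp: least_def)
    next
      fix y assume "y \<in> Lower L_order A"
      then show "y \<sqsubseteq>\<^bsub>L_order\<^esub> s" using least_Upper_above[OF s _ B] by blast
    qed (fact A, rule least_closed[OF s])
    then show "\<exists>i. greatest L_order i (Lower L_order A)" by blast
  qed (rule sup)
qed

lemma equilibria_complete_lattice:
  assumes maps: "\<And>C. C \<in> L \<Longrightarrow> R C \<in> L"
    and mono: "\<And>C D. C \<in> L \<Longrightarrow> D \<in> L \<Longrightarrow> L_le C D \<Longrightarrow> L_le (R C) (R D)"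
  shows "equilibria \<noteq> {} \<and> complete_lattice equilibrium_order"
proof -
  interpret L: complete_lattice L_order by (rule complete_lattice_L)
  have "isotone L_order L_order R"
    using mono L.weak_partial_order_axioms by (auto simp: isotone_def)
  then have wcl: "weak_complete_lattice (fpl L_order R)"
    using maps by (intro Knaster_Tarski L.weak.weak_complete_lattice_axioms) auto
  have fpl: "fpl L_order R = equilibrium_order"
    by (simp add: L_order_def equilibrium_order_def equilibria_def fps_def)
  interpret E: weak_complete_lattice equilibrium_order using wcl by (simp add: fpl)
  \<comment> \<open>Tarski's theorem yields a complete lattice up to \<open>eq\<close>. Here
    \<open>eq\<close> is equality, so the order is antisymmetric in the strict sense.\<close>
  have po: "partial_order equilibrium_order"
    by unfold_locales (simp add: equilibrium_order_def)
  have "complete_lattice equilibrium_order"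
    by (rule partial_order.complete_latticeI[OF po]) (use E.sup_exists E.inf_exists in auto)
  \<comment> \<open>The infimum of the empty set is a greatest equilibrium, so at least one
    exists.\<close>
  moreover have "\<exists>g. greatest equilibrium_order g (Lower equilibrium_order {})"
    using E.inf_exists[of "{}"] by simp
  then have "carrier equilibrium_order \<noteq> {}"
    using greatest_closed by fastforce
  ultimately show ?thesis by (simp add: equilibrium_order_def)
qed

end


section \<open>Submodularity and monotonicity of the best response\<close>

context geometric_mfg
begin

lemma flows_measurable: "\<mu> \<in> flows \<Longrightarrow> \<mu> \<in> measurable_flows T"
  by (simp add: flows_def)

text \<open>\<open>\<psi>\<close> is bounded only from above. Along a flow its monotonicity and the
  upper bound \<open>mu_max\<close> supply a lower bound, which makes the cost integrable; time 0,
  on which the bounds of \<open>flows\<close> are silent, is Lebesgue null.\<close>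

lemma psi_flow_bound:
  assumes \<mu>: "\<mu> \<in> flows"
  shows "AE t in lborel. t \<in> {0..T} \<longrightarrow> \<psi> (\<mu> t) \<le> 0 \<and> \<bar>\<psi> (\<mu> t)\<bar> \<le> - \<psi> (mu_max K)"
proof -
  have "AE t in time_measure T. 0 < t \<longrightarrow> st_le (\<mu> t) (mu_max K)"
    using \<mu> by (auto simp: flows_def)
  from AE_time_measure_lborel[OF T_pos this] AE_lborel_singleton[of "0::real"]
  show ?thesis
  proof eventually_elim
    case (elim t)
    show ?case
    proof
      assume t: "t \<in> {0..T}"
      then have p: "\<mu> t \<in> prob_measures" using measurable_flows_prob_measures[OF flows_measurable[OF \<mu>]] by blast
      have "\<psi> (mu_max K) \<le> \<psi> (\<mu> t)"
        using elim t by (intro psi_decreasing p mu_max_in_prob_measures K_pos) auto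
      then show "\<psi> (\<mu> t) \<le> 0 \<and> \<bar>\<psi> (\<mu> t)\<bar> \<le> - \<psi> (mu_max K)" using psi_nonpos[OF p] by linarith
    qed
  qed
qed

text \<open>The integrand of \<open>J\<close> with \<open>model\<close>, whose paths are continuous,
  in the place of \<open>state\<close>.\<close>

definition running :: "(real \<Rightarrow> 'w \<Rightarrow> real) \<Rightarrow> (real \<Rightarrow> real measure) \<Rightarrow> real \<Rightarrow> 'w \<Rightarrow> real" where
  "running \<alpha> \<mu> t \<omega> = (\<alpha> t \<omega>)\<^sup>2 / 2 + model \<alpha> \<mu> t \<omega> * \<psi> (\<mu> t)"

text \<open>\<open>J\<close> integrates over time for each outcome, but \<open>state\<close> and
  \<open>model\<close> agree almost surely for each time; \<open>path_eq_AE\<close> bridges the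
  difference.\<close>

lemma
  assumes \<alpha>: "\<alpha> \<in> controls" and \<mu>: "\<mu> \<in> measurable_flows T"
  shows progressive_running: "progressive F T (running \<alpha> \<mu>)"
    and J_eq_running: "J \<alpha> \<mu> = (\<integral>\<omega>. (LINT t:{0..T}|lborel. running \<alpha> \<mu> t \<omega>) \<partial>M)"
proof -
  have p: "progressive F T \<alpha>" using \<alpha> by (simp add: controls_def)
  have p\<psi>: "progressive F T (\<lambda>s \<omega>. \<psi> (\<mu> s))"
    by (rule progressive_deterministic[OF measurable_flow_compose[OF psi_measurable \<mu>]])
  have gen: "progressive F T (\<lambda>t \<omega>. (\<alpha> t \<omega>)\<^sup>2 / 2 + X t \<omega> * \<psi> (\<mu> t))" if X: "progressive F T X" for X
  proof (rule progressiveI)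
    fix t assume t: "t \<in> {0..T}"
    note [measurable] = progressiveD[OF p t] progressiveD[OF p\<psi> t] progressiveD[OF X t]
    show "(\<lambda>p. (\<alpha> (fst p) (snd p))\<^sup>2 / 2 + X (fst p) (snd p) * \<psi> (\<mu> (fst p))) \<in> borel_measurable (restrict_space borel {0..t} \<Otimes>\<^sub>M F t)"
      by measurable
  qed
  show pr: "progressive F T (running \<alpha> \<mu>)"
    using gen[OF progressive_model[OF \<alpha> \<mu>]] by (simp add: running_def[abs_def])
  define st where "st t \<omega> = (\<alpha> t \<omega>)\<^sup>2 / 2 + state \<alpha> \<mu> t \<omega> * \<psi> (\<mu> t)" for t \<omega>
  have ps: "progressive F T st"
    using gen[OF progressive_state[OF \<alpha> \<mu>]] by (simp add: st_def[abs_def])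
  have T: "T \<in> {0..T}" using T_pos by simp
  have meas: "(\<lambda>\<omega>. LINT t:{0..T}|lborel. Y t \<omega>) \<in> borel_measurable M" if "progressive F T Y" for Y
    using measurable_F_M[OF T progressive_adapted[OF progressive_primitive[OF that] T]] by (simp add: primitive_def)
  have "AE \<omega> in M. AE s in lborel. s \<in> {0..T} \<longrightarrow> st s \<omega> = running \<alpha> \<mu> s \<omega>"
  proof (rule path_eq_AE[OF ps pr], rule AE_I2, rule impI)
    fix s assume "s \<in> {0..T}"
    from state_eq_model[OF \<alpha> \<mu> this] show "AE \<omega> in M. st s \<omega> = running \<alpha> \<mu> s \<omega>"
      by eventually_elim (simp add: st_def running_def)
  qed
  then have "AE \<omega> in M. (LINT t:{0..T}|lborel. st t \<omega>) = (LINT t:{0..T}|lborel. running \<alpha> \<mu> t \<omega>)"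
    using AE_space
  proof eventually_elim
    case (elim \<omega>)
    show ?case
      unfolding set_lebesgue_integral_def
    proof (rule integral_cong_AE)
      show "(\<lambda>t. indicat_real {0..T} t *\<^sub>R st t \<omega>) \<in> borel_measurable lborel"
        "(\<lambda>t. indicat_real {0..T} t *\<^sub>R running \<alpha> \<mu> t \<omega>) \<in> borel_measurable lborel"
        using joint_measurable_section[OF progressive_joint_measurable[OF ps T] elim(2)]
          joint_measurable_section[OF progressive_joint_measurable[OF pr T] elim(2)]
        by (auto simp: set_borel_measurable_def)
      show "AE t in lborel. indicat_real {0..T} t *\<^sub>R st t \<omega> = indicat_real {0..T} t *\<^sub>R running \<alpha> \<mu> t \<omega>"
        using elim(1) by eventually_elim (auto simp: indicator_def)
    qed
  qed
  then show "J \<alpha> \<mu> = (\<integral>\<omega>. (LINT t:{0..T}|lborel. running \<alpha> \<mu> t \<omega>) \<partial>M)"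
    unfolding J_def st_def[symmetric] by (intro integral_cong_AE meas ps pr)
qed

text \<open>Without integrability the integrals in \<open>J\<close> could take the default value 0
  and inequalities between costs would be void. The running cost is dominated by c^2 / 2 + p (1 +
  X^2), and X is in L2(dt x M).\<close>

lemma
  assumes \<alpha>: "\<alpha> \<in> controls" and \<mu>: "\<mu> \<in> flows"
  shows running_path_integrable: "\<omega> \<in> space M \<Longrightarrow> set_integrable lborel {0..T} (\<lambda>t. running \<alpha> \<mu> t \<omega>)"
    and running_integrable: "integrable M (\<lambda>\<omega>. LINT t:{0..T}|lborel. running \<alpha> \<mu> t \<omega>)"
proof -
  interpret prob_space M by (rule prob_M)
  note \<mu>' = flows_measurable[OF \<mu>]
  note pr = progressive_running[OF \<alpha> \<mu>']
  have T: "T \<in> {0..T}" using T_pos by simp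
  obtain c where c: "\<And>a. a \<in> U \<Longrightarrow> \<bar>a\<bar> \<le> c"
    using compact_imp_bounded[OF U_compact] by (auto simp: bounded_iff)
  define p where "p = - \<psi> (mu_max K)"
  have p0: "0 \<le> p" unfolding p_def using psi_nonpos[OF mu_max_in_prob_measures[OF K_pos]] by simp
  have bound: "AE t in lborel. t \<in> {0..T} \<longrightarrow> (\<forall>\<omega>\<in>space M. \<bar>running \<alpha> \<mu> t \<omega>\<bar> \<le> c\<^sup>2 / 2 + p * \<bar>model \<alpha> \<mu> t \<omega>\<bar>)"
    using psi_flow_bound[OF \<mu>]
  proof eventually_elim
    case (elim t)
    show ?case
    proof (intro impI ballI)
      fix \<omega> assume t: "t \<in> {0..T}" and \<omega>: "\<omega> \<in> space M"
      have "\<bar>\<alpha> t \<omega>\<bar> \<le> c" using \<alpha> t \<omega> by (intro c) (auto simp: controls_def)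
      then have "(\<alpha> t \<omega>)\<^sup>2 \<le> c\<^sup>2" by (intro abs_le_square_iff[THEN iffD1]) auto
      moreover have "\<bar>model \<alpha> \<mu> t \<omega> * \<psi> (\<mu> t)\<bar> \<le> p * \<bar>model \<alpha> \<mu> t \<omega>\<bar>"
        using elim t unfolding p_def abs_mult by (subst mult.commute) (intro mult_right_mono, auto)
      ultimately show "\<bar>running \<alpha> \<mu> t \<omega>\<bar> \<le> c\<^sup>2 / 2 + p * \<bar>model \<alpha> \<mu> t \<omega>\<bar>"
        unfolding running_def using zero_le_power2[of "\<alpha> t \<omega>"] by linarith
    qed
  qed
  have path: "set_integrable lborel {0..T} (\<lambda>t. running \<alpha> \<mu> t \<omega>)" if \<omega>: "\<omega> \<in> space M" for \<omega>
  proof -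
    have "compact ((\<lambda>t. model \<alpha> \<mu> t \<omega>) ` {0..T})"
      by (intro compact_continuous_image model_continuous[OF \<alpha> \<mu>' \<omega>]) simp
    then obtain k where k: "\<And>t. t \<in> {0..T} \<Longrightarrow> \<bar>model \<alpha> \<mu> t \<omega>\<bar> \<le> k"
      using compact_imp_bounded by (force simp: bounded_iff)
    show ?thesis
      unfolding set_integrable_def
    proof (rule integrableI_bounded_set[of "{0..T}" _ _ "c\<^sup>2 / 2 + p * k"])
      show "(\<lambda>t. indicat_real {0..T} t *\<^sub>R running \<alpha> \<mu> t \<omega>) \<in> borel_measurable lborel"
        using joint_measurable_section[OF progressive_joint_measurable[OF pr T] \<omega>] by (simp add: set_borel_measurable_def)
      show "AE t in lborel. t \<in> {0..T} \<longrightarrow> norm (indicat_real {0..T} t *\<^sub>R running \<alpha> \<mu> t \<omega>) \<le> c\<^sup>2 / 2 + p * k"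
        using bound
      proof eventually_elim
        case (elim t)
        show ?case
        proof
          assume t: "t \<in> {0..T}"
          have "p * \<bar>model \<alpha> \<mu> t \<omega>\<bar> \<le> p * k" using k[OF t] p0 by (intro mult_left_mono)
          moreover have "\<bar>running \<alpha> \<mu> t \<omega>\<bar> \<le> c\<^sup>2 / 2 + p * \<bar>model \<alpha> \<mu> t \<omega>\<bar>" using elim t \<omega> by blast
          ultimately show "norm (indicat_real {0..T} t *\<^sub>R running \<alpha> \<mu> t \<omega>) \<le> c\<^sup>2 / 2 + p * k" using t by simp
        qed
      qed
    qed (auto simp: emeasure_lborel_Icc_eq)
  qed
  then show "\<omega> \<in> space M \<Longrightarrow> set_integrable lborel {0..T} (\<lambda>t. running \<alpha> \<mu> t \<omega>)" .
  have jm: "joint_measurable T (model \<alpha> \<mu>)" by (rule progressive_joint_measurable[OF progressive_model[OF \<alpha> \<mu>'] T])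
  show "integrable M (\<lambda>\<omega>. LINT t:{0..T}|lborel. running \<alpha> \<mu> t \<omega>)"
  proof (rule integrableI_bounded)
    show "(\<lambda>\<omega>. LINT t:{0..T}|lborel. running \<alpha> \<mu> t \<omega>) \<in> borel_measurable M"
      using measurable_F_M[OF T progressive_adapted[OF progressive_primitive[OF pr] T]] by (simp add: primitive_def)
    have "(\<integral>\<^sup>+\<omega>. ennreal (norm (LINT t:{0..T}|lborel. running \<alpha> \<mu> t \<omega>)) \<partial>M)
      \<le> (\<integral>\<^sup>+\<omega>. ennreal (c\<^sup>2 / 2 + p) * ennreal T + ennreal p * (\<integral>\<^sup>+t\<in>{0..T}. ennreal ((model \<alpha> \<mu> t \<omega>)\<^sup>2) \<partial>lborel) \<partial>M)"
    proof (rule nn_integral_mono)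
      fix \<omega> assume \<omega>: "\<omega> \<in> space M"
      have "ennreal (norm (LINT t:{0..T}|lborel. running \<alpha> \<mu> t \<omega>)) \<le> (\<integral>\<^sup>+t. ennreal (norm (indicat_real {0..T} t *\<^sub>R running \<alpha> \<mu> t \<omega>)) \<partial>lborel)"
        using integral_norm_bound_ennreal[OF path[OF \<omega>, unfolded set_integrable_def]] by (simp add: set_lebesgue_integral_def)
      also have "\<dots> \<le> (\<integral>\<^sup>+t. ennreal (c\<^sup>2 / 2 + p) * indicator {0..T} t + ennreal p * (ennreal ((model \<alpha> \<mu> t \<omega>)\<^sup>2) * indicator {0..T} t) \<partial>lborel)"
      proof (rule nn_integral_mono_AE)
        show "AE t in lborel. ennreal (norm (indicat_real {0..T} t *\<^sub>R running \<alpha> \<mu> t \<omega>)) \<le> ennreal (c\<^sup>2 / 2 + p) * indicator {0..T} t + ennreal p * (ennreal ((model \<alpha> \<mu> t \<omega>)\<^sup>2) * indicator {0..T} t)"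
          using bound
        proof eventually_elim
          case (elim t)
          show ?case
          proof (cases "t \<in> {0..T}")
            case True
            have sq: "\<bar>x\<bar> \<le> 1 + x\<^sup>2" for x :: real
            proof -
              have "0 \<le> (\<bar>x\<bar> - 1)\<^sup>2" by simp
              then have "2 * \<bar>x\<bar> \<le> 1 + x\<^sup>2" by (simp add: power2_diff)
              then show ?thesis by simp
            qed
            have "\<bar>running \<alpha> \<mu> t \<omega>\<bar> \<le> c\<^sup>2 / 2 + p * \<bar>model \<alpha> \<mu> t \<omega>\<bar>" using elim True \<omega> by blast
            also have "\<dots> \<le> c\<^sup>2 / 2 + p * (1 + (model \<alpha> \<mu> t \<omega>)\<^sup>2)"
              using p0 sq by (intro add_left_mono mult_left_mono)
            finally have "\<bar>running \<alpha> \<mu> t \<omega>\<bar> \<le> (c\<^sup>2 / 2 + p) + p * (model \<alpha> \<mu> t \<omega>)\<^sup>2" by (simp add: algebra_simps)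
            then have "ennreal \<bar>running \<alpha> \<mu> t \<omega>\<bar> \<le> ennreal ((c\<^sup>2 / 2 + p) + p * (model \<alpha> \<mu> t \<omega>)\<^sup>2)" by (rule ennreal_leI)
            also have "\<dots> = ennreal (c\<^sup>2 / 2 + p) + ennreal p * ennreal ((model \<alpha> \<mu> t \<omega>)\<^sup>2)"
              using p0 by (subst ennreal_plus) (auto simp: ennreal_mult)
            finally show ?thesis using True by simp
          qed simp
        qed
      qed
      also have "\<dots> = ennreal (c\<^sup>2 / 2 + p) * ennreal T + ennreal p * (\<integral>\<^sup>+t\<in>{0..T}. ennreal ((model \<alpha> \<mu> t \<omega>)\<^sup>2) \<partial>lborel)"
      proof -
        have "(\<lambda>t. ennreal ((indicat_real {0..T} t *\<^sub>R model \<alpha> \<mu> t \<omega>)\<^sup>2)) \<in> borel_measurable lborel"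
          using joint_measurable_section[OF jm \<omega>] unfolding set_borel_measurable_def by measurable
        also have "(\<lambda>t. ennreal ((indicat_real {0..T} t *\<^sub>R model \<alpha> \<mu> t \<omega>)\<^sup>2)) = (\<lambda>t. ennreal ((model \<alpha> \<mu> t \<omega>)\<^sup>2) * indicator {0..T} t)"
          by (auto simp: indicator_def)
        finally have [measurable]: "(\<lambda>t. ennreal ((model \<alpha> \<mu> t \<omega>)\<^sup>2) * indicator {0..T} t) \<in> borel_measurable lborel" .
        show ?thesis using T_pos by (simp add: nn_integral_add nn_integral_cmult nn_integral_cmult_indicator)
      qed
      finally show "ennreal (norm (LINT t:{0..T}|lborel. running \<alpha> \<mu> t \<omega>)) \<le>
        ennreal (c\<^sup>2 / 2 + p) * ennreal T + ennreal p * (\<integral>\<^sup>+t\<in>{0..T}. ennreal ((model \<alpha> \<mu> t \<omega>)\<^sup>2) \<partial>lborel)" .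
    qed
    also have "\<dots> = ennreal (c\<^sup>2 / 2 + p) * ennreal T + ennreal p * sq_norm T (model \<alpha> \<mu>)"
      using measurable_inner_sq_norm[OF less_imp_le[OF T_pos] jm]
      by (simp add: nn_integral_add nn_integral_cmult emeasure_space_1 sq_norm_def)
    also have "\<dots> < \<infinity>" using sq_norm_model[OF \<alpha> \<mu>'] by (simp add: ennreal_mult_less_top)
    finally show "(\<integral>\<^sup>+\<omega>. ennreal (norm (LINT t:{0..T}|lborel. running \<alpha> \<mu> t \<omega>)) \<partial>M) < \<infinity>" .
  qed
qed

text \<open>Proved for each outcome and almost every time. Where A <= B both sides coincide. Where A
  > B the controls are exchanged, the squares cancel, and the difference is g (exp A - exp B) (x
  \<open>\<psi>\<close>(\<open>\<mu>\<close>) - y \<open>\<psi>\<close>(\<open>\<nu>\<close>)). Here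
  g >= 0 since \<open>\<xi>\<close> is positive, and the last factor is nonnegative since 0 < x <= y
  and \<open>\<psi>\<close>(\<open>\<nu>\<close>) <= \<open>\<psi>\<close>(\<open>\<mu>\<close>) <=
  0.\<close>

lemma J_submodular:
  assumes \<alpha>: "\<alpha> \<in> controls" and \<beta>: "\<beta> \<in> controls" and \<mu>: "\<mu> \<in> flows" and \<nu>: "\<nu> \<in> flows"
    and le: "AE t in time_measure T. st_le (\<mu> t) (\<nu> t)"
  shows "J (meet \<alpha> \<beta>) \<mu> + J (join \<alpha> \<beta>) \<nu> \<le> J \<alpha> \<mu> + J \<beta> \<nu>"
proof -
  note \<mu>' = flows_measurable[OF \<mu>] and \<nu>' = flows_measurable[OF \<nu>]
  note jc = join_in_controls[OF \<alpha> \<beta>] and mc = meet_in_controls[OF \<alpha> \<beta>]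
  have le_t: "AE t in lborel. t \<in> {0..T} \<longrightarrow> st_le (\<mu> t) (\<nu> t)"
    by (rule AE_time_measure_lborel[OF T_pos le])
  note prob = measurable_flows_prob_measures[OF \<mu>'] measurable_flows_prob_measures[OF \<nu>']
  obtain c where c: "bounded_density T c (\<lambda>s. m (\<mu> s))" using m_flow_density[OF \<mu>'] .
  obtain c' where c': "bounded_density T c' (\<lambda>s. m (\<nu> s))" using m_flow_density[OF \<nu>'] .
  have m_le: "primitive (\<lambda>s. m (\<mu> s)) t \<le> primitive (\<lambda>s. m (\<nu> s)) t" if "t \<in> {0..T}" for t
  proof (rule primitive_mono_AE[OF c c' that])
    show "AE s in lborel. s \<in> {0..T} \<longrightarrow> m (\<mu> s) \<le> m (\<nu> s)"
      using le_t by eventually_elim (use m_increasing prob in blast)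
  qed
  have path: "(LINT t:{0..T}|lborel. running (meet \<alpha> \<beta>) \<mu> t \<omega>) + (LINT t:{0..T}|lborel. running (join \<alpha> \<beta>) \<nu> t \<omega>)
    \<le> (LINT t:{0..T}|lborel. running \<alpha> \<mu> t \<omega>) + (LINT t:{0..T}|lborel. running \<beta> \<nu> t \<omega>)"
    if \<omega>: "\<omega> \<in> space M" and \<xi>: "0 < \<xi> \<omega>" for \<omega>
  proof -
    note i = running_path_integrable[OF mc \<mu> \<omega>] running_path_integrable[OF jc \<nu> \<omega>]
      running_path_integrable[OF \<alpha> \<mu> \<omega>] running_path_integrable[OF \<beta> \<nu> \<omega>]
    have "(LINT t:{0..T}|lborel. running (meet \<alpha> \<beta>) \<mu> t \<omega> + running (join \<alpha> \<beta>) \<nu> t \<omega>)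
      \<le> (LINT t:{0..T}|lborel. running \<alpha> \<mu> t \<omega> + running \<beta> \<nu> t \<omega>)"
      unfolding set_lebesgue_integral_def
    proof (rule integral_mono_AE)
      show "integrable lborel (\<lambda>t. indicat_real {0..T} t *\<^sub>R (running (meet \<alpha> \<beta>) \<mu> t \<omega> + running (join \<alpha> \<beta>) \<nu> t \<omega>))"
        "integrable lborel (\<lambda>t. indicat_real {0..T} t *\<^sub>R (running \<alpha> \<mu> t \<omega> + running \<beta> \<nu> t \<omega>))"
        using set_integral_add(1)[OF i(1,2)] set_integral_add(1)[OF i(3,4)] by (simp_all add: set_integrable_def)
      show "AE t in lborel. indicat_real {0..T} t *\<^sub>R (running (meet \<alpha> \<beta>) \<mu> t \<omega> + running (join \<alpha> \<beta>) \<nu> t \<omega>)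
        \<le> indicat_real {0..T} t *\<^sub>R (running \<alpha> \<mu> t \<omega> + running \<beta> \<nu> t \<omega>)"
        using le_t
      proof eventually_elim
        case (elim t)
        show ?case
        proof (cases "t \<in> {0..T}")
          case t: True
          define A where "A = primitive (\<lambda>s. \<alpha> s \<omega>) t"
          define B where "B = primitive (\<lambda>s. \<beta> s \<omega>) t"
          define g where "g = \<xi> \<omega> * exp (\<sigma> * W_mod t \<omega> - \<sigma>\<^sup>2 * t / 2)"
          define x where "x = exp (primitive (\<lambda>s. m (\<mu> s)) t)"
          define y where "y = exp (primitive (\<lambda>s. m (\<nu> s)) t)"
          have g: "0 \<le> g" using \<xi> by (simp add: g_def)
          have xy: "0 < x" "x \<le> y" using m_le[OF t] by (auto simp: x_def y_def)
          have \<psi>: "\<psi> (\<nu> t) \<le> \<psi> (\<mu> t)" "\<psi> (\<nu> t) \<le> 0"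
            using psi_decreasing[OF prob(1)[OF t] prob(2)[OF t]] psi_nonpos[OF prob(2)[OF t]] elim t by auto
          have X: "model \<alpha> \<mu> t \<omega> = g * (exp A * x)" "model \<beta> \<nu> t \<omega> = g * (exp B * y)"
            "model (meet \<alpha> \<beta>) \<mu> t \<omega> = g * (exp (min A B) * x)" "model (join \<alpha> \<beta>) \<nu> t \<omega> = g * (exp (max A B) * y)"
            using model_eq[OF \<alpha> \<mu>' \<omega> t] model_eq[OF \<beta> \<nu>' \<omega> t] model_eq[OF mc \<mu>' \<omega> t] model_eq[OF jc \<nu>' \<omega> t]
              primitive_join[OF \<alpha> \<beta> \<omega> t] primitive_meet[OF \<alpha> \<beta> \<omega> t]
            by (simp_all add: g_def x_def y_def A_def B_def)
          have "running (meet \<alpha> \<beta>) \<mu> t \<omega> + running (join \<alpha> \<beta>) \<nu> t \<omega> \<le> running \<alpha> \<mu> t \<omega> + running \<beta> \<nu> t \<omega>"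
          proof (cases "A > B")
            case False
            then have "meet \<alpha> \<beta> t \<omega> = \<alpha> t \<omega>" "join \<alpha> \<beta> t \<omega> = \<beta> t \<omega>"
              by (simp_all add: meet_def join_def A_def B_def)
            then show ?thesis using False unfolding running_def X by (simp add: min_def max_def)
          next
            case True
            then have mj: "meet \<alpha> \<beta> t \<omega> = \<beta> t \<omega>" "join \<alpha> \<beta> t \<omega> = \<alpha> t \<omega>"
              by (simp_all add: meet_def join_def A_def B_def)
            have "y * \<psi> (\<nu> t) \<le> x * \<psi> (\<nu> t)" using xy \<psi> by (intro mult_right_mono_neg)
            also have "\<dots> \<le> x * \<psi> (\<mu> t)" using xy \<psi> by (intro mult_left_mono) auto
            finally have "0 \<le> x * \<psi> (\<mu> t) - y * \<psi> (\<nu> t)" by simp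
            moreover have "0 \<le> exp A - exp B" using True by simp
            ultimately have "0 \<le> g * ((exp A - exp B) * (x * \<psi> (\<mu> t) - y * \<psi> (\<nu> t)))"
              using g by (intro mult_nonneg_nonneg)
            moreover have "running \<alpha> \<mu> t \<omega> + running \<beta> \<nu> t \<omega> - (running (meet \<alpha> \<beta>) \<mu> t \<omega> + running (join \<alpha> \<beta>) \<nu> t \<omega>)
              = g * ((exp A - exp B) * (x * \<psi> (\<mu> t) - y * \<psi> (\<nu> t)))"
              using True unfolding running_def X mj by (simp add: min_def max_def algebra_simps)
            ultimately show ?thesis by linarith
          qed
          then show ?thesis using t by simp
        qed simp
      qed
    qed
    then show ?thesis using set_integral_add(2)[OF i(1,2)] set_integral_add(2)[OF i(3,4)] by simp
  qed
  note I = running_integrable[OF mc \<mu>] running_integrable[OF jc \<nu>] running_integrable[OF \<alpha> \<mu>] running_integrable[OF \<beta> \<nu>]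
  have "(\<integral>\<omega>. (LINT t:{0..T}|lborel. running (meet \<alpha> \<beta>) \<mu> t \<omega>) + (LINT t:{0..T}|lborel. running (join \<alpha> \<beta>) \<nu> t \<omega>) \<partial>M)
    \<le> (\<integral>\<omega>. (LINT t:{0..T}|lborel. running \<alpha> \<mu> t \<omega>) + (LINT t:{0..T}|lborel. running \<beta> \<nu> t \<omega>) \<partial>M)"
  proof (rule integral_mono_AE)
    show "AE \<omega> in M. (LINT t:{0..T}|lborel. running (meet \<alpha> \<beta>) \<mu> t \<omega>) + (LINT t:{0..T}|lborel. running (join \<alpha> \<beta>) \<nu> t \<omega>)
      \<le> (LINT t:{0..T}|lborel. running \<alpha> \<mu> t \<omega>) + (LINT t:{0..T}|lborel. running \<beta> \<nu> t \<omega>)"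
      using xi_pos AE_space by eventually_elim (rule path)
  qed (use I in auto)
  then show ?thesis
    using I by (simp add: J_eq_running[OF mc \<mu>'] J_eq_running[OF jc \<nu>'] J_eq_running[OF \<alpha> \<mu>'] J_eq_running[OF \<beta> \<nu>'])
qed

section \<open>The best response as a monotone map of the lattice\<close>

lemma optimal_control_minimizer:
  assumes "unique_minimizer \<mu>"
  shows "minimizer \<mu> (optimal_control \<mu>)"
  unfolding optimal_control_def by (rule someI_ex[of "minimizer \<mu>"]) (use assms in \<open>simp add: unique_minimizer_def\<close>)

text \<open>The optimal controls themselves are not compared: \<open>join\<close> equals
  \<open>\<beta>\<close> almost everywhere, which orders only the primitives, but does so at every
  time. Hence the states are ordered almost surely at each t, including the atoms 0 and T of the
  time measure.\<close>

lemma response_flow_mono: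
  assumes \<mu>: "\<mu> \<in> flows" and \<nu>: "\<nu> \<in> flows" and um: "unique_minimizer \<mu>" and un: "unique_minimizer \<nu>"
    and le: "AE t in time_measure T. st_le (\<mu> t) (\<nu> t)" and t: "t \<in> {0..T}"
  shows "st_le (response_flow \<mu> t) (response_flow \<nu> t)"
proof -
  interpret prob_space M by (rule prob_M)
  define \<alpha> where "\<alpha> = optimal_control \<mu>"
  define \<beta> where "\<beta> = optimal_control \<nu>"
  have min: "minimizer \<mu> \<alpha>" "minimizer \<nu> \<beta>"
    unfolding \<alpha>_def \<beta>_def by (rule optimal_control_minimizer[OF um] optimal_control_minimizer[OF un])+
  then have c: "\<alpha> \<in> controls" "\<beta> \<in> controls" by (auto simp: minimizer_def)
  note \<mu>' = flows_measurable[OF \<mu>] and \<nu>' = flows_measurable[OF \<nu>]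
  note jc = join_in_controls[OF c] and mc = meet_in_controls[OF c]
  have "J \<alpha> \<mu> \<le> J (meet \<alpha> \<beta>) \<mu>" using min(1) mc by (simp add: minimizer_def)
  then have "J (join \<alpha> \<beta>) \<nu> \<le> J \<beta> \<nu>" using J_submodular[OF c \<mu> \<nu> le] by linarith
  then have "minimizer \<nu> (join \<alpha> \<beta>)" using min(2) jc by (auto simp: minimizer_def intro: order.trans)
  then have eq: "AE p in restrict_space lborel {0..T} \<Otimes>\<^sub>M M. join \<alpha> \<beta> (fst p) (snd p) = \<beta> (fst p) (snd p)"
    using un min(2) by (simp add: unique_minimizer_def)
  let ?N = "restrict_space lborel {0..T}"
  interpret N: finite_measure ?N
    by standard (simp add: space_restrict_space emeasure_restrict_space emeasure_lborel_Icc_eq)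
  interpret P: pair_sigma_finite ?N M ..
  have "AE s in ?N. AE \<omega> in M. join \<alpha> \<beta> s \<omega> = \<beta> s \<omega>" using P.AE_pair[OF eq] by simp
  then have "AE s in lborel. s \<in> {0..T} \<longrightarrow> (AE \<omega> in M. join \<alpha> \<beta> s \<omega> = \<beta> s \<omega>)"
    by (simp add: AE_restrict_space_iff)
  then have path_eq: "AE \<omega> in M. AE s in lborel. s \<in> {0..T} \<longrightarrow> join \<alpha> \<beta> s \<omega> = \<beta> s \<omega>"
    using jc c by (intro path_eq_AE) (auto simp: controls_def)
  obtain cm where cm: "bounded_density T cm (\<lambda>s. m (\<mu> s))" using m_flow_density[OF \<mu>'] .
  obtain cn where cn: "bounded_density T cn (\<lambda>s. m (\<nu> s))" using m_flow_density[OF \<nu>'] .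
  have m_le: "primitive (\<lambda>s. m (\<mu> s)) t \<le> primitive (\<lambda>s. m (\<nu> s)) t"
  proof (rule primitive_mono_AE[OF cm cn t])
    show "AE s in lborel. s \<in> {0..T} \<longrightarrow> m (\<mu> s) \<le> m (\<nu> s)"
      using AE_time_measure_lborel[OF T_pos le] by eventually_elim
        (use m_increasing measurable_flows_prob_measures[OF \<mu>'] measurable_flows_prob_measures[OF \<nu>'] in blast)
  qed
  have "AE \<omega> in M. state \<alpha> \<mu> t \<omega> \<le> state \<beta> \<nu> t \<omega>"
    using path_eq state_eq_model[OF c(1) \<mu>' t] state_eq_model[OF c(2) \<nu>' t] xi_pos AE_space
  proof eventually_elim
    case (elim \<omega>)
    note \<omega> = \<open>\<omega> \<in> space M\<close>
    obtain j where j: "bounded_density T j (\<lambda>s. join \<alpha> \<beta> s \<omega>)" using control_density[OF jc \<omega>] .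
    obtain b where b: "bounded_density T b (\<lambda>s. \<beta> s \<omega>)" using control_density[OF c(2) \<omega>] .
    have "primitive (\<lambda>s. join \<alpha> \<beta> s \<omega>) t = primitive (\<lambda>s. \<beta> s \<omega>) t"
      by (rule primitive_cong_AE[OF j b t]) (use elim in blast)
    then have "primitive (\<lambda>s. \<alpha> s \<omega>) t \<le> primitive (\<lambda>s. \<beta> s \<omega>) t"
      using primitive_join[OF c \<omega> t] by (simp add: max_def split: if_splits)
    then have "exp (primitive (\<lambda>s. \<alpha> s \<omega>) t) * exp (primitive (\<lambda>s. m (\<mu> s)) t)
        \<le> exp (primitive (\<lambda>s. \<beta> s \<omega>) t) * exp (primitive (\<lambda>s. m (\<nu> s)) t)"
      using m_le by (intro mult_mono) auto
    then have "model \<alpha> \<mu> t \<omega> \<le> model \<beta> \<nu> t \<omega>"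
      unfolding model_eq[OF c(1) \<mu>' \<omega> t] model_eq[OF c(2) \<nu>' \<omega> t] using elim by (intro mult_left_mono) auto
    then show ?case using elim by simp
  qed
  then have ae: "AE \<omega> in M. state \<beta> \<nu> t \<omega> \<le> s \<longrightarrow> state \<alpha> \<mu> t \<omega> \<le> s" for s
    by eventually_elim auto
  have [measurable]: "state \<alpha> \<mu> t \<in> borel_measurable M" "state \<beta> \<nu> t \<in> borel_measurable M"
    using measurable_F_M[OF t progressive_adapted[OF progressive_state[OF c(1) \<mu>'] t]]
      measurable_F_M[OF t progressive_adapted[OF progressive_state[OF c(2) \<nu>'] t]] by auto
  have "measure M {\<omega>\<in>space M. state \<beta> \<nu> t \<omega> \<le> s} \<le> measure M {\<omega>\<in>space M. state \<alpha> \<mu> t \<omega> \<le> s}" for s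
    by (rule finite_measure_mono_AE) (use ae[of s] in \<open>auto elim!: AE_mp\<close>)
  moreover have "cdf (distr M borel X) s = measure M {\<omega>\<in>space M. X \<omega> \<le> s}" if "X \<in> borel_measurable M" for X and s :: real
    unfolding cdf_def using that by (subst measure_distr) (auto intro!: arg_cong[where f="measure M"])
  ultimately show ?thesis
    by (simp add: st_le_def response_flow_def \<alpha>_def[symmetric] \<beta>_def[symmetric])
qed

text \<open>Markov's inequality for the square of \<open>X\<close> gives the tail bound K / s^2 on
  both sides. Cut off to [0, 1], these tails are the distribution functions of \<open>mu_min\<close>
  and \<open>mu_max\<close>.\<close>

lemma law_bounds:
  assumes X: "X \<in> borel_measurable M" and K: "(\<integral>\<^sup>+\<omega>. ennreal ((X \<omega>)\<^sup>2) \<partial>M) \<le> ennreal K"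
  shows "st_le (mu_min K) (distr M borel X)" "st_le (distr M borel X) (mu_max K)"
proof -
  interpret prob_space M by (rule prob_M)
  note [measurable] = X
  have cdf: "cdf (distr M borel X) s = prob {\<omega>\<in>space M. X \<omega> \<le> s}" for s
    unfolding cdf_def by (subst measure_distr) (auto intro!: arg_cong[where f=prob])
  have tail: "prob {\<omega>\<in>space M. s\<^sup>2 \<le> (X \<omega>)\<^sup>2} \<le> K / s\<^sup>2" if "s \<noteq> 0" for s
  proof -
    have s: "0 < s\<^sup>2" using that by simp
    have "emeasure M {\<omega>\<in>space M. s\<^sup>2 \<le> (X \<omega>)\<^sup>2} = emeasure M ({\<omega>\<in>space M. 1 \<le> ennreal (1 / s\<^sup>2) * ennreal ((X \<omega>)\<^sup>2)})"
    proof (rule arg_cong[where f="emeasure M"])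
      have "1 \<le> ennreal (1 / s\<^sup>2) * ennreal ((X \<omega>)\<^sup>2) \<longleftrightarrow> s\<^sup>2 \<le> (X \<omega>)\<^sup>2" for \<omega>
        using s by (simp add: ennreal_mult[symmetric] ennreal_1[symmetric] ennreal_le_iff le_divide_eq del: ennreal_1)
      then show "{\<omega>\<in>space M. s\<^sup>2 \<le> (X \<omega>)\<^sup>2} = {\<omega>\<in>space M. 1 \<le> ennreal (1 / s\<^sup>2) * ennreal ((X \<omega>)\<^sup>2)}" by auto
    qed
    also have "\<dots> \<le> ennreal (1 / s\<^sup>2) * (\<integral>\<^sup>+\<omega>. ennreal ((X \<omega>)\<^sup>2) * indicator (space M) \<omega> \<partial>M)"
      by (rule nn_integral_Markov_inequality) auto
    also have "(\<integral>\<^sup>+\<omega>. ennreal ((X \<omega>)\<^sup>2) * indicator (space M) \<omega> \<partial>M) = (\<integral>\<^sup>+\<omega>. ennreal ((X \<omega>)\<^sup>2) \<partial>M)"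
      by (intro nn_integral_cong) simp
    also have "ennreal (1 / s\<^sup>2) * \<dots> \<le> ennreal (1 / s\<^sup>2) * ennreal K" using K by (intro mult_left_mono) auto
    also have "\<dots> = ennreal (K / s\<^sup>2)" using K_pos by (simp add: ennreal_mult[symmetric])
    finally show ?thesis using K_pos s by (simp add: emeasure_eq_measure ennreal_le_iff)
  qed
  show "st_le (mu_min K) (distr M borel X)"
    unfolding st_le_def cdf cdf_mu_min[OF K_pos]
  proof
    fix s
    have "prob {\<omega>\<in>space M. X \<omega> \<le> s} \<le> K / s\<^sup>2" if "s < 0"
    proof -
      have "s\<^sup>2 \<le> (X \<omega>)\<^sup>2" if "X \<omega> \<le> s" for \<omega>
        using that \<open>s < 0\<close> by (intro abs_le_square_iff[THEN iffD1]) auto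
      then have "prob {\<omega>\<in>space M. X \<omega> \<le> s} \<le> prob {\<omega>\<in>space M. s\<^sup>2 \<le> (X \<omega>)\<^sup>2}"
        by (intro finite_measure_mono) auto
      also have "\<dots> \<le> K / s\<^sup>2" using that by (intro tail) simp
      finally show ?thesis .
    qed
    then show "prob {\<omega>\<in>space M. X \<omega> \<le> s} \<le> min_df K s" by (auto simp: min_df_def)
  qed
  show "st_le (distr M borel X) (mu_max K)"
    unfolding st_le_def cdf cdf_mu_max[OF K_pos]
  proof
    fix s
    have "1 - K / s\<^sup>2 \<le> prob {\<omega>\<in>space M. X \<omega> \<le> s}" if "s > 0"
    proof -
      have "s\<^sup>2 \<le> (X \<omega>)\<^sup>2" if "\<not> X \<omega> \<le> s" for \<omega>
        using that \<open>s > 0\<close> by (intro abs_le_square_iff[THEN iffD1]) auto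
      then have "prob {\<omega>\<in>space M. \<not> X \<omega> \<le> s} \<le> prob {\<omega>\<in>space M. s\<^sup>2 \<le> (X \<omega>)\<^sup>2}"
        by (intro finite_measure_mono) auto
      also have "\<dots> \<le> K / s\<^sup>2" using that by (intro tail) simp
      finally have "prob {\<omega>\<in>space M. \<not> X \<omega> \<le> s} \<le> K / s\<^sup>2" .
      then show ?thesis using prob_neg[of "\<lambda>\<omega>. X \<omega> \<le> s"] by simp
    qed
    then show "max_df K s \<le> prob {\<omega>\<in>space M. X \<omega> \<le> s}" by (auto simp: max_df_def)
  qed
qed

text \<open>Measurability in time follows from weak continuity of the laws of \<open>model\<close>,
  all of whose paths are continuous; the bounds come from \<open>K_bound\<close>, which speaks of
  \<open>state\<close>.\<close>

lemma response_flow_in_flows: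
  assumes \<mu>: "\<mu> \<in> flows" and um: "unique_minimizer \<mu>"
  shows "response_flow \<mu> \<in> flows"
proof -
  interpret prob_space M by (rule prob_M)
  define \<alpha> where "\<alpha> = optimal_control \<mu>"
  have \<alpha>: "\<alpha> \<in> controls" using optimal_control_minimizer[OF um] by (simp add: minimizer_def \<alpha>_def)
  note \<mu>' = flows_measurable[OF \<mu>]
  have mst: "state \<alpha> \<mu> t \<in> borel_measurable M" if "t \<in> {0..T}" for t
    using measurable_F_M[OF that progressive_adapted[OF progressive_state[OF \<alpha> \<mu>'] that]] .
  have mmo: "model \<alpha> \<mu> t \<in> borel_measurable M" if "t \<in> {0..T}" for t
    using measurable_F_M[OF that progressive_adapted[OF progressive_model[OF \<alpha> \<mu>'] that]] .
  have law: "response_flow \<mu> t = distr M borel (model \<alpha> \<mu> t)" if "t \<in> {0..T}" for t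
    unfolding response_flow_def \<alpha>_def[symmetric]
    by (rule distr_cong_AE[OF refl refl state_eq_model[OF \<alpha> \<mu>' that] mst[OF that] mmo[OF that]])
  have "response_flow \<mu> \<in> measurable_flows T"
  proof (rule continuous_imp_measurable_flow)
    show "response_flow \<mu> t \<in> prob_measures" if "t \<in> {0..T}" for t
      unfolding law[OF that] using mmo[OF that] by (simp add: prob_measures_def)
    fix f :: "real \<Rightarrow> real" assume f: "continuous_on UNIV f" "bounded (range f)"
    obtain c where c: "\<And>x. \<bar>f x\<bar> \<le> c" using f(2) by (auto simp: bounded_iff)
    have [measurable]: "f \<in> borel_measurable borel" using f(1) by (rule borel_measurable_continuous_onI)
    have "continuous_on {0..T} (\<lambda>t. \<integral>\<omega>. f (model \<alpha> \<mu> t \<omega>) \<partial>M)"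
      unfolding continuous_on_sequentially comp_def
    proof (intro allI ballI impI)
      fix x a assume a: "a \<in> {0..T}" and x: "(\<forall>n. x n \<in> {0..T}) \<and> x \<longlonglongrightarrow> a"
      show "(\<lambda>n. \<integral>\<omega>. f (model \<alpha> \<mu> (x n) \<omega>) \<partial>M) \<longlonglongrightarrow> (\<integral>\<omega>. f (model \<alpha> \<mu> a \<omega>) \<partial>M)"
      proof (rule integral_dominated_convergence[where w="\<lambda>_. c"])
        show "AE \<omega> in M. (\<lambda>n. f (model \<alpha> \<mu> (x n) \<omega>)) \<longlonglongrightarrow> f (model \<alpha> \<mu> a \<omega>)"
        proof (rule AE_I2)
          fix \<omega> assume \<omega>: "\<omega> \<in> space M"
          have "(\<lambda>n. model \<alpha> \<mu> (x n) \<omega>) \<longlonglongrightarrow> model \<alpha> \<mu> a \<omega>"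
            using continuous_on_tendsto_compose[OF model_continuous[OF \<alpha> \<mu>' \<omega>], of x a sequentially] x a by auto
          then show "(\<lambda>n. f (model \<alpha> \<mu> (x n) \<omega>)) \<longlonglongrightarrow> f (model \<alpha> \<mu> a \<omega>)"
            by (intro continuous_on_tendsto_compose[OF f(1)]) auto
        qed
      qed (use mmo x a c in auto)
    qed
    also have "?this \<longleftrightarrow> continuous_on {0..T} (\<lambda>t. \<integral>x. f x \<partial>response_flow \<mu> t)"
      using mmo by (intro continuous_on_cong) (auto simp: law integral_distr)
    finally show "continuous_on {0..T} (\<lambda>t. \<integral>x. f x \<partial>response_flow \<mu> t)" .
  qed
  moreover have "response_flow \<mu> 0 = distr M borel \<xi>"
  proof -
    have "0 \<in> {0..T}" using T_pos by simp
    then show ?thesis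
      unfolding law[OF \<open>0 \<in> {0..T}\<close>]
      by (intro distr_cong_AE model_initial[OF \<alpha> \<mu>'] mmo sq_int_measurable[OF sq_int_xi]) auto
  qed
  moreover have "AE t in time_measure T. 0 < t \<longrightarrow> st_le (mu_min K) (response_flow \<mu> t) \<and> st_le (response_flow \<mu> t) (mu_max K)"
  proof (rule AE_time_measureI[OF T_pos], rule impI)
    fix t assume t: "t \<in> {0..T}"
    show "st_le (mu_min K) (response_flow \<mu> t) \<and> st_le (response_flow \<mu> t) (mu_max K)"
      unfolding response_flow_def \<alpha>_def[symmetric]
      using law_bounds[OF mst[OF t] K_bound[OF \<alpha> \<mu>' t]] by simp
  qed
  ultimately show ?thesis by (simp add: flows_def)
qed

text \<open>The optimal control is chosen separately for each representative. The responses of two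
  equivalent flows are nevertheless equivalent, because monotonicity applies in both directions; so
  the union in \<open>R\<close> is a single class.\<close>

lemma R_class:
  assumes \<mu>: "\<mu> \<in> flows" and uniq: "\<And>\<mu>. \<mu> \<in> flows \<Longrightarrow> unique_minimizer \<mu>"
  shows "R (flow_class \<mu>) = flow_class (response_flow \<mu>)"
proof -
  have "flow_class (response_flow \<nu>) = flow_class (response_flow \<mu>)" if "\<nu> \<in> flow_class \<mu>" for \<nu>
  proof -
    have \<nu>: "\<nu> \<in> flows" and eq: "AE t in time_measure T. \<mu> t = \<nu> t" using that by (auto simp: flow_equiv_def)
    have le: "AE t in time_measure T. st_le (\<mu> t) (\<nu> t)" "AE t in time_measure T. st_le (\<nu> t) (\<mu> t)"
      using eq by (eventually_elim, simp add: st_le_refl)+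
    show ?thesis
      by (intro flow_equiv_iff_st_le response_flow_in_flows \<mu> \<nu> uniq
          AE_time_measureI[OF T_pos response_flow_mono[OF \<mu> \<nu> uniq[OF \<mu>] uniq[OF \<nu>] le(1)]]
          AE_time_measureI[OF T_pos response_flow_mono[OF \<nu> \<mu> uniq[OF \<nu>] uniq[OF \<mu>] le(2)]])
  qed
  moreover have "\<mu> \<in> flow_class \<mu>" using \<mu> by (auto simp: flow_equiv_def)
  ultimately show ?thesis unfolding R_def by blast
qed

lemma equilibria_lattice:
  assumes uniq: "\<And>\<mu>. \<mu> \<in> flows \<Longrightarrow> unique_minimizer \<mu>"
  shows "equilibria \<noteq> {} \<and> complete_lattice equilibrium_order"
proof (rule equilibria_complete_lattice)
  show "R C \<in> L" if "C \<in> L" for C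
    using that R_class[OF _ uniq] by (auto elim!: L_E intro!: flow_class_in_L response_flow_in_flows uniq)
  show "L_le (R C) (R D)" if CD: "C \<in> L" "D \<in> L" "L_le C D" for C D
  proof -
    obtain \<mu> where \<mu>: "\<mu> \<in> flows" "C = flow_class \<mu>" using CD(1) by (rule L_E)
    obtain \<nu> where \<nu>: "\<nu> \<in> flows" "D = flow_class \<nu>" using CD(2) by (rule L_E)
    have "AE t in time_measure T. st_le (\<mu> t) (\<nu> t)" using CD(3) \<mu> \<nu> by (simp add: L_le_class_iff)
    then have "AE t in time_measure T. st_le (response_flow \<mu> t) (response_flow \<nu> t)"
      by (intro AE_time_measureI[OF T_pos response_flow_mono[OF \<mu>(1) \<nu>(1) uniq[OF \<mu>(1)] uniq[OF \<nu>(1)]]])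
    then show ?thesis
      using \<mu> \<nu> by (simp add: R_class[OF _ uniq] L_le_class_iff response_flow_in_flows uniq)
  qed
qed

end

text \<open>The unique minimizers enter as a hypothesis, in the place where the informal statement
  infers them from strict convexity of the cost.\<close>

theorem mainTheorem5:
  fixes M :: "'w measure" and F :: "real \<Rightarrow> 'w measure" and T :: real
    and W :: "real \<Rightarrow> 'w \<Rightarrow> real" and \<sigma> :: real and \<xi> :: "'w \<Rightarrow> real"
    and U :: "real set" and m \<psi> :: "real measure \<Rightarrow> real" and K :: real
  assumes mfg: "geometric_mfg M F T W \<sigma> \<xi> U m \<psi> K"
    and unique_minimizers:
      "\<And>\<mu>. \<mu> \<in> geometric_mfg.flows M T \<xi> K \<Longrightarrow>
         geometric_mfg.unique_minimizer M F T W \<sigma> \<xi> U m \<psi> \<mu>"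
  shows "geometric_mfg.equilibria M F T W \<sigma> \<xi> U m \<psi> K \<noteq> {} \<and>
    complete_lattice (geometric_mfg.equilibrium_order M F T W \<sigma> \<xi> U m \<psi> K)"
proof -
  interpret geometric_mfg M F T W \<sigma> \<xi> U m \<psi> K by (rule mfg)
  show ?thesis by (rule equilibria_lattice[OF unique_minimizers])
qed

end
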